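(* Let $p$ be a prime, let $\mathcal{O}_p$ be the maximal $\mathbb{Z}_p$-order in the quaternion division $\mathbb{Q}_p$-algebra, and let $\mathfrak{P}_p$ be its unique maximal two-sided ideal, with residue field $\mathcal{O}_p/\mathfrak{P}_p=\mathbb{F}_{p^2}$. Then the $\mathbb{Z}_p$-order $\mathcal{O}_p\otimes_{\mathbb{Z}_p}\mathcal{O}_p^{\mathrm{opp}}$ has finite representation type, and up to isomorphism there are exactly four indecomposable $(\mathcal{O}_p,\mathcal{O}_p)$-bilattices: $\mathcal{O}_p$, $\mathfrak{P}_p$, $\mathbb{L}_1$ and $\mathbb{L}_2$. Every $(\mathcal{O}_p,\mathcal{O}_p)$-bilattice $L_p$ is isomorphic to a direct sum $$\mathcal{O}_p^{\oplus r_1}\oplus\mathfrak{P}_p^{\oplus r_2}\oplus\mathbb{L}_1^{\oplus t_1}\oplus\mathbb{L}_2^{\oplus t_2}$$ for a unique quadruple $(r_1,r_2,t_1,t_2)\in\mathbb{Z}_{\ge 0}^4$. Moreover, the following are equivalent for any two $(\mathcal{O}_p,\mathcal{O}_p)$-bilattices $L_p$ and $L_p'$: (1) $L_p$ and $L_p'$ are isomorphic; (2) the $(\mathbb{F}_{p^2},\mathcal{O}_p/p\mathcal{O}_p)$-bimodules $L_p/(\mathfrak{P}_pL_p)$ and $L_p'/(\mathfrak{P}_pL_p')$ are isomorphic; (3) the $(\mathcal{O}_p/p\mathcal{O}_p,\mathbb{F}_{p^2})$-bimodules $L_p/(L_p\mathfrak{P}_p)$ and $L_p'/(L_p'\mathfrak{P}_p)$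 are isomorphic.
   Context: An $(\mathcal{O}_p,\mathcal{O}_p)$-bilattice is an $(\mathcal{O}_p,\mathcal{O}_p)$-bimodule (with the left and right actions of $\mathbb{Z}_p$ agreeing) that is free of finite rank over $\mathbb{Z}_p$; equivalently, a left $\mathcal{O}_p\otimes_{\mathbb{Z}_p}\mathcal{O}_p^{\mathrm{opp}}$-lattice. Finite representation type means that there are only finitely many isomorphism classes of indecomposable lattices. $\mathcal{O}_p$ and $\mathfrak{P}_p$ are bilattices via left and right multiplication. Let $K$ be the unramified quadratic extension of $\mathbb{Q}_p$ with ring of integers $O_K$ and nontrivial automorphism $\sigma$. Choose an embedding of $K$ in the quaternion division algebra, a uniformizer $\pi$ of $\mathbb{Q}_p$ and $\Pi\in\mathcal{O}_p$ such that $\mathcal{O}_p=O_K\oplus O_K\Pi$, $\Pi^2=\pi$, and $\Pi a=a^\sigma\Pi$ for all $a\in O_K$. Then $\mathfrak{P}_p=\Pi\mathcal{O}_p$. For $i=1,2$, $\mathbb{L}_i$ is the free right $\mathcal{O}_p$-module $\mathcal{O}_p^{\oplus 2}$ of column vectors, with $\alpha\in\mathcal{O}_p$ acting on the left by the matrix $\varphi_i(\alpha)$, where $\varphi_1,\varphi_2:\mathcal{O}_p\hookrightarrow\mathrm{Mat}_2(\mathcal{O}_p)$ are the $\mathbb{Z}_p$-algebra embeddings determined by $$\varphi_1:\ \Pi\mapsto\begin{bmatrix}0&\pi\\1&0\end{bmatrix},\quad a\mapsto\begin{bmatrix}a&0\\0&a^\sigma\end{bmatrix};\qquad \varphi_2:\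 \Pi\mapsto\begin{bmatrix}0&\pi\\1&0\end{bmatrix},\quad a\mapsto\begin{bmatrix}a^\sigma&0\\0&a\end{bmatrix}\qquad(a\in O_K).$$ *)

theory Defs
  imports "HOL-Algebra.Algebra"
begin

section \<open>The ring of p-adic integers and quaternion division algebras\<close>

text \<open>The inverse limit of the rings of integers modulo \<open>p ^ n\<close>; the component at \<open>n\<close> is the
  representative in \<open>{0..<p ^ n}\<close>.\<close>

definition Zp :: "nat \<Rightarrow> (nat \<Rightarrow> int) ring" where
  "Zp p = \<lparr>carrier = {x. \<forall>n. 0 \<le> x n \<and> x n < int p ^ n \<and> x (Suc n) mod int p ^ n = x n},
     monoid.mult = (\<lambda>x y n. (x n * y n) mod int p ^ n),
     monoid.one = (\<lambda>n. 1 mod int p ^ n),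
     ring.zero = (\<lambda>n. 0),
     ring.add = (\<lambda>x y n. (x n + y n) mod int p ^ n)\<rparr>"

definition division_algebra :: "('a, 'e) ring_scheme \<Rightarrow> bool" where
  "division_algebra D \<longleftrightarrow> ring D \<and> \<one>\<^bsub>D\<^esub> \<noteq> \<zero>\<^bsub>D\<^esub> \<and> Units D = carrier D - {\<zero>\<^bsub>D\<^esub>}"

definition ring_center :: "('a, 'e) ring_scheme \<Rightarrow> 'a set" where
  "ring_center D = {z \<in> carrier D. \<forall>x\<in>carrier D. z \<otimes>\<^bsub>D\<^esub> x = x \<otimes>\<^bsub>D\<^esub> z}"

text \<open>\<open>\<rat>\<^sub>p\<close> is the fraction field of \<open>\<int>\<^sub>p\<close>. A \<open>\<rat>\<^sub>p\<close>-algebra structure on a division ring is the same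
  as an injective ring homomorphism \<open>\<iota>\<close> from \<open>\<int>\<^sub>p\<close> with central image; \<open>\<rat>\<^sub>p\<close> is then
  identified with the following set of fractions.\<close>

definition Qp_in :: "nat \<Rightarrow> ('a, 'e) ring_scheme \<Rightarrow> ((nat \<Rightarrow> int) \<Rightarrow> 'a) \<Rightarrow> 'a set" where
  "Qp_in p D \<iota> = {\<iota> a \<otimes>\<^bsub>D\<^esub> inv\<^bsub>D\<^esub> (\<iota> b) | a b.
     a \<in> carrier (Zp p) \<and> b \<in> carrier (Zp p) \<and> b \<noteq> \<zero>\<^bsub>Zp p\<^esub>}"

text \<open>A quaternion division algebra is a central division algebra of dimension 4.\<close>

definition quaternion_division_algebra ::
    "nat \<Rightarrow> ('a, 'e) ring_scheme \<Rightarrow> ((nat \<Rightarrow> int) \<Rightarrow> 'a) \<Rightarrow> bool" where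
  "quaternion_division_algebra p D \<iota> \<longleftrightarrow>
     division_algebra D \<and> \<iota> \<in> ring_hom (Zp p) D \<and> inj_on \<iota> (carrier (Zp p)) \<and>
     ring_center D = Qp_in p D \<iota> \<and> ring.dimension D 4 (Qp_in p D \<iota>) (carrier D)"

text \<open>A \<open>\<int>\<^sub>p\<close>-order is a subring that is finitely generated as a \<open>\<int>\<^sub>p\<close>-module and spans \<open>D\<close>
  over \<open>\<rat>\<^sub>p\<close>.\<close>

definition Zp_order ::
    "nat \<Rightarrow> ('a, 'e) ring_scheme \<Rightarrow> ((nat \<Rightarrow> int) \<Rightarrow> 'a) \<Rightarrow> 'a set \<Rightarrow> bool" where
  "Zp_order p D \<iota> S \<longleftrightarrow>
     subring S D \<and> \<iota> ` carrier (Zp p) \<subseteq> S \<and>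
     (\<exists>B. finite B \<and> B \<subseteq> carrier D \<and>
        S = {finsum D (\<lambda>b. \<iota> (c b) \<otimes>\<^bsub>D\<^esub> b) B | c. c \<in> B \<rightarrow> carrier (Zp p)}) \<and>
     (\<forall>x\<in>carrier D. \<exists>z\<in>carrier (Zp p). z \<noteq> \<zero>\<^bsub>Zp p\<^esub> \<and> \<iota> z \<otimes>\<^bsub>D\<^esub> x \<in> S)"

definition maximal_Zp_order ::
    "nat \<Rightarrow> ('a, 'e) ring_scheme \<Rightarrow> ((nat \<Rightarrow> int) \<Rightarrow> 'a) \<Rightarrow> 'a set \<Rightarrow> bool" where
  "maximal_Zp_order p D \<iota> S \<longleftrightarrow>
     Zp_order p D \<iota> S \<and> (\<forall>S'. Zp_order p D \<iota> S' \<and> S \<subseteq> S' \<longrightarrow> S' = S)"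

text \<open>The elements of \<open>K\<close> that are roots of a monic polynomial over \<open>\<int>\<^sub>p\<close>.\<close>

definition ring_of_integers ::
    "nat \<Rightarrow> ('a, 'e) ring_scheme \<Rightarrow> ((nat \<Rightarrow> int) \<Rightarrow> 'a) \<Rightarrow> 'a set \<Rightarrow> 'a set" where
  "ring_of_integers p D \<iota> K = {x \<in> K. \<exists>n c. (\<forall>i<n. c i \<in> carrier (Zp p)) \<and>
     x [^]\<^bsub>D\<^esub> (n::nat) = finsum D (\<lambda>i. \<iota> (c i) \<otimes>\<^bsub>D\<^esub> x [^]\<^bsub>D\<^esub> i) {..<n}}"

definition multiples :: "nat \<Rightarrow> ('a, 'e) ring_scheme \<Rightarrow> 'a set" where
  "multiples n R = {[n] \<cdot>\<^bsub>R\<^esub> x | x. x \<in> carrier R}"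

text \<open>Unramified: \<open>p\<close> generates the maximal ideal of the ring of integers.\<close>

definition unramified_quadratic_in ::
    "nat \<Rightarrow> ('a, 'e) ring_scheme \<Rightarrow> ((nat \<Rightarrow> int) \<Rightarrow> 'a) \<Rightarrow> 'a set \<Rightarrow> bool" where
  "unramified_quadratic_in p D \<iota> K \<longleftrightarrow>
     subfield K D \<and> Qp_in p D \<iota> \<subseteq> K \<and> ring.dimension D 2 (Qp_in p D \<iota>) K \<and>
     (let OK = D\<lparr>carrier := ring_of_integers p D \<iota> K\<rparr> in maximalideal (multiples p OK) OK)"

definition nontrivial_automorphism ::
    "nat \<Rightarrow> ('a, 'e) ring_scheme \<Rightarrow> ((nat \<Rightarrow> int) \<Rightarrow> 'a) \<Rightarrow> 'a set \<Rightarrow> ('a \<Rightarrow> 'a) \<Rightarrow> bool" where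
  "nontrivial_automorphism p D \<iota> K \<sigma> \<longleftrightarrow>
     \<sigma> \<in> ring_iso (D\<lparr>carrier := K\<rparr>) (D\<lparr>carrier := K\<rparr>) \<and>
     (\<forall>x\<in>Qp_in p D \<iota>. \<sigma> x = x) \<and> (\<exists>x\<in>K. \<sigma> x \<noteq> x)"

definition Zp_uniformizer :: "nat \<Rightarrow> (nat \<Rightarrow> int) \<Rightarrow> bool" where
  "Zp_uniformizer p u \<longleftrightarrow> u \<in> carrier (Zp p) \<and> maximalideal (PIdl\<^bsub>Zp p\<^esub> u) (Zp p)"


section \<open>Modules and bimodules over noncommutative rings\<close>

text \<open>The locale \<^locale>\<open>module\<close> assumes a commutative ring of scalars, so only its record type is used
  here. The fields for multiplication and unit of a module are irrelevant and left undefined.\<close>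

definition left_module :: "('a, 'e) ring_scheme \<Rightarrow> ('a, 'm, 'f) module_scheme \<Rightarrow> bool" where
  "left_module R M \<longleftrightarrow> ring R \<and> abelian_group M \<and>
     (\<forall>a\<in>carrier R. \<forall>x\<in>carrier M. a \<odot>\<^bsub>M\<^esub> x \<in> carrier M) \<and>
     (\<forall>a\<in>carrier R. \<forall>b\<in>carrier R. \<forall>x\<in>carrier M.
        (a \<oplus>\<^bsub>R\<^esub> b) \<odot>\<^bsub>M\<^esub> x = a \<odot>\<^bsub>M\<^esub> x \<oplus>\<^bsub>M\<^esub> b \<odot>\<^bsub>M\<^esub> x) \<and>
     (\<forall>a\<in>carrier R. \<forall>x\<in>carrier M. \<forall>y\<in>carrier M.
        a \<odot>\<^bsub>M\<^esub> (x \<oplus>\<^bsub>M\<^esub> y) = a \<odot>\<^bsub>M\<^esub> x \<oplus>\<^bsub>M\<^esub> a \<odot>\<^bsub>M\<^esub> y) \<and>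
     (\<forall>a\<in>carrier R. \<forall>b\<in>carrier R. \<forall>x\<in>carrier M.
        (a \<otimes>\<^bsub>R\<^esub> b) \<odot>\<^bsub>M\<^esub> x = a \<odot>\<^bsub>M\<^esub> (b \<odot>\<^bsub>M\<^esub> x)) \<and>
     (\<forall>x\<in>carrier M. \<one>\<^bsub>R\<^esub> \<odot>\<^bsub>M\<^esub> x = x)"

record ('a, 'b, 'm) bimodule = "('a, 'm) module" +
  rsmult :: "['m, 'b] \<Rightarrow> 'm" (infixl \<open>\<star>\<index>\<close> 70)

definition bimodule ::
    "('a, 'e) ring_scheme \<Rightarrow> ('b, 'f) ring_scheme \<Rightarrow> ('a, 'b, 'm) bimodule \<Rightarrow> bool" where
  "bimodule R S M \<longleftrightarrow> left_module R M \<and> ring S \<and>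
     (\<forall>x\<in>carrier M. \<forall>b\<in>carrier S. x \<star>\<^bsub>M\<^esub> b \<in> carrier M) \<and>
     (\<forall>x\<in>carrier M. \<forall>b\<in>carrier S. \<forall>c\<in>carrier S.
        x \<star>\<^bsub>M\<^esub> (b \<oplus>\<^bsub>S\<^esub> c) = x \<star>\<^bsub>M\<^esub> b \<oplus>\<^bsub>M\<^esub> x \<star>\<^bsub>M\<^esub> c) \<and>
     (\<forall>x\<in>carrier M. \<forall>y\<in>carrier M. \<forall>b\<in>carrier S.
        (x \<oplus>\<^bsub>M\<^esub> y) \<star>\<^bsub>M\<^esub> b = x \<star>\<^bsub>M\<^esub> b \<oplus>\<^bsub>M\<^esub> y \<star>\<^bsub>M\<^esub> b) \<and>
     (\<forall>x\<in>carrier M. \<forall>b\<in>carrier S. \<forall>c\<in>carrier S.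
        x \<star>\<^bsub>M\<^esub> (b \<otimes>\<^bsub>S\<^esub> c) = (x \<star>\<^bsub>M\<^esub> b) \<star>\<^bsub>M\<^esub> c) \<and>
     (\<forall>x\<in>carrier M. x \<star>\<^bsub>M\<^esub> \<one>\<^bsub>S\<^esub> = x) \<and>
     (\<forall>a\<in>carrier R. \<forall>x\<in>carrier M. \<forall>b\<in>carrier S.
        (a \<odot>\<^bsub>M\<^esub> x) \<star>\<^bsub>M\<^esub> b = a \<odot>\<^bsub>M\<^esub> (x \<star>\<^bsub>M\<^esub> b))"

definition left_module_isomorphic ::
    "('a, 'e) ring_scheme \<Rightarrow> ('a, 'm, 'f) module_scheme \<Rightarrow> ('a, 'n, 'g) module_scheme \<Rightarrow> bool" where
  "left_module_isomorphic R M N \<longleftrightarrow> (\<exists>f. bij_betw f (carrier M) (carrier N) \<and>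
     (\<forall>x\<in>carrier M. \<forall>y\<in>carrier M. f (x \<oplus>\<^bsub>M\<^esub> y) = f x \<oplus>\<^bsub>N\<^esub> f y) \<and>
     (\<forall>a\<in>carrier R. \<forall>x\<in>carrier M. f (a \<odot>\<^bsub>M\<^esub> x) = a \<odot>\<^bsub>N\<^esub> f x))"

definition bimodule_isomorphic ::
    "('a, 'e) ring_scheme \<Rightarrow> ('b, 'f) ring_scheme \<Rightarrow>
      ('a, 'b, 'm) bimodule \<Rightarrow> ('a, 'b, 'n) bimodule \<Rightarrow> bool" where
  "bimodule_isomorphic R S M N \<longleftrightarrow> (\<exists>f. bij_betw f (carrier M) (carrier N) \<and>
     (\<forall>x\<in>carrier M. \<forall>y\<in>carrier M. f (x \<oplus>\<^bsub>M\<^esub> y) = f x \<oplus>\<^bsub>N\<^esub> f y) \<and>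
     (\<forall>a\<in>carrier R. \<forall>x\<in>carrier M. f (a \<odot>\<^bsub>M\<^esub> x) = a \<odot>\<^bsub>N\<^esub> f x) \<and>
     (\<forall>x\<in>carrier M. \<forall>b\<in>carrier S. f (x \<star>\<^bsub>M\<^esub> b) = f x \<star>\<^bsub>N\<^esub> b))"

definition left_submodule ::
    "('a, 'e) ring_scheme \<Rightarrow> ('a, 'm, 'f) module_scheme \<Rightarrow> 'm set \<Rightarrow> bool" where
  "left_submodule R M A \<longleftrightarrow> subgroup A (add_monoid M) \<and>
     (\<forall>a\<in>carrier R. \<forall>x\<in>A. a \<odot>\<^bsub>M\<^esub> x \<in> A)"

definition subbimodule ::
    "('a, 'e) ring_scheme \<Rightarrow> ('b, 'f) ring_scheme \<Rightarrow> ('a, 'b, 'm) bimodule \<Rightarrow> 'm set \<Rightarrow> bool" where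
  "subbimodule R S M A \<longleftrightarrow> left_submodule R M A \<and> (\<forall>x\<in>A. \<forall>b\<in>carrier S. x \<star>\<^bsub>M\<^esub> b \<in> A)"

definition internal_direct_sum :: "('m, 'f) ring_scheme \<Rightarrow> 'm set \<Rightarrow> 'm set \<Rightarrow> bool" where
  "internal_direct_sum M A B \<longleftrightarrow> A \<inter> B = {\<zero>\<^bsub>M\<^esub>} \<and> A <+>\<^bsub>M\<^esub> B = carrier M"

definition indecomposable_left_module ::
    "('a, 'e) ring_scheme \<Rightarrow> ('a, 'm, 'f) module_scheme \<Rightarrow> bool" where
  "indecomposable_left_module R M \<longleftrightarrow> carrier M \<noteq> {\<zero>\<^bsub>M\<^esub>} \<and>
     (\<forall>A B. left_submodule R M A \<and> left_submodule R M B \<and> internal_direct_sum M A B \<longrightarrow>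
        A = {\<zero>\<^bsub>M\<^esub>} \<or> B = {\<zero>\<^bsub>M\<^esub>})"

definition indecomposable_bimodule ::
    "('a, 'e) ring_scheme \<Rightarrow> ('b, 'f) ring_scheme \<Rightarrow> ('a, 'b, 'm) bimodule \<Rightarrow> bool" where
  "indecomposable_bimodule R S M \<longleftrightarrow> carrier M \<noteq> {\<zero>\<^bsub>M\<^esub>} \<and>
     (\<forall>A B. subbimodule R S M A \<and> subbimodule R S M B \<and> internal_direct_sum M A B \<longrightarrow>
        A = {\<zero>\<^bsub>M\<^esub>} \<or> B = {\<zero>\<^bsub>M\<^esub>})"

definition bimodule_sum ::
    "('a, 'b, 'm) bimodule \<Rightarrow> ('a, 'b, 'n) bimodule \<Rightarrow> ('a, 'b, 'm \<times> 'n) bimodule"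
    (infixr \<open>\<oplus>\<^sub>B\<close> 65) where
  "M \<oplus>\<^sub>B N = \<lparr>carrier = carrier M \<times> carrier N, monoid.mult = undefined, monoid.one = undefined,
     ring.zero = (\<zero>\<^bsub>M\<^esub>, \<zero>\<^bsub>N\<^esub>),
     ring.add = (\<lambda>(x, y) (x', y'). (x \<oplus>\<^bsub>M\<^esub> x', y \<oplus>\<^bsub>N\<^esub> y')),
     module.smult = (\<lambda>a (x, y). (a \<odot>\<^bsub>M\<^esub> x, a \<odot>\<^bsub>N\<^esub> y)),
     rsmult = (\<lambda>(x, y) b. (x \<star>\<^bsub>M\<^esub> b, y \<star>\<^bsub>N\<^esub> b))\<rparr>"

definition bimodule_power ::
    "('a, 'b, 'm) bimodule \<Rightarrow> nat \<Rightarrow> ('a, 'b, nat \<Rightarrow> 'm) bimodule" (infixr \<open>^\<^sub>B\<close> 80) where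
  "M ^\<^sub>B n = \<lparr>carrier = {..<n} \<rightarrow>\<^sub>E carrier M, monoid.mult = undefined, monoid.one = undefined,
     ring.zero = (\<lambda>i\<in>{..<n}. \<zero>\<^bsub>M\<^esub>),
     ring.add = (\<lambda>x y. \<lambda>i\<in>{..<n}. x i \<oplus>\<^bsub>M\<^esub> y i),
     module.smult = (\<lambda>a x. \<lambda>i\<in>{..<n}. a \<odot>\<^bsub>M\<^esub> x i),
     rsmult = (\<lambda>x b. \<lambda>i\<in>{..<n}. x i \<star>\<^bsub>M\<^esub> b)\<rparr>"

text \<open>The subgroups \<open>I L\<close> and \<open>L J\<close> generated by all products, and the quotient \<open>L / N\<close> with the induced
  actions of residue classes, written like \<^const>\<open>rcoset_mult\<close>.\<close>

definition ideal_times :: "'a set \<Rightarrow> ('a, 'b, 'm) bimodule \<Rightarrow> 'm set" where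
  "ideal_times I L = generate (add_monoid L) {a \<odot>\<^bsub>L\<^esub> x | a x. a \<in> I \<and> x \<in> carrier L}"

definition times_ideal :: "('a, 'b, 'm) bimodule \<Rightarrow> 'b set \<Rightarrow> 'm set" where
  "times_ideal L J = generate (add_monoid L) {x \<star>\<^bsub>L\<^esub> b | x b. x \<in> carrier L \<and> b \<in> J}"

definition quotient_bimodule ::
    "('a, 'b, 'm) bimodule \<Rightarrow> 'm set \<Rightarrow> ('a set, 'b set, 'm set) bimodule" where
  "quotient_bimodule L N = \<lparr>carrier = a_rcosets\<^bsub>L\<^esub> N, monoid.mult = undefined, monoid.one = undefined,
     ring.zero = N, ring.add = set_add L,
     module.smult = (\<lambda>A C. \<Union>a\<in>A. \<Union>x\<in>C. N +>\<^bsub>L\<^esub> (a \<odot>\<^bsub>L\<^esub> x)),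
     rsmult = (\<lambda>C B. \<Union>x\<in>C. \<Union>b\<in>B. N +>\<^bsub>L\<^esub> (x \<star>\<^bsub>L\<^esub> b))\<rparr>"


section \<open>Lattices, bilattices and finite representation type\<close>

definition free_of_finite_rank ::
    "nat \<Rightarrow> ((nat \<Rightarrow> int) \<Rightarrow> 'a) \<Rightarrow> ('a, 'm, 'f) module_scheme \<Rightarrow> bool" where
  "free_of_finite_rank p \<iota> M \<longleftrightarrow> (\<exists>B. finite B \<and> B \<subseteq> carrier M \<and>
     (\<forall>x\<in>carrier M. \<exists>!c. c \<in> B \<rightarrow>\<^sub>E carrier (Zp p) \<and>
        x = finsum M (\<lambda>b. \<iota> (c b) \<odot>\<^bsub>M\<^esub> b) B))"

definition left_lattice ::
    "nat \<Rightarrow> ((nat \<Rightarrow> int) \<Rightarrow> 'a) \<Rightarrow> ('a, 'e) ring_scheme \<Rightarrow> ('a, 'm, 'f) module_scheme \<Rightarrow> bool" where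
  "left_lattice p \<iota> R M \<longleftrightarrow> left_module R M \<and> free_of_finite_rank p \<iota> M"

definition bilattice ::
    "nat \<Rightarrow> ((nat \<Rightarrow> int) \<Rightarrow> 'a) \<Rightarrow> ('a, 'e) ring_scheme \<Rightarrow> ('a, 'a, 'm) bimodule \<Rightarrow> bool" where
  "bilattice p \<iota> R L \<longleftrightarrow> bimodule R R L \<and>
     (\<forall>z\<in>carrier (Zp p). \<forall>x\<in>carrier L. \<iota> z \<odot>\<^bsub>L\<^esub> x = x \<star>\<^bsub>L\<^esub> \<iota> z) \<and>
     free_of_finite_rank p \<iota> L"

text \<open>Finitely many isomorphism classes among the indecomposable lattices with elements in the type
  \<open>'m\<close>. Every lattice is isomorphic to one with underlying set \<open>\<int>\<^sub>p\<close>-tuples, so an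
  instance of \<open>'m\<close> that can hold these already covers all isomorphism classes.\<close>

definition finite_representation_type ::
    "'m itself \<Rightarrow> nat \<Rightarrow> ((nat \<Rightarrow> int) \<Rightarrow> 'a) \<Rightarrow> ('a, 'e) ring_scheme \<Rightarrow> bool" where
  "finite_representation_type _ p \<iota> R \<longleftrightarrow>
     (let I = {M :: ('a, 'm) module. left_lattice p \<iota> R M \<and> indecomposable_left_module R M}
      in finite (I // {(M, N) \<in> I \<times> I. left_module_isomorphic R M N}))"

definition opposite_ring :: "('a, 'e) ring_scheme \<Rightarrow> ('a, 'e) ring_scheme" where
  "opposite_ring R = R\<lparr>monoid.mult := (\<lambda>x y. y \<otimes>\<^bsub>R\<^esub> x)\<rparr>"

text \<open>The tensor product over \<open>\<int>\<^sub>p\<close> of two \<open>\<int>\<^sub>p\<close>-algebras with structure maps \<open>\<iota>\<close>, \<open>\<kappa>\<close>: the free abelian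
  group on pairs, with the product extending \<open>(a, b) (a', b') = (a a', b b')\<close> bilinearly, modulo
  the ideal generated by the relations of a balanced biadditive map. (The subgroup generated by
  these relations is already an ideal.)\<close>

definition pair_ring ::
    "('a, 'e) ring_scheme \<Rightarrow> ('b, 'f) ring_scheme \<Rightarrow> (('a \<times> 'b) \<Rightarrow>\<^sub>0 int) ring" where
  "pair_ring R S = \<lparr>carrier = carrier (free_Abelian_group (carrier R \<times> carrier S)),
     monoid.mult = (\<lambda>u v. frag_extend (\<lambda>(a, b). frag_extend (\<lambda>(a', b').
       frag_of (a \<otimes>\<^bsub>R\<^esub> a', b \<otimes>\<^bsub>S\<^esub> b')) v) u),
     monoid.one = frag_of (\<one>\<^bsub>R\<^esub>, \<one>\<^bsub>S\<^esub>), ring.zero = 0, ring.add = (+)\<rparr>"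

definition tensor_relations ::
    "nat \<Rightarrow> ((nat \<Rightarrow> int) \<Rightarrow> 'a) \<Rightarrow> ((nat \<Rightarrow> int) \<Rightarrow> 'b) \<Rightarrow>
      ('a, 'e) ring_scheme \<Rightarrow> ('b, 'f) ring_scheme \<Rightarrow> (('a \<times> 'b) \<Rightarrow>\<^sub>0 int) set" where
  "tensor_relations p \<iota> \<kappa> R S =
     {frag_of (a \<oplus>\<^bsub>R\<^esub> a', b) - frag_of (a, b) - frag_of (a', b) | a a' b.
        a \<in> carrier R \<and> a' \<in> carrier R \<and> b \<in> carrier S} \<union>
     {frag_of (a, b \<oplus>\<^bsub>S\<^esub> b') - frag_of (a, b) - frag_of (a, b') | a b b'.
        a \<in> carrier R \<and> b \<in> carrier S \<and> b' \<in> carrier S} \<union>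
     {frag_of (a \<otimes>\<^bsub>R\<^esub> \<iota> z, b) - frag_of (a, \<kappa> z \<otimes>\<^bsub>S\<^esub> b) | a z b.
        a \<in> carrier R \<and> z \<in> carrier (Zp p) \<and> b \<in> carrier S}"

definition tensor_ideal ::
    "nat \<Rightarrow> ((nat \<Rightarrow> int) \<Rightarrow> 'a) \<Rightarrow> ((nat \<Rightarrow> int) \<Rightarrow> 'b) \<Rightarrow>
      ('a, 'e) ring_scheme \<Rightarrow> ('b, 'f) ring_scheme \<Rightarrow> (('a \<times> 'b) \<Rightarrow>\<^sub>0 int) set" where
  "tensor_ideal p \<iota> \<kappa> R S = Idl\<^bsub>pair_ring R S\<^esub> (tensor_relations p \<iota> \<kappa> R S)"

definition tensor_ring ::
    "nat \<Rightarrow> ((nat \<Rightarrow> int) \<Rightarrow> 'a) \<Rightarrow> ((nat \<Rightarrow> int) \<Rightarrow> 'b) \<Rightarrow>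
      ('a, 'e) ring_scheme \<Rightarrow> ('b, 'f) ring_scheme \<Rightarrow> (('a \<times> 'b) \<Rightarrow>\<^sub>0 int) set ring" where
  "tensor_ring p \<iota> \<kappa> R S = pair_ring R S Quot tensor_ideal p \<iota> \<kappa> R S"

definition tensor_structure_map ::
    "nat \<Rightarrow> ((nat \<Rightarrow> int) \<Rightarrow> 'a) \<Rightarrow> ((nat \<Rightarrow> int) \<Rightarrow> 'b) \<Rightarrow>
      ('a, 'e) ring_scheme \<Rightarrow> ('b, 'f) ring_scheme \<Rightarrow> (nat \<Rightarrow> int) \<Rightarrow> (('a \<times> 'b) \<Rightarrow>\<^sub>0 int) set" where
  "tensor_structure_map p \<iota> \<kappa> R S z =
     tensor_ideal p \<iota> \<kappa> R S +>\<^bsub>pair_ring R S\<^esub> frag_of (\<iota> z, \<one>\<^bsub>S\<^esub>)"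


section \<open>The bilattices in question\<close>

definition ideal_bimodule :: "('a, 'e) ring_scheme \<Rightarrow> 'a set \<Rightarrow> ('a, 'a, 'a) bimodule" where
  "ideal_bimodule R I = \<lparr>carrier = I, monoid.mult = undefined, monoid.one = undefined,
     ring.zero = \<zero>\<^bsub>R\<^esub>, ring.add = ring.add R, module.smult = monoid.mult R, rsmult = monoid.mult R\<rparr>"

text \<open>The matrix with rows \<open>(a, b)\<close> and \<open>(c, d)\<close> is encoded as \<open>((a, b), (c, d))\<close>.\<close>

type_synonym 'a mat2 = "('a \<times> 'a) \<times> ('a \<times> 'a)"

definition mat2_ring :: "('a, 'e) ring_scheme \<Rightarrow> 'a mat2 ring" where
  "mat2_ring R = \<lparr>carrier = (carrier R \<times> carrier R) \<times> (carrier R \<times> carrier R),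
     monoid.mult = (\<lambda>((a, b), (c, d)) ((a', b'), (c', d')).
       ((a \<otimes>\<^bsub>R\<^esub> a' \<oplus>\<^bsub>R\<^esub> b \<otimes>\<^bsub>R\<^esub> c', a \<otimes>\<^bsub>R\<^esub> b' \<oplus>\<^bsub>R\<^esub> b \<otimes>\<^bsub>R\<^esub> d'),
        (c \<otimes>\<^bsub>R\<^esub> a' \<oplus>\<^bsub>R\<^esub> d \<otimes>\<^bsub>R\<^esub> c', c \<otimes>\<^bsub>R\<^esub> b' \<oplus>\<^bsub>R\<^esub> d \<otimes>\<^bsub>R\<^esub> d'))),
     monoid.one = ((\<one>\<^bsub>R\<^esub>, \<zero>\<^bsub>R\<^esub>), (\<zero>\<^bsub>R\<^esub>, \<one>\<^bsub>R\<^esub>)),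
     ring.zero = ((\<zero>\<^bsub>R\<^esub>, \<zero>\<^bsub>R\<^esub>), (\<zero>\<^bsub>R\<^esub>, \<zero>\<^bsub>R\<^esub>)),
     ring.add = (\<lambda>((a, b), (c, d)) ((a', b'), (c', d')).
       ((a \<oplus>\<^bsub>R\<^esub> a', b \<oplus>\<^bsub>R\<^esub> b'), (c \<oplus>\<^bsub>R\<^esub> c', d \<oplus>\<^bsub>R\<^esub> d')))\<rparr>"

definition column_bimodule ::
    "('a, 'e) ring_scheme \<Rightarrow> ('a \<Rightarrow> 'a mat2) \<Rightarrow> ('a, 'a, 'a \<times> 'a) bimodule" where
  "column_bimodule R \<phi> = \<lparr>carrier = carrier R \<times> carrier R, monoid.mult = undefined, monoid.one = undefined,
     ring.zero = (\<zero>\<^bsub>R\<^esub>, \<zero>\<^bsub>R\<^esub>),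
     ring.add = (\<lambda>(x, y) (x', y'). (x \<oplus>\<^bsub>R\<^esub> x', y \<oplus>\<^bsub>R\<^esub> y')),
     module.smult = (\<lambda>\<alpha> (x, y). case \<phi> \<alpha> of ((a, b), (c, d)) \<Rightarrow>
       (a \<otimes>\<^bsub>R\<^esub> x \<oplus>\<^bsub>R\<^esub> b \<otimes>\<^bsub>R\<^esub> y, c \<otimes>\<^bsub>R\<^esub> x \<oplus>\<^bsub>R\<^esub> d \<otimes>\<^bsub>R\<^esub> y)),
     rsmult = (\<lambda>(x, y) \<beta>. (x \<otimes>\<^bsub>R\<^esub> \<beta>, y \<otimes>\<^bsub>R\<^esub> \<beta>))\<rparr>"

end

theory Submission
  imports Defs
begin

text \<open>Write \<open>W\<close> for the unramified quadratic order in \<open>O\<close>. On a bilattice \<open>L\<close> the left and the right action of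
  \<open>W\<close> commute, so \<open>L\<close> splits into the part where \<open>a x = x a\<close> and the part where \<open>a x = x \<sigma>(a)\<close>, for all
  \<open>a \<in> W\<close>; multiplication by \<open>\<Pi>\<close> on either side exchanges the two. If some homogeneous \<open>x\<close> has \<open>x \<Pi>\<close>
  outside \<open>\<Pi> L\<close>, then \<open>x\<close> and \<open>\<Pi> x\<close> are a basis over \<open>O\<close> of a copy of one of the two column bilattices, and
  a \<open>W\<close>-linear functional with value \<open>1\<close> at \<open>\<Pi> x \<Pi>\<close> splits it off. Otherwise \<open>L \<Pi> \<subseteq> \<Pi> L\<close>, conjugation by
  \<open>\<Pi>\<close> is a semilinear involution, and by Galois descent it fixes some homogeneous \<open>x\<close> outside \<open>\<Pi> L\<close>, which
  generates a direct summand isomorphic to \<open>O\<close> or to \<open>\<Pi> O\<close>. Induction on the rank gives the decomposition. The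
  multiplicities are read off from the reduction \<open>L / \<Pi> L\<close>: count its homogeneous parts and their images under
  right multiplication by \<open>\<Pi>\<close>. The anti-involution \<open>a + b \<Pi> \<mapsto> a + \<sigma>(b) \<Pi>\<close> of \<open>O\<close> exchanges the two reductions.\<close>

\<comment> \<open>Splitting into homogeneous parts and averaging over the Galois group both require
  \<open>w \<ominus> \<sigma> w\<close> to be a unit of \<open>W\<close>. In residue characteristic
  2 an antisymmetric unit c has c - \<sigma>(c) = 2 c, no unit, and \<open>w\<close> comes from a
  congruence modulo 2 instead. Summands are split off by functionals: as \<open>Z\<close> is local,
  a vector outside \<open>pi2\<close> times L has a coordinate that is a unit. Lattices are
  described by finite dual bases, which pass to direct summands and get shorter when a nonzero
  summand is removed. With q the order of the residue field, the reduction of a sum with exponents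
  r1, r2, t1, t2 has homogeneous parts with q^(r1 + t1 + t2) and q^(r2 + t1 + t2) elements, and
  their images under right multiplication by \<pi> have q^t1 and q^t2 elements. These four
  cardinalities recover the exponents, show that the four models are indecomposable, and spare
  lifting an isomorphism of reductions. All this takes place over an abstract order, of which the
  p-adic order is an instance; modules over the tensor product are translated into bimodules through
  pure tensors.\<close>
syntax (input) "_index" :: "logic \<Rightarrow> index" (\<open>\<^sub>_\<close> [1000] 1000)

section \<open>Bimodules\<close>

locale bimod =
  fixes R :: "('a, 'e) ring_scheme" and S :: "('b, 'f) ring_scheme" and M :: "('a, 'b, 'm) bimodule"
  assumes bimodule: "bimodule R S M"
begin

sublocale abelian_group M
  using bimodule by (simp add: bimodule_def left_module_def)

lemma left_ring: "ring R" and right_ring: "ring S"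
  using bimodule by (auto simp: bimodule_def left_module_def)

lemma smult_closed [simp, intro]: "a \<in> carrier R \<Longrightarrow> x \<in> carrier M \<Longrightarrow> a \<odot>\<^sub>M x \<in> carrier M"
  and rsmult_closed [simp, intro]: "x \<in> carrier M \<Longrightarrow> b \<in> carrier S \<Longrightarrow> x \<star>\<^sub>M b \<in> carrier M"
  and smult_l_distr: "a \<in> carrier R \<Longrightarrow> a' \<in> carrier R \<Longrightarrow> x \<in> carrier M \<Longrightarrow>
    (a \<oplus>\<^sub>R a') \<odot>\<^sub>M x = a \<odot>\<^sub>M x \<oplus>\<^sub>M a' \<odot>\<^sub>M x"
  and smult_r_distr: "a \<in> carrier R \<Longrightarrow> x \<in> carrier M \<Longrightarrow> y \<in> carrier M \<Longrightarrow>
    a \<odot>\<^sub>M (x \<oplus>\<^sub>M y) = a \<odot>\<^sub>M x \<oplus>\<^sub>M a \<odot>\<^sub>M y"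
  and smult_assoc: "a \<in> carrier R \<Longrightarrow> a' \<in> carrier R \<Longrightarrow> x \<in> carrier M \<Longrightarrow>
    (a \<otimes>\<^sub>R a') \<odot>\<^sub>M x = a \<odot>\<^sub>M (a' \<odot>\<^sub>M x)"
  and smult_one [simp]: "x \<in> carrier M \<Longrightarrow> \<one>\<^sub>R \<odot>\<^sub>M x = x"
  and rsmult_r_distr: "x \<in> carrier M \<Longrightarrow> b \<in> carrier S \<Longrightarrow> b' \<in> carrier S \<Longrightarrow>
    x \<star>\<^sub>M (b \<oplus>\<^sub>S b') = x \<star>\<^sub>M b \<oplus>\<^sub>M x \<star>\<^sub>M b'"
  and rsmult_l_distr: "x \<in> carrier M \<Longrightarrow> y \<in> carrier M \<Longrightarrow> b \<in> carrier S \<Longrightarrow>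
    (x \<oplus>\<^sub>M y) \<star>\<^sub>M b = x \<star>\<^sub>M b \<oplus>\<^sub>M y \<star>\<^sub>M b"
  and rsmult_assoc: "x \<in> carrier M \<Longrightarrow> b \<in> carrier S \<Longrightarrow> b' \<in> carrier S \<Longrightarrow>
    x \<star>\<^sub>M (b \<otimes>\<^sub>S b') = (x \<star>\<^sub>M b) \<star>\<^sub>M b'"
  and rsmult_one [simp]: "x \<in> carrier M \<Longrightarrow> x \<star>\<^sub>M \<one>\<^sub>S = x"
  and smult_rsmult: "a \<in> carrier R \<Longrightarrow> x \<in> carrier M \<Longrightarrow> b \<in> carrier S \<Longrightarrow>
    (a \<odot>\<^sub>M x) \<star>\<^sub>M b = a \<odot>\<^sub>M (x \<star>\<^sub>M b)"
  using bimodule by (auto simp: bimodule_def left_module_def)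

text \<open>Applied to the maps given by a fixed left or a fixed right scalar, so that the rules for
  zero and for negatives on the two sides have one common source.\<close>

lemma additive_zero:
  assumes "f \<in> carrier M \<rightarrow> carrier M" and "\<And>x y. x \<in> carrier M \<Longrightarrow> y \<in> carrier M \<Longrightarrow>
    f (x \<oplus>\<^sub>M y) = f x \<oplus>\<^sub>M f y"
  shows "f \<zero>\<^sub>M = \<zero>\<^sub>M" "x \<in> carrier M \<Longrightarrow> f (\<ominus>\<^sub>M x) = \<ominus>\<^sub>M f x"
proof -
  have c: "f x \<in> carrier M" if "x \<in> carrier M" for x using assms(1) that by auto
  have "f \<zero>\<^sub>M \<oplus>\<^sub>M f \<zero>\<^sub>M = f \<zero>\<^sub>M"
    using assms(2)[of "\<zero>\<^sub>M" "\<zero>\<^sub>M"] by simp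
  then show z: "f \<zero>\<^sub>M = \<zero>\<^sub>M" using c[of "\<zero>\<^sub>M"]
    by (metis add.l_cancel_one zero_closed)
  assume x: "x \<in> carrier M"
  have "f (\<ominus>\<^sub>M x) \<oplus>\<^sub>M f x = \<zero>\<^sub>M"
    using assms(2)[of "\<ominus>\<^sub>M x" x] x z by (simp add: l_neg)
  then show "f (\<ominus>\<^sub>M x) = \<ominus>\<^sub>M f x" using c x by (simp add: minus_equality)
qed

lemma smult_zero [simp]: "a \<in> carrier R \<Longrightarrow> a \<odot>\<^sub>M \<zero>\<^sub>M = \<zero>\<^sub>M"
  and smult_minus: "a \<in> carrier R \<Longrightarrow> x \<in> carrier M \<Longrightarrow> a \<odot>\<^sub>M (\<ominus>\<^sub>M x) = \<ominus>\<^sub>M (a \<odot>\<^sub>M x)"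
  using additive_zero[of "\<lambda>x. a \<odot>\<^sub>M x"] by (auto simp: smult_r_distr)

lemma zero_rsmult [simp]: "b \<in> carrier S \<Longrightarrow> \<zero>\<^sub>M \<star>\<^sub>M b = \<zero>\<^sub>M"
  and minus_rsmult: "b \<in> carrier S \<Longrightarrow> x \<in> carrier M \<Longrightarrow> (\<ominus>\<^sub>M x) \<star>\<^sub>M b = \<ominus>\<^sub>M (x \<star>\<^sub>M b)"
  using additive_zero[of "\<lambda>x. x \<star>\<^sub>M b"] by (auto simp: rsmult_l_distr)

lemma zero_smult [simp]: "x \<in> carrier M \<Longrightarrow> \<zero>\<^sub>R \<odot>\<^sub>M x = \<zero>\<^sub>M"
proof -
  assume x: "x \<in> carrier M"
  interpret R: ring R by (rule left_ring)
  have "\<zero>\<^sub>R \<odot>\<^sub>M x \<oplus>\<^sub>M \<zero>\<^sub>R \<odot>\<^sub>M x = \<zero>\<^sub>R \<odot>\<^sub>M x"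
    using smult_l_distr[of "\<zero>\<^sub>R" "\<zero>\<^sub>R" x] x by simp
  then show ?thesis using x by (metis add.l_cancel_one R.zero_closed smult_closed)
qed

lemma uminus_smult: "a \<in> carrier R \<Longrightarrow> x \<in> carrier M \<Longrightarrow> (\<ominus>\<^sub>R a) \<odot>\<^sub>M x = \<ominus>\<^sub>M (a \<odot>\<^sub>M x)"
proof -
  assume x: "a \<in> carrier R" "x \<in> carrier M"
  interpret R: ring R by (rule left_ring)
  have "(\<ominus>\<^sub>R a) \<odot>\<^sub>M x \<oplus>\<^sub>M a \<odot>\<^sub>M x = \<zero>\<^sub>M"
    using smult_l_distr[of "\<ominus>\<^sub>R a" a x] x by (simp add: R.l_neg)
  then show ?thesis using x by (simp add: minus_equality)
qed

lemma rsmult_zero [simp]: "x \<in> carrier M \<Longrightarrow> x \<star>\<^sub>M \<zero>\<^sub>S = \<zero>\<^sub>M"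
proof -
  assume x: "x \<in> carrier M"
  interpret S: ring S by (rule right_ring)
  have "x \<star>\<^sub>M \<zero>\<^sub>S \<oplus>\<^sub>M x \<star>\<^sub>M \<zero>\<^sub>S = x \<star>\<^sub>M \<zero>\<^sub>S"
    using rsmult_r_distr[of x "\<zero>\<^sub>S" "\<zero>\<^sub>S"] x by simp
  then show ?thesis using x by (metis add.l_cancel_one S.zero_closed rsmult_closed)
qed

lemma rsmult_uminus: "x \<in> carrier M \<Longrightarrow> b \<in> carrier S \<Longrightarrow> x \<star>\<^sub>M (\<ominus>\<^sub>S b) = \<ominus>\<^sub>M (x \<star>\<^sub>M b)"
proof -
  assume x: "b \<in> carrier S" "x \<in> carrier M"
  interpret S: ring S by (rule right_ring)
  have "x \<star>\<^sub>M (\<ominus>\<^sub>S b) \<oplus>\<^sub>M x \<star>\<^sub>M b = \<zero>\<^sub>M"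
    using rsmult_r_distr[of x "\<ominus>\<^sub>S b" b] x by (simp add: S.l_neg)
  then show ?thesis using x by (simp add: minus_equality)
qed

end

text \<open>The isomorphism relation hides its map under a quantifier and demands bijectivity. The
  splitting arguments work with the map itself, and with a projection and its section, which in
  general are not bijective.\<close>

definition bimodule_hom ::
    "('a, 'e) ring_scheme \<Rightarrow> ('b, 'f) ring_scheme \<Rightarrow>
      ('a, 'b, 'm) bimodule \<Rightarrow> ('a, 'b, 'n) bimodule \<Rightarrow> ('m \<Rightarrow> 'n) \<Rightarrow> bool" where
  "bimodule_hom R S M N f \<longleftrightarrow> f \<in> carrier M \<rightarrow> carrier N \<and>
     (\<forall>x\<in>carrier M. \<forall>y\<in>carrier M. f (x \<oplus>\<^sub>M y) = f x \<oplus>\<^sub>N f y) \<and>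
     (\<forall>a\<in>carrier R. \<forall>x\<in>carrier M. f (a \<odot>\<^sub>M x) = a \<odot>\<^sub>N f x) \<and>
     (\<forall>x\<in>carrier M. \<forall>b\<in>carrier S. f (x \<star>\<^sub>M b) = f x \<star>\<^sub>N b)"

lemma bimodule_isomorphic_iff:
  "bimodule_isomorphic R S M N \<longleftrightarrow> (\<exists>f. bimodule_hom R S M N f \<and> bij_betw f (carrier M) (carrier N))"
proof -
  have "(bij_betw f (carrier M) (carrier N) \<and> B) =
      ((f \<in> carrier M \<rightarrow> carrier N \<and> B) \<and> bij_betw f (carrier M) (carrier N))" for B f
    using bij_betw_imp_funcset[of f] by auto
  then show ?thesis unfolding bimodule_isomorphic_def bimodule_hom_def by presburger
qed

lemma bimodule_hom_compose:
  "bimodule_hom R S M N f \<Longrightarrow> bimodule_hom R S N Q g \<Longrightarrow> bimodule_hom R S M Q (g \<circ> f)"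
  by (auto simp: bimodule_hom_def Pi_iff)

lemma bimodule_hom_inv_into:
  assumes "bimodule R S M" "bimodule_hom R S M N f" "bij_betw f (carrier M) (carrier N)"
  shows "bimodule_hom R S N M (inv_into (carrier M) f)"
proof -
  interpret bimod R S M using assms(1) by (simp add: bimod_def)
  let ?g = "inv_into (carrier M) f"
  have c: "?g y \<in> carrier M" "f (?g y) = y" if "y \<in> carrier N" for y
    using assms(3) that by (auto simp: bij_betw_def intro: inv_into_into f_inv_into_f)
  have g: "?g (f x) = x" if "x \<in> carrier M" for x
    using assms(3) that by (auto simp: bij_betw_def)
  have h: "f (x \<oplus>\<^sub>M y) = f x \<oplus>\<^sub>N f y" "a \<in> carrier R \<Longrightarrow> f (a \<odot>\<^sub>M x) = a \<odot>\<^sub>N f x"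
      "b \<in> carrier S \<Longrightarrow> f (x \<star>\<^sub>M b) = f x \<star>\<^sub>N b"
    if "x \<in> carrier M" "y \<in> carrier M" for x y a b
    using assms(2) that by (auto simp: bimodule_hom_def)
  have "?g (x \<oplus>\<^sub>N y) = ?g x \<oplus>\<^sub>M ?g y" if "x \<in> carrier N" "y \<in> carrier N" for x y
    using g[of "?g x \<oplus>\<^sub>M ?g y"] h(1)[of "?g x" "?g y"] c that by simp
  moreover have "?g (a \<odot>\<^sub>N x) = a \<odot>\<^sub>M ?g x" if "x \<in> carrier N" "a \<in> carrier R" for x a
    using g[of "a \<odot>\<^sub>M ?g x"] h(2)[of "?g x" "?g x" a] c that by simp
  moreover have "?g (x \<star>\<^sub>N a) = ?g x \<star>\<^sub>M a" if "x \<in> carrier N" "a \<in> carrier S" for x a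
    using g[of "?g x \<star>\<^sub>M a"] h(3)[of "?g x" "?g x" a] c that by simp
  ultimately show ?thesis using c by (auto simp: bimodule_hom_def)
qed

lemma bimodule_isomorphic_refl: "bimodule_isomorphic R S M M"
  unfolding bimodule_isomorphic_def by (rule exI[of _ "\<lambda>x. x"]) (auto simp: bij_betw_def)

lemma bimodule_isomorphic_trans:
  "bimodule_isomorphic R S M N \<Longrightarrow> bimodule_isomorphic R S N Q \<Longrightarrow> bimodule_isomorphic R S M Q"
  unfolding bimodule_isomorphic_iff by (blast intro: bimodule_hom_compose bij_betw_trans)

text \<open>The inverse map respects the operations because sums and scalar multiples of elements of
  \<open>M\<close> stay in \<open>M\<close>; the bimodule hypothesis on the source provides this
  closure.\<close>

lemma bimodule_isomorphic_sym:
  "bimodule_isomorphic R S M N \<Longrightarrow> bimodule R S M \<Longrightarrow> bimodule_isomorphic R S N M"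
  unfolding bimodule_isomorphic_iff by (blast intro: bimodule_hom_inv_into bij_betw_inv_into)

lemma bimodule_isomorphicI:
  assumes "bimodule_hom R S M N f" "g \<in> carrier N \<rightarrow> carrier M"
    "\<And>x. x \<in> carrier M \<Longrightarrow> g (f x) = x" "\<And>y. y \<in> carrier N \<Longrightarrow> f (g y) = y"
  shows "bimodule_isomorphic R S M N"
proof -
  have "bij_betw f (carrier M) (carrier N)"
    using assms by (intro bij_betw_byWitness[where f' = g]) (auto simp: bimodule_hom_def)
  then show ?thesis unfolding bimodule_isomorphic_iff using assms(1) by blast
qed

section \<open>External direct sums and powers\<close>

lemma abelian_group_sum:
  assumes "abelian_group M" "abelian_group N"
  shows "abelian_group (M \<oplus>\<^sub>B N)"
proof -
  interpret M: abelian_group M by fact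
  interpret N: abelian_group N by fact
  show ?thesis
  proof (rule abelian_groupI)
    fix x assume x: "x \<in> carrier (M \<oplus>\<^sub>B N)"
    then show "\<exists>y\<in>carrier (M \<oplus>\<^sub>B N). y \<oplus>\<^bsub>M \<oplus>\<^sub>B N\<^esub> x = \<zero>\<^bsub>M \<oplus>\<^sub>B N\<^esub>"
      by (intro bexI[of _ "(\<ominus>\<^sub>M fst x, \<ominus>\<^sub>N snd x)"])
        (auto simp: bimodule_sum_def M.l_neg N.l_neg)
  qed (auto simp: bimodule_sum_def M.a_ac N.a_ac)
qed

lemma bimodule_sum_simps [simp]:
  "carrier (M \<oplus>\<^sub>B N) = carrier M \<times> carrier N" "\<zero>\<^bsub>M \<oplus>\<^sub>B N\<^esub> = (\<zero>\<^sub>M, \<zero>\<^sub>N)"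
  "(x, y) \<oplus>\<^bsub>M \<oplus>\<^sub>B N\<^esub> (x', y') = (x \<oplus>\<^sub>M x', y \<oplus>\<^sub>N y')"
  "a \<odot>\<^bsub>M \<oplus>\<^sub>B N\<^esub> (x, y) = (a \<odot>\<^sub>M x, a \<odot>\<^sub>N y)"
  "(x, y) \<star>\<^bsub>M \<oplus>\<^sub>B N\<^esub> b = (x \<star>\<^sub>M b, y \<star>\<^sub>N b)"
  by (simp_all add: bimodule_sum_def)

lemma bimodule_sum_bimodule:
  assumes "bimodule R S M" "bimodule R S N"
  shows "bimodule R S (M \<oplus>\<^sub>B N)"
proof -
  interpret M: bimod R S M using assms(1) by (simp add: bimod_def)
  interpret N: bimod R S N using assms(2) by (simp add: bimod_def)
  have "abelian_group (M \<oplus>\<^sub>B N)"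
    using abelian_group_sum M.abelian_group_axioms N.abelian_group_axioms by blast
  then show ?thesis using M.left_ring M.right_ring
    by (auto simp: bimodule_def left_module_def M.smult_l_distr N.smult_l_distr
        M.smult_r_distr N.smult_r_distr M.smult_assoc N.smult_assoc
        M.rsmult_l_distr N.rsmult_l_distr
        M.rsmult_r_distr N.rsmult_r_distr M.rsmult_assoc N.rsmult_assoc
        M.smult_rsmult N.smult_rsmult)
qed

lemma bimodule_power_simps [simp]:
  "carrier (M ^\<^sub>B n) = {..<n} \<rightarrow>\<^sub>E carrier M" "\<zero>\<^bsub>M ^\<^sub>B n\<^esub> = (\<lambda>i\<in>{..<n}. \<zero>\<^sub>M)"
  "x \<oplus>\<^bsub>M ^\<^sub>B n\<^esub> y = (\<lambda>i\<in>{..<n}. x i \<oplus>\<^sub>M y i)"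
  "a \<odot>\<^bsub>M ^\<^sub>B n\<^esub> x = (\<lambda>i\<in>{..<n}. a \<odot>\<^sub>M x i)"
  "x \<star>\<^bsub>M ^\<^sub>B n\<^esub> b = (\<lambda>i\<in>{..<n}. x i \<star>\<^sub>M b)"
  by (simp_all add: bimodule_power_def)

lemma abelian_group_power:
  assumes "abelian_group M"
  shows "abelian_group (M ^\<^sub>B n)"
proof -
  interpret M: abelian_group M by fact
  show ?thesis
  proof (rule abelian_groupI)
    fix x assume x: "x \<in> carrier (M ^\<^sub>B n)"
    then show "\<exists>y\<in>carrier (M ^\<^sub>B n). y \<oplus>\<^bsub>M ^\<^sub>B n\<^esub> x = \<zero>\<^bsub>M ^\<^sub>B n\<^esub>"
      by (intro bexI[of _ "\<lambda>i\<in>{..<n}. \<ominus>\<^sub>M x i"])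
        (auto simp: PiE_iff fun_eq_iff M.l_neg)
  qed (auto simp: PiE_iff fun_eq_iff extensional_def M.a_ac)
qed

lemma bimodule_power_bimodule:
  assumes "bimodule R S M"
  shows "bimodule R S (M ^\<^sub>B n)"
proof -
  interpret M: bimod R S M using assms by (simp add: bimod_def)
  interpret R: ring R by (rule M.left_ring)
  interpret S: ring S by (rule M.right_ring)
  have "abelian_group (M ^\<^sub>B n)"
    using abelian_group_power M.abelian_group_axioms by blast
  then show ?thesis unfolding bimodule_def left_module_def using M.left_ring M.right_ring
    by (auto simp: PiE_iff fun_eq_iff extensional_def M.smult_l_distr M.smult_r_distr M.smult_assoc
        M.rsmult_l_distr M.rsmult_r_distr M.rsmult_assoc M.smult_rsmult)
qed

lemma bimodule_sum_cong:
  assumes "bimodule_isomorphic R S M M'" "bimodule_isomorphic R S N N'"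
  shows "bimodule_isomorphic R S (M \<oplus>\<^sub>B N) (M' \<oplus>\<^sub>B N')"
proof -
  from assms obtain f g where f: "bimodule_hom R S M M' f" "bij_betw f (carrier M) (carrier M')"
    and g: "bimodule_hom R S N N' g" "bij_betw g (carrier N) (carrier N')"
    by (auto simp: bimodule_isomorphic_iff)
  then show ?thesis unfolding bimodule_isomorphic_iff
    by (intro exI[of _ "map_prod f g"]) (auto simp: bimodule_hom_def bij_betw_map_prod)
qed

lemma bimodule_sum_left_commute: "bimodule_isomorphic R S (M \<oplus>\<^sub>B N \<oplus>\<^sub>B Q) (N \<oplus>\<^sub>B M \<oplus>\<^sub>B Q)"
  by (rule bimodule_isomorphicI[where f = "\<lambda>(x, y, z). (y, x, z)" and g = "\<lambda>(x, y, z). (y, x, z)"])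
    (auto simp: bimodule_hom_def)

text \<open>The extra summand becomes the coordinate with index \<open>n\<close>, the one by which
  \<open>{..<Suc n}\<close> exceeds \<open>{..<n}\<close>. The second statement carries a summand
  past the front term of an iterated sum; repeating it brings a new copy of a model to the power it
  belongs to.\<close>

lemma bimodule_power_absorb:
  fixes R :: "('a, 'e) ring_scheme" and S :: "('b, 'f) ring_scheme" and N :: "('a, 'b, 'n) bimodule"
  shows "bimodule_isomorphic R S (M \<oplus>\<^sub>B M ^\<^sub>B n \<oplus>\<^sub>B N) (M ^\<^sub>B Suc n \<oplus>\<^sub>B N)"
  "bimodule_isomorphic R S (M \<oplus>\<^sub>B Q) Q' \<Longrightarrow>
     bimodule_isomorphic R S (M \<oplus>\<^sub>B N \<oplus>\<^sub>B Q) (N \<oplus>\<^sub>B Q')"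
proof -
  let ?f = "\<lambda>(x, y, z). (\<lambda>i\<in>{..<Suc n}. if i = n then x else y i, z)"
  let ?g = "\<lambda>(y, z). (y n, restrict y {..<n}, z)"
  show "bimodule_isomorphic R S (M \<oplus>\<^sub>B M ^\<^sub>B n \<oplus>\<^sub>B N) (M ^\<^sub>B Suc n \<oplus>\<^sub>B N)"
  proof (rule bimodule_isomorphicI[where f = ?f and g = ?g])
    show "bimodule_hom R S (M \<oplus>\<^sub>B M ^\<^sub>B n \<oplus>\<^sub>B N) (M ^\<^sub>B Suc n \<oplus>\<^sub>B N) ?f"
      unfolding bimodule_hom_def
    proof (intro conjI ballI)
      show "?f \<in> carrier (M \<oplus>\<^sub>B M ^\<^sub>B n \<oplus>\<^sub>B N) \<rightarrow> carrier (M ^\<^sub>B Suc n \<oplus>\<^sub>B N)"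
        by (clarsimp simp: Pi_iff) (metis PiE_mem lessThan_iff less_antisym)
    qed (clarsimp, rule ext, simp)+
    show "?g \<in> carrier (M ^\<^sub>B Suc n \<oplus>\<^sub>B N) \<rightarrow> carrier (M \<oplus>\<^sub>B M ^\<^sub>B n \<oplus>\<^sub>B N)"
      by (clarsimp simp: Pi_iff) (metis PiE_mem lessThan_iff lessI less_SucI)
    show "?g (?f x) = x" if "x \<in> carrier (M \<oplus>\<^sub>B M ^\<^sub>B n \<oplus>\<^sub>B N)" for x
    proof -
      obtain u v z where x: "x = (u, v, z)" by (cases x)
      then have v: "v \<in> {..<n} \<rightarrow>\<^sub>E carrier M" using that by simp
      have "restrict (\<lambda>i\<in>{..<Suc n}. if i = n then u else v i) {..<n} = v"
        by (intro ext) (simp add: PiE_arb[OF v] restrict_def)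
      then show ?thesis by (simp add: x)
    qed
    show "?f (?g y) = y" if "y \<in> carrier (M ^\<^sub>B Suc n \<oplus>\<^sub>B N)" for y
    proof -
      obtain u z where y: "y = (u, z)" by (cases y)
      then have u: "u \<in> {..<Suc n} \<rightarrow>\<^sub>E carrier M" using that by simp
      have "(\<lambda>i\<in>{..<Suc n}. if i = n then u n else restrict u {..<n} i) = u"
        by (intro ext) (simp add: PiE_arb[OF u] restrict_def)
      then show ?thesis by (simp add: y)
    qed
  qed
  show "bimodule_isomorphic R S (M \<oplus>\<^sub>B N \<oplus>\<^sub>B Q) (N \<oplus>\<^sub>B Q')"
    if "bimodule_isomorphic R S (M \<oplus>\<^sub>B Q) Q'"
    by (rule bimodule_isomorphic_trans[OF bimodule_sum_left_commute
          bimodule_sum_cong[OF bimodule_isomorphic_refl that]])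
qed

section \<open>Subbimodules and internal direct sums\<close>

abbreviation sub_bimodule :: "('a, 'b, 'm) bimodule \<Rightarrow> 'm set \<Rightarrow> ('a, 'b, 'm) bimodule" where
  "sub_bimodule M A \<equiv> M\<lparr>carrier := A\<rparr>"

lemma subbimoduleD:
  assumes "subbimodule R S M A"
  shows "A \<subseteq> carrier M" "\<zero>\<^sub>M \<in> A" "x \<in> A \<Longrightarrow> y \<in> A \<Longrightarrow> x \<oplus>\<^sub>M y \<in> A"
    "x \<in> A \<Longrightarrow> \<ominus>\<^sub>M x \<in> A" "a \<in> carrier R \<Longrightarrow> x \<in> A \<Longrightarrow> a \<odot>\<^sub>M x \<in> A"
    "x \<in> A \<Longrightarrow> b \<in> carrier S \<Longrightarrow> x \<star>\<^sub>M b \<in> A"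
proof -
  have s: "subgroup A (add_monoid M)" using assms by (simp add: subbimodule_def left_submodule_def)
  show "A \<subseteq> carrier M" "\<zero>\<^sub>M \<in> A" "x \<in> A \<Longrightarrow> y \<in> A \<Longrightarrow> x \<oplus>\<^sub>M y \<in> A"
    "x \<in> A \<Longrightarrow> \<ominus>\<^sub>M x \<in> A"
    using subgroup.subset[OF s] subgroup.one_closed[OF s] subgroup.m_closed[OF s]
      subgroup.m_inv_closed[OF s] by (auto simp: a_inv_def)
  show "a \<in> carrier R \<Longrightarrow> x \<in> A \<Longrightarrow> a \<odot>\<^sub>M x \<in> A" "x \<in> A \<Longrightarrow> b \<in> carrier S \<Longrightarrow> x \<star>\<^sub>M b \<in> A"
    using assms by (auto simp: subbimodule_def left_submodule_def)
qed

context bimod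
begin

text \<open>Negation is left multiplication by the negative of the unit, so closure under sums and
  under the left action already makes \<open>A\<close> a subgroup.\<close>

lemma subbimoduleI:
  assumes "A \<subseteq> carrier M" "\<zero>\<^sub>M \<in> A" "\<And>x y. x \<in> A \<Longrightarrow> y \<in> A \<Longrightarrow> x \<oplus>\<^sub>M y \<in> A"
    "\<And>a x. a \<in> carrier R \<Longrightarrow> x \<in> A \<Longrightarrow> a \<odot>\<^sub>M x \<in> A"
    "\<And>x b. x \<in> A \<Longrightarrow> b \<in> carrier S \<Longrightarrow> x \<star>\<^sub>M b \<in> A"
  shows "subbimodule R S M A"
proof -
  interpret R: ring R by (rule left_ring)
  have "\<ominus>\<^sub>M x \<in> A" if "x \<in> A" for x
    using assms(4)[of "\<ominus>\<^sub>R \<one>\<^sub>R" x] that assms(1) by (auto simp: uminus_smult subset_iff)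
  then have "subgroup A (add_monoid M)"
    using assms(1-3) by (intro add.subgroupI) (auto simp: a_inv_def)
  then show ?thesis using assms(4,5) by (auto simp: subbimodule_def left_submodule_def)
qed

lemma sub_bimodule_bimodule:
  assumes "subbimodule R S M A"
  shows "bimodule R S (sub_bimodule M A)"
proof -
  note A = subbimoduleD[OF assms]
  have sub: "x \<in> A \<Longrightarrow> x \<in> carrier M" for x using A(1) by auto
  have "abelian_group (sub_bimodule M A)"
  proof (rule abelian_groupI)
    fix x assume "x \<in> carrier (sub_bimodule M A)"
    then show "\<exists>y\<in>carrier (sub_bimodule M A). y \<oplus>\<^bsub>sub_bimodule M A\<^esub> x = \<zero>\<^bsub>sub_bimodule M A\<^esub>"
      by (intro bexI[of _ "\<ominus>\<^sub>M x"]) (auto simp: l_neg sub A)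
  qed (use A in \<open>auto simp: sub a_ac\<close>)
  then show ?thesis using left_ring right_ring A
    by (auto simp: bimodule_def left_module_def sub smult_l_distr smult_r_distr smult_assoc
        rsmult_l_distr rsmult_r_distr rsmult_assoc smult_rsmult)
qed

lemma kernel_subbimodule:
  assumes "bimodule_hom R S M N f" "bimodule R S N"
  shows "subbimodule R S M {x \<in> carrier M. f x = \<zero>\<^sub>N}"
proof -
  interpret N: bimod R S N using assms(2) by (simp add: bimod_def)
  have "f (\<zero>\<^sub>M \<oplus>\<^sub>M \<zero>\<^sub>M) = f \<zero>\<^sub>M \<oplus>\<^sub>N f \<zero>\<^sub>M" "f \<zero>\<^sub>M \<in> carrier N"
    using assms(1) zero_closed unfolding bimodule_hom_def by blast+
  then have "f \<zero>\<^sub>M = \<zero>\<^sub>N" by (metis N.add.l_cancel_one l_zero zero_closed)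
  then show ?thesis using assms(1) by (intro subbimoduleI) (auto simp: bimodule_hom_def)
qed

lemma image_subbimodule:
  assumes "bimodule_hom R S N M f" "bimodule R S N"
  shows "subbimodule R S M (f ` carrier N)"
proof -
  interpret N: bimod R S N using assms(2) by (simp add: bimod_def)
  have "f (\<zero>\<^sub>N \<oplus>\<^sub>N \<zero>\<^sub>N) = f \<zero>\<^sub>N \<oplus>\<^sub>M f \<zero>\<^sub>N" "f \<zero>\<^sub>N \<in> carrier M"
    using assms(1) N.zero_closed unfolding bimodule_hom_def by blast+
  then have z: "f \<zero>\<^sub>N = \<zero>\<^sub>M" by (metis add.l_cancel_one N.l_zero N.zero_closed)
  have h: "f x \<in> carrier M" "f x \<oplus>\<^sub>M f y = f (x \<oplus>\<^sub>N y)" "a \<in> carrier R \<Longrightarrow> a \<odot>\<^sub>M f x = f (a \<odot>\<^sub>N x)"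
      "b \<in> carrier S \<Longrightarrow> f x \<star>\<^sub>M b = f (x \<star>\<^sub>N b)"
    if "x \<in> carrier N" "y \<in> carrier N" for x y a b
    using assms(1) that by (auto simp: bimodule_hom_def)
  show ?thesis
    by (rule subbimoduleI) (auto simp: h intro: image_eqI[of _ _ "\<zero>\<^sub>N"] z[symmetric])
qed

text \<open>Addition is an isomorphism from the external sum. Two representations of one vector
  differ by an element that lies in \<open>A\<close> as a difference of first terms and in
  \<open>B\<close> as a difference of second terms, hence vanishes.\<close>

lemma internal_direct_sum_isomorphic:
  assumes "subbimodule R S M A" "subbimodule R S M B" "internal_direct_sum M A B"
  shows "bimodule_isomorphic R S M (sub_bimodule M A \<oplus>\<^sub>B sub_bimodule M B)"
proof -
  note A = subbimoduleD[OF assms(1)] and B = subbimoduleD[OF assms(2)]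
  have sub: "x \<in> A \<Longrightarrow> x \<in> carrier M" "x \<in> B \<Longrightarrow> x \<in> carrier M" for x using A(1) B(1) by auto
  have AB: "A \<inter> B = {\<zero>\<^sub>M}" and S: "A <+>\<^sub>M B = carrier M"
    using assms(3) by (auto simp: internal_direct_sum_def)
  let ?f = "\<lambda>(x, y). x \<oplus>\<^sub>M y"
  have hom: "bimodule_hom R S (sub_bimodule M A \<oplus>\<^sub>B sub_bimodule M B) M ?f"
    by (auto simp: bimodule_hom_def sub a_ac smult_r_distr rsmult_l_distr)
  have surj: "?f ` (A \<times> B) = carrier M"
    unfolding S[symmetric] by (force simp: set_add_def set_mult_def image_iff)
  have inj: "inj_on ?f (A \<times> B)"
  proof (intro inj_onI, clarify)
    fix x y x' y' assume h: "x \<in> A" "y \<in> B" "x' \<in> A" "y' \<in> B" "x \<oplus>\<^sub>M y = x' \<oplus>\<^sub>M y'"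
    have "x' \<oplus>\<^sub>M (x \<ominus>\<^sub>M x' \<oplus>\<^sub>M y) = x \<oplus>\<^sub>M y"
      using h sub by (simp add: minus_eq a_lcomm[of x'] r_neg2 a_assoc)
    then have "x \<ominus>\<^sub>M x' \<oplus>\<^sub>M y = y'" unfolding h(5) using h sub by simp
    then have "x \<ominus>\<^sub>M x' = y' \<ominus>\<^sub>M y" using h sub
      by (metis add.inv_solve_right minus_closed minus_eq)
    moreover have "x \<ominus>\<^sub>M x' \<in> A" "y' \<ominus>\<^sub>M y \<in> B" using h A B by (auto simp: minus_eq)
    ultimately have "x \<ominus>\<^sub>M x' = \<zero>\<^sub>M" "y' \<ominus>\<^sub>M y = \<zero>\<^sub>M" using AB by auto
    then have "x = x'" "y' = y" using h sub by (simp_all add: minus_eq add.inv_solve_right')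
    then show "x = x' \<and> y = y'" by simp
  qed
  have "bimodule_isomorphic R S (sub_bimodule M A \<oplus>\<^sub>B sub_bimodule M B) M"
    unfolding bimodule_isomorphic_iff using hom surj inj by (intro exI[of _ ?f]) (simp add: bij_betw_def)
  then show ?thesis
    by (rule bimodule_isomorphic_sym)
      (intro bimodule_sum_bimodule sub_bimodule_bimodule assms)
qed

text \<open>Every \<open>x\<close> is \<open>h (f x)\<close> plus a remainder killed by
  \<open>f\<close>, since \<open>f\<close> undoes \<open>h\<close>. The image of the section and the
  kernel of the projection are therefore complementary, and \<open>f\<close> identifies that image
  with \<open>T\<close>.\<close>

lemma split_internal_direct_sum:
  assumes "bimodule R S T" "bimodule_hom R S M T f" "bimodule_hom R S T M h"
    "\<And>t. t \<in> carrier T \<Longrightarrow> f (h t) = t"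
  shows "internal_direct_sum M (h ` carrier T) {x \<in> carrier M. f x = \<zero>\<^sub>T}"
    "bimodule_isomorphic R S (sub_bimodule M (h ` carrier T)) T"
proof -
  interpret T: bimod R S T using assms(1) by (simp add: bimod_def)
  have f: "f x \<in> carrier T" "f (x \<oplus>\<^sub>M y) = f x \<oplus>\<^sub>T f y" if "x \<in> carrier M" "y \<in> carrier M" for x y
    using assms(2) that by (auto simp: bimodule_hom_def)
  have h: "h x \<in> carrier M" "h (x \<oplus>\<^sub>T y) = h x \<oplus>\<^sub>M h y" if "x \<in> carrier T" "y \<in> carrier T" for x y
    using assms(3) that by (auto simp: bimodule_hom_def)
  have "h \<zero>\<^sub>T \<oplus>\<^sub>M h \<zero>\<^sub>T = h \<zero>\<^sub>T" using h(2)[of "\<zero>\<^sub>T" "\<zero>\<^sub>T"] by simp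
  then have hz: "h \<zero>\<^sub>T = \<zero>\<^sub>M" using h by (metis add.l_cancel_one T.zero_closed)
  have "x \<in> (h ` carrier T) <+>\<^sub>M {x \<in> carrier M. f x = \<zero>\<^sub>T}" if x: "x \<in> carrier M" for x
  proof -
    let ?t = "f x"
    have t: "?t \<in> carrier T" using f x by auto
    have "f (x \<oplus>\<^sub>M h (\<ominus>\<^sub>T ?t)) = \<zero>\<^sub>T" 
      using f(2)[OF x h(1)[of "\<ominus>\<^sub>T ?t"]] t assms(4) by (simp add: T.r_neg)
    moreover have "h ?t \<oplus>\<^sub>M h (\<ominus>\<^sub>T ?t) = \<zero>\<^sub>M"
      using h(2)[of ?t "\<ominus>\<^sub>T ?t"] t hz by (simp add: T.r_neg)
    then have "x = h ?t \<oplus>\<^sub>M (x \<oplus>\<^sub>M h (\<ominus>\<^sub>T ?t))"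
      using x t h by (simp add: a_lcomm)
    ultimately show ?thesis using x t h
      by (auto simp: set_add_def set_mult_def intro!: exI[of _ ?t] bexI[of _ ?t] exI[of _ "x \<oplus>\<^sub>M h (\<ominus>\<^sub>T ?t)"])
  qed
  moreover have "(h ` carrier T) <+>\<^sub>M {x \<in> carrier M. f x = \<zero>\<^sub>T} \<subseteq> carrier M"
    using h by (auto simp: set_add_def set_mult_def)
  moreover have "f \<zero>\<^sub>M = \<zero>\<^sub>T" using assms(4)[of "\<zero>\<^sub>T"] hz by simp
  then have "h ` carrier T \<inter> {x \<in> carrier M. f x = \<zero>\<^sub>T} = {\<zero>\<^sub>M}"
    using assms(4) hz by (auto intro: image_eqI[of _ _ "\<zero>\<^sub>T"])
  ultimately show "internal_direct_sum M (h ` carrier T) {x \<in> carrier M. f x = \<zero>\<^sub>T}"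
    unfolding internal_direct_sum_def by blast
  have sub: "h ` carrier T \<subseteq> carrier M" using h by auto
  have "bimodule_hom R S (sub_bimodule M (h ` carrier T)) T f"
    using f(1)[OF _ zero_closed] f(2) h(1)[OF _ T.zero_closed] assms(2) by (auto simp: bimodule_hom_def)
  then show "bimodule_isomorphic R S (sub_bimodule M (h ` carrier T)) T"
    by (rule bimodule_isomorphicI[where g = h]) (use h assms(4) in auto)
qed

end

section \<open>Reductions of bimodules\<close>

lemma generate_image:
  assumes "f \<in> carrier M \<rightarrow> carrier N" "\<And>x y. x \<in> carrier M \<Longrightarrow> y \<in> carrier M \<Longrightarrow> f (x \<oplus>\<^sub>M y) = f x \<oplus>\<^sub>N f y"
    "abelian_group M" "abelian_group N" "K \<subseteq> carrier M"
  shows "f ` generate (add_monoid M) K = generate (add_monoid N) (f ` K)"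
proof -
  interpret M: abelian_group M by fact
  interpret N: abelian_group N by fact
  interpret group_hom "add_monoid M" "add_monoid N" f
    using assms(1,2) M.a_group N.a_group by (auto simp: group_hom_def group_hom_axioms_def hom_def)
  show ?thesis using generate_img[of K] assms(5) by simp
qed

text \<open>Surjectivity of \<open>f\<close> makes the generating products of the source map onto
  those of the target; the generated subgroups then correspond.\<close>

lemma ideal_times_isomorphic:
  assumes "bimodule R S L" "bimodule R S L'" "bimodule_hom R S L L' f" "f ` carrier L = carrier L'" "I \<subseteq> carrier R"
  shows "f ` ideal_times I L = ideal_times I L'"
proof -
  interpret L: bimod R S L using assms(1) by (simp add: bimod_def)
  interpret L': bimod R S L' using assms(2) by (simp add: bimod_def)
  have h: "f \<in> carrier L \<rightarrow> carrier L'" "\<And>x y. x \<in> carrier L \<Longrightarrow> y \<in> carrier L \<Longrightarrow> f (x \<oplus>\<^sub>L y) = f x \<oplus>\<^sub>L' f y"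
    "\<And>a x. a \<in> carrier R \<Longrightarrow> x \<in> carrier L \<Longrightarrow> f (a \<odot>\<^sub>L x) = a \<odot>\<^sub>L' f x"
    using assms(3) by (auto simp: bimodule_hom_def)
  have "f ` {a \<odot>\<^sub>L x |a x. a \<in> I \<and> x \<in> carrier L} = {a \<odot>\<^sub>L' x |a x. a \<in> I \<and> x \<in> carrier L'}"
    (is "f ` ?A = ?B")
  proof (intro equalityI subsetI)
    show "y \<in> ?B" if "y \<in> f ` ?A" for y using that assms(5) h by (fastforce simp: subset_iff)
    fix y assume "y \<in> ?B"
    then obtain a x where y: "y = a \<odot>\<^sub>L' f x" "a \<in> I" "x \<in> carrier L"
      unfolding assms(4)[symmetric] by auto
    then have "y = f (a \<odot>\<^sub>L x)" using h(3) assms(5) by auto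
    then show "y \<in> f ` ?A" using y(2,3) by auto
  qed
  moreover have "?A \<subseteq> carrier L" using assms(5) by auto
  ultimately show ?thesis unfolding ideal_times_def
    using generate_image[OF h(1,2) L.abelian_group_axioms L'.abelian_group_axioms] by simp
qed

lemma a_r_coset_image:
  assumes "\<And>x y. x \<in> carrier L \<Longrightarrow> y \<in> carrier L \<Longrightarrow> f (x \<oplus>\<^sub>L y) = f x \<oplus>\<^sub>L' f y"
    "N \<subseteq> carrier L" "x \<in> carrier L"
  shows "f ` (N +>\<^sub>L x) = (f ` N) +>\<^sub>L' f x"
  using assms by (force simp: a_r_coset_def r_coset_def subset_iff)

text \<open>The isomorphism of quotients is the direct image of cosets under \<open>f\<close>. The
  scalars \<open>R'\<close> and \<open>S'\<close> enter as collections of subsets of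
  \<open>R\<close> and \<open>S\<close>, which lets the two sides be reduced modulo different
  ideals.\<close>

lemma quotient_bimodule_isomorphic:
  assumes L: "bimodule R S L" and L': "bimodule R S L'" and iso: "bimodule_isomorphic R S L L'"
    and I: "I \<subseteq> carrier R" and A: "\<And>A. A \<in> carrier R' \<Longrightarrow> A \<subseteq> carrier R"
    and B: "\<And>B. B \<in> carrier S' \<Longrightarrow> B \<subseteq> carrier S"
  shows "bimodule_isomorphic R' S' (quotient_bimodule L (ideal_times I L)) (quotient_bimodule L' (ideal_times I L'))"
proof -
  interpret L: bimod R S L using L by (simp add: bimod_def)
  interpret L': bimod R S L' using L' by (simp add: bimod_def)
  obtain f where f: "bimodule_hom R S L L' f" "bij_betw f (carrier L) (carrier L')"
    using iso by (auto simp: bimodule_isomorphic_iff)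
  let ?N = "ideal_times I L" and ?N' = "ideal_times I L'"
  have h: "f x \<in> carrier L'" "y \<in> carrier L \<Longrightarrow> f (x \<oplus>\<^sub>L y) = f x \<oplus>\<^sub>L' f y"
      "a \<in> carrier R \<Longrightarrow> f (a \<odot>\<^sub>L x) = a \<odot>\<^sub>L' f x" "b \<in> carrier S \<Longrightarrow> f (x \<star>\<^sub>L b) = f x \<star>\<^sub>L' b"
    if "x \<in> carrier L" for x y a b
    using f(1) that by (auto simp: bimodule_hom_def)
  have surj: "f ` carrier L = carrier L'" and inj: "inj_on f (carrier L)"
    using f(2) by (auto simp: bij_betw_def)
  have N: "f ` ?N = ?N'" by (rule ideal_times_isomorphic[OF L L' f(1) surj I])
  have sub: "?N \<subseteq> carrier L" unfolding ideal_times_def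
    using L.add.generate_incl[of "{a \<odot>\<^sub>L x |a x. a \<in> I \<and> x \<in> carrier L}"] I by auto
  have cos: "f ` (?N +>\<^sub>L x) = ?N' +>\<^sub>L' f x" if "x \<in> carrier L" for x
    using a_r_coset_image[of L f L' ?N x] h sub that N by simp
  have car: "carrier (quotient_bimodule L ?N) = (\<lambda>x. ?N +>\<^sub>L x) ` carrier L"
    "carrier (quotient_bimodule L' ?N') = (\<lambda>x. ?N' +>\<^sub>L' x) ` carrier L'"
    by (auto simp: quotient_bimodule_def A_RCOSETS_def RCOSETS_def a_r_coset_def)
  have Csub: "C \<subseteq> carrier L" if "C \<in> carrier (quotient_bimodule L ?N)" for C
    using that sub L.a_r_coset_subset_G by (auto simp: car)
  have "bij_betw ((`) f) (carrier (quotient_bimodule L ?N)) (carrier (quotient_bimodule L' ?N'))"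
    unfolding bij_betw_def
  proof
    show "inj_on ((`) f) (carrier (quotient_bimodule L ?N))"
      using inj Csub by (meson inj_onI inj_on_image_eq_iff)
    show "(`) f ` carrier (quotient_bimodule L ?N) = carrier (quotient_bimodule L' ?N')"
      unfolding car image_image surj[symmetric] using cos by (intro image_cong) auto
  qed
  moreover have "f ` (C \<oplus>\<^bsub>quotient_bimodule L ?N\<^esub> C') = f ` C \<oplus>\<^bsub>quotient_bimodule L' ?N'\<^esub> f ` C'"
    if "C \<in> carrier (quotient_bimodule L ?N)" "C' \<in> carrier (quotient_bimodule L ?N)" for C C'
    using Csub[OF that(1)] Csub[OF that(2)] h
    by (force simp: quotient_bimodule_def set_add_def set_mult_def subset_iff image_UN)
  moreover have "f ` (Q \<odot>\<^bsub>quotient_bimodule L ?N\<^esub> C) = Q \<odot>\<^bsub>quotient_bimodule L' ?N'\<^esub> f ` C"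
    if "C \<in> carrier (quotient_bimodule L ?N)" "Q \<in> carrier R'" for C Q
  proof -
    have "f ` (?N +>\<^sub>L (a \<odot>\<^sub>L x)) = ?N' +>\<^sub>L' (a \<odot>\<^sub>L' f x)" if "a \<in> Q" "x \<in> C" for a x
    proof -
      have "a \<in> carrier R" "x \<in> carrier L" using Csub[OF \<open>C \<in> _\<close>] A[OF \<open>Q \<in> _\<close>] that by auto
      then show ?thesis using cos[of "a \<odot>\<^sub>L x"] h(3) by simp
    qed
    then show ?thesis by (simp add: quotient_bimodule_def image_UN)
  qed
  moreover have "f ` (C \<star>\<^bsub>quotient_bimodule L ?N\<^esub> Q) = f ` C \<star>\<^bsub>quotient_bimodule L' ?N'\<^esub> Q"
    if "C \<in> carrier (quotient_bimodule L ?N)" "Q \<in> carrier S'" for C Q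
  proof -
    have "f ` (?N +>\<^sub>L (x \<star>\<^sub>L b)) = ?N' +>\<^sub>L' (f x \<star>\<^sub>L' b)" if "b \<in> Q" "x \<in> C" for b x
    proof -
      have "b \<in> carrier S" "x \<in> carrier L" using Csub[OF \<open>C \<in> _\<close>] B[OF \<open>Q \<in> _\<close>] that by auto
      then show ?thesis using cos[of "x \<star>\<^sub>L b"] h(4) by simp
    qed
    then show ?thesis by (simp add: quotient_bimodule_def image_UN)
  qed
  ultimately show ?thesis unfolding bimodule_isomorphic_def by (intro exI[of _ "(`) f"]) auto
qed

text \<open>The last two assumptions say that \<open>I\<close> and \<open>J\<close> act as zero on
  the quotient of \<open>L\<close> by \<open>N\<close>. Residue classes modulo them therefore act on
  cosets, and every union in \<open>quotient_bimodule\<close> collapses to one coset.\<close>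

locale bimod_quotient = bimod R S L for R :: "('a, 'e) ring_scheme" and S :: "('b, 'f) ring_scheme" and L :: "('a, 'b, 'm) bimodule" +
  fixes I J N
  assumes left_ideal: "ideal I R" and right_ideal: "ideal J S" and subbimodule: "subbimodule R S L N"
    and left_absorb: "\<And>a x. a \<in> I \<Longrightarrow> x \<in> carrier L \<Longrightarrow> a \<odot>\<^sub>L x \<in> N"
    and right_absorb: "\<And>b x. b \<in> J \<Longrightarrow> x \<in> carrier L \<Longrightarrow> x \<star>\<^sub>L b \<in> N"
begin

abbreviation Q where "Q \<equiv> quotient_bimodule L N"
abbreviation cls where "cls x \<equiv> N +>\<^sub>L x"

lemma abelian_subgroup_N: "abelian_subgroup N L"
  using subbimodule abelian_group_axioms
  by (intro abelian_subgroupI3) (auto simp: subbimodule_def left_submodule_def additive_subgroup_def)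

sublocale N: abelian_subgroup N L by (rule abelian_subgroup_N)

sublocale I: ideal I R by (rule left_ideal)
sublocale J: ideal J S by (rule right_ideal)

lemma carrier_Q: "carrier Q = cls ` carrier L"
  by (auto simp: quotient_bimodule_def A_RCOSETS_def RCOSETS_def a_r_coset_def)

lemma cls_closed [simp]: "x \<in> carrier L \<Longrightarrow> cls x \<in> carrier Q"
  by (simp add: carrier_Q)

lemma cls_mem_iff: "x \<in> carrier L \<Longrightarrow> y \<in> carrier L \<Longrightarrow> x \<in> cls y \<longleftrightarrow> x \<ominus>\<^sub>L y \<in> N"
  by (simp add: N.a_rcos_module minus_eq)

lemma cls_eq_iff: "x \<in> carrier L \<Longrightarrow> y \<in> carrier L \<Longrightarrow> cls x = cls y \<longleftrightarrow> x \<ominus>\<^sub>L y \<in> N"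
  using N.a_rcos_self[of x] N.a_repr_independence'[of x y] by (auto simp: cls_mem_iff[symmetric])

lemma cls_add: "x \<in> carrier L \<Longrightarrow> y \<in> carrier L \<Longrightarrow> cls x \<oplus>\<^sub>Q cls y = cls (x \<oplus>\<^sub>L y)"
  by (simp add: quotient_bimodule_def N.a_rcos_sum)

text \<open>Expanding (i + a) (n + x) leaves a x up to i (n + x) + a n. The first of these terms is
  absorbed by the ideal and the second by the submodule, so all representatives contribute the same
  coset.\<close>

lemma smult_cls:
  assumes "a \<in> carrier R" "x \<in> carrier L"
  shows "(I +>\<^sub>R a) \<odot>\<^sub>Q cls x = cls (a \<odot>\<^sub>L x)"
proof -
  note NN = subbimoduleD[OF subbimodule]
  have "cls (a' \<odot>\<^sub>L x') = cls (a \<odot>\<^sub>L x)" if "a' \<in> I +>\<^sub>R a" "x' \<in> cls x" for a' x'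
  proof -
    note mem = that
    obtain i n where a': "a' = i \<oplus>\<^sub>R a" "i \<in> I" and x': "x' = n \<oplus>\<^sub>L x" "n \<in> N"
      using mem unfolding a_r_coset_def' UN_iff singleton_iff by metis
    have c: "i \<in> carrier R" "n \<in> carrier L" "x' \<in> carrier L"
      using a' x' NN(1) I.a_subset assms by auto
    have "a' \<odot>\<^sub>L x' = i \<odot>\<^sub>L x' \<oplus>\<^sub>L a \<odot>\<^sub>L x'"
      using a' c assms by (simp add: smult_l_distr)
    also have "a \<odot>\<^sub>L x' = a \<odot>\<^sub>L n \<oplus>\<^sub>L a \<odot>\<^sub>L x"
      using x' c assms by (simp add: smult_r_distr)
    finally have "a' \<odot>\<^sub>L x' = (i \<odot>\<^sub>L x' \<oplus>\<^sub>L a \<odot>\<^sub>L n) \<oplus>\<^sub>L a \<odot>\<^sub>L x"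
      using c assms by (simp add: a_assoc)
    moreover have "i \<odot>\<^sub>L x' \<oplus>\<^sub>L a \<odot>\<^sub>L n \<in> N"
      using c a' x' assms NN left_absorb by auto
    ultimately have "a' \<odot>\<^sub>L x' \<in> cls (a \<odot>\<^sub>L x)"
      by (auto simp: a_r_coset_def r_coset_def)
    then show ?thesis using N.a_repr_independence' assms by auto
  qed
  then have "(\<Union>a'\<in>I +>\<^sub>R a. \<Union>x'\<in>cls x. cls (a' \<odot>\<^sub>L x')) =
      (\<Union>a'\<in>I +>\<^sub>R a. \<Union>x'\<in>cls x. cls (a \<odot>\<^sub>L x))"
    by (intro SUP_cong refl)
  also have "\<dots> = cls (a \<odot>\<^sub>L x)"
    using I.a_rcos_self[OF assms(1)] N.a_rcos_self[OF assms(2)] by blast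
  finally show ?thesis by (simp add: quotient_bimodule_def)
qed

lemma cls_rsmult:
  assumes "a \<in> carrier S" "x \<in> carrier L"
  shows "cls x \<star>\<^sub>Q (J +>\<^sub>S a) = cls (x \<star>\<^sub>L a)"
proof -
  note NN = subbimoduleD[OF subbimodule]
  have "cls (x' \<star>\<^sub>L a') = cls (x \<star>\<^sub>L a)" if "a' \<in> J +>\<^sub>S a" "x' \<in> cls x" for a' x'
  proof -
    note mem = that
    obtain i n where a': "a' = i \<oplus>\<^sub>S a" "i \<in> J" and x': "x' = n \<oplus>\<^sub>L x" "n \<in> N"
      using mem unfolding a_r_coset_def' UN_iff singleton_iff by metis
    have c: "i \<in> carrier S" "n \<in> carrier L" "x' \<in> carrier L"
      using a' x' NN(1) J.a_subset assms by auto
    have "x' \<star>\<^sub>L a' = x' \<star>\<^sub>L i \<oplus>\<^sub>L x' \<star>\<^sub>L a"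
      using a' c assms by (simp add: rsmult_r_distr)
    also have "x' \<star>\<^sub>L a = n \<star>\<^sub>L a \<oplus>\<^sub>L x \<star>\<^sub>L a"
      using x' c assms by (simp add: rsmult_l_distr)
    finally have "x' \<star>\<^sub>L a' = (x' \<star>\<^sub>L i \<oplus>\<^sub>L n \<star>\<^sub>L a) \<oplus>\<^sub>L x \<star>\<^sub>L a"
      using c assms by (simp add: a_assoc)
    moreover have "x' \<star>\<^sub>L i \<oplus>\<^sub>L n \<star>\<^sub>L a \<in> N"
      using c a' x' assms NN right_absorb by auto
    ultimately have "x' \<star>\<^sub>L a' \<in> cls (x \<star>\<^sub>L a)"
      by (auto simp: a_r_coset_def r_coset_def)
    then show ?thesis using N.a_repr_independence' assms by auto
  qed
  then have "(\<Union>x'\<in>cls x. \<Union>a'\<in>J +>\<^sub>S a. cls (x' \<star>\<^sub>L a')) =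
      (\<Union>x'\<in>cls x. \<Union>a'\<in>J +>\<^sub>S a. cls (x \<star>\<^sub>L a))"
    by (intro SUP_cong refl)
  also have "\<dots> = cls (x \<star>\<^sub>L a)"
    using J.a_rcos_self[OF assms(1)] N.a_rcos_self[OF assms(2)] by blast
  finally show ?thesis by (simp add: quotient_bimodule_def)
qed

end

lemma carrier_FactRing: "carrier (R Quot I) = (\<lambda>a. I +>\<^sub>R a) ` carrier R"
  by (auto simp: FactRing_def A_RCOSETS_def RCOSETS_def a_r_coset_def)

text \<open>A coset modulo \<open>N \<times> N'\<close> is the product of a coset modulo
  \<open>N\<close> and one modulo \<open>N'\<close>, and the map sends a pair of cosets to their
  product set. It is injective because cosets are nonempty, and nonempty product sets determine
  their factors.\<close>

lemma quotient_bimodule_sum: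
  assumes "bimod_quotient R S L I J N" "bimod_quotient R S M I J N'"
  shows "bimodule_isomorphic (R Quot I) (S Quot J) (quotient_bimodule L N \<oplus>\<^sub>B quotient_bimodule M N')
    (quotient_bimodule (L \<oplus>\<^sub>B M) (N \<times> N'))"
proof -
  interpret L: bimod_quotient R S L I J N by fact
  interpret M: bimod_quotient R S M I J N' by fact
  note LN = subbimoduleD[OF L.subbimodule] and MN = subbimoduleD[OF M.subbimodule]
  have "bimodule R S (L \<oplus>\<^sub>B M)"
    using bimodule_sum_bimodule L.bimodule M.bimodule by blast
  then interpret LM: bimod R S "L \<oplus>\<^sub>B M" by (simp add: bimod_def)
  have "subbimodule R S (L \<oplus>\<^sub>B M) (N \<times> N')"
  proof (rule LM.subbimoduleI)
    show "N \<times> N' \<subseteq> carrier (L \<oplus>\<^sub>B M)" using LN(1) MN(1) by auto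
  qed (auto simp: LN(2,3,5,6) MN(2,3,5,6))
  then interpret LM: bimod_quotient R S "L \<oplus>\<^sub>B M" I J "N \<times> N'"
    using L.left_ideal L.right_ideal
    by unfold_locales (auto simp: L.left_absorb M.left_absorb L.right_absorb M.right_absorb)
  have cls: "LM.cls (x, y) = L.cls x \<times> M.cls y" for x y
    by (auto simp: a_r_coset_def r_coset_def)
  let ?f = "\<lambda>(C, C'). C \<times> C'"
  have "bij_betw ?f (carrier (L.Q \<oplus>\<^sub>B M.Q)) (carrier LM.Q)"
    unfolding bij_betw_def
  proof
    have ne: "L.cls x \<noteq> {}" "M.cls y \<noteq> {}" if "x \<in> carrier L" "y \<in> carrier M" for x y
      using that L.N.a_rcos_self M.N.a_rcos_self by blast+
    show "inj_on ?f (carrier (L.Q \<oplus>\<^sub>B M.Q))"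
    proof (rule inj_onI)
      fix C D assume "C \<in> carrier (L.Q \<oplus>\<^sub>B M.Q)" "D \<in> carrier (L.Q \<oplus>\<^sub>B M.Q)" and eq: "?f C = ?f D"
      then obtain x y x' y' where C: "C = (L.cls x, M.cls y)" "D = (L.cls x', M.cls y')"
        "x \<in> carrier L" "y \<in> carrier M" "x' \<in> carrier L" "y' \<in> carrier M"
        by (auto simp: L.carrier_Q M.carrier_Q)
      then show "C = D" using eq ne[OF C(3,4)] by (simp add: times_eq_iff)
    qed
    have "?f ` (L.cls ` carrier L \<times> M.cls ` carrier M) = LM.cls ` (carrier L \<times> carrier M)"
    proof (intro equalityI subsetI)
      fix C assume "C \<in> ?f ` (L.cls ` carrier L \<times> M.cls ` carrier M)"
      then obtain x y where "x \<in> carrier L" "y \<in> carrier M" "C = LM.cls (x, y)"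
        by (auto simp: cls)
      then show "C \<in> LM.cls ` (carrier L \<times> carrier M)" by blast
    next
      fix C assume "C \<in> LM.cls ` (carrier L \<times> carrier M)"
      then obtain x y where "x \<in> carrier L" "y \<in> carrier M" "C = ?f (L.cls x, M.cls y)"
        by (auto simp: cls)
      then show "C \<in> ?f ` (L.cls ` carrier L \<times> M.cls ` carrier M)" by blast
    qed
    then show "?f ` carrier (L.Q \<oplus>\<^sub>B M.Q) = carrier LM.Q"
      by (simp add: L.carrier_Q M.carrier_Q LM.carrier_Q)
  qed
  then show ?thesis unfolding bimodule_isomorphic_def
  proof (intro exI[of _ ?f] conjI ballI)
    fix C C' assume "C \<in> carrier (L.Q \<oplus>\<^sub>B M.Q)" "C' \<in> carrier (L.Q \<oplus>\<^sub>B M.Q)"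
    then obtain x y x' y' where "C = (L.cls x, M.cls y)" "C' = (L.cls x', M.cls y')"
      "x \<in> carrier L" "y \<in> carrier M" "x' \<in> carrier L" "y' \<in> carrier M"
      by (auto simp: L.carrier_Q M.carrier_Q)
    then show "?f (C \<oplus>\<^bsub>L.Q \<oplus>\<^sub>B M.Q\<^esub> C') = ?f C \<oplus>\<^bsub>LM.Q\<^esub> ?f C'"
      using LM.cls_add[of "(x, y)" "(x', y')"] by (simp add: L.cls_add M.cls_add cls)
  next
    fix A C assume "A \<in> carrier (R Quot I)" "C \<in> carrier (L.Q \<oplus>\<^sub>B M.Q)"
    then obtain x y a where "C = (L.cls x, M.cls y)" "A = I +>\<^sub>R a"
      "x \<in> carrier L" "y \<in> carrier M" "a \<in> carrier R"
      by (auto simp: L.carrier_Q M.carrier_Q carrier_FactRing)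
    then show "?f (A \<odot>\<^bsub>L.Q \<oplus>\<^sub>B M.Q\<^esub> C) = A \<odot>\<^bsub>LM.Q\<^esub> ?f C"
      using LM.smult_cls[of a "(x, y)"] by (simp add: L.smult_cls M.smult_cls cls)
  next
    fix A C assume "A \<in> carrier (S Quot J)" "C \<in> carrier (L.Q \<oplus>\<^sub>B M.Q)"
    then obtain x y a where "C = (L.cls x, M.cls y)" "A = J +>\<^sub>S a"
      "x \<in> carrier L" "y \<in> carrier M" "a \<in> carrier S"
      by (auto simp: L.carrier_Q M.carrier_Q carrier_FactRing)
    then show "?f (C \<star>\<^bsub>L.Q \<oplus>\<^sub>B M.Q\<^esub> A) = ?f C \<star>\<^bsub>LM.Q\<^esub> A"
      using LM.cls_rsmult[of a "(x, y)"] by (simp add: L.cls_rsmult M.cls_rsmult cls)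
  qed
qed

section \<open>Quaternion orders\<close>

text \<open>An axiomatic description of the maximal order \<open>O = W \<oplus> W \<pi>\<close> in terms of a discrete valuation ring
  \<open>Z\<close>, its unramified quadratic extension \<open>W\<close> with involution \<open>\<sigma>\<close>, and an element \<open>\<pi>\<close> whose square is a
  uniformizer of \<open>Z\<close>. The element \<open>w - \<sigma> w\<close> is a unit with inverse \<open>u\<close>, which makes
  \<open>W = Z \<oplus> Z w\<close>.\<close>

locale quat_order = ring R for R (structure) +
  fixes Z W :: "'a set" and \<sigma> :: "'a \<Rightarrow> 'a" and \<pi> w u :: 'a
  assumes Z_subring: "subring Z R" and W_subring: "subring W R" and Z_W: "Z \<subseteq> W"
    and W_comm: "\<lbrakk>a \<in> W; b \<in> W\<rbrakk> \<Longrightarrow> a \<otimes> b = b \<otimes> a"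
    and Z_central: "\<lbrakk>z \<in> Z; r \<in> carrier R\<rbrakk> \<Longrightarrow> z \<otimes> r = r \<otimes> z"
    and sigma_closed [simp]: "a \<in> W \<Longrightarrow> \<sigma> a \<in> W"
    and sigma_add: "\<lbrakk>a \<in> W; b \<in> W\<rbrakk> \<Longrightarrow> \<sigma> (a \<oplus> b) = \<sigma> a \<oplus> \<sigma> b"
    and sigma_mult: "\<lbrakk>a \<in> W; b \<in> W\<rbrakk> \<Longrightarrow> \<sigma> (a \<otimes> b) = \<sigma> a \<otimes> \<sigma> b"
    and sigma_sigma [simp]: "a \<in> W \<Longrightarrow> \<sigma> (\<sigma> a) = a"
    and sigma_Z [simp]: "z \<in> Z \<Longrightarrow> \<sigma> z = z"
    and sigma_fixed: "\<lbrakk>a \<in> W; \<sigma> a = a\<rbrakk> \<Longrightarrow> a \<in> Z"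
    and w_closed [simp]: "w \<in> W" and u_closed [simp]: "u \<in> W" and u_inverse: "u \<otimes> (w \<ominus> \<sigma> w) = \<one>"
    and pi_closed [simp]: "\<pi> \<in> carrier R"
    and pi_comm: "a \<in> W \<Longrightarrow> \<pi> \<otimes> a = \<sigma> a \<otimes> \<pi>"
    and pi2_Z [simp]: "\<pi> \<otimes> \<pi> \<in> Z"
    and decompose: "r \<in> carrier R \<Longrightarrow> \<exists>a\<in>W. \<exists>b\<in>W. r = a \<oplus> b \<otimes> \<pi>"
    and integral: "\<lbrakk>r \<in> carrier R; s \<in> carrier R; r \<otimes> s = \<zero>\<rbrakk> \<Longrightarrow> r = \<zero> \<or> s = \<zero>"
    and independent: "\<lbrakk>a \<in> W; b \<in> W; a \<oplus> b \<otimes> \<pi> = \<zero>\<rbrakk> \<Longrightarrow> a = \<zero>"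
    and pi_nonzero: "\<pi> \<noteq> \<zero>"
    and dvr: "\<lbrakk>z \<in> Z; z \<noteq> \<zero>\<rbrakk> \<Longrightarrow> \<exists>n::nat. \<exists>v\<in>Z. \<exists>v'\<in>Z. v \<otimes> v' = \<one> \<and> z = (\<pi> \<otimes> \<pi>) [^] n \<otimes> v"
    and nonunit: "z \<in> Z \<Longrightarrow> (\<pi> \<otimes> \<pi>) \<otimes> z \<noteq> \<one>"
    and local: "a \<in> W \<Longrightarrow> (\<exists>b\<in>W. a \<otimes> b = \<one>) \<or> (\<exists>b\<in>W. a = (\<pi> \<otimes> \<pi>) \<otimes> b)"
begin

lemma W_carrier [simp]: "a \<in> W \<Longrightarrow> a \<in> carrier R"
  and W_zero [simp]: "\<zero> \<in> W" and W_one [simp]: "\<one> \<in> W"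
  and W_neg [simp]: "a \<in> W \<Longrightarrow> \<ominus> a \<in> W"
  and W_mult [simp]: "\<lbrakk>a \<in> W; b \<in> W\<rbrakk> \<Longrightarrow> a \<otimes> b \<in> W"
  and W_add [simp]: "\<lbrakk>a \<in> W; b \<in> W\<rbrakk> \<Longrightarrow> a \<oplus> b \<in> W"
  using subringE[OF W_subring] by auto

lemma W_minus [simp]: "\<lbrakk>a \<in> W; b \<in> W\<rbrakk> \<Longrightarrow> a \<ominus> b \<in> W"
  by (simp add: minus_eq)

lemma Z_in_W [simp]: "z \<in> Z \<Longrightarrow> z \<in> W"
  and Z_zero [simp]: "\<zero> \<in> Z" and Z_one [simp]: "\<one> \<in> Z"
  and Z_neg [simp]: "a \<in> Z \<Longrightarrow> \<ominus> a \<in> Z"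
  and Z_mult [simp]: "\<lbrakk>a \<in> Z; b \<in> Z\<rbrakk> \<Longrightarrow> a \<otimes> b \<in> Z"
  and Z_add [simp]: "\<lbrakk>a \<in> Z; b \<in> Z\<rbrakk> \<Longrightarrow> a \<oplus> b \<in> Z"
  using subringE[OF Z_subring] Z_W by auto

lemma Z_minus [simp]: "\<lbrakk>a \<in> Z; b \<in> Z\<rbrakk> \<Longrightarrow> a \<ominus> b \<in> Z"
  by (simp add: minus_eq)

abbreviation pi2 where "pi2 \<equiv> \<pi> \<otimes> \<pi>"

lemma W_lcomm: "\<lbrakk>a \<in> W; b \<in> W; c \<in> carrier R\<rbrakk> \<Longrightarrow> a \<otimes> (b \<otimes> c) = b \<otimes> (a \<otimes> c)"
  by (metis W_carrier W_comm m_assoc)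

lemmas W_ac = m_assoc W_comm W_lcomm
lemmas W_simps = W_ac l_distr r_distr a_ac minus_eq l_minus r_minus minus_add

lemma sigma_zero [simp]: "\<sigma> \<zero> = \<zero>" and sigma_one [simp]: "\<sigma> \<one> = \<one>"
  by (simp_all add: sigma_Z)

lemma sigma_neg: "a \<in> W \<Longrightarrow> \<sigma> (\<ominus> a) = \<ominus> \<sigma> a"
  by (rule minus_equality[symmetric]) (simp_all add: sigma_add[symmetric] l_neg)

lemma sigma_minus: "\<lbrakk>a \<in> W; b \<in> W\<rbrakk> \<Longrightarrow> \<sigma> (a \<ominus> b) = \<sigma> a \<ominus> \<sigma> b"
  by (simp add: minus_eq sigma_add sigma_neg)

text \<open>The two elements of the Galois group, indexed by a truth value. The same index names the
  two homogeneous parts of a bimodule and the two column embeddings, so each pair is handled by one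
  argument; composition is exclusive or.\<close>

definition tw :: "bool \<Rightarrow> 'a \<Rightarrow> 'a" where "tw s a = (if s then \<sigma> a else a)"

lemma tw_simps [simp]: "tw False a = a" "tw True a = \<sigma> a"
  by (simp_all add: tw_def)

lemma tw_closed [simp]: "a \<in> W \<Longrightarrow> tw s a \<in> W"
  and tw_add: "\<lbrakk>a \<in> W; b \<in> W\<rbrakk> \<Longrightarrow> tw s (a \<oplus> b) = tw s a \<oplus> tw s b"
  and tw_mult: "\<lbrakk>a \<in> W; b \<in> W\<rbrakk> \<Longrightarrow> tw s (a \<otimes> b) = tw s a \<otimes> tw s b"
  and tw_tw: "a \<in> W \<Longrightarrow> tw s (tw t a) = tw (s \<noteq> t) a"
  and tw_Z [simp]: "z \<in> Z \<Longrightarrow> tw s z = z"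
  and sigma_tw: "a \<in> W \<Longrightarrow> \<sigma> (tw s a) = tw (\<not> s) a"
  and tw_sigma: "a \<in> W \<Longrightarrow> tw s (\<sigma> a) = tw (\<not> s) a"
  and tw_neg: "a \<in> W \<Longrightarrow> tw s (\<ominus> a) = \<ominus> tw s a"
  by (auto simp: tw_def sigma_add sigma_mult sigma_neg)

lemma tw_same [simp]: "a \<in> W \<Longrightarrow> tw s (tw s a) = a"
  by (simp add: tw_tw)

lemma W_fixed_add: "a \<in> W \<Longrightarrow> a \<oplus> \<sigma> a \<in> Z" and W_fixed_mult: "a \<in> W \<Longrightarrow> a \<otimes> \<sigma> a \<in> Z"
  by (rule sigma_fixed; simp add: sigma_add sigma_mult W_comm a_comm[of a])+

text \<open>The characteristic equation of \<open>w\<close> over \<open>Z\<close>: its coefficients,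
  trace and norm, lie in \<open>Z\<close> by \<open>W_fixed_add\<close> and
  \<open>W_fixed_mult\<close>.\<close>

lemma w_square: "w \<otimes> w = (w \<oplus> \<sigma> w) \<otimes> w \<ominus> w \<otimes> \<sigma> w"
  by (simp add: W_simps r_neg)

lemma u_inverse': "(w \<ominus> \<sigma> w) \<otimes> u = \<one>"
  using u_inverse W_comm[of u "w \<ominus> \<sigma> w"] by simp

lemma one_not_zero: "\<one> \<noteq> \<zero>"
  using pi_nonzero by (metis pi_closed r_one r_null)

text \<open>Conjugation changes the sign of \<open>w \<ominus> \<sigma> w\<close>, and hence of its
  inverse.\<close>

lemma sigma_u: "\<sigma> u = \<ominus> u"
proof -
  have "\<sigma> u \<otimes> (\<sigma> w \<ominus> w) = \<one>"
    using arg_cong[OF u_inverse, of \<sigma>] by (simp add: sigma_mult sigma_minus)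
  then have "\<sigma> u \<otimes> (\<sigma> w \<ominus> w) \<otimes> u = u" by simp
  moreover have "(\<sigma> w \<ominus> w) \<otimes> u = \<ominus> ((w \<ominus> \<sigma> w) \<otimes> u)" by (simp add: W_simps)
  ultimately have "\<sigma> u \<otimes> (\<ominus> \<one>) = u" by (simp add: m_assoc u_inverse')
  then have "\<ominus> \<sigma> u = u" by (simp add: r_minus)
  then show ?thesis using minus_minus[of "\<sigma> u"] by simp
qed

lemma minus_swap:
  assumes "a \<in> carrier R" "b \<in> carrier R" "c \<in> carrier R" "d \<in> carrier R" "c \<ominus> d = a \<ominus> b"
  shows "a \<ominus> c = b \<ominus> d"
proof -
  have "a = (c \<ominus> d) \<oplus> b" using assms by (simp add: minus_eq a_assoc l_neg)
  also have "\<dots> = c \<oplus> (b \<ominus> d)" using assms by (simp add: minus_eq a_ac)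
  finally have "a = c \<oplus> (b \<ominus> d)" .
  then have "a \<ominus> c = c \<oplus> (b \<ominus> d) \<ominus> c" by simp
  also have "\<dots> = \<ominus> c \<oplus> (c \<oplus> (b \<ominus> d))" using assms by (simp add: minus_eq a_comm[of "\<ominus> c"])
  also have "\<dots> = b \<ominus> d" using assms by (simp add: r_neg1)
  finally show ?thesis .
qed

text \<open>Subtracting its conjugate from a = x + y w leaves a - \<sigma>(a) = y (w - \<sigma>(w)),
  which dictates y = (a - \<sigma>(a)) u. Both this y and a - y w turn out to be fixed by \<sigma>,
  hence lie in \<open>Z\<close>.\<close>

lemma W_span: assumes a: "a \<in> W" obtains x y where "x \<in> Z" "y \<in> Z" "a = x \<oplus> y \<otimes> w"
proof -
  define y where "y = (a \<ominus> \<sigma> a) \<otimes> u"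
  have y: "y \<in> W" using a by (simp add: y_def)
  have "\<sigma> y = (\<sigma> a \<ominus> a) \<otimes> (\<ominus> u)" using a by (simp add: y_def sigma_mult sigma_minus sigma_u)
  also have "\<dots> = y" using a by (simp add: y_def W_simps)
  finally have yZ: "y \<in> Z" by (rule sigma_fixed[OF y])
  have "y \<otimes> (w \<ominus> \<sigma> w) = (a \<ominus> \<sigma> a) \<otimes> (u \<otimes> (w \<ominus> \<sigma> w))" using a by (simp only: y_def m_assoc W_carrier W_minus sigma_closed w_closed u_closed)
  also have "\<dots> = a \<ominus> \<sigma> a" using a by (simp add: u_inverse)
  finally have e: "y \<otimes> w \<ominus> y \<otimes> \<sigma> w = a \<ominus> \<sigma> a" using y by (simp add: W_simps)
  have f: "a \<ominus> y \<otimes> w = \<sigma> a \<ominus> y \<otimes> \<sigma> w" using a y by (intro minus_swap[OF _ _ _ _ e]) simp_all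
  have "\<sigma> (a \<ominus> y \<otimes> w) = \<sigma> a \<ominus> y \<otimes> \<sigma> w" using a yZ y by (simp add: sigma_minus sigma_mult)
  also note f[symmetric]
  finally have "\<sigma> (a \<ominus> y \<otimes> w) = a \<ominus> y \<otimes> w" .
  then have "a \<ominus> y \<otimes> w \<in> Z" using a y by (intro sigma_fixed) simp_all
  moreover have "a = (a \<ominus> y \<otimes> w) \<oplus> y \<otimes> w" using a y by (simp add: minus_eq a_assoc l_neg)
  ultimately show thesis using that yZ by blast
qed

text \<open>The antisymmetry of \<open>u\<close> turns the trace of \<open>w \<otimes> u\<close>
  into (w - \<sigma>(w)) u. An element of trace one permits averaging over the Galois group even
  when 2 is not invertible.\<close>

lemma trace_one: obtains c where "c \<in> W" "c \<oplus> \<sigma> c = \<one>"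
proof
  show "w \<otimes> u \<in> W" by simp
  show "w \<otimes> u \<oplus> \<sigma> (w \<otimes> u) = \<one>" using u_inverse' by (simp add: sigma_mult sigma_u l_distr r_minus l_minus minus_eq)
qed

lemma pi2_comm: "r \<in> carrier R \<Longrightarrow> r \<otimes> pi2 = pi2 \<otimes> r"
  using Z_central by force

lemma pi2_nonzero: "pi2 \<noteq> \<zero>"
  using integral[of \<pi> \<pi>] pi_nonzero by auto

lemma pi_comm': "a \<in> W \<Longrightarrow> a \<otimes> \<pi> = \<pi> \<otimes> \<sigma> a"
  using pi_comm[of "\<sigma> a"] by simp

lemma independent': "\<lbrakk>a \<in> W; b \<in> W; a \<oplus> b \<otimes> \<pi> = \<zero>\<rbrakk> \<Longrightarrow> b = \<zero>"
  using independent[of a b] integral[of b \<pi>] pi_nonzero by auto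

lemma decompose_unique:
  assumes "a \<in> W" "b \<in> W" "c \<in> W" "d \<in> W" "a \<oplus> b \<otimes> \<pi> = c \<oplus> d \<otimes> \<pi>"
  shows "a = c" "b = d"
proof -
  have "(a \<ominus> c) \<oplus> (b \<ominus> d) \<otimes> \<pi> = (a \<oplus> b \<otimes> \<pi>) \<ominus> (c \<oplus> d \<otimes> \<pi>)"
    using assms(1-4) by (simp add: minus_eq l_distr l_minus minus_add a_ac)
  also have "\<dots> = \<zero>" using assms by (simp add: minus_eq r_neg)
  finally have "a \<ominus> c = \<zero>" "b \<ominus> d = \<zero>"
    using independent[of "a \<ominus> c" "b \<ominus> d"] independent'[of "a \<ominus> c" "b \<ominus> d"] assms(1-4) by simp_all
  then show "a = c" "b = d" using assms(1-4) by auto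
qed

lemma cancel_right: "\<lbrakk>r \<in> carrier R; s \<in> carrier R; t \<in> carrier R; t \<noteq> \<zero>; r \<otimes> t = s \<otimes> t\<rbrakk> \<Longrightarrow> r = s"
proof -
  assume h: "r \<in> carrier R" "s \<in> carrier R" "t \<in> carrier R" "t \<noteq> \<zero>" "r \<otimes> t = s \<otimes> t"
  then have "(r \<ominus> s) \<otimes> t = \<zero>" by (simp add: minus_eq l_distr l_minus r_neg)
  then show "r = s" using integral[of "r \<ominus> s" t] h by auto
qed

text \<open>Moving \<pi> across W + W \<pi> applies \<sigma> to the coefficients, so left and right
  multiples of \<pi> form the same two-sided ideal.\<close>

lemma pi_swap: "r \<in> carrier R \<Longrightarrow> \<exists>r'\<in>carrier R. r \<otimes> \<pi> = \<pi> \<otimes> r'" "r \<in> carrier R \<Longrightarrow> \<exists>r'\<in>carrier R. \<pi> \<otimes> r = r' \<otimes> \<pi>"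
proof -
  assume r: "r \<in> carrier R"
  then obtain a b where ab: "a \<in> W" "b \<in> W" "r = a \<oplus> b \<otimes> \<pi>" using decompose by blast
  have "r \<otimes> \<pi> = \<pi> \<otimes> (\<sigma> a \<oplus> \<sigma> b \<otimes> \<pi>)" using ab by (simp add: l_distr r_distr pi_comm' m_assoc)
  then show "\<exists>r'\<in>carrier R. r \<otimes> \<pi> = \<pi> \<otimes> r'" by (rule bexI) (simp add: ab)
  have "\<pi> \<otimes> r = (\<sigma> a \<oplus> \<sigma> b \<otimes> \<pi>) \<otimes> \<pi>" using ab by (simp add: l_distr r_distr pi_comm m_assoc[symmetric])
  then show "\<exists>r'\<in>carrier R. \<pi> \<otimes> r = r' \<otimes> \<pi>" by (rule bexI) (simp add: ab)
qed

text \<open>Multiplying c + d \<pi> by \<pi> puts d \<pi>^2 into the \<open>W\<close> coordinate,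
  and coordinates are unique. The ideal generated by \<pi> thus meets \<open>W\<close> in
  \<open>pi2\<close> times \<open>W\<close>.\<close>

lemma W_pi_multiple: assumes "a \<in> W" "r \<in> carrier R" "a = r \<otimes> \<pi>" shows "\<exists>b\<in>W. a = pi2 \<otimes> b"
proof -
  obtain c d where cd: "c \<in> W" "d \<in> W" "r = c \<oplus> d \<otimes> \<pi>" using decompose assms(2) by blast
  have "a \<oplus> \<zero> \<otimes> \<pi> = d \<otimes> pi2 \<oplus> c \<otimes> \<pi>" using assms cd by (simp add: l_distr m_assoc a_comm)
  then have "a = d \<otimes> pi2" by (intro decompose_unique(1)[of a \<zero> _ c]) (use assms cd in auto)
  then show ?thesis using cd pi2_comm by auto
qed

end

lemma (in bimod) finsum_smult:
  assumes "a \<in> carrier R" "f \<in> A \<rightarrow> carrier M"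
  shows "a \<odot>\<^sub>M finsum M f A = finsum M (\<lambda>i. a \<odot>\<^sub>M f i) A"
  using assms(2)
proof (induction A rule: infinite_finite_induct)
  case (insert i A)
  then have "f i \<in> carrier M" "f \<in> A \<rightarrow> carrier M" by auto
  then show ?case using insert assms(1) by (simp add: smult_r_distr Pi_iff)
qed (simp_all add: assms(1))

lemmas (in bimod) group_simps = a_ac minus_add a_minus_def r_neg r_neg1 r_neg2 l_neg

section \<open>Dual bases, homogeneous parts and local arithmetic\<close>

context quat_order
begin

definition Zlinear :: "('a, 'a, 'm) bimodule \<Rightarrow> ('m \<Rightarrow> 'a) \<Rightarrow> bool" where
  "Zlinear L f \<longleftrightarrow> (\<forall>x\<in>carrier L. f x \<in> Z) \<and>
     (\<forall>x\<in>carrier L. \<forall>y\<in>carrier L. f (x \<oplus>\<^sub>L y) = f x \<oplus> f y) \<and>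
     (\<forall>z\<in>Z. \<forall>x\<in>carrier L. f (z \<odot>\<^sub>L x) = z \<otimes> f x)"

text \<open>A finite dual basis characterizes finitely generated projective modules. Unlike freeness it passes
  to direct summands at once.\<close>

definition dual_basis :: "('a, 'a, 'm) bimodule \<Rightarrow> 'i set \<Rightarrow> ('i \<Rightarrow> 'm) \<Rightarrow> ('i \<Rightarrow> 'm \<Rightarrow> 'a) \<Rightarrow> bool" where
  "dual_basis L I e \<nu> \<longleftrightarrow> finite I \<and> e \<in> I \<rightarrow> carrier L \<and> (\<forall>i\<in>I. Zlinear L (\<nu> i)) \<and>
     (\<forall>x\<in>carrier L. x = finsum L (\<lambda>i. \<nu> i x \<odot>\<^sub>L e i) I)"

text \<open>A functional of type \<open>s\<close> kills the component of the opposite type.\<close>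

definition bifunctional :: "('a, 'a, 'm) bimodule \<Rightarrow> bool \<Rightarrow> ('m \<Rightarrow> 'a) \<Rightarrow> bool" where
  "bifunctional L s \<mu> \<longleftrightarrow> (\<forall>x\<in>carrier L. \<mu> x \<in> W) \<and>
     (\<forall>x\<in>carrier L. \<forall>y\<in>carrier L. \<mu> (x \<oplus>\<^sub>L y) = \<mu> x \<oplus> \<mu> y) \<and>
     (\<forall>a\<in>W. \<forall>x\<in>carrier L. \<mu> (a \<odot>\<^sub>L x) = a \<otimes> \<mu> x) \<and>
     (\<forall>a\<in>W. \<forall>x\<in>carrier L. \<mu> (x \<star>\<^sub>L a) = tw s a \<otimes> \<mu> x)"

text \<open>The tensor product of \<open>W\<close> with itself over \<open>Z\<close> is a product of
  two copies of \<open>W\<close>, because w - \<sigma>(w) is a unit. These sets are the parts of a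
  bimodule cut out by the two idempotents.\<close>

definition comp :: "('a, 'a, 'm) bimodule \<Rightarrow> bool \<Rightarrow> 'm set" where
  "comp L s = {x \<in> carrier L. \<forall>a\<in>W. a \<odot>\<^sub>L x = x \<star>\<^sub>L tw s a}"

text \<open>An inverse of \<open>pi2\<close> in \<open>W\<close> would equal its own conjugate,
  inverses being unique, and so lie in \<open>Z\<close>, where \<open>nonunit\<close> forbids
  it.\<close>

lemma nonunit_W: "b \<in> W \<Longrightarrow> pi2 \<otimes> b \<noteq> \<one>"
proof
  assume b: "b \<in> W" "pi2 \<otimes> b = \<one>"
  have "pi2 \<otimes> \<sigma> b = \<one>" using arg_cong[OF b(2), of \<sigma>] b(1) by (simp add: sigma_mult)
  then have "\<sigma> b \<otimes> pi2 = b \<otimes> pi2" using b pi2_comm by simp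
  then have "\<sigma> b = b" using cancel_right[of "\<sigma> b" b pi2] b pi2_nonzero by simp
  then have "b \<in> Z" by (rule sigma_fixed[OF b(1)])
  then show False using nonunit b(2) by blast
qed

lemma Z_local: "z \<in> Z \<Longrightarrow> (\<exists>v\<in>Z. v \<otimes> z = \<one>) \<or> (\<exists>y\<in>Z. z = pi2 \<otimes> y)"
proof (cases "z = \<zero>")
  case True then show ?thesis by (intro disjI2 bexI[of _ \<zero>]) simp_all
next
  case False
  assume "z \<in> Z"
  then obtain n v v' where n: "v \<in> Z" "v' \<in> Z" "v \<otimes> v' = \<one>" "z = pi2 [^] (n::nat) \<otimes> v"
    using dvr False by blast
  show ?thesis
  proof (cases n)
    case 0
    then have "v' \<otimes> z = \<one>" using n W_comm[of v' v] by simp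
    then show ?thesis using n(2) by blast
  next
    case (Suc m)
    have p: "pi2 [^] m \<in> Z" by (induction m) simp_all
    have "z = pi2 \<otimes> (pi2 [^] m \<otimes> v)" 
      using n Suc p W_lcomm[of "pi2 [^] m" pi2 v] m_assoc[of "pi2 [^] m" pi2 v] by simp
    then show ?thesis using n(1) p by (intro disjI2 bexI[of _ "pi2 [^] m \<otimes> v"]) simp_all
  qed
qed

text \<open>If this element were divisible by \<open>pi2\<close>, so would be 1. Locality of
  \<open>W\<close> then supplies the inverse that a geometric series gives over a complete
  ring.\<close>

lemma unit_one_minus: "b \<in> W \<Longrightarrow> \<exists>d\<in>W. d \<otimes> (\<one> \<ominus> pi2 \<otimes> b) = \<one>"
proof -
  assume b: "b \<in> W"
  have "\<one> \<ominus> pi2 \<otimes> b \<noteq> pi2 \<otimes> c" if c: "c \<in> W" for c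
  proof
    assume h: "\<one> \<ominus> pi2 \<otimes> b = pi2 \<otimes> c"
    have "\<one> = (\<one> \<ominus> pi2 \<otimes> b) \<oplus> pi2 \<otimes> b" using b by (simp add: minus_eq a_assoc l_neg)
    then have "pi2 \<otimes> (c \<oplus> b) = \<one>" using h b c by (simp add: r_distr)
    then show False using nonunit_W[of "c \<oplus> b"] b c by simp
  qed
  then obtain d where "d \<in> W" "(\<one> \<ominus> pi2 \<otimes> b) \<otimes> d = \<one>" using local[of "\<one> \<ominus> pi2 \<otimes> b"] b by auto
  then show ?thesis using b W_comm[of d "\<one> \<ominus> pi2 \<otimes> b"] by auto
qed

end

text \<open>The index set of the dual basis is taken in the element type \<open>'m\<close>, since an
  assumption cannot quantify over types. A basis of the module can index itself, and passing to a
  summand keeps the index type.\<close>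

locale lattice_bimod = quat_order R Z W \<sigma> \<pi> w u + M: bimod R R L
  for R :: "('a, 'e) ring_scheme" (structure) and Z W \<sigma> \<pi> w u and L :: "('a, 'a, 'm) bimodule" +
  assumes central: "\<lbrakk>z \<in> Z; x \<in> carrier L\<rbrakk> \<Longrightarrow> z \<odot>\<^sub>L x = x \<star>\<^sub>L z"
    and dual: "\<exists>(I :: 'm set) e \<nu>. dual_basis L I e \<nu>"
begin

lemma pi2_central: "x \<in> carrier L \<Longrightarrow> \<pi> \<odot>\<^sub>L (\<pi> \<odot>\<^sub>L x) = x \<star>\<^sub>L \<pi> \<star>\<^sub>L \<pi>"
  using central[of pi2 x] by (simp add: M.smult_assoc M.rsmult_assoc)

text \<open>Coordinates with respect to a dual basis live in the domain \<open>Z\<close>: if a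
  nonzero scalar annihilates \<open>x\<close>, all coordinates of \<open>x\<close> vanish, and these
  reconstruct \<open>x\<close>.\<close>

lemma torsion_free: "\<lbrakk>z \<in> Z; z \<noteq> \<zero>; x \<in> carrier L; z \<odot>\<^sub>L x = \<zero>\<^sub>L\<rbrakk> \<Longrightarrow> x = \<zero>\<^sub>L"
proof -
  assume h: "z \<in> Z" "z \<noteq> \<zero>" "x \<in> carrier L" "z \<odot>\<^sub>L x = \<zero>\<^sub>L"
  obtain I :: "'m set" and e \<nu> where d: "dual_basis L I e \<nu>" using dual by blast
  have "\<nu> i x = \<zero>" if "i \<in> I" for i
  proof -
    have l: "Zlinear L (\<nu> i)" using d that by (simp add: dual_basis_def)
    have c: "\<nu> i x \<in> Z" using l h by (simp add: Zlinear_def)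
    have "z \<otimes> \<nu> i x = \<nu> i (z \<odot>\<^sub>L x)" using l h(1,3) unfolding Zlinear_def by simp
    also have "\<dots> = \<nu> i (\<zero> \<odot>\<^sub>L x)" using h by simp
    also have "\<dots> = \<zero> \<otimes> \<nu> i x" using l h(3) Z_zero unfolding Zlinear_def by blast
    finally have "z \<otimes> \<nu> i x = \<zero>" using c by simp
    then show ?thesis using integral[of z "\<nu> i x"] h c by simp
  qed
  then have "finsum L (\<lambda>i. \<nu> i x \<odot>\<^sub>L e i) I = finsum L (\<lambda>i. \<zero>\<^sub>L) I"
    using d by (intro M.finsum_cong') (auto simp: dual_basis_def Pi_iff)
  then show ?thesis using d h(3) by (simp add: dual_basis_def)
qed

lemma pi_cancel: "\<lbrakk>x \<in> carrier L; y \<in> carrier L; \<pi> \<odot>\<^sub>L x = \<pi> \<odot>\<^sub>L y\<rbrakk> \<Longrightarrow> x = y"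
proof -
  assume h: "x \<in> carrier L" "y \<in> carrier L" "\<pi> \<odot>\<^sub>L x = \<pi> \<odot>\<^sub>L y"
  have "pi2 \<odot>\<^sub>L (x \<oplus>\<^sub>L \<ominus>\<^sub>L y) = \<pi> \<odot>\<^sub>L (\<pi> \<odot>\<^sub>L x \<oplus>\<^sub>L \<ominus>\<^sub>L (\<pi> \<odot>\<^sub>L y))"
    using h(1,2) by (simp add: M.smult_assoc M.smult_r_distr M.smult_minus)
  also have "\<dots> = \<zero>\<^sub>L" using h by (simp add: M.r_neg)
  finally have "x \<oplus>\<^sub>L \<ominus>\<^sub>L y = \<zero>\<^sub>L" using torsion_free[of pi2] pi2_nonzero h by simp
  then show ?thesis using h by (metis M.a_inv_closed M.minus_equality M.minus_minus)
qed

text \<open>If \<open>pi2\<close> divided every coordinate, the reconstruction of \<open>x\<close>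
  from its coordinates would exhibit \<open>x\<close> as a multiple of \<open>pi2\<close>. In the
  local ring \<open>Z\<close> a coordinate outside \<open>pi2\<close> times \<open>Z\<close> is
  invertible.\<close>

lemma primitive_coordinate:
  fixes I :: "'i set"
  assumes x: "x \<in> carrier L" "\<forall>y\<in>carrier L. x \<noteq> pi2 \<odot>\<^sub>L y" and d: "dual_basis L I e \<nu>"
  obtains i v where "i \<in> I" "v \<in> Z" "v \<otimes> \<nu> i x = \<one>"
proof -
  have e: "e i \<in> carrier L" "Zlinear L (\<nu> i)" if "i \<in> I" for i using d that by (auto simp: dual_basis_def)
  have "\<exists>i\<in>I. \<forall>y\<in>Z. \<nu> i x \<noteq> pi2 \<otimes> y"
  proof (rule ccontr)
    assume "\<not> ?thesis"
    then obtain y where y: "\<And>i. i \<in> I \<Longrightarrow> y i \<in> Z \<and> \<nu> i x = pi2 \<otimes> y i" by metis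
    have "x = finsum L (\<lambda>i. \<nu> i x \<odot>\<^sub>L e i) I" using d x(1) by (auto simp: dual_basis_def)
    also have "\<dots> = finsum L (\<lambda>i. pi2 \<odot>\<^sub>L (y i \<odot>\<^sub>L e i)) I"
      using y e by (intro M.finsum_cong') (auto simp: M.smult_assoc)
    also have "\<dots> = pi2 \<odot>\<^sub>L finsum L (\<lambda>i. y i \<odot>\<^sub>L e i) I"
      using y e by (intro M.finsum_smult[symmetric]) auto
    finally have "x = pi2 \<odot>\<^sub>L finsum L (\<lambda>i. y i \<odot>\<^sub>L e i) I" .
    moreover have "finsum L (\<lambda>i. y i \<odot>\<^sub>L e i) I \<in> carrier L" using y e by (intro M.finsum_closed) auto
    ultimately show False using x(2) by blast
  qed
  then obtain i where i: "i \<in> I" "\<forall>y\<in>Z. \<nu> i x \<noteq> pi2 \<otimes> y" by blast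
  have "\<nu> i x \<in> Z" using e(2)[OF i(1)] x(1) by (simp add: Zlinear_def)
  then obtain v where "v \<in> Z" "v \<otimes> \<nu> i x = \<one>" using Z_local[of "\<nu> i x"] i(2) by blast
  then show thesis using that i(1) by blast
qed

lemma primitive_functional:
  assumes "x \<in> carrier L" "\<forall>y\<in>carrier L. x \<noteq> pi2 \<odot>\<^sub>L y"
  obtains f where "Zlinear L f" "f x = \<one>"
proof -
  obtain I :: "'m set" and e \<nu> where d: "dual_basis L I e \<nu>" using dual by blast
  obtain i v where i: "i \<in> I" "v \<in> Z" "v \<otimes> \<nu> i x = \<one>" using primitive_coordinate[OF assms d] by blast
  have "Zlinear L (\<nu> i)" using d i by (simp add: dual_basis_def)
  then have "Zlinear L (\<lambda>y. v \<otimes> \<nu> i y)" using i(2) by (auto simp: Zlinear_def r_distr W_lcomm)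
  then show thesis using that i(3) by blast
qed

text \<open>A substitute for Nakayama's lemma. If every vector were divisible by \<pi>, a nonzero
  vector would be divisible by all powers of \<open>pi2\<close>, whereas one of its coordinates is
  nonzero and has finite valuation.\<close>

lemma not_pi_divisible:
  assumes "carrier L \<noteq> {\<zero>\<^sub>L}"
  obtains x where "x \<in> carrier L" "\<forall>y\<in>carrier L. x \<noteq> \<pi> \<odot>\<^sub>L y"
proof (rule ccontr)
  assume "\<not> thesis"
  then have all: "\<forall>x\<in>carrier L. \<exists>y\<in>carrier L. x = \<pi> \<odot>\<^sub>L y" using that by blast
  obtain x where x: "x \<in> carrier L" "x \<noteq> \<zero>\<^sub>L" using assms by auto
  obtain I :: "'m set" and e \<nu> where d: "dual_basis L I e \<nu>" using dual by blast
  have "\<exists>i\<in>I. \<nu> i x \<noteq> \<zero>"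
  proof (rule ccontr)
    assume "\<not> ?thesis"
    then have "finsum L (\<lambda>i. \<nu> i x \<odot>\<^sub>L e i) I = finsum L (\<lambda>i. \<zero>\<^sub>L) I"
      using d by (intro M.finsum_cong') (auto simp: dual_basis_def Pi_iff)
    then show False using d x by (auto simp: dual_basis_def)
  qed
  then obtain i where i: "i \<in> I" "\<nu> i x \<noteq> \<zero>" by blast
  then have l: "Zlinear L (\<nu> i)" using d by (simp add: dual_basis_def)
  then obtain n v v' where n: "v \<in> Z" "v' \<in> Z" "v \<otimes> v' = \<one>" "\<nu> i x = pi2 [^] (n::nat) \<otimes> v"
    using dvr[of "\<nu> i x"] i x by (auto simp: Zlinear_def)
  have pz: "pi2 [^] m \<in> Z" "pi2 [^] m \<noteq> \<zero>" for m :: nat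
  proof -
    show *: "pi2 [^] m \<in> Z" for m :: nat by (induction m) simp_all
    show "pi2 [^] m \<noteq> \<zero>"
    proof (induction m)
      case 0 then show ?case by (simp add: one_not_zero)
    next
      case (Suc m) then show ?case using integral[of "pi2 [^] m" pi2] pi2_nonzero *[of m] by auto
    qed
  qed
  have "\<exists>y\<in>carrier L. x = pi2 [^] m \<odot>\<^sub>L y" for m :: nat
  proof (induction m)
    case 0 then show ?case using x by auto
  next
    case (Suc m)
    then obtain y y' y'' where y: "x = pi2 [^] m \<odot>\<^sub>L y" "y \<in> carrier L" "y = \<pi> \<odot>\<^sub>L y'" "y' \<in> carrier L"
      "y' = \<pi> \<odot>\<^sub>L y''" "y'' \<in> carrier L" using all by metis
    have "x = pi2 [^] m \<odot>\<^sub>L (pi2 \<odot>\<^sub>L y'')" using y by (simp add: M.smult_assoc)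
    also have "\<dots> = (pi2 [^] m \<otimes> pi2) \<odot>\<^sub>L y''" using y(6) by (simp add: M.smult_assoc)
    finally show ?case using y(6) by auto
  qed
  \<comment> \<open>One power more than the valuation \<open>n\<close> of the coordinate, so that
    the unit \<open>v\<close> becomes a multiple of \<open>pi2\<close>.\<close>
  from this[of "Suc n"] obtain y where y: "y \<in> carrier L" "x = pi2 [^] Suc n \<odot>\<^sub>L y" by blast
  have yz: "\<nu> i y \<in> Z" using l y by (simp add: Zlinear_def)
  have "pi2 [^] n \<otimes> v = pi2 [^] Suc n \<otimes> \<nu> i y" using n(4) l y pz(1)[of "Suc n"] unfolding Zlinear_def by metis
  then have "v \<otimes> pi2 [^] n = (pi2 \<otimes> \<nu> i y) \<otimes> pi2 [^] n"
    using n(1) yz pz(1)[of n] W_comm[of v "pi2 [^] n"] W_comm[of "pi2 [^] n" "pi2 \<otimes> \<nu> i y"]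
      m_assoc[of "pi2 [^] n" pi2 "\<nu> i y"] by simp
  then have "v = pi2 \<otimes> \<nu> i y" using cancel_right[of v "pi2 \<otimes> \<nu> i y" "pi2 [^] n"] pz[of n] n yz by simp
  then have "pi2 \<otimes> (\<nu> i y \<otimes> v') = \<one>" using n yz by (simp add: m_assoc)
  then show False using nonunit[of "\<nu> i y \<otimes> v'"] n yz by simp
qed

end

section \<open>Homogeneous components and functionals on them\<close>

context lattice_bimod
begin

text \<open>A \<open>Z\<close>-valued functional with value 1 at \<open>x\<close> is extended to a
  \<open>W\<close>-linear one in which it is the \<open>w\<close>-coordinate. The value at
  \<open>x\<close> then is \<open>w\<close> plus an element of \<open>Z\<close>, which is a unit and
  can be normalized to 1.\<close>

lemma W_functional:
  assumes "x \<in> carrier L" "\<forall>y\<in>carrier L. x \<noteq> pi2 \<odot>\<^sub>L y"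
  obtains l where "\<And>y. y \<in> carrier L \<Longrightarrow> l y \<in> W" "\<And>y z. \<lbrakk>y \<in> carrier L; z \<in> carrier L\<rbrakk> \<Longrightarrow> l (y \<oplus>\<^sub>L z) = l y \<oplus> l z"
    "\<And>a y. \<lbrakk>a \<in> W; y \<in> carrier L\<rbrakk> \<Longrightarrow> l (a \<odot>\<^sub>L y) = a \<otimes> l y" "l x = \<one>"
proof -
  obtain f where f: "Zlinear L f" "f x = \<one>" using primitive_functional assms by blast
  define t n where "t = w \<oplus> \<sigma> w" and "n = w \<otimes> \<sigma> w"
  have tn: "t \<in> Z" "n \<in> Z" "w \<otimes> w = t \<otimes> w \<ominus> n"
    using W_fixed_add[of w] W_fixed_mult[of w] w_square by (simp_all add: t_def n_def)
  have fc: "f y \<in> Z" "f y \<in> carrier R" "f y \<in> W" if "y \<in> carrier L" for y using f that by (auto simp: Zlinear_def)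
  have fa: "f (y \<oplus>\<^sub>L z) = f y \<oplus> f z" if "y \<in> carrier L" "z \<in> carrier L" for y z using f that by (auto simp: Zlinear_def)
  have fz: "f (a \<odot>\<^sub>L y) = a \<otimes> f y" if "a \<in> Z" "y \<in> carrier L" for a y using f that by (auto simp: Zlinear_def)
  \<comment> \<open>The shape is forced: if l(y) = c + f(y) w is \<open>W\<close>-linear, then w
    l(y) has \<open>w\<close>-coordinate c + t f(y) by the quadratic equation of \<open>w\<close>,
    and this must be f(w y).\<close>
  define l where "l y = (f (w \<odot>\<^sub>L y) \<ominus> t \<otimes> f y) \<oplus> f y \<otimes> w" for y
  have lc: "l y \<in> W" if "y \<in> carrier L" for y using fc that tn by (simp add: l_def)
  have la: "l (y \<oplus>\<^sub>L z) = l y \<oplus> l z" if "y \<in> carrier L" "z \<in> carrier L" for y z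
    using that tn fc by (simp add: l_def M.smult_r_distr fa r_distr l_distr minus_eq minus_add a_ac)
  have lz: "l (a \<odot>\<^sub>L y) = a \<otimes> l y" if "a \<in> Z" "y \<in> carrier L" for a y
  proof -
    have "w \<odot>\<^sub>L (a \<odot>\<^sub>L y) = a \<odot>\<^sub>L (w \<odot>\<^sub>L y)" using that W_comm[of w a] by (simp add: M.smult_assoc[symmetric])
    then show ?thesis using that tn fc by (simp add: l_def fz r_distr l_distr minus_eq r_minus W_ac)
  qed
  have lw: "l (w \<odot>\<^sub>L y) = w \<otimes> l y" if y: "y \<in> carrier L" for y
  proof -
    have "w \<odot>\<^sub>L (w \<odot>\<^sub>L y) = (t \<otimes> w \<ominus> n) \<odot>\<^sub>L y" using y tn by (simp add: M.smult_assoc[symmetric])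
    also have "\<dots> = t \<odot>\<^sub>L (w \<odot>\<^sub>L y) \<oplus>\<^sub>L (\<ominus> n) \<odot>\<^sub>L y" using y tn by (simp add: minus_eq M.smult_l_distr M.smult_assoc)
    finally have "f (w \<odot>\<^sub>L (w \<odot>\<^sub>L y)) = t \<otimes> f (w \<odot>\<^sub>L y) \<oplus> (\<ominus> n) \<otimes> f y" using y tn by (simp add: fa fz)
    then have 1: "l (w \<odot>\<^sub>L y) = (t \<otimes> f (w \<odot>\<^sub>L y) \<ominus> n \<otimes> f y) \<ominus> t \<otimes> f (w \<odot>\<^sub>L y) \<oplus> f (w \<odot>\<^sub>L y) \<otimes> w"
      using y tn fc by (simp add: l_def minus_eq l_minus)
    also have "\<dots> = f (w \<odot>\<^sub>L y) \<otimes> w \<ominus> n \<otimes> f y"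
      using y tn fc by (simp add: minus_eq a_ac r_neg1 r_neg2 r_neg l_neg)
    also have "\<dots> = w \<otimes> l y"
    proof -
      have "w \<otimes> l y = w \<otimes> f (w \<odot>\<^sub>L y) \<ominus> t \<otimes> w \<otimes> f y \<oplus> (w \<otimes> w) \<otimes> f y"
        using y tn(1,2) fc by (simp add: l_def minus_eq r_distr r_minus W_ac)
      also have "\<dots> = w \<otimes> f (w \<odot>\<^sub>L y) \<ominus> t \<otimes> w \<otimes> f y \<oplus> (t \<otimes> w \<ominus> n) \<otimes> f y" by (simp only: tn(3))
      also have "\<dots> = w \<otimes> f (w \<odot>\<^sub>L y) \<ominus> t \<otimes> w \<otimes> f y \<oplus> (t \<otimes> w \<otimes> f y \<ominus> n \<otimes> f y)"
        using y tn(1,2) fc by (simp add: minus_eq l_distr l_minus)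
      also have "\<dots> = f (w \<odot>\<^sub>L y) \<otimes> w \<ominus> n \<otimes> f y"
        using y tn fc by (simp add: minus_eq a_assoc r_neg1 W_comm)
      finally show ?thesis by simp
    qed
    finally show ?thesis .
  qed
  have lW: "l (a \<odot>\<^sub>L y) = a \<otimes> l y" if a: "a \<in> W" and y: "y \<in> carrier L" for a y
  proof -
    obtain p q where pq: "p \<in> Z" "q \<in> Z" "a = p \<oplus> q \<otimes> w" using W_span[OF a] by blast
    then have "a \<odot>\<^sub>L y = p \<odot>\<^sub>L y \<oplus>\<^sub>L q \<odot>\<^sub>L (w \<odot>\<^sub>L y)" using y by (simp add: M.smult_l_distr M.smult_assoc)
    then show ?thesis using pq y lc by (simp add: la lz lw l_distr m_assoc)
  qed
  obtain v where v: "v \<in> W" "v \<otimes> l x = \<one>"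
  proof -
    \<comment> \<open>If \<open>pi2\<close> divided l(x) = c + w with c in \<open>Z\<close>, it
      would also divide l(x) - \<sigma>(l(x)) = w - \<sigma>(w), which is a unit.\<close>
    have "l x \<noteq> pi2 \<otimes> b" if b: "b \<in> W" for b
    proof
      assume h: "l x = pi2 \<otimes> b"
      define c where "c = f (w \<odot>\<^sub>L x) \<ominus> t"
      have c: "c \<in> Z" using fc assms(1) tn by (simp add: c_def)
      have lx: "l x = c \<oplus> w" using f(2) tn by (simp add: l_def c_def)
      have "w \<ominus> \<sigma> w = l x \<ominus> \<sigma> (l x)" using c a_lcomm[of w "\<ominus> c" "\<ominus> \<sigma> w"]
        by (simp add: lx sigma_add minus_eq minus_add a_assoc r_neg2)
      also have "\<dots> = pi2 \<otimes> (b \<ominus> \<sigma> b)" unfolding h using b by (simp add: sigma_mult minus_eq r_distr r_minus)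
      finally have "pi2 \<otimes> (b \<ominus> \<sigma> b) \<otimes> u = \<one>" using u_inverse' by simp
      then have "pi2 \<otimes> ((b \<ominus> \<sigma> b) \<otimes> u) = \<one>" using b m_assoc[of pi2 "b \<ominus> \<sigma> b" u] by simp
      then show False using nonunit_W[of "(b \<ominus> \<sigma> b) \<otimes> u"] b by simp
    qed
    then obtain v where "v \<in> W" "l x \<otimes> v = \<one>" using local[of "l x"] lc assms(1) by blast
    then show ?thesis using that[of v] lc assms(1) W_comm[of v "l x"] by simp
  qed
  show thesis
  proof (rule that[of "\<lambda>y. v \<otimes> l y"])
    show "v \<otimes> l y \<in> W" if "y \<in> carrier L" for y using that v lc by simp
    show "v \<otimes> l (y \<oplus>\<^sub>L z) = v \<otimes> l y \<oplus> v \<otimes> l z" if "y \<in> carrier L" "z \<in> carrier L" for y z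
      using that v lc by (simp add: la r_distr)
    show "v \<otimes> l (a \<odot>\<^sub>L y) = a \<otimes> (v \<otimes> l y)" if "a \<in> W" "y \<in> carrier L" for a y
      using that v lc W_lcomm[of v a "l y"] by (simp add: lW)
    show "v \<otimes> l x = \<one>" by (rule v)
  qed
qed

text \<open>\<open>W\<close> is spanned by 1 and \<open>w\<close> over \<open>Z\<close>, and
  \<open>Z\<close> acts centrally, so the condition for all of \<open>W\<close> follows from the one
  for \<open>w\<close>.\<close>

lemma compI: "\<lbrakk>y \<in> carrier L; w \<odot>\<^sub>L y = y \<star>\<^sub>L tw s w\<rbrakk> \<Longrightarrow> y \<in> comp L s"
  unfolding comp_def
proof (intro CollectI conjI ballI)
  fix a assume h: "y \<in> carrier L" "w \<odot>\<^sub>L y = y \<star>\<^sub>L tw s w" "a \<in> W"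
  obtain p q where pq: "p \<in> Z" "q \<in> Z" "a = p \<oplus> q \<otimes> w" using W_span[OF h(3)] by blast
  have "a \<odot>\<^sub>L y = y \<star>\<^sub>L p \<oplus>\<^sub>L q \<odot>\<^sub>L (y \<star>\<^sub>L tw s w)" using pq h by (simp add: M.smult_l_distr M.smult_assoc central)
  also have "q \<odot>\<^sub>L (y \<star>\<^sub>L tw s w) = y \<star>\<^sub>L (tw s w \<otimes> q)" using pq h by (simp add: central M.rsmult_assoc)
  also have "y \<star>\<^sub>L p \<oplus>\<^sub>L y \<star>\<^sub>L (tw s w \<otimes> q) = y \<star>\<^sub>L tw s a"
    using pq h(1) W_comm[of q "tw s w"] by (simp add: M.rsmult_r_distr[symmetric] tw_add tw_mult)
  finally show "a \<odot>\<^sub>L y = y \<star>\<^sub>L tw s a" .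
qed

lemma compD: "x \<in> comp L s \<Longrightarrow> x \<in> carrier L" "\<lbrakk>x \<in> comp L s; a \<in> W\<rbrakk> \<Longrightarrow> a \<odot>\<^sub>L x = x \<star>\<^sub>L tw s a"
  by (auto simp: comp_def)

text \<open>Left multiplication by \<open>w\<close> is annihilated by the quadratic polynomial whose
  roots are right multiplication by \<open>w\<close> and by \<open>\<sigma> w\<close>. The two
  components are the Lagrange projections, whose denominator w - \<sigma>(w) is invertible.\<close>

lemma comp_decompose:
  assumes x: "x \<in> carrier L"
  obtains x0 x1 where "x0 \<in> comp L False" "x1 \<in> comp L True" "x = x0 \<oplus>\<^sub>L x1"
proof -
  define t n where "t = w \<oplus> \<sigma> w" and "n = w \<otimes> \<sigma> w"
  have tn: "t \<in> Z" "n \<in> Z" "w \<otimes> w = t \<otimes> w \<ominus> n"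
    using W_fixed_add[of w] W_fixed_mult[of w] w_square by (simp_all add: t_def n_def)
  \<comment> \<open>Multiplication by \<open>u\<close> divides by the difference of the two roots in
    advance, so the numerators below add up to \<open>x\<close>.\<close>
  define y where "y = x \<star>\<^sub>L u"
  have y: "y \<in> carrier L" using x by (simp add: y_def)
  define x0 x1 where "x0 = w \<odot>\<^sub>L y \<ominus>\<^sub>L y \<star>\<^sub>L \<sigma> w" and "x1 = y \<star>\<^sub>L w \<ominus>\<^sub>L w \<odot>\<^sub>L y"
  have ww: "w \<odot>\<^sub>L (w \<odot>\<^sub>L y) = w \<odot>\<^sub>L y \<star>\<^sub>L w \<oplus>\<^sub>L w \<odot>\<^sub>L y \<star>\<^sub>L \<sigma> w \<ominus>\<^sub>L y \<star>\<^sub>L n"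
  proof -
    have "w \<odot>\<^sub>L (w \<odot>\<^sub>L y) = (t \<otimes> w \<ominus> n) \<odot>\<^sub>L y" using y tn by (simp add: M.smult_assoc[symmetric])
    also have "\<dots> = t \<odot>\<^sub>L (w \<odot>\<^sub>L y) \<ominus>\<^sub>L n \<odot>\<^sub>L y" using y tn by (simp add: a_minus_def M.smult_l_distr M.smult_assoc M.uminus_smult)
    also have "t \<odot>\<^sub>L (w \<odot>\<^sub>L y) = w \<odot>\<^sub>L y \<star>\<^sub>L w \<oplus>\<^sub>L w \<odot>\<^sub>L y \<star>\<^sub>L \<sigma> w"
      using y tn by (simp add: central t_def M.rsmult_r_distr)
    finally show ?thesis using y tn by (simp add: central)
  qed
  have yn: "y \<star>\<^sub>L \<sigma> w \<star>\<^sub>L w = y \<star>\<^sub>L n" "y \<star>\<^sub>L w \<star>\<^sub>L \<sigma> w = y \<star>\<^sub>L n"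
    using y W_comm[of w "\<sigma> w"] by (simp_all add: n_def M.rsmult_assoc[symmetric])
  have x0: "x0 \<in> comp L False"
  proof (rule compI)
    show "x0 \<in> carrier L" using y by (simp add: x0_def)
    have "w \<odot>\<^sub>L x0 = w \<odot>\<^sub>L (w \<odot>\<^sub>L y) \<ominus>\<^sub>L w \<odot>\<^sub>L y \<star>\<^sub>L \<sigma> w"
      using y by (simp add: x0_def a_minus_def M.smult_r_distr M.smult_minus M.smult_rsmult)
    also have "\<dots> = w \<odot>\<^sub>L y \<star>\<^sub>L w \<ominus>\<^sub>L y \<star>\<^sub>L n" unfolding ww using y tn
      by (simp add: a_minus_def M.group_simps)
    also have "\<dots> = x0 \<star>\<^sub>L w" using y yn by (simp add: x0_def a_minus_def M.rsmult_l_distr M.minus_rsmult)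
    finally show "w \<odot>\<^sub>L x0 = x0 \<star>\<^sub>L tw False w" by simp
  qed
  have x1: "x1 \<in> comp L True"
  proof (rule compI)
    show "x1 \<in> carrier L" using y by (simp add: x1_def)
    have "w \<odot>\<^sub>L x1 = w \<odot>\<^sub>L y \<star>\<^sub>L w \<ominus>\<^sub>L w \<odot>\<^sub>L (w \<odot>\<^sub>L y)"
      using y by (simp add: x1_def a_minus_def M.smult_r_distr M.smult_minus M.smult_rsmult)
    also have "\<dots> = y \<star>\<^sub>L n \<ominus>\<^sub>L w \<odot>\<^sub>L y \<star>\<^sub>L \<sigma> w" unfolding ww using y tn
      by (simp add: a_minus_def M.group_simps)
    also have "\<dots> = x1 \<star>\<^sub>L \<sigma> w" using y yn by (simp add: x1_def a_minus_def M.rsmult_l_distr M.minus_rsmult)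
    finally show "w \<odot>\<^sub>L x1 = x1 \<star>\<^sub>L tw True w" by simp
  qed
  have "x0 \<oplus>\<^sub>L x1 = y \<star>\<^sub>L w \<ominus>\<^sub>L y \<star>\<^sub>L \<sigma> w"
    using y by (simp add: x0_def x1_def a_minus_def M.group_simps)
  also have "\<dots> = y \<star>\<^sub>L (w \<ominus> \<sigma> w)" using y by (simp add: a_minus_def M.rsmult_r_distr M.rsmult_uminus)
  also have "\<dots> = x" using x u_inverse by (simp add: y_def M.rsmult_assoc[symmetric])
  finally show thesis using that x0 x1 by simp
qed

text \<open>The functional of \<open>W_functional\<close> is composed with a Lagrange projection,
  now with respect to the right action of \<open>w\<close>. On vectors of type \<open>s\<close> the
  projection is the identity, so the value at \<open>x\<close> stays 1.\<close>

lemma primitive_bifunctional: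
  assumes x: "x \<in> comp L s" "\<forall>y\<in>carrier L. x \<noteq> pi2 \<odot>\<^sub>L y"
  obtains \<mu> where "bifunctional L s \<mu>" "\<mu> x = \<one>"
proof -
  have xc: "x \<in> carrier L" using compD x by blast
  obtain l where lc: "\<And>y. y \<in> carrier L \<Longrightarrow> l y \<in> W"
    and la: "\<And>y z. \<lbrakk>y \<in> carrier L; z \<in> carrier L\<rbrakk> \<Longrightarrow> l (y \<oplus>\<^sub>L z) = l y \<oplus> l z"
    and lW: "\<And>a y. \<lbrakk>a \<in> W; y \<in> carrier L\<rbrakk> \<Longrightarrow> l (a \<odot>\<^sub>L y) = a \<otimes> l y" and lx: "l x = \<one>"
    using W_functional[OF xc x(2)] by blast
  define t n where "t = w \<oplus> \<sigma> w" and "n = w \<otimes> \<sigma> w"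
  have tn: "t \<in> Z" "n \<in> Z" "w \<otimes> w = t \<otimes> w \<ominus> n"
    using W_fixed_add[of w] W_fixed_mult[of w] w_square by (simp_all add: t_def n_def)
  define v v' where "v = tw s w" and "v' = tw s (\<sigma> w)"
  have v: "v \<in> W" "v' \<in> W" "v \<oplus> v' = t" "v \<otimes> v' = n" by (auto simp: v_def v'_def t_def n_def tw_def a_comm W_comm)
  have lr: "l (y \<star>\<^sub>L z) = z \<otimes> l y" if "z \<in> Z" "y \<in> carrier L" for y z
    using that by (simp add: central[symmetric] lW)
  \<comment> \<open>On a vector of the unwanted type the right action of \<open>v'\<close> is the
    left action of \<open>w\<close>, so this difference vanishes there.\<close>
  define \<mu> where "\<mu> y = (w \<otimes> l y \<ominus> l (y \<star>\<^sub>L v')) \<otimes> u" for y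
  have mc: "\<mu> y \<in> W" if "y \<in> carrier L" for y using lc v that by (simp add: \<mu>_def)
  have ma: "\<mu> (y \<oplus>\<^sub>L z) = \<mu> y \<oplus> \<mu> z" if "y \<in> carrier L" "z \<in> carrier L" for y z
    using that lc v by (simp add: \<mu>_def la M.rsmult_l_distr r_distr l_distr minus_eq minus_add a_ac)
  have mW: "\<mu> (a \<odot>\<^sub>L y) = a \<otimes> \<mu> y" if "a \<in> W" "y \<in> carrier L" for a y
    using that lc v by (simp add: \<mu>_def lW M.smult_rsmult minus_eq r_distr l_distr r_minus l_minus W_ac)
  \<comment> \<open>\<open>v\<close> and \<open>v'\<close> have trace \<open>t\<close> and norm
    \<open>n\<close>, like \<open>w\<close> and its conjugate. Substituting for
    \<open>l (y \<star>\<^sub>L v')\<close> by means of the trace reduces the claim to the quadratic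
    equation of \<open>w\<close>.\<close>
  have mv: "\<mu> (y \<star>\<^sub>L v) = w \<otimes> \<mu> y" if y: "y \<in> carrier L" for y
  proof -
    have "l (y \<star>\<^sub>L v) \<oplus> l (y \<star>\<^sub>L v') = t \<otimes> l y"
      using y v tn by (simp add: la[symmetric] M.rsmult_r_distr[symmetric] lr)
    then have e: "l (y \<star>\<^sub>L v') = t \<otimes> l y \<ominus> l (y \<star>\<^sub>L v)" using y v lc tn
      by (metis W_carrier Z_in_W a_comm add.inv_solve_right minus_eq M.rsmult_closed m_closed)
    have "w \<otimes> \<mu> y = (w \<otimes> w \<otimes> l y \<ominus> w \<otimes> l (y \<star>\<^sub>L v')) \<otimes> u"
      using y v lc by (simp add: \<mu>_def minus_eq r_distr l_distr r_minus l_minus W_ac)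
    also have "w \<otimes> w \<otimes> l y \<ominus> w \<otimes> l (y \<star>\<^sub>L v') = w \<otimes> l (y \<star>\<^sub>L v) \<ominus> n \<otimes> l y"
      unfolding e tn(3) using y v lc tn
      by (simp add: minus_eq r_distr l_distr r_minus l_minus minus_add W_ac a_ac r_neg r_neg1 r_neg2)
    also have "n \<otimes> l y = l (y \<star>\<^sub>L v \<star>\<^sub>L v')" using y v tn by (simp add: lr M.rsmult_assoc[symmetric])
    finally show ?thesis by (simp add: \<mu>_def)
  qed
  have mr: "\<mu> (y \<star>\<^sub>L a) = tw s a \<otimes> \<mu> y" if a: "a \<in> W" and y: "y \<in> carrier L" for a y
  proof -
    obtain p q where pq: "p \<in> Z" "q \<in> Z" "tw s a = p \<oplus> q \<otimes> w" using W_span[of "tw s a"] a by auto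
    have "a = tw s (tw s a)" using a by simp
    also have "\<dots> = p \<oplus> q \<otimes> v" unfolding pq(3) using pq(1,2) by (simp add: tw_add tw_mult v_def)
    finally have "y \<star>\<^sub>L a = p \<odot>\<^sub>L y \<oplus>\<^sub>L q \<odot>\<^sub>L y \<star>\<^sub>L v" using y pq v by (simp add: M.rsmult_r_distr M.rsmult_assoc central)
    then show ?thesis using y pq v mc by (simp add: ma mW mv l_distr m_assoc M.smult_rsmult)
  qed
  have "x \<star>\<^sub>L v' = \<sigma> w \<odot>\<^sub>L x" using compD[OF x(1)] by (simp add: v'_def)
  then have "\<mu> x = (w \<ominus> \<sigma> w) \<otimes> u" using xc by (simp add: \<mu>_def lW lx)
  then show thesis using that[of \<mu>] u_inverse' mc ma mW mr by (simp add: bifunctional_def)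
qed

end

section \<open>Ideals and columns as bimodules\<close>

lemma (in ring) ideal_bimodule_bimodule:
  assumes "ideal I R"
  shows "bimodule R R (ideal_bimodule R I)"
proof -
  interpret I: ideal I R by fact
  have sub: "x \<in> I \<Longrightarrow> x \<in> carrier R" for x using I.a_subset by blast
  have "abelian_group (ideal_bimodule R I)"
  proof (rule abelian_groupI)
    fix x assume "x \<in> carrier (ideal_bimodule R I)"
    then show "\<exists>y\<in>carrier (ideal_bimodule R I). y \<oplus>\<^bsub>ideal_bimodule R I\<^esub> x = \<zero>\<^bsub>ideal_bimodule R I\<^esub>"
      by (intro bexI[of _ "\<ominus> x"]) (auto simp: ideal_bimodule_def sub l_neg)
  qed (auto simp: ideal_bimodule_def sub a_ac)
  then show ?thesis using ring_axioms unfolding bimodule_def left_module_def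
    by (intro conjI ballI) (simp_all add: ideal_bimodule_def sub l_distr r_distr m_assoc I.I_l_closed I.I_r_closed)
qed

lemma (in ring) column_bimodule_bimodule:
  assumes "\<phi> \<in> ring_hom R (mat2_ring R)"
  shows "bimodule R R (column_bimodule R \<phi>)"
proof -
  have hom: "\<phi> a \<in> carrier (mat2_ring R)" "\<phi> (a \<oplus> b) = \<phi> a \<oplus>\<^bsub>mat2_ring R\<^esub> \<phi> b"
    "\<phi> (a \<otimes> b) = \<phi> a \<otimes>\<^bsub>mat2_ring R\<^esub> \<phi> b" "\<phi> \<one> = \<one>\<^bsub>mat2_ring R\<^esub>"
    if "a \<in> carrier R" "b \<in> carrier R" for a b
    using assms that by (auto simp: ring_hom_def)
  have "abelian_group (column_bimodule R \<phi>)"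
  proof (rule abelian_groupI)
    fix x assume "x \<in> carrier (column_bimodule R \<phi>)"
    then show "\<exists>y\<in>carrier (column_bimodule R \<phi>). y \<oplus>\<^bsub>column_bimodule R \<phi>\<^esub> x = \<zero>\<^bsub>column_bimodule R \<phi>\<^esub>"
      by (intro bexI[of _ "(\<ominus> fst x, \<ominus> snd x)"]) (auto simp: column_bimodule_def l_neg)
  qed (auto simp: column_bimodule_def a_ac)
  moreover have "left_module R (column_bimodule R \<phi>)"
    unfolding left_module_def
  proof (intro conjI ballI calculation ring_axioms)
    let ?T = "column_bimodule R \<phi>"
    fix a x assume a: "a \<in> carrier R" and x: "x \<in> carrier ?T"
    obtain a1 a2 a3 a4 where p: "\<phi> a = ((a1, a2), (a3, a4))" by (cases "\<phi> a") auto
    have pc: "a1 \<in> carrier R" "a2 \<in> carrier R" "a3 \<in> carrier R" "a4 \<in> carrier R"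
      using hom(1)[OF a a] p by (auto simp: mat2_ring_def)
    obtain x1 x2 where x': "x = (x1, x2)" "x1 \<in> carrier R" "x2 \<in> carrier R"
      using x by (auto simp: column_bimodule_def)
    show "a \<odot>\<^sub>?T x \<in> carrier ?T" using pc x' by (simp add: column_bimodule_def p)
    {
      fix y assume "y \<in> carrier ?T"
      then obtain y1 y2 where y': "y = (y1, y2)" "y1 \<in> carrier R" "y2 \<in> carrier R"
        by (auto simp: column_bimodule_def)
      show "a \<odot>\<^sub>?T (x \<oplus>\<^sub>?T y) = a \<odot>\<^sub>?T x \<oplus>\<^sub>?T a \<odot>\<^sub>?T y"
        using pc x' y' by (simp add: column_bimodule_def p r_distr a_ac)
    }
    fix b assume b: "b \<in> carrier R"
    obtain b1 b2 b3 b4 where q: "\<phi> b = ((b1, b2), (b3, b4))" by (cases "\<phi> b") auto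
    have qc: "b1 \<in> carrier R" "b2 \<in> carrier R" "b3 \<in> carrier R" "b4 \<in> carrier R"
      using hom(1)[OF b b] q by (auto simp: mat2_ring_def)
    show "(a \<oplus> b) \<odot>\<^sub>?T x = a \<odot>\<^sub>?T x \<oplus>\<^sub>?T b \<odot>\<^sub>?T x"
      using pc qc x' hom(2)[OF a b] by (simp add: column_bimodule_def p q mat2_ring_def l_distr a_ac)
    show "(a \<otimes> b) \<odot>\<^sub>?T x = a \<odot>\<^sub>?T (b \<odot>\<^sub>?T x)"
      using pc qc x' hom(3)[OF a b]
      by (simp add: column_bimodule_def p q mat2_ring_def l_distr r_distr a_ac m_assoc)
  next
    fix x assume "x \<in> carrier (column_bimodule R \<phi>)"
    then show "\<one> \<odot>\<^bsub>column_bimodule R \<phi>\<^esub> x = x"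
      using hom(4)[OF one_closed one_closed] by (auto simp: column_bimodule_def mat2_ring_def)
  qed
  moreover have "(a \<odot>\<^bsub>column_bimodule R \<phi>\<^esub> x) \<star>\<^bsub>column_bimodule R \<phi>\<^esub> b = a \<odot>\<^bsub>column_bimodule R \<phi>\<^esub> (x \<star>\<^bsub>column_bimodule R \<phi>\<^esub> b)"
    if a: "a \<in> carrier R" and x: "x \<in> carrier (column_bimodule R \<phi>)" and b: "b \<in> carrier R" for a x b
  proof -
    obtain a1 a2 a3 a4 where p: "\<phi> a = ((a1, a2), (a3, a4))" by (cases "\<phi> a") auto
    have pc: "a1 \<in> carrier R" "a2 \<in> carrier R" "a3 \<in> carrier R" "a4 \<in> carrier R"
      using hom(1)[OF a a] p by (auto simp: mat2_ring_def)
    then show ?thesis using x b by (auto simp: column_bimodule_def p l_distr m_assoc)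
  qed
  ultimately show ?thesis using ring_axioms unfolding bimodule_def
    by (intro conjI ballI) (auto simp: column_bimodule_def l_distr r_distr m_assoc)
qed

context quat_order
begin

text \<open>The ring is the sum of \<open>W\<close> and \<open>W\<close> \<pi>, so equivariance
  under \<open>W\<close> and under \<pi> on each side implies full equivariance.\<close>

lemma bimodule_homI:
  fixes L :: "('a, 'a, 'm) bimodule" and N :: "('a, 'a, 'n) bimodule"
  assumes "bimodule R R L" "bimodule R R N" and f: "\<And>x. x \<in> carrier L \<Longrightarrow> f x \<in> carrier N"
    and add: "\<And>x y. \<lbrakk>x \<in> carrier L; y \<in> carrier L\<rbrakk> \<Longrightarrow> f (x \<oplus>\<^sub>L y) = f x \<oplus>\<^sub>N f y"
    and W: "\<And>a x. \<lbrakk>a \<in> W; x \<in> carrier L\<rbrakk> \<Longrightarrow> f (a \<odot>\<^sub>L x) = a \<odot>\<^sub>N f x" "\<And>x. x \<in> carrier L \<Longrightarrow> f (\<pi> \<odot>\<^sub>L x) = \<pi> \<odot>\<^sub>N f x"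
      "\<And>a x. \<lbrakk>a \<in> W; x \<in> carrier L\<rbrakk> \<Longrightarrow> f (x \<star>\<^sub>L a) = f x \<star>\<^sub>N a" "\<And>x. x \<in> carrier L \<Longrightarrow> f (x \<star>\<^sub>L \<pi>) = f x \<star>\<^sub>N \<pi>"
  shows "bimodule_hom R R L N f"
proof -
  interpret L: bimod R R L using assms(1) by (simp add: bimod_def)
  interpret N: bimod R R N using assms(2) by (simp add: bimod_def)
  have "f (r \<odot>\<^sub>L x) = r \<odot>\<^sub>N f x" if r: "r \<in> carrier R" and x: "x \<in> carrier L" for r x
  proof -
    obtain a b where ab: "a \<in> W" "b \<in> W" "r = a \<oplus> b \<otimes> \<pi>" using decompose r by blast
    then show ?thesis using x f by (simp add: L.smult_l_distr L.smult_assoc N.smult_l_distr N.smult_assoc add W)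
  qed
  moreover have "f (x \<star>\<^sub>L r) = f x \<star>\<^sub>N r" if r: "r \<in> carrier R" and x: "x \<in> carrier L" for r x
  proof -
    obtain a b where ab: "a \<in> W" "b \<in> W" "r = a \<oplus> b \<otimes> \<pi>" using decompose r by blast
    then show ?thesis using x f by (simp add: L.rsmult_r_distr L.rsmult_assoc N.rsmult_r_distr N.rsmult_assoc add W)
  qed
  ultimately show ?thesis using f add by (simp add: bimodule_hom_def)
qed

text \<open>The shape of \<open>\<phi>\<^sub>1\<close> for \<open>False\<close> and of
  \<open>\<phi>\<^sub>2\<close> for \<open>True\<close>. The index is the type of the first basis
  column, a homogeneous vector that \<pi> carries to the second basis column.\<close>

definition column_type :: "bool \<Rightarrow> ('a \<Rightarrow> 'a mat2) \<Rightarrow> bool" where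
  "column_type s \<phi> \<longleftrightarrow> \<phi> \<in> ring_hom R (mat2_ring R) \<and> \<phi> \<pi> = ((\<zero>, pi2), (\<one>, \<zero>)) \<and>
     (\<forall>a\<in>W. \<phi> a = ((tw s a, \<zero>), (\<zero>, tw (\<not> s) a)))"

text \<open>The index is again a type: 1 is homogeneous of type \<open>False\<close> and \<pi> of
  type \<open>True\<close>. Both generators commute with \<pi>, as does the fixed vector that Galois
  descent will produce.\<close>

definition generator :: "bool \<Rightarrow> 'a" where "generator s = (if s then \<pi> else \<one>)"

definition generated :: "bool \<Rightarrow> 'a set" where "generated s = (\<lambda>r. r \<otimes> generator s) ` carrier R"

lemma generator_closed [simp]: "generator s \<in> carrier R"
  and generator_nonzero: "generator s \<noteq> \<zero>"
  and generator_comm: "a \<in> W \<Longrightarrow> generator s \<otimes> a = tw s a \<otimes> generator s"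
  and generator_pi: "generator s \<otimes> \<pi> = \<pi> \<otimes> generator s"
  by (simp_all add: generator_def pi_nonzero one_not_zero pi_comm)

lemma generator_swap: "r \<in> carrier R \<Longrightarrow> \<exists>r'\<in>carrier R. generator s \<otimes> r = r' \<otimes> generator s"
  using pi_swap(2) by (auto simp: generator_def)

lemma ideal_generated: "ideal (generated s) R"
proof (rule idealI)
  show "ring R" by (rule ring_axioms)
  show "subgroup (generated s) (add_monoid R)"
  proof (rule add.subgroupI)
    show "generated s \<subseteq> carrier R" by (auto simp: generated_def)
    show "generated s \<noteq> {}" by (auto simp: generated_def)
    show "\<ominus> a \<in> generated s" if "a \<in> generated s" for a
      using that by (auto simp: generated_def l_minus[symmetric])
    show "a \<oplus> b \<in> generated s" if "a \<in> generated s" "b \<in> generated s" for a b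
      using that by (auto simp: generated_def l_distr[symmetric])
  qed
  show "x \<otimes> a \<in> generated s" if "a \<in> generated s" "x \<in> carrier R" for a x
    using that by (auto simp: generated_def m_assoc[symmetric])
  show "a \<otimes> x \<in> generated s" if a: "a \<in> generated s" and x: "x \<in> carrier R" for a x
  proof -
    obtain r where r: "r \<in> carrier R" "a = r \<otimes> generator s" using a by (auto simp: generated_def)
    obtain x' where x': "x' \<in> carrier R" "generator s \<otimes> x = x' \<otimes> generator s" using generator_swap x by blast
    have "a \<otimes> x = (r \<otimes> x') \<otimes> generator s" using r x x' by (simp add: m_assoc)
    then show ?thesis using r x' by (auto simp: generated_def)
  qed
qed

end

section \<open>Splitting off one of the four models\<close>

context lattice_bimod
begin

lemma bifunctionalD:
  assumes "bifunctional L s \<mu>"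
  shows "x \<in> carrier L \<Longrightarrow> \<mu> x \<in> W" "\<lbrakk>x \<in> carrier L; y \<in> carrier L\<rbrakk> \<Longrightarrow> \<mu> (x \<oplus>\<^sub>L y) = \<mu> x \<oplus> \<mu> y"
    "\<lbrakk>a \<in> W; x \<in> carrier L\<rbrakk> \<Longrightarrow> \<mu> (a \<odot>\<^sub>L x) = a \<otimes> \<mu> x" "\<lbrakk>a \<in> W; x \<in> carrier L\<rbrakk> \<Longrightarrow> \<mu> (x \<star>\<^sub>L a) = tw s a \<otimes> \<mu> x"
  using assms by (auto simp: bifunctional_def)

text \<open>Moving \<open>w\<close> across \<open>x\<close> evaluates \<mu>(w x) in two ways, as w
  \<mu>(x) and as \<sigma>(w) \<mu>(x); the difference of the two scalars is a unit.\<close>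

lemma bifunctional_opposite:
  assumes m: "bifunctional L s \<mu>" and x: "x \<in> comp L (\<not> s)"
  shows "\<mu> x = \<zero>"
proof -
  have xc: "x \<in> carrier L" and "w \<odot>\<^sub>L x = x \<star>\<^sub>L tw (\<not> s) w" using compD x by auto
  then have "w \<otimes> \<mu> x = tw s (tw (\<not> s) w) \<otimes> \<mu> x"
    using bifunctionalD(3)[OF m, of w x] bifunctionalD(4)[OF m, of "tw (\<not> s) w" x] by simp
  then have "w \<otimes> \<mu> x = \<sigma> w \<otimes> \<mu> x" by (simp add: tw_tw)
  then have "(w \<ominus> \<sigma> w) \<otimes> \<mu> x = \<zero>" using bifunctionalD(1)[OF m xc] by (simp add: minus_eq l_distr l_minus r_neg)
  moreover have "w \<ominus> \<sigma> w \<noteq> \<zero>" using u_inverse one_not_zero by (metis W_carrier r_null u_closed)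
  ultimately show ?thesis using integral[of "w \<ominus> \<sigma> w" "\<mu> x"] bifunctionalD(1)[OF m xc] by simp
qed

lemma pi_comp: "x \<in> comp L s \<Longrightarrow> \<pi> \<odot>\<^sub>L x \<in> comp L (\<not> s)" "x \<in> comp L s \<Longrightarrow> x \<star>\<^sub>L \<pi> \<in> comp L (\<not> s)"
proof -
  assume x: "x \<in> comp L s"
  have xc: "x \<in> carrier L" using compD x by blast
  have "a \<odot>\<^sub>L (\<pi> \<odot>\<^sub>L x) = \<pi> \<odot>\<^sub>L x \<star>\<^sub>L tw (\<not> s) a" if "a \<in> W" for a
  proof -
    have "a \<odot>\<^sub>L (\<pi> \<odot>\<^sub>L x) = \<pi> \<odot>\<^sub>L (\<sigma> a \<odot>\<^sub>L x)" using that xc by (simp add: M.smult_assoc[symmetric] pi_comm')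
    then show ?thesis using that xc compD(2)[OF x, of "\<sigma> a"] by (simp add: M.smult_rsmult tw_sigma)
  qed
  then show "\<pi> \<odot>\<^sub>L x \<in> comp L (\<not> s)" using xc by (simp add: comp_def)
  have "a \<odot>\<^sub>L (x \<star>\<^sub>L \<pi>) = x \<star>\<^sub>L \<pi> \<star>\<^sub>L tw (\<not> s) a" if "a \<in> W" for a
  proof -
    have "a \<odot>\<^sub>L (x \<star>\<^sub>L \<pi>) = x \<star>\<^sub>L tw s a \<star>\<^sub>L \<pi>" using that xc compD(2)[OF x, of a] by (simp add: M.smult_rsmult[symmetric])
    then show ?thesis using that xc by (simp add: M.rsmult_assoc[symmetric] pi_comm' sigma_tw)
  qed
  then show "x \<star>\<^sub>L \<pi> \<in> comp L (\<not> s)" using xc by (simp add: comp_def)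
qed

lemma comp_closed:
  "\<lbrakk>x \<in> comp L s; y \<in> comp L s\<rbrakk> \<Longrightarrow> x \<oplus>\<^sub>L y \<in> comp L s" "\<lbrakk>a \<in> W; x \<in> comp L s\<rbrakk> \<Longrightarrow> a \<odot>\<^sub>L x \<in> comp L s"
proof -
  show "\<lbrakk>x \<in> comp L s; y \<in> comp L s\<rbrakk> \<Longrightarrow> x \<oplus>\<^sub>L y \<in> comp L s"
    by (simp add: comp_def M.smult_r_distr M.rsmult_l_distr)
  assume a: "a \<in> W" and x: "x \<in> comp L s"
  have xc: "x \<in> carrier L" using compD x by blast
  have "b \<odot>\<^sub>L (a \<odot>\<^sub>L x) = a \<odot>\<^sub>L x \<star>\<^sub>L tw s b" if "b \<in> W" for b
  proof -
    have "b \<odot>\<^sub>L (a \<odot>\<^sub>L x) = a \<odot>\<^sub>L (b \<odot>\<^sub>L x)" using a xc that W_comm[of a b] by (simp add: M.smult_assoc[symmetric])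
    also have "\<dots> = a \<odot>\<^sub>L (x \<star>\<^sub>L tw s b)" using compD(2)[OF x that] by simp
    finally show ?thesis using a xc that by (simp add: M.smult_rsmult)
  qed
  then show "a \<odot>\<^sub>L x \<in> comp L s" using a xc by (simp add: comp_def)
qed

text \<open>Subtracting a multiple of \<open>\<pi> x \<pi>\<close> from \<open>x\<close> makes the functional vanish at \<open>x\<close> and changes its
  value at \<open>\<pi> x \<pi>\<close> only by a unit.\<close>

lemma normalized_bifunctional:
  assumes x: "x \<in> comp L s" and nd: "\<forall>y\<in>carrier L. x \<star>\<^sub>L \<pi> \<noteq> \<pi> \<odot>\<^sub>L y"
  obtains x' \<mu> where "x' \<in> comp L s" "bifunctional L s \<mu>" "\<mu> x' = \<zero>" "\<mu> (\<pi> \<odot>\<^sub>L x' \<star>\<^sub>L \<pi>) = \<one>"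
proof -
  define z where "z = \<pi> \<odot>\<^sub>L x \<star>\<^sub>L \<pi>"
  have xc: "x \<in> carrier L" using compD x by blast
  have z: "z \<in> comp L s" using pi_comp(2)[OF pi_comp(1)[OF x]] by (simp add: z_def)
  have zc: "z \<in> carrier L" using compD z by blast
  have "\<forall>y\<in>carrier L. z \<noteq> pi2 \<odot>\<^sub>L y"
  proof
    fix y assume y: "y \<in> carrier L"
    then show "z \<noteq> pi2 \<odot>\<^sub>L y" using nd pi_cancel[of "x \<star>\<^sub>L \<pi>" "\<pi> \<odot>\<^sub>L y"] xc
      by (auto simp: z_def M.smult_assoc M.smult_rsmult)
  qed
  then obtain m where m: "bifunctional L s m" "m z = \<one>" using primitive_bifunctional z by blast
  note mD = bifunctionalD[OF m(1)]
  define c where "c = m x"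
  have c: "c \<in> W" using mD(1) xc by (simp add: c_def)
  define y where "y = x \<oplus>\<^sub>L (\<ominus> c) \<odot>\<^sub>L z"
  have y: "y \<in> comp L s" using x z c by (simp add: y_def comp_closed)
  have yc: "y \<in> carrier L" using compD y by blast
  have my: "m y = \<zero>" using c zc xc m(2) by (simp add: y_def mD c_def[symmetric] r_neg)
  have "\<pi> \<odot>\<^sub>L y \<star>\<^sub>L \<pi> = z \<oplus>\<^sub>L \<pi> \<odot>\<^sub>L ((\<ominus> c) \<odot>\<^sub>L z) \<star>\<^sub>L \<pi>"
    using xc zc c by (simp add: y_def z_def M.smult_r_distr M.rsmult_l_distr)
  also have "\<pi> \<odot>\<^sub>L ((\<ominus> c) \<odot>\<^sub>L z) \<star>\<^sub>L \<pi> = (\<ominus> \<sigma> c) \<odot>\<^sub>L (\<pi> \<odot>\<^sub>L z \<star>\<^sub>L \<pi>)"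
    using zc c by (simp add: M.smult_assoc[symmetric] M.smult_rsmult pi_comm sigma_neg)
  \<comment> \<open>Multiplying by \<pi> on both sides twice returns \<open>x\<close> up to a
    central factor \<pi>^4. The correction to the value at \<pi> x \<pi> is hence divisible by
    \<open>pi2\<close>, and the new value is a unit by \<open>unit_one_minus\<close>.\<close>
  also have "\<pi> \<odot>\<^sub>L z \<star>\<^sub>L \<pi> = pi2 \<odot>\<^sub>L (pi2 \<odot>\<^sub>L x)"
    using xc pi2_central[of "\<pi> \<odot>\<^sub>L (\<pi> \<odot>\<^sub>L x)"] by (simp add: z_def M.smult_assoc M.smult_rsmult)
  finally have "m (\<pi> \<odot>\<^sub>L y \<star>\<^sub>L \<pi>) = \<one> \<ominus> \<sigma> c \<otimes> (pi2 \<otimes> (pi2 \<otimes> c))"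
    using xc zc c m(2) by (simp add: mD c_def[symmetric] minus_eq l_minus)
  also have "\<sigma> c \<otimes> (pi2 \<otimes> (pi2 \<otimes> c)) = pi2 \<otimes> (\<sigma> c \<otimes> (pi2 \<otimes> c))"
    using c W_lcomm[of "\<sigma> c" pi2 "pi2 \<otimes> c"] by simp
  finally obtain d where d: "d \<in> W" "d \<otimes> m (\<pi> \<odot>\<^sub>L y \<star>\<^sub>L \<pi>) = \<one>"
    using unit_one_minus[of "\<sigma> c \<otimes> (pi2 \<otimes> c)"] c by auto
  have "bifunctional L s (\<lambda>v. d \<otimes> m v)"
    using d(1) mD by (auto simp: bifunctional_def r_distr W_lcomm)
  then show thesis using that[of y "\<lambda>v. d \<otimes> m v"] y my d by simp
qed

end

lemma column_bimodule_simps [simp]: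
  "carrier (column_bimodule R \<phi>) = carrier R \<times> carrier R"
  "(x, y) \<oplus>\<^bsub>column_bimodule R \<phi>\<^esub> (x', y') = (x \<oplus>\<^sub>R x', y \<oplus>\<^sub>R y')"
  "\<zero>\<^bsub>column_bimodule R \<phi>\<^esub> = (\<zero>\<^sub>R, \<zero>\<^sub>R)"
  "(x, y) \<star>\<^bsub>column_bimodule R \<phi>\<^esub> b = (x \<otimes>\<^sub>R b, y \<otimes>\<^sub>R b)"
  by (simp_all add: column_bimodule_def)

lemma ideal_bimodule_simps [simp]:
  "carrier (ideal_bimodule R I) = I" "x \<oplus>\<^bsub>ideal_bimodule R I\<^esub> y = x \<oplus>\<^sub>R y" "\<zero>\<^bsub>ideal_bimodule R I\<^esub> = \<zero>\<^sub>R"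
  "a \<odot>\<^bsub>ideal_bimodule R I\<^esub> x = a \<otimes>\<^sub>R x" "x \<star>\<^bsub>ideal_bimodule R I\<^esub> a = x \<otimes>\<^sub>R a"
  by (simp_all add: ideal_bimodule_def)

lemma (in quat_order) column_type_smult:
  assumes "column_type s \<phi>" "x \<in> carrier R" "y \<in> carrier R"
  shows "\<pi> \<odot>\<^bsub>column_bimodule R \<phi>\<^esub> (x, y) = (pi2 \<otimes> y, x)"
    "a \<in> W \<Longrightarrow> a \<odot>\<^bsub>column_bimodule R \<phi>\<^esub> (x, y) = (tw s a \<otimes> x, tw (\<not> s) a \<otimes> y)"
  using assms by (auto simp: column_bimodule_def column_type_def)

context lattice_bimod
begin

text \<open>The section sends the two basis columns to \<open>x\<close> and \<pi> x. Its left
  inverse reads off coordinates with an \<open>R\<close>-valued functional made from \<mu>, linear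
  on the right over \<open>R\<close>, which vanishes at \<open>x\<close> and is 1 at \<pi>
  x.\<close>

lemma column_split:
  assumes phi: "column_type s \<phi>" and x: "x \<in> comp L s" and m: "bifunctional L s \<mu>" "\<mu> x = \<zero>" "\<mu> (\<pi> \<odot>\<^sub>L x \<star>\<^sub>L \<pi>) = \<one>"
  obtains f h where "bimodule_hom R R L (column_bimodule R \<phi>) f" "bimodule_hom R R (column_bimodule R \<phi>) L h"
    "\<And>t. t \<in> carrier (column_bimodule R \<phi>) \<Longrightarrow> f (h t) = t"
proof -
  let ?T = "column_bimodule R \<phi>"
  have T: "bimodule R R ?T" using phi column_bimodule_bimodule by (simp add: column_type_def)
  interpret T: bimod R R ?T using T by (simp add: bimod_def)
  note mD = bifunctionalD[OF m(1)]
  note pT = column_type_smult[OF phi]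
  have xc: "x \<in> carrier L" using compD x by blast
  have px: "\<pi> \<odot>\<^sub>L x \<in> comp L (\<not> s)" by (rule pi_comp(1)[OF x])
  define h where "h = (\<lambda>(a, b). x \<star>\<^sub>L a \<oplus>\<^sub>L \<pi> \<odot>\<^sub>L x \<star>\<^sub>L b)"
  \<comment> \<open>Linearity on the right under \<pi> dictates the first coordinate: if G(y) = A +
    B \<pi> with B the twisted \<mu>(y), then G(y) \<pi> has \<pi>-coordinate A, which must be the
    twisted \<mu>(y \<pi>).\<close>
  define G where "G y = tw (\<not> s) (\<mu> (y \<star>\<^sub>L \<pi>)) \<oplus> tw (\<not> s) (\<mu> y) \<otimes> \<pi>" for y
  define f where "f y = (G (\<pi> \<odot>\<^sub>L y), G y)" for y
  have Gc: "G y \<in> carrier R" if "y \<in> carrier L" for y using that mD by (simp add: G_def)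
  have Ga: "G (y \<oplus>\<^sub>L z) = G y \<oplus> G z" if "y \<in> carrier L" "z \<in> carrier L" for y z
    using that mD by (simp add: G_def M.rsmult_l_distr tw_add l_distr a_ac)
  have Gl: "G (a \<odot>\<^sub>L y) = tw (\<not> s) a \<otimes> G y" if "y \<in> carrier L" "a \<in> W" for y a
    using that mD by (simp add: G_def M.smult_rsmult tw_mult r_distr m_assoc)
  have Gr: "G (y \<star>\<^sub>L a) = G y \<otimes> a" if y: "y \<in> carrier L" and a: "a \<in> W" for y a
  proof -
    have "y \<star>\<^sub>L a \<star>\<^sub>L \<pi> = y \<star>\<^sub>L \<pi> \<star>\<^sub>L \<sigma> a" using y a by (simp add: M.rsmult_assoc[symmetric] pi_comm')
    then have "G (y \<star>\<^sub>L a) = a \<otimes> tw (\<not> s) (\<mu> (y \<star>\<^sub>L \<pi>)) \<oplus> (\<sigma> a \<otimes> tw (\<not> s) (\<mu> y)) \<otimes> \<pi>"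
      using y a mD by (simp add: G_def tw_mult tw_tw tw_sigma)
    also have "\<dots> = tw (\<not> s) (\<mu> (y \<star>\<^sub>L \<pi>)) \<otimes> a \<oplus> tw (\<not> s) (\<mu> y) \<otimes> (\<sigma> a \<otimes> \<pi>)"
      using y a mD by (simp add: W_ac)
    also have "\<dots> = G y \<otimes> a" using y a mD by (simp add: G_def l_distr m_assoc pi_comm)
    finally show ?thesis .
  qed
  have Gp: "G (y \<star>\<^sub>L \<pi>) = G y \<otimes> \<pi>" if y: "y \<in> carrier L" for y
  proof -
    have "\<mu> (y \<star>\<^sub>L \<pi> \<star>\<^sub>L \<pi>) = pi2 \<otimes> \<mu> y" using mD(4)[of pi2 y] y by (simp add: M.rsmult_assoc)
    moreover have "tw (\<not> s) (pi2 \<otimes> \<mu> y) = tw (\<not> s) (\<mu> y) \<otimes> pi2"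
      using tw_mult[of pi2 "\<mu> y" "\<not> s"] W_comm[of pi2 "tw (\<not> s) (\<mu> y)"] y mD(1) by simp
    ultimately show ?thesis using y mD(1) by (simp add: G_def l_distr m_assoc a_comm)
  qed
  have Gpp: "G (\<pi> \<odot>\<^sub>L (\<pi> \<odot>\<^sub>L y)) = pi2 \<otimes> G y" if y: "y \<in> carrier L" for y
    using Gl[of y pi2] y by (simp add: M.smult_assoc)
  have f: "bimodule_hom R R L ?T f"
  proof (rule bimodule_homI[OF M.bimodule T])
    show "f y \<in> carrier ?T" if "y \<in> carrier L" for y using that Gc by (simp add: f_def)
    show "f (y \<oplus>\<^sub>L z) = f y \<oplus>\<^sub>?T f z" if "y \<in> carrier L" "z \<in> carrier L" for y z
      using that by (simp add: f_def Ga M.smult_r_distr)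
    show "f (a \<odot>\<^sub>L y) = a \<odot>\<^sub>?T f y" if "a \<in> W" "y \<in> carrier L" for a y
    proof -
      have "\<pi> \<odot>\<^sub>L (a \<odot>\<^sub>L y) = \<sigma> a \<odot>\<^sub>L (\<pi> \<odot>\<^sub>L y)" using that by (simp add: M.smult_assoc[symmetric] pi_comm)
      then show ?thesis using that by (simp add: f_def pT Gc Gl tw_sigma)
    qed
    show "f (\<pi> \<odot>\<^sub>L y) = \<pi> \<odot>\<^sub>?T f y" if "y \<in> carrier L" for y
      using that by (simp add: f_def pT Gc Gpp)
    show "f (y \<star>\<^sub>L a) = f y \<star>\<^sub>?T a" if "a \<in> W" "y \<in> carrier L" for a y
      using that by (simp add: f_def Gr M.smult_rsmult[symmetric])
    show "f (y \<star>\<^sub>L \<pi>) = f y \<star>\<^sub>?T \<pi>" if "y \<in> carrier L" for y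
      using that by (simp add: f_def Gp M.smult_rsmult[symmetric])
  qed
  have h: "bimodule_hom R R ?T L h"
  proof (rule bimodule_homI[OF T M.bimodule])
    show "h t \<in> carrier L" if "t \<in> carrier ?T" for t using that xc by (auto simp: h_def)
    show "h (t \<oplus>\<^sub>?T t') = h t \<oplus>\<^sub>L h t'" if "t \<in> carrier ?T" "t' \<in> carrier ?T" for t t'
      using that xc by (auto simp: h_def M.rsmult_r_distr M.a_ac)
    show "h (c \<odot>\<^sub>?T t) = c \<odot>\<^sub>L h t" if c: "c \<in> W" and t: "t \<in> carrier ?T" for c t
    proof -
      obtain a b where ab: "t = (a, b)" "a \<in> carrier R" "b \<in> carrier R" using t by auto
      have "h (c \<odot>\<^sub>?T t) = x \<star>\<^sub>L tw s c \<star>\<^sub>L a \<oplus>\<^sub>L \<pi> \<odot>\<^sub>L x \<star>\<^sub>L tw (\<not> s) c \<star>\<^sub>L b"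
        using ab c xc by (simp add: h_def pT M.rsmult_assoc)
      also have "\<dots> = c \<odot>\<^sub>L h t"
        using ab c xc compD(2)[OF x c] compD(2)[OF px c] by (simp add: h_def M.smult_r_distr M.smult_rsmult[symmetric])
      finally show ?thesis .
    qed
    show "h (\<pi> \<odot>\<^sub>?T t) = \<pi> \<odot>\<^sub>L h t" if t: "t \<in> carrier ?T" for t
    proof -
      obtain a b where ab: "t = (a, b)" "a \<in> carrier R" "b \<in> carrier R" using t by auto
      have "h (\<pi> \<odot>\<^sub>?T t) = pi2 \<odot>\<^sub>L x \<star>\<^sub>L b \<oplus>\<^sub>L \<pi> \<odot>\<^sub>L x \<star>\<^sub>L a"
        using ab xc central[of pi2 x] by (simp add: h_def pT M.rsmult_assoc)
      also have "\<dots> = \<pi> \<odot>\<^sub>L h t" using ab xc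
        by (simp add: h_def M.smult_r_distr M.smult_rsmult M.smult_assoc M.a_comm)
      finally show ?thesis .
    qed
    show "h (t \<star>\<^sub>?T a) = h t \<star>\<^sub>L a" if "a \<in> W" "t \<in> carrier ?T" for a t
      using that xc by (auto simp: h_def M.rsmult_l_distr M.rsmult_assoc)
    show "h (t \<star>\<^sub>?T \<pi>) = h t \<star>\<^sub>L \<pi>" if "t \<in> carrier ?T" for t
      using that xc by (auto simp: h_def M.rsmult_l_distr M.rsmult_assoc)
  qed
  \<comment> \<open>\<mu> vanishes at x \<pi>, which has the opposite type, and at \<open>x\<close>
    by the normalization. In the next fact the type removes \<mu>(\<pi> x) and leaves the normalized
    value 1 at \<pi> x \<pi>.\<close>
  have Gx: "G x = \<zero>"
    using bifunctional_opposite[OF m(1) pi_comp(2)[OF x]] m(2) by (simp add: G_def)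
  have Gpx: "G (\<pi> \<odot>\<^sub>L x) = \<one>"
    using bifunctional_opposite[OF m(1) px] m(3) by (simp add: G_def)
  have Grr: "G (y \<star>\<^sub>L r) = G y \<otimes> r" if y: "y \<in> carrier L" and r: "r \<in> carrier R" for y r
  proof -
    obtain a b where "a \<in> W" "b \<in> W" "r = a \<oplus> b \<otimes> \<pi>" using decompose r by blast
    then show ?thesis using y Gc by (simp add: M.rsmult_r_distr M.rsmult_assoc Ga Gr Gp r_distr m_assoc)
  qed
  have "f (h t) = t" if t: "t \<in> carrier ?T" for t
  proof -
    obtain a b where ab: "t = (a, b)" "a \<in> carrier R" "b \<in> carrier R" using t by auto
    have "G (h t) = b" using ab xc by (simp add: h_def Ga Grr Gx Gpx)
    moreover have "\<pi> \<odot>\<^sub>L h t = \<pi> \<odot>\<^sub>L x \<star>\<^sub>L a \<oplus>\<^sub>L pi2 \<odot>\<^sub>L x \<star>\<^sub>L b"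
      using ab xc by (simp add: h_def M.smult_r_distr M.smult_rsmult M.smult_assoc)
    then have "G (\<pi> \<odot>\<^sub>L h t) = a" using ab xc by (simp add: Ga Grr Gl Gx Gpx)
    ultimately show ?thesis by (simp add: f_def ab)
  qed
  then show thesis using that f h by blast
qed

text \<open>If \<open>L \<pi> \<subseteq> \<pi> L\<close>, conjugation by \<open>\<pi>\<close> is an involution on \<open>L\<close>. Galois descent along \<open>W / Z\<close> produces a
  fixed vector outside \<open>\<pi> L\<close>, and averaging produces an equivariant functional.\<close>

lemma ideal_split:
  assumes nz: "carrier L \<noteq> {\<zero>\<^sub>L}" and sub: "\<forall>y\<in>carrier L. \<exists>z\<in>carrier L. y \<star>\<^sub>L \<pi> = \<pi> \<odot>\<^sub>L z"
  obtains s f h where "bimodule_hom R R L (ideal_bimodule R (generated s)) f"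
    "bimodule_hom R R (ideal_bimodule R (generated s)) L h" "\<And>t. t \<in> generated s \<Longrightarrow> f (h t) = t"
proof -
  \<comment> \<open>\<open>\<tau>\<close> sends y to the conjugate of y by the inverse of \<pi>,
    expressed through the divisibility hypothesis; \<open>pi_cancel\<close> makes its values
    unique.\<close>
  obtain \<tau> where tc: "\<And>y. y \<in> carrier L \<Longrightarrow> \<tau> y \<in> carrier L" and t: "\<And>y. y \<in> carrier L \<Longrightarrow> \<pi> \<odot>\<^sub>L \<tau> y = y \<star>\<^sub>L \<pi>"
    using sub by metis
  have tI: "\<tau> y = z" if "y \<in> carrier L" "z \<in> carrier L" "y \<star>\<^sub>L \<pi> = \<pi> \<odot>\<^sub>L z" for y z
    using that tc t pi_cancel by metis
  have tt: "\<tau> (\<tau> y) = y" if "y \<in> carrier L" for y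
  proof (rule tI)
    have "\<pi> \<odot>\<^sub>L (\<tau> y \<star>\<^sub>L \<pi>) = y \<star>\<^sub>L \<pi> \<star>\<^sub>L \<pi>" using that tc t[OF that] by (simp add: M.smult_rsmult[symmetric])
    also have "\<dots> = \<pi> \<odot>\<^sub>L (\<pi> \<odot>\<^sub>L y)" using that pi2_central by simp
    finally show "\<tau> y \<star>\<^sub>L \<pi> = \<pi> \<odot>\<^sub>L y" using pi_cancel[of "\<tau> y \<star>\<^sub>L \<pi>" "\<pi> \<odot>\<^sub>L y"] that tc by simp
  qed (use that tc in simp_all)
  have ta: "\<tau> (y \<oplus>\<^sub>L z) = \<tau> y \<oplus>\<^sub>L \<tau> z" if "y \<in> carrier L" "z \<in> carrier L" for y z
    using that tc t by (intro tI) (simp_all add: M.rsmult_l_distr M.smult_r_distr)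
  have tl: "\<tau> (a \<odot>\<^sub>L y) = \<sigma> a \<odot>\<^sub>L \<tau> y" if "y \<in> carrier L" "a \<in> W" for a y
  proof (rule tI)
    have "\<pi> \<odot>\<^sub>L (\<sigma> a \<odot>\<^sub>L \<tau> y) = a \<odot>\<^sub>L (\<pi> \<odot>\<^sub>L \<tau> y)" using that tc by (simp add: M.smult_assoc[symmetric] pi_comm')
    then show "a \<odot>\<^sub>L y \<star>\<^sub>L \<pi> = \<pi> \<odot>\<^sub>L (\<sigma> a \<odot>\<^sub>L \<tau> y)" using that t by (simp add: M.smult_rsmult)
  qed (use that tc in simp_all)
  have tr: "\<tau> (y \<star>\<^sub>L a) = \<tau> y \<star>\<^sub>L \<sigma> a" if "y \<in> carrier L" "a \<in> W" for a y
  proof (rule tI)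
    have "y \<star>\<^sub>L a \<star>\<^sub>L \<pi> = y \<star>\<^sub>L \<pi> \<star>\<^sub>L \<sigma> a" using that tc by (simp add: M.rsmult_assoc[symmetric] pi_comm')
    then show "y \<star>\<^sub>L a \<star>\<^sub>L \<pi> = \<pi> \<odot>\<^sub>L (\<tau> y \<star>\<^sub>L \<sigma> a)" using that tc t[of y, symmetric] by (simp add: M.smult_rsmult)
  qed (use that tc in simp_all)
  have tp: "\<tau> (\<pi> \<odot>\<^sub>L y) = \<pi> \<odot>\<^sub>L \<tau> y" if "y \<in> carrier L" for y
    using that tc t by (intro tI) (simp_all add: M.smult_rsmult)
  have tcomp: "\<tau> y \<in> comp L s" if "y \<in> comp L s" for y s
  proof -
    have yc: "y \<in> carrier L" using compD that by blast
    have "a \<odot>\<^sub>L \<tau> y = \<tau> y \<star>\<^sub>L tw s a" if a: "a \<in> W" for a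
    proof -
      have "a \<odot>\<^sub>L \<tau> y = \<tau> (\<sigma> a \<odot>\<^sub>L y)" using tl[of y "\<sigma> a"] yc a by simp
      also have "\<dots> = \<tau> (y \<star>\<^sub>L tw s (\<sigma> a))" using compD(2)[OF \<open>y \<in> comp L s\<close>, of "\<sigma> a"] a by simp
      also have "\<dots> = \<tau> y \<star>\<^sub>L \<sigma> (tw s (\<sigma> a))" using tr yc a by simp
      finally show ?thesis using a by (simp add: tw_sigma sigma_tw)
    qed
    then show ?thesis using tc yc by (simp add: comp_def)
  qed
  obtain y0 where y0: "y0 \<in> carrier L" "\<forall>y\<in>carrier L. y0 \<noteq> \<pi> \<odot>\<^sub>L y" using not_pi_divisible nz by blast
  obtain s y where y: "y \<in> comp L s" "\<forall>z\<in>carrier L. y \<noteq> \<pi> \<odot>\<^sub>L z"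
  proof -
    obtain a b where ab: "a \<in> comp L False" "b \<in> comp L True" "y0 = a \<oplus>\<^sub>L b" using comp_decompose y0(1) by blast
    have "\<exists>s. \<exists>y\<in>comp L s. \<forall>z\<in>carrier L. y \<noteq> \<pi> \<odot>\<^sub>L z"
    proof (rule ccontr)
      assume "\<not> ?thesis"
      then have all: "\<forall>s. \<forall>y\<in>comp L s. \<exists>z\<in>carrier L. y = \<pi> \<odot>\<^sub>L z" by simp
      obtain z z' where z: "z \<in> carrier L" "a = \<pi> \<odot>\<^sub>L z" "z' \<in> carrier L" "b = \<pi> \<odot>\<^sub>L z'"
        using bspec[OF spec[OF all] ab(1)] bspec[OF spec[OF all] ab(2)] by blast
      then have "y0 = \<pi> \<odot>\<^sub>L (z \<oplus>\<^sub>L z')" using ab(3) by (simp add: M.smult_r_distr)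
      then show False using y0(2) z by blast
    qed
    then show ?thesis using that by blast
  qed
  have yc: "y \<in> carrier L" using compD y by blast
  obtain x where x: "x \<in> comp L s" "\<tau> x = x" "\<forall>z\<in>carrier L. x \<noteq> \<pi> \<odot>\<^sub>L z"
  proof -
    \<comment> \<open>The sums of y and of w y with their images under \<open>\<tau>\<close>.
      Together they recover y, since x2 - \<sigma>(w) x1 = (w - \<sigma>(w)) y, so they cannot both
      lie in \<pi> L.\<close>
    define x1 x2 where "x1 = y \<oplus>\<^sub>L \<tau> y" and "x2 = w \<odot>\<^sub>L y \<oplus>\<^sub>L \<sigma> w \<odot>\<^sub>L \<tau> y"
    have xs: "x1 \<in> comp L s" "x2 \<in> comp L s" using y tcomp by (simp_all add: x1_def x2_def comp_closed)
    have tx: "\<tau> x1 = x1" "\<tau> x2 = x2" using yc tc tt by (simp_all add: x1_def x2_def ta tl M.a_comm)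
    have "(\<forall>z\<in>carrier L. x1 \<noteq> \<pi> \<odot>\<^sub>L z) \<or> (\<forall>z\<in>carrier L. x2 \<noteq> \<pi> \<odot>\<^sub>L z)"
    proof (rule ccontr)
      assume "\<not> ?thesis"
      then obtain z z' where z: "z \<in> carrier L" "x1 = \<pi> \<odot>\<^sub>L z" "z' \<in> carrier L" "x2 = \<pi> \<odot>\<^sub>L z'" by blast
      have c: "w \<odot>\<^sub>L y \<in> carrier L" "\<sigma> w \<odot>\<^sub>L y \<in> carrier L" "\<sigma> w \<odot>\<^sub>L \<tau> y \<in> carrier L" using yc tc by simp_all
      have "(w \<ominus> \<sigma> w) \<odot>\<^sub>L y = w \<odot>\<^sub>L y \<oplus>\<^sub>L \<ominus>\<^sub>L (\<sigma> w \<odot>\<^sub>L y)"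
        using yc by (simp add: minus_eq M.smult_l_distr M.uminus_smult)
      also have "\<dots> = x2 \<oplus>\<^sub>L \<ominus>\<^sub>L (\<sigma> w \<odot>\<^sub>L x1)"
      proof -
        have "x2 \<oplus>\<^sub>L \<ominus>\<^sub>L (\<sigma> w \<odot>\<^sub>L x1) = w \<odot>\<^sub>L y \<oplus>\<^sub>L (\<sigma> w \<odot>\<^sub>L \<tau> y \<oplus>\<^sub>L (\<ominus>\<^sub>L (\<sigma> w \<odot>\<^sub>L \<tau> y) \<oplus>\<^sub>L \<ominus>\<^sub>L (\<sigma> w \<odot>\<^sub>L y)))"
          using yc tc by (simp add: x1_def x2_def M.smult_r_distr M.minus_add M.a_assoc M.a_comm[of "\<ominus>\<^sub>L (\<sigma> w \<odot>\<^sub>L y)"])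
        also have "\<dots> = w \<odot>\<^sub>L y \<oplus>\<^sub>L \<ominus>\<^sub>L (\<sigma> w \<odot>\<^sub>L y)" using c by (simp add: M.r_neg2)
        finally show ?thesis by simp
      qed
      also have "\<dots> = \<pi> \<odot>\<^sub>L (z' \<oplus>\<^sub>L \<ominus>\<^sub>L (w \<odot>\<^sub>L z))"
      proof -
        have "\<sigma> w \<odot>\<^sub>L (\<pi> \<odot>\<^sub>L z) = \<pi> \<odot>\<^sub>L (w \<odot>\<^sub>L z)" using z by (simp add: M.smult_assoc[symmetric] pi_comm)
        then show ?thesis using z by (simp add: M.smult_r_distr M.smult_minus)
      qed
      finally have "u \<odot>\<^sub>L ((w \<ominus> \<sigma> w) \<odot>\<^sub>L y) = u \<odot>\<^sub>L (\<pi> \<odot>\<^sub>L (z' \<oplus>\<^sub>L \<ominus>\<^sub>L (w \<odot>\<^sub>L z)))" by simp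
      moreover have "u \<odot>\<^sub>L ((w \<ominus> \<sigma> w) \<odot>\<^sub>L y) = y" using yc u_inverse by (simp add: M.smult_assoc[symmetric])
      moreover have "u \<odot>\<^sub>L (\<pi> \<odot>\<^sub>L (z' \<oplus>\<^sub>L \<ominus>\<^sub>L (w \<odot>\<^sub>L z))) = \<pi> \<odot>\<^sub>L (\<sigma> u \<odot>\<^sub>L (z' \<oplus>\<^sub>L \<ominus>\<^sub>L (w \<odot>\<^sub>L z)))"
        using z pi_comm'[of u] by (simp add: M.smult_assoc[symmetric])
      ultimately show False using y(2) z by auto
    qed
    then show ?thesis using that xs tx by blast
  qed
  have xc: "x \<in> carrier L" using compD x by blast
  have xp: "x \<star>\<^sub>L \<pi> = \<pi> \<odot>\<^sub>L x" using t[OF xc] x(2) by simp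
  obtain c where c: "c \<in> W" "c \<oplus> \<sigma> c = \<one>" using trace_one by blast
  have "\<forall>z\<in>carrier L. \<pi> \<odot>\<^sub>L x \<noteq> pi2 \<odot>\<^sub>L z"
    using x(3) xc pi_cancel[of x] by (metis M.smult_assoc M.smult_closed pi_closed)
  \<comment> \<open>The functional is normalized at \<pi> x, of the type opposite to
    \<open>x\<close>, because its value at y will become the coefficient of \<pi> and its value at
    \<pi> y will give the constant coefficient.\<close>
  then obtain m0 where m0: "bifunctional L (\<not> s) m0" "m0 (\<pi> \<odot>\<^sub>L x) = \<one>"
    using primitive_bifunctional[OF pi_comp(1)[OF x(1)]] by blast
  note mD = bifunctionalD[OF m0(1)]
  \<comment> \<open>Averaging with weights \<open>c\<close> and its conjugate makes \<mu> intertwine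
    \<open>\<tau>\<close> with \<sigma>. As \<open>c\<close> has trace one and \<open>\<tau>\<close>
    fixes \<pi> x, the value there remains 1.\<close>
  define \<mu> where "\<mu> y = c \<otimes> m0 y \<oplus> \<sigma> (c \<otimes> m0 (\<tau> y))" for y
  have mc: "\<mu> y \<in> W" if "y \<in> carrier L" for y using that c tc mD by (simp add: \<mu>_def)
  have ma: "\<mu> (y \<oplus>\<^sub>L z) = \<mu> y \<oplus> \<mu> z" if "y \<in> carrier L" "z \<in> carrier L" for y z
    using that c tc mD by (simp add: \<mu>_def ta sigma_mult sigma_add r_distr a_ac)
  have ml: "\<mu> (a \<odot>\<^sub>L y) = a \<otimes> \<mu> y" if "a \<in> W" "y \<in> carrier L" for a y
    using that c tc mD by (simp add: \<mu>_def tl sigma_mult r_distr W_ac)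
  have mr: "\<mu> (y \<star>\<^sub>L a) = tw (\<not> s) a \<otimes> \<mu> y" if "a \<in> W" "y \<in> carrier L" for a y
    using that c tc mD by (simp add: \<mu>_def tr sigma_mult sigma_tw tw_sigma r_distr W_ac)
  have mt: "\<mu> (\<tau> y) = \<sigma> (\<mu> y)" if "y \<in> carrier L" for y
    using that c tc mD by (simp add: \<mu>_def tt sigma_add sigma_mult a_comm)
  have mx: "\<mu> (\<pi> \<odot>\<^sub>L x) = \<one>" using c xc x(2) m0(2) by (simp add: \<mu>_def tp)
  have m: "bifunctional L (\<not> s) \<mu>" using mc ma ml mr by (simp add: bifunctional_def)
  have mx0: "\<mu> x = \<zero>" using bifunctional_opposite[OF m] x(1) by simp
  \<comment> \<open>The \<open>R\<close>-valued functional with \<pi>-coordinate \<mu>. Linearity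
    under left multiplication by \<pi> fixes the other coordinate; linearity under right
    multiplication by \<pi> is what the averaging provides.\<close>
  define F where "F y = \<sigma> (\<mu> (\<pi> \<odot>\<^sub>L y)) \<oplus> \<mu> y \<otimes> \<pi>" for y
  have Fc: "F y \<in> carrier R" if "y \<in> carrier L" for y using that mc by (simp add: F_def)
  have Fa: "F (y \<oplus>\<^sub>L z) = F y \<oplus> F z" if "y \<in> carrier L" "z \<in> carrier L" for y z
    using that mc by (simp add: F_def ma M.smult_r_distr sigma_add l_distr a_ac)
  have Fl: "F (a \<odot>\<^sub>L y) = a \<otimes> F y" if "a \<in> W" "y \<in> carrier L" for a y
  proof -
    have "\<pi> \<odot>\<^sub>L (a \<odot>\<^sub>L y) = \<sigma> a \<odot>\<^sub>L (\<pi> \<odot>\<^sub>L y)" using that by (simp add: M.smult_assoc[symmetric] pi_comm)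
    then show ?thesis using that mc by (simp add: F_def ml sigma_mult r_distr m_assoc)
  qed
  have Fp: "F (\<pi> \<odot>\<^sub>L y) = \<pi> \<otimes> F y" if "y \<in> carrier L" for y
  proof -
    have "\<mu> (\<pi> \<odot>\<^sub>L (\<pi> \<odot>\<^sub>L y)) = pi2 \<otimes> \<mu> y" using ml[of pi2 y] that by (simp add: M.smult_assoc)
    then have "F (\<pi> \<odot>\<^sub>L y) = pi2 \<otimes> \<sigma> (\<mu> y) \<oplus> \<mu> (\<pi> \<odot>\<^sub>L y) \<otimes> \<pi>" using that mc by (simp add: F_def sigma_mult)
    also have "pi2 \<otimes> \<sigma> (\<mu> y) = \<pi> \<otimes> (\<mu> y \<otimes> \<pi>)" using that mc by (simp add: m_assoc pi_comm')
    also have "\<mu> (\<pi> \<odot>\<^sub>L y) \<otimes> \<pi> = \<pi> \<otimes> \<sigma> (\<mu> (\<pi> \<odot>\<^sub>L y))" using that mc by (simp add: pi_comm')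
    finally show ?thesis using that mc by (simp add: F_def r_distr a_comm)
  qed
  have Fr: "F (y \<star>\<^sub>L a) = F y \<otimes> tw s a" if "a \<in> W" "y \<in> carrier L" for a y
  proof -
    have "F (y \<star>\<^sub>L a) = \<sigma> (\<mu> (\<pi> \<odot>\<^sub>L y \<star>\<^sub>L a)) \<oplus> \<mu> (y \<star>\<^sub>L a) \<otimes> \<pi>" using that by (simp add: F_def M.smult_rsmult)
    also have "\<dots> = tw s a \<otimes> \<sigma> (\<mu> (\<pi> \<odot>\<^sub>L y)) \<oplus> (tw (\<not> s) a \<otimes> \<mu> y) \<otimes> \<pi>"
      using that mc by (simp add: mr sigma_mult sigma_tw)
    also have "\<dots> = \<sigma> (\<mu> (\<pi> \<odot>\<^sub>L y)) \<otimes> tw s a \<oplus> \<mu> y \<otimes> (tw (\<not> s) a \<otimes> \<pi>)" using that mc by (simp add: W_ac)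
    also have "tw (\<not> s) a \<otimes> \<pi> = \<pi> \<otimes> tw s a" using that by (simp add: pi_comm' sigma_tw)
    finally show ?thesis using that mc by (simp add: F_def l_distr m_assoc)
  qed
  have Fq: "F (y \<star>\<^sub>L \<pi>) = F y \<otimes> \<pi>" if y: "y \<in> carrier L" for y
  proof -
    have "F (y \<star>\<^sub>L \<pi>) = \<pi> \<otimes> F (\<tau> y)" using t[OF y, symmetric] Fp tc y by simp
    also have "F (\<tau> y) = \<mu> (\<pi> \<odot>\<^sub>L y) \<oplus> \<sigma> (\<mu> y) \<otimes> \<pi>" using y mc by (simp add: F_def tp[symmetric] mt)
    also have "\<pi> \<otimes> \<dots> = (\<sigma> (\<mu> (\<pi> \<odot>\<^sub>L y)) \<oplus> \<mu> y \<otimes> \<pi>) \<otimes> \<pi>"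
      using y mc pi_comm[of "\<mu> (\<pi> \<odot>\<^sub>L y)"] pi_comm[of "\<sigma> (\<mu> y)"] by (simp add: r_distr l_distr m_assoc[symmetric])
    finally show ?thesis by (simp add: F_def)
  qed
  have Fx: "F x = \<one>" using mx mx0 by (simp add: F_def)
  let ?T = "ideal_bimodule R (generated s)" and ?g = "generator s"
  have T: "bimodule R R ?T" by (rule ideal_bimodule_bimodule[OF ideal_generated])
  \<comment> \<open>Multiplying by the generator turns the twist \<open>tw s\<close>, through which
    \<open>F\<close> transforms under right scalars, into the ordinary right action of
    \<open>W\<close>.\<close>
  define f where "f y = F y \<otimes> ?g" for y
  have f: "bimodule_hom R R L ?T f"
  proof (rule bimodule_homI[OF M.bimodule T])
    show "f y \<in> carrier ?T" if "y \<in> carrier L" for y using that Fc by (auto simp: f_def generated_def)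
    show "f (y \<oplus>\<^sub>L z) = f y \<oplus>\<^sub>?T f z" if "y \<in> carrier L" "z \<in> carrier L" for y z
      using that Fc by (simp add: f_def Fa l_distr)
    show "f (a \<odot>\<^sub>L y) = a \<odot>\<^sub>?T f y" if "a \<in> W" "y \<in> carrier L" for a y
      using that Fc by (simp add: f_def Fl m_assoc)
    show "f (\<pi> \<odot>\<^sub>L y) = \<pi> \<odot>\<^sub>?T f y" if "y \<in> carrier L" for y
      using that Fc by (simp add: f_def Fp m_assoc)
    show "f (y \<star>\<^sub>L a) = f y \<star>\<^sub>?T a" if "a \<in> W" "y \<in> carrier L" for a y
      using that Fc by (simp add: f_def Fr m_assoc generator_comm)
    show "f (y \<star>\<^sub>L \<pi>) = f y \<star>\<^sub>?T \<pi>" if "y \<in> carrier L" for y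
      using that Fc by (simp add: f_def Fq m_assoc generator_pi)
  qed
  \<comment> \<open>Division by the generator: the quotient exists for \<open>v\<close> in the ideal
    and is unique because there are no zero divisors.\<close>
  define h where "h v = (THE r. r \<in> carrier R \<and> r \<otimes> ?g = v) \<odot>\<^sub>L x" for v
  have hr: "h (r \<otimes> ?g) = r \<odot>\<^sub>L x" if "r \<in> carrier R" for r
  proof -
    have "(THE r'. r' \<in> carrier R \<and> r' \<otimes> ?g = r \<otimes> ?g) = r"
      using that cancel_right[of _ r ?g] generator_nonzero by (intro the_equality) auto
    then show ?thesis by (simp add: h_def)
  qed
  have h: "bimodule_hom R R ?T L h"
  proof (rule bimodule_homI[OF T M.bimodule])
    fix v assume "v \<in> carrier ?T"
    then obtain r where r: "r \<in> carrier R" "v = r \<otimes> ?g" by (auto simp: generated_def)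
    show "h v \<in> carrier L" using r xc by (simp add: hr)
    show "h (a \<odot>\<^sub>?T v) = a \<odot>\<^sub>L h v" if "a \<in> W" for a
      using r xc that hr[of "a \<otimes> r"] hr[of r] by (simp add: m_assoc M.smult_assoc)
    show "h (\<pi> \<odot>\<^sub>?T v) = \<pi> \<odot>\<^sub>L h v"
      using r xc hr[of "\<pi> \<otimes> r"] hr[of r] by (simp add: m_assoc M.smult_assoc)
    show "h (v \<star>\<^sub>?T a) = h v \<star>\<^sub>L a" if "a \<in> W" for a
      using r xc that hr[of "r \<otimes> tw s a"] hr[of r] compD(2)[OF x(1), of "tw s a"]
      by (simp add: m_assoc M.smult_assoc generator_comm M.smult_rsmult)
    show "h (v \<star>\<^sub>?T \<pi>) = h v \<star>\<^sub>L \<pi>"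
      using r xc hr[of "r \<otimes> \<pi>"] hr[of r] xp by (simp add: m_assoc M.smult_assoc generator_pi M.smult_rsmult)
    fix v' assume "v' \<in> carrier ?T"
    then obtain r' where r': "r' \<in> carrier R" "v' = r' \<otimes> ?g" by (auto simp: generated_def)
    show "h (v \<oplus>\<^sub>?T v') = h v \<oplus>\<^sub>L h v'"
      using r r' xc hr[of "r \<oplus> r'"] hr[of r] hr[of r'] by (simp add: l_distr M.smult_l_distr)
  qed
  have "f (h v) = v" if v: "v \<in> generated s" for v
  proof -
    obtain r where r: "r \<in> carrier R" "v = r \<otimes> ?g" using v by (auto simp: generated_def)
    obtain a b where ab: "a \<in> W" "b \<in> W" "r = a \<oplus> b \<otimes> \<pi>" using decompose r(1) by blast
    have "F (r \<odot>\<^sub>L x) = r \<otimes> F x" using ab xc Fc by (simp add: M.smult_l_distr M.smult_assoc Fa Fl Fp l_distr m_assoc)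
    then show ?thesis using r Fx hr by (simp add: f_def)
  qed
  then show thesis using that[of s f h] f h by blast
qed

end

section \<open>Decomposition of lattices\<close>

context quat_order
begin

abbreviation lat :: "('a, 'a, 'm) bimodule \<Rightarrow> bool" where "lat L \<equiv> lattice_bimod R Z W \<sigma> \<pi> w u L"

definition Zhom :: "('a, 'a, 'm) bimodule \<Rightarrow> ('a, 'a, 'n) bimodule \<Rightarrow> ('m \<Rightarrow> 'n) \<Rightarrow> bool" where
  "Zhom L M f \<longleftrightarrow> f \<in> carrier L \<rightarrow> carrier M \<and>
     (\<forall>x\<in>carrier L. \<forall>y\<in>carrier L. f (x \<oplus>\<^sub>L y) = f x \<oplus>\<^sub>M f y) \<and>
     (\<forall>z\<in>Z. \<forall>x\<in>carrier L. f (z \<odot>\<^sub>L x) = z \<odot>\<^sub>M f x)"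

lemma Zhom_finsum:
  assumes "Zhom L M f" "bimodule R R L" "bimodule R R M" "g \<in> A \<rightarrow> carrier L"
  shows "f (finsum L g A) = finsum M (\<lambda>i. f (g i)) A"
proof -
  interpret L: bimod R R L using assms(2) by (simp add: bimod_def)
  interpret M: bimod R R M using assms(3) by (simp add: bimod_def)
  have f: "f x \<in> carrier M" if "x \<in> carrier L" for x using assms(1) that by (auto simp: Zhom_def)
  have fa: "f (x \<oplus>\<^sub>L y) = f x \<oplus>\<^sub>M f y" if "x \<in> carrier L" "y \<in> carrier L" for x y
    using assms(1) that by (auto simp: Zhom_def)
  have "f \<zero>\<^sub>L = f (\<zero> \<odot>\<^sub>L \<zero>\<^sub>L)" by simp
  also have "\<dots> = \<zero> \<odot>\<^sub>M f \<zero>\<^sub>L" using assms(1) Z_zero L.zero_closed unfolding Zhom_def by blast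
  finally have z: "f \<zero>\<^sub>L = \<zero>\<^sub>M" using f by simp
  show ?thesis using assms(4)
  proof (induction A rule: infinite_finite_induct)
    case (insert i A)
    then have "g i \<in> carrier L" "g \<in> A \<rightarrow> carrier L" by auto
    then show ?case using insert f by (simp add: fa Pi_iff)
  qed (simp_all add: z)
qed

text \<open>The functionals are pulled back along \<open>i\<close> and the vectors pushed along
  \<open>r\<close>. These maps are asked to be \<open>Z\<close>-linear, which leaves the freedom to
  take for \<open>i\<close> a map that is no bimodule homomorphism, as the descent on the rank
  does.\<close>

lemma dual_basis_retract:
  assumes d: "dual_basis L I e \<nu>" and L: "bimodule R R L" and M: "bimodule R R M"
    and i: "Zhom M L i" and r: "Zhom L M r" and ri: "\<And>x. x \<in> carrier M \<Longrightarrow> r (i x) = x"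
  shows "dual_basis M I (r \<circ> e) (\<lambda>k. \<nu> k \<circ> i)"
  unfolding dual_basis_def
proof (intro conjI ballI)
  show "finite I" using d by (simp add: dual_basis_def)
  have e: "e k \<in> carrier L" "Zlinear L (\<nu> k)" if "k \<in> I" for k using d that by (auto simp: dual_basis_def)
  have ic: "i x \<in> carrier L" if "x \<in> carrier M" for x using i that by (auto simp: Zhom_def)
  show "r \<circ> e \<in> I \<rightarrow> carrier M" using r e by (auto simp: Zhom_def)
  show "Zlinear M (\<nu> k \<circ> i)" if "k \<in> I" for k
    using e(2)[OF that] i ic by (auto simp: Zlinear_def Zhom_def)
  fix x assume x: "x \<in> carrier M"
  interpret L: bimod R R L using L by (simp add: bimod_def)
  interpret M: bimod R R M using M by (simp add: bimod_def)
  have nc: "\<nu> k (i x) \<in> Z" if "k \<in> I" for k using e(2)[OF that] ic[OF x] by (simp add: Zlinear_def)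
  have "x = r (finsum L (\<lambda>k. \<nu> k (i x) \<odot>\<^sub>L e k) I)" using d ic[OF x] ri[OF x] by (simp add: dual_basis_def)
  also have "\<dots> = finsum M (\<lambda>k. r (\<nu> k (i x) \<odot>\<^sub>L e k)) I"
    using nc e by (intro Zhom_finsum[OF r L M]) auto
  also have "\<dots> = finsum M (\<lambda>k. (\<nu> k \<circ> i) x \<odot>\<^sub>M (r \<circ> e) k) I"
    using r nc e by (intro M.finsum_cong') (auto simp: Zhom_def Pi_iff)
  finally show "x = finsum M (\<lambda>k. (\<nu> k \<circ> i) x \<odot>\<^sub>M (r \<circ> e) k) I" .
qed

lemma dual_basis_drop:
  assumes d: "dual_basis L I e \<nu>" and L: "bimodule R R L" and j: "j \<in> I" "\<And>x. x \<in> carrier L \<Longrightarrow> \<nu> j x = \<zero>"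
  shows "dual_basis L (I - {j}) e \<nu>"
proof -
  interpret L: bimod R R L using L by (simp add: bimod_def)
  have fin: "finite I" using d by (simp add: dual_basis_def)
  have e: "e k \<in> carrier L" "Zlinear L (\<nu> k)" if "k \<in> I" for k using d that by (auto simp: dual_basis_def)
  have "x = finsum L (\<lambda>k. \<nu> k x \<odot>\<^sub>L e k) (I - {j})" if x: "x \<in> carrier L" for x
  proof -
    have nc: "\<nu> k x \<in> carrier R" if "k \<in> I" for k using e(2)[OF that] x by (simp add: Zlinear_def)
    have "x = finsum L (\<lambda>k. \<nu> k x \<odot>\<^sub>L e k) (insert j (I - {j}))"
      using d x j(1) by (simp add: dual_basis_def insert_absorb)
    also have "\<dots> = \<nu> j x \<odot>\<^sub>L e j \<oplus>\<^sub>L finsum L (\<lambda>k. \<nu> k x \<odot>\<^sub>L e k) (I - {j})"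
      using fin e nc j(1) by (intro L.finsum_insert) auto
    also have "\<dots> = finsum L (\<lambda>k. \<nu> k x \<odot>\<^sub>L e k) (I - {j})"
    proof -
      have "finsum L (\<lambda>k. \<nu> k x \<odot>\<^sub>L e k) (I - {j}) \<in> carrier L" using e nc by (intro L.finsum_closed) auto
      then show ?thesis using j e x by simp
    qed
    finally show ?thesis .
  qed
  then show ?thesis using d by (auto simp: dual_basis_def)
qed

end

section \<open>Complements of direct summands\<close>

context lattice_bimod
begin

lemma lat_sub_bimodule:
  assumes A: "subbimodule R R L A" and d: "dual_basis (sub_bimodule L A) (I :: 'm set) e \<nu>"
  shows "lat (sub_bimodule L A)"
proof -
  interpret A: bimod R R "sub_bimodule L A" using M.sub_bimodule_bimodule[OF A] by (simp add: bimod_def)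
  show ?thesis
    by unfold_locales (use d central subbimoduleD(1)[OF A] in auto)
qed

text \<open>The last claim is the descent. A primitive vector \<open>x\<close> of the summand has a
  coordinate j that is a unit. Shearing the complement along \<open>x\<close> makes this coordinate
  vanish on it, and the projection along the summand undoes the shear, so the complement inherits a
  dual basis without j.\<close>

lemma split_lattice:
  fixes T :: "('a, 'a, 'n) bimodule" and I :: "'m set"
  assumes T: "bimodule R R T" and f: "bimodule_hom R R L T f" and h: "bimodule_hom R R T L h"
    and fh: "\<And>t. t \<in> carrier T \<Longrightarrow> f (h t) = t" and nz: "carrier T \<noteq> {\<zero>\<^sub>T}" and d: "dual_basis L I e \<nu>"
  defines "K \<equiv> {x \<in> carrier L. f x = \<zero>\<^sub>T}"
  shows "subbimodule R R L K" "internal_direct_sum L (h ` carrier T) K"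
    "bimodule_isomorphic R R L (T \<oplus>\<^sub>B sub_bimodule L K)"
    "\<exists>(J :: 'm set) e' \<nu>'. dual_basis (sub_bimodule L K) J e' \<nu>' \<and> card J < card I"
proof -
  interpret T: bimod R R T using T by (simp add: bimod_def)
  show K: "subbimodule R R L K" unfolding K_def by (rule M.kernel_subbimodule[OF f T])
  have H: "subbimodule R R L (h ` carrier T)" by (rule M.image_subbimodule[OF h T])
  show ds: "internal_direct_sum L (h ` carrier T) K" unfolding K_def
    by (rule M.split_internal_direct_sum(1)[OF T f h fh])
  show "bimodule_isomorphic R R L (T \<oplus>\<^sub>B sub_bimodule L K)"
    by (rule bimodule_isomorphic_trans[OF M.internal_direct_sum_isomorphic[OF H K ds]
          bimodule_sum_cong[OF M.split_internal_direct_sum(2)[OF T f h fh] bimodule_isomorphic_refl]])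
  have fx1: "f x \<in> carrier T" if "x \<in> carrier L" for x using f that by (auto simp: bimodule_hom_def)
  have fx2: "f (x \<oplus>\<^sub>L y) = f x \<oplus>\<^sub>T f y" if "x \<in> carrier L" "y \<in> carrier L" for x y
    using f that by (auto simp: bimodule_hom_def)
  have fx3: "f (r \<odot>\<^sub>L x) = r \<odot>\<^sub>T f x" if "x \<in> carrier L" "r \<in> carrier R" for x r
    using f that by (auto simp: bimodule_hom_def)
  have hx1: "h x \<in> carrier L" if "x \<in> carrier T" for x using h that by (auto simp: bimodule_hom_def)
  have hx2: "h (x \<oplus>\<^sub>T y) = h x \<oplus>\<^sub>L h y" if "x \<in> carrier T" "y \<in> carrier T" for x y
    using h that by (auto simp: bimodule_hom_def)
  have hx3: "h (r \<odot>\<^sub>T x) = r \<odot>\<^sub>L h x" if "x \<in> carrier T" "r \<in> carrier R" for x r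
    using h that by (auto simp: bimodule_hom_def)
  note fx = fx1 fx2 fx3 and hx = hx1 hx2 hx3
  have bH: "bimodule R R (sub_bimodule L (h ` carrier T))" "bimodule R R (sub_bimodule L K)"
    using M.sub_bimodule_bimodule H K by blast+
  have HL: "h ` carrier T \<subseteq> carrier L" "K \<subseteq> carrier L" using subbimoduleD(1) H K by blast+
  have "dual_basis (sub_bimodule L (h ` carrier T)) I ((\<lambda>x. h (f x)) \<circ> e) (\<lambda>k. \<nu> k \<circ> (\<lambda>x. x))"
    by (rule dual_basis_retract[OF d M.bimodule bH(1)]) (use HL fx hx fh in \<open>auto simp: Zhom_def subset_iff\<close>)
  then interpret H: lattice_bimod R Z W \<sigma> \<pi> w u "sub_bimodule L (h ` carrier T)"
    using lat_sub_bimodule[OF H] by blast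
  obtain t0 where t0: "t0 \<in> carrier T" "t0 \<noteq> \<zero>\<^sub>T" using nz T.zero_closed by blast
  have "\<zero>\<^sub>L = \<zero> \<odot>\<^sub>L h \<zero>\<^sub>T" using hx(1)[of "\<zero>\<^sub>T"] by simp
  also have "\<dots> = h (\<zero> \<odot>\<^sub>T \<zero>\<^sub>T)" using hx(3)[of "\<zero>\<^sub>T" \<zero>] by simp
  finally have hz: "h \<zero>\<^sub>T = \<zero>\<^sub>L" by simp
  have "h t0 \<noteq> \<zero>\<^sub>L" using fh[OF t0(1)] fh[OF T.zero_closed] hz t0(2) by metis
  then have "carrier (sub_bimodule L (h ` carrier T)) \<noteq> {\<zero>\<^bsub>sub_bimodule L (h ` carrier T)\<^esub>}" using t0(1) by auto
  \<comment> \<open>This vector is outside \<pi> times the summand. Projecting a supposed equation x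
    = \<pi>^2 y into the summand shows that \<open>pi2\<close> does not divide it in
    \<open>L\<close> either.\<close>
  then obtain x where x: "x \<in> h ` carrier T" "\<forall>y\<in>h ` carrier T. x \<noteq> \<pi> \<odot>\<^sub>L y"
    using H.not_pi_divisible by auto
  have xL: "x \<in> carrier L" using x HL by blast
  have hfx: "h (f x) = x" using x(1) fh by auto
  have np: "\<forall>y\<in>carrier L. x \<noteq> pi2 \<odot>\<^sub>L y"
  proof (intro ballI notI)
    fix y assume y: "y \<in> carrier L" "x = pi2 \<odot>\<^sub>L y"
    have "x = h (f (pi2 \<odot>\<^sub>L y))" using hfx y(2) by simp
    also have "\<dots> = pi2 \<odot>\<^sub>L h (f y)" using fx hx y(1) by simp
    also have "\<dots> = \<pi> \<odot>\<^sub>L (h (\<pi> \<odot>\<^sub>T f y))" using fx hx y(1) by (simp add: M.smult_assoc)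
    finally have "x = \<pi> \<odot>\<^sub>L (h (\<pi> \<odot>\<^sub>T f y))" .
    moreover have "\<pi> \<odot>\<^sub>T f y \<in> carrier T" using fx1[OF y(1)] by simp
    ultimately show False using x(2) by auto
  qed
  obtain j v where j: "j \<in> I" "v \<in> Z" "v \<otimes> \<nu> j x = \<one>" using primitive_coordinate[OF xL np d] by blast
  have nj: "Zlinear L (\<nu> j)" using d j by (simp add: dual_basis_def)
  have njc: "\<nu> j y \<in> Z" if "y \<in> carrier L" for y using nj that by (simp add: Zlinear_def)
  have nja: "\<nu> j (y \<oplus>\<^sub>L z) = \<nu> j y \<oplus> \<nu> j z" if "y \<in> carrier L" "z \<in> carrier L" for y z
    using nj that by (simp add: Zlinear_def)
  have njz: "\<nu> j (a \<odot>\<^sub>L y) = a \<otimes> \<nu> j y" if "y \<in> carrier L" "a \<in> Z" for y a using nj that by (simp add: Zlinear_def)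
  \<comment> \<open>The shear: \<open>v\<close> inverts the coordinate of \<open>x\<close>, so
    subtracting this multiple of \<open>x\<close> cancels coordinate j.\<close>
  define i where "i y = y \<oplus>\<^sub>L (\<ominus> (\<nu> j y \<otimes> v)) \<odot>\<^sub>L x" for y
  define r where "r y = y \<oplus>\<^sub>L \<ominus>\<^sub>L (h (f y))" for y
  have ic: "i y \<in> carrier L" if "y \<in> carrier L" for y using that xL njc j by (simp add: i_def)
  have fz: "f \<zero>\<^sub>L = \<zero>\<^sub>T" using fh[OF T.zero_closed] hz by simp
  have Kf: "y \<in> carrier L" "f y = \<zero>\<^sub>T" if "y \<in> K" for y using that by (auto simp: K_def)
  have rc: "r y \<in> K" if "y \<in> carrier L" for y
  proof -
    have "\<ominus>\<^sub>L (h (f y)) = (\<ominus> \<one>) \<odot>\<^sub>L h (f y)" using that fx hx by (simp add: M.uminus_smult)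
    also have "\<dots> = h ((\<ominus> \<one>) \<odot>\<^sub>T f y)" using that fx hx by simp
    finally have e: "\<ominus>\<^sub>L (h (f y)) = h ((\<ominus> \<one>) \<odot>\<^sub>T f y)" .
    have "f (r y) = f y \<oplus>\<^sub>T (\<ominus> \<one>) \<odot>\<^sub>T f y" unfolding r_def e using that fx hx fh by simp
    also have "\<dots> = \<zero>\<^sub>T" using that fx by (simp add: T.uminus_smult T.r_neg)
    finally show ?thesis using that fx hx by (simp add: K_def r_def)
  qed
  have iZ: "Zhom (sub_bimodule L K) L i"
    unfolding Zhom_def
  proof (intro conjI ballI funcsetI; simp)
    show "i y \<in> carrier L" if "y \<in> K" for y using ic Kf(1)[OF that] .
    show "i (y \<oplus>\<^sub>L z) = i y \<oplus>\<^sub>L i z" if "y \<in> K" "z \<in> K" for y z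
      using Kf(1)[OF that(1)] Kf(1)[OF that(2)] xL njc j
      by (simp add: i_def nja l_distr minus_add M.smult_l_distr M.a_ac)
    show "i (a \<odot>\<^sub>L y) = a \<odot>\<^sub>L i y" if "a \<in> Z" "y \<in> K" for a y
      using Kf(1)[OF that(2)] that(1) xL njc j
      by (simp add: i_def njz M.smult_r_distr M.smult_assoc[symmetric] r_minus m_assoc)
  qed
  have rZ: "Zhom L (sub_bimodule L K) r"
    unfolding Zhom_def
  proof (intro conjI ballI funcsetI; simp)
    show "r y \<in> K" if "y \<in> carrier L" for y using rc that .
    show "r (y \<oplus>\<^sub>L z) = r y \<oplus>\<^sub>L r z" if "y \<in> carrier L" "z \<in> carrier L" for y z
      using that fx hx by (simp add: r_def M.minus_add M.a_ac)
    show "r (a \<odot>\<^sub>L y) = a \<odot>\<^sub>L r y" if "a \<in> Z" "y \<in> carrier L" for a y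
      using that fx hx by (simp add: r_def M.smult_r_distr M.smult_minus)
  qed
  have rx: "r x = \<zero>\<^sub>L" using hfx xL by (simp add: r_def M.r_neg)
  have ry: "r y = y" if "y \<in> K" for y using Kf[OF that] hz by (simp add: r_def M.minus_equality)
  have ri: "r (i y) = y" if "y \<in> carrier (sub_bimodule L K)" for y
  proof -
    have yc: "y \<in> K" "y \<in> carrier L" using that HL by auto
    have c: "\<ominus> (\<nu> j y \<otimes> v) \<in> Z" using njc yc j by simp
    have "r (i y) = r y \<oplus>\<^sub>L r ((\<ominus> (\<nu> j y \<otimes> v)) \<odot>\<^sub>L x)" using rZ yc c xL by (simp add: i_def Zhom_def)
    also have "r ((\<ominus> (\<nu> j y \<otimes> v)) \<odot>\<^sub>L x) = \<zero>\<^sub>L" using rZ c xL rx by (simp add: Zhom_def)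
    finally show ?thesis using ry yc by simp
  qed
  have "dual_basis (sub_bimodule L K) I (r \<circ> e) (\<lambda>k. \<nu> k \<circ> i)"
    by (rule dual_basis_retract[OF d M.bimodule bH(2) iZ rZ ri])
  moreover have "(\<nu> j \<circ> i) y = \<zero>" if "y \<in> carrier (sub_bimodule L K)" for y
  proof -
    have yc: "y \<in> carrier L" using that HL by auto
    have "\<nu> j (i y) = \<nu> j y \<oplus> (\<ominus> (\<nu> j y \<otimes> v)) \<otimes> \<nu> j x" using yc xL njc j by (simp add: i_def nja njz)
    also have "\<dots> = \<nu> j y \<ominus> \<nu> j y \<otimes> (v \<otimes> \<nu> j x)" using yc xL njc j by (simp add: l_minus minus_eq m_assoc)
    also have "\<dots> = \<zero>" using j(3) njc yc by (simp add: minus_eq r_neg)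
    finally show ?thesis by simp
  qed
  ultimately have "dual_basis (sub_bimodule L K) (I - {j}) (r \<circ> e) (\<lambda>k. \<nu> k \<circ> i)"
    using dual_basis_drop[OF _ bH(2) j(1)] by blast
  moreover have "card (I - {j}) < card I" using d j(1) by (intro psubset_card_mono) (auto simp: dual_basis_def)
  ultimately show "\<exists>(J :: 'm set) e' \<nu>'. dual_basis (sub_bimodule L K) J e' \<nu>' \<and> card J < card I" by blast
qed

text \<open>The projection onto \<open>A\<close> along \<open>B\<close> is \<open>Z\<close>-linear
  because components are unique; with the inclusion it makes \<open>A\<close> a retract of
  \<open>L\<close> and transfers the dual basis.\<close>

lemma lat_direct_summand:
  assumes A: "subbimodule R R L A" and B: "subbimodule R R L B" and ds: "internal_direct_sum L A B"
  shows "lat (sub_bimodule L A)"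
proof -
  obtain I :: "'m set" and e \<nu> where d: "dual_basis L I e \<nu>" using dual by blast
  have bA: "bimodule R R (sub_bimodule L A)" and bB: "bimodule R R (sub_bimodule L B)"
    using M.sub_bimodule_bimodule A B by blast+
  have AL: "A \<subseteq> carrier L" "B \<subseteq> carrier L" using subbimoduleD(1) A B by blast+
  have AB: "A \<inter> B = {\<zero>\<^sub>L}" using ds by (simp add: internal_direct_sum_def)
  have "\<exists>a b. a \<in> A \<and> b \<in> B \<and> x = a \<oplus>\<^sub>L b" if "x \<in> carrier L" for x
    using ds that unfolding internal_direct_sum_def set_add_def' by blast
  then obtain r q where rq: "\<And>x. x \<in> carrier L \<Longrightarrow> r x \<in> A" "\<And>x. x \<in> carrier L \<Longrightarrow> q x \<in> B"
    "\<And>x. x \<in> carrier L \<Longrightarrow> x = r x \<oplus>\<^sub>L q x" by metis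
  have uniq: "a = a'" if "a \<in> A" "a' \<in> A" "b \<in> B" "b' \<in> B" "a \<oplus>\<^sub>L b = a' \<oplus>\<^sub>L b'" for a a' b b'
  proof -
    have c: "a \<in> carrier L" "a' \<in> carrier L" "b \<in> carrier L" "b' \<in> carrier L" using that AL by auto
    have "a' \<oplus>\<^sub>L ((a \<oplus>\<^sub>L \<ominus>\<^sub>L a') \<oplus>\<^sub>L b) = a \<oplus>\<^sub>L b"
      using c by (simp add: M.a_lcomm[of a'] M.r_neg2 M.a_assoc)
    then have "(a \<oplus>\<^sub>L \<ominus>\<^sub>L a') \<oplus>\<^sub>L b = b'" unfolding that(5) using c by simp
    then have "a \<oplus>\<^sub>L \<ominus>\<^sub>L a' = b' \<oplus>\<^sub>L \<ominus>\<^sub>L b" using c by (metis M.add.inv_solve_right M.a_closed M.a_inv_closed)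
    moreover have "a \<oplus>\<^sub>L \<ominus>\<^sub>L a' \<in> A" "b' \<oplus>\<^sub>L \<ominus>\<^sub>L b \<in> B"
      using that subbimoduleD(3,4)[OF A] subbimoduleD(3,4)[OF B] by auto
    ultimately have "a \<oplus>\<^sub>L \<ominus>\<^sub>L a' = \<zero>\<^sub>L" using AB by auto
    then show "a = a'" using c by (simp add: M.add.inv_solve_right')
  qed
  have "Zhom L (sub_bimodule L A) r"
    unfolding Zhom_def
  proof (intro conjI ballI funcsetI; simp)
    show "r x \<in> A" if "x \<in> carrier L" for x using rq that by blast
    show "r (x \<oplus>\<^sub>L y) = r x \<oplus>\<^sub>L r y" if xy: "x \<in> carrier L" "y \<in> carrier L" for x y
    proof (rule uniq)
      have c: "r x \<in> carrier L" "q x \<in> carrier L" "r y \<in> carrier L" "q y \<in> carrier L" using rq xy AL by blast+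
      have "r (x \<oplus>\<^sub>L y) \<oplus>\<^sub>L q (x \<oplus>\<^sub>L y) = x \<oplus>\<^sub>L y" using rq(3)[of "x \<oplus>\<^sub>L y"] xy by simp
      also have "\<dots> = (r x \<oplus>\<^sub>L q x) \<oplus>\<^sub>L (r y \<oplus>\<^sub>L q y)" using rq(3) xy by simp
      also have "\<dots> = (r x \<oplus>\<^sub>L r y) \<oplus>\<^sub>L (q x \<oplus>\<^sub>L q y)" using c by (simp add: M.a_ac)
      finally show "r (x \<oplus>\<^sub>L y) \<oplus>\<^sub>L q (x \<oplus>\<^sub>L y) = (r x \<oplus>\<^sub>L r y) \<oplus>\<^sub>L (q x \<oplus>\<^sub>L q y)" .
    qed (use rq xy subbimoduleD(3)[OF A] subbimoduleD(3)[OF B] in auto)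
    show "r (a \<odot>\<^sub>L x) = a \<odot>\<^sub>L r x" if a: "a \<in> Z" "x \<in> carrier L" for a x
    proof (rule uniq)
      have c: "r x \<in> carrier L" "q x \<in> carrier L" using rq a AL by blast+
      have "r (a \<odot>\<^sub>L x) \<oplus>\<^sub>L q (a \<odot>\<^sub>L x) = a \<odot>\<^sub>L x" using rq(3)[of "a \<odot>\<^sub>L x"] a by simp
      also have "\<dots> = a \<odot>\<^sub>L (r x \<oplus>\<^sub>L q x)" using rq(3) a by simp
      also have "\<dots> = a \<odot>\<^sub>L r x \<oplus>\<^sub>L a \<odot>\<^sub>L q x" using c a by (simp add: M.smult_r_distr)
      finally show "r (a \<odot>\<^sub>L x) \<oplus>\<^sub>L q (a \<odot>\<^sub>L x) = a \<odot>\<^sub>L r x \<oplus>\<^sub>L a \<odot>\<^sub>L q x" .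
    qed (use rq a subbimoduleD(5)[OF A] subbimoduleD(5)[OF B] in auto)
  qed
  moreover have "Zhom (sub_bimodule L A) L (\<lambda>x. x)" using AL by (auto simp: Zhom_def)
  moreover have "r x = x" if x: "x \<in> A" for x
  proof (rule uniq)
    show "r x \<oplus>\<^sub>L q x = x \<oplus>\<^sub>L \<zero>\<^sub>L" using rq(3)[of x] x AL by auto
  qed (use rq x AL subbimoduleD(2)[OF B] in auto)
  ultimately show ?thesis
    using dual_basis_retract[OF d M.bimodule bA] lat_sub_bimodule[OF A] by fastforce
qed

end

text \<open>Derived from the absorption rule by inserting a zeroth power as last summand, which
  contributes a single element.\<close>

lemma bimodule_power_Suc:
  fixes R :: "('a, 'e) ring_scheme" and S :: "('b, 'f) ring_scheme" and M :: "('a, 'b, 'm) bimodule"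
  shows "bimodule_isomorphic R S (M \<oplus>\<^sub>B M ^\<^sub>B n) (M ^\<^sub>B Suc n)"
proof -
  have z: "bimodule_isomorphic R S (N \<oplus>\<^sub>B M ^\<^sub>B 0) N" for N :: "('a, 'b, 'n) bimodule"
    by (rule bimodule_isomorphicI[where f = fst and g = "\<lambda>x. (x, \<lambda>i. undefined)"]) (auto simp: bimodule_hom_def)
  have z': "bimodule_isomorphic R S N (N \<oplus>\<^sub>B M ^\<^sub>B 0)" for N :: "('a, 'b, 'n) bimodule"
    by (rule bimodule_isomorphicI[where g = fst and f = "\<lambda>x. (x, \<lambda>i. undefined)"])
      (auto simp: bimodule_hom_def restrict_def)
  show ?thesis
    by (rule bimodule_isomorphic_trans[OF bimodule_sum_cong[OF bimodule_isomorphic_refl z']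
          bimodule_isomorphic_trans[OF bimodule_power_absorb(1) z]])
qed

context quat_order
begin

definition splits_off :: "('a, 'a, 'm) bimodule \<Rightarrow> ('a, 'a, 'n) bimodule \<Rightarrow> bool" where
  "splits_off L T \<longleftrightarrow> (\<exists>f h. bimodule_hom R R L T f \<and> bimodule_hom R R T L h \<and> (\<forall>t\<in>carrier T. f (h t) = t))"

lemma generated_False: "generated False = carrier R"
  by (force simp: generated_def generator_def)

end

text \<open>The lattice property of the four models and the finiteness of \<open>W\<close> modulo
  \<open>pi2\<close> are assumptions here, so that the classification does not depend on how they
  are obtained; \<open>quat_bimodules_O\<close> discharges them for the p-adic order.\<close>

locale quat_bimodules = quat_order R Z W \<sigma> \<pi> w u
  for R :: "('a, 'e) ring_scheme" (structure) and Z W \<sigma> \<pi> w u +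
  fixes \<phi>\<^sub>1 \<phi>\<^sub>2 :: "'a \<Rightarrow> 'a mat2"
  assumes phi1: "column_type False \<phi>\<^sub>1" and phi2: "column_type True \<phi>\<^sub>2"
    and lat_ideal: "lat (ideal_bimodule R (generated t))"
    and lat_column: "lat (column_bimodule R \<phi>\<^sub>1)" "lat (column_bimodule R \<phi>\<^sub>2)"
    and residue_finite: "finite ((\<lambda>a. {b \<in> W. \<exists>c\<in>W. a \<ominus> b = pi2 \<otimes> c}) ` W)"
begin

abbreviation "LO \<equiv> ideal_bimodule R (generated False)"
abbreviation "LP \<equiv> ideal_bimodule R (generated True)"
abbreviation "C1 \<equiv> column_bimodule R \<phi>\<^sub>1"
abbreviation "C2 \<equiv> column_bimodule R \<phi>\<^sub>2"

abbreviation power_sum where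
  "power_sum r\<^sub>1 r\<^sub>2 t\<^sub>1 t\<^sub>2 \<equiv> (LO ^\<^sub>B r\<^sub>1) \<oplus>\<^sub>B (LP ^\<^sub>B r\<^sub>2) \<oplus>\<^sub>B (C1 ^\<^sub>B t\<^sub>1) \<oplus>\<^sub>B (C2 ^\<^sub>B t\<^sub>2)"

definition phi :: "bool \<Rightarrow> 'a \<Rightarrow> 'a mat2" where "phi s = (if s then \<phi>\<^sub>2 else \<phi>\<^sub>1)"

lemma phi_type: "column_type s (phi s)" and lat_phi: "lat (column_bimodule R (phi s))"
  using phi1 phi2 lat_column by (auto simp: phi_def)

lemma lat_bimodule: "lat L \<Longrightarrow> bimodule R R L"
  by (simp add: lattice_bimod_def bimod_def)

lemma splits_off_cases:
  assumes "lat L" "carrier L \<noteq> {\<zero>\<^sub>L}"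
  shows "splits_off L LO \<or> splits_off L LP \<or> splits_off L C1 \<or> splits_off L C2"
proof -
  interpret L: lattice_bimod R Z W \<sigma> \<pi> w u L by fact
  show ?thesis
  proof (cases "\<exists>s. \<exists>x\<in>comp L s. \<forall>y\<in>carrier L. x \<star>\<^sub>L \<pi> \<noteq> \<pi> \<odot>\<^sub>L y")
    case True
    then obtain s x where "x \<in> comp L s" "\<forall>y\<in>carrier L. x \<star>\<^sub>L \<pi> \<noteq> \<pi> \<odot>\<^sub>L y" by blast
    then obtain x' \<mu> where "x' \<in> comp L s" "bifunctional L s \<mu>" "\<mu> x' = \<zero>" "\<mu> (\<pi> \<odot>\<^sub>L x' \<star>\<^sub>L \<pi>) = \<one>"
      using L.normalized_bifunctional by blast
    then have "splits_off L (column_bimodule R (phi s))"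
      using L.column_split[OF phi_type] unfolding splits_off_def by metis
    then show ?thesis by (auto simp: phi_def split: if_splits)
  next
    case False
    have "\<exists>z\<in>carrier L. y \<star>\<^sub>L \<pi> = \<pi> \<odot>\<^sub>L z" if y: "y \<in> carrier L" for y
    proof -
      obtain a b where ab: "a \<in> comp L False" "b \<in> comp L True" "y = a \<oplus>\<^sub>L b" using L.comp_decompose y by blast
      then obtain z z' where z: "z \<in> carrier L" "a \<star>\<^sub>L \<pi> = \<pi> \<odot>\<^sub>L z" "z' \<in> carrier L" "b \<star>\<^sub>L \<pi> = \<pi> \<odot>\<^sub>L z'"
        using False by metis
      have "y \<star>\<^sub>L \<pi> = \<pi> \<odot>\<^sub>L (z \<oplus>\<^sub>L z')"
        using ab z L.compD(1)[OF ab(1)] L.compD(1)[OF ab(2)] by (simp add: L.M.rsmult_l_distr L.M.smult_r_distr)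
      then show ?thesis using z by blast
    qed
    then obtain s where "splits_off L (ideal_bimodule R (generated s))"
      using L.ideal_split[OF assms(2)] unfolding splits_off_def by (metis ideal_bimodule_simps(1))
    then show ?thesis by (cases s) auto
  qed
qed

lemma model_nonzero:
  "carrier LO \<noteq> {\<zero>\<^sub>LO}" "carrier LP \<noteq> {\<zero>\<^sub>LP}" "carrier C1 \<noteq> {\<zero>\<^sub>C1}" "carrier C2 \<noteq> {\<zero>\<^sub>C2}"
proof -
  have "generator s \<in> generated s" for s by (force simp: generated_def)
  then show "carrier LO \<noteq> {\<zero>\<^sub>LO}" "carrier LP \<noteq> {\<zero>\<^sub>LP}"
    unfolding ideal_bimodule_simps using generator_nonzero by (metis singletonD)+
  have "(\<one>, \<one>) \<in> carrier R \<times> carrier R" "(\<one>, \<one>) \<noteq> (\<zero>, \<zero>)" using one_not_zero by auto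
  then show "carrier C1 \<noteq> {\<zero>\<^sub>C1}" "carrier C2 \<noteq> {\<zero>\<^sub>C2}" unfolding column_bimodule_simps by blast+
qed

lemma power_sum_absorb:
  "bimodule_isomorphic R R (LO \<oplus>\<^sub>B power_sum r\<^sub>1 r\<^sub>2 t\<^sub>1 t\<^sub>2) (power_sum (Suc r\<^sub>1) r\<^sub>2 t\<^sub>1 t\<^sub>2)"
  "bimodule_isomorphic R R (LP \<oplus>\<^sub>B power_sum r\<^sub>1 r\<^sub>2 t\<^sub>1 t\<^sub>2) (power_sum r\<^sub>1 (Suc r\<^sub>2) t\<^sub>1 t\<^sub>2)"
  "bimodule_isomorphic R R (C1 \<oplus>\<^sub>B power_sum r\<^sub>1 r\<^sub>2 t\<^sub>1 t\<^sub>2) (power_sum r\<^sub>1 r\<^sub>2 (Suc t\<^sub>1) t\<^sub>2)"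
  "bimodule_isomorphic R R (C2 \<oplus>\<^sub>B power_sum r\<^sub>1 r\<^sub>2 t\<^sub>1 t\<^sub>2) (power_sum r\<^sub>1 r\<^sub>2 t\<^sub>1 (Suc t\<^sub>2))"
  by (rule bimodule_power_absorb bimodule_power_Suc)+

lemma decomposition_step:
  fixes L :: "('a, 'a, 'm) bimodule" and I :: "'m set"
  assumes L: "lat L" "dual_basis L I e \<nu>" and T: "lat T" "carrier T \<noteq> {\<zero>\<^sub>T}" "splits_off L T"
  shows "\<exists>(K :: ('a, 'a, 'm) bimodule) (J :: 'm set) e' \<nu>'. lat K \<and> dual_basis K J e' \<nu>' \<and>
    card J < card I \<and> bimodule_isomorphic R R L (T \<oplus>\<^sub>B K)"
proof -
  interpret L: lattice_bimod R Z W \<sigma> \<pi> w u L by (rule L(1))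
  obtain f h where fh: "bimodule_hom R R L T f" "bimodule_hom R R T L h"
    "\<And>t. t \<in> carrier T \<Longrightarrow> f (h t) = t" using T(3) unfolding splits_off_def by blast
  note s = L.split_lattice[OF lat_bimodule[OF T(1)] fh T(2) L(2)]
  show ?thesis using s(3,4) L.lat_sub_bimodule[OF s(1)] by blast
qed

lemma isomorphic_sum_trans:
  assumes "bimodule_isomorphic R R L (T \<oplus>\<^sub>B K)" "bimodule_isomorphic R R K S'" "bimodule_isomorphic R R (T \<oplus>\<^sub>B S') S"
  shows "bimodule_isomorphic R R L S"
  by (rule bimodule_isomorphic_trans[OF assms(1)
      bimodule_isomorphic_trans[OF bimodule_sum_cong[OF bimodule_isomorphic_refl assms(2)] assms(3)]])

text \<open>The complements are carved out of \<open>L\<close> and keep its element type, so the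
  induction runs over one type although the models live on others. The measure is the size of a dual
  basis, which is why the inductive claim carries the basis along.\<close>

theorem decomposition:
  fixes L :: "('a, 'a, 'm) bimodule"
  assumes "lat L"
  shows "\<exists>r\<^sub>1 r\<^sub>2 t\<^sub>1 t\<^sub>2. bimodule_isomorphic R R L (power_sum r\<^sub>1 r\<^sub>2 t\<^sub>1 t\<^sub>2)"
proof -
  have "\<exists>r\<^sub>1 r\<^sub>2 t\<^sub>1 t\<^sub>2. bimodule_isomorphic R R L (power_sum r\<^sub>1 r\<^sub>2 t\<^sub>1 t\<^sub>2)"
    if "lat L" "dual_basis L I e \<nu>" for L :: "('a, 'a, 'm) bimodule" and I :: "'m set" and e \<nu>
    using that
  proof (induction "card I" arbitrary: L I e \<nu> rule: less_induct)
    case less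
    interpret L: lattice_bimod R Z W \<sigma> \<pi> w u L by (rule less.prems(1))
    show ?case
    proof (cases "carrier L = {\<zero>\<^sub>L}")
      case True
      \<comment> \<open>A zeroth power has one element, the function that is
        \<open>undefined\<close> everywhere.\<close>
      let ?z = "(\<lambda>i::nat. undefined, \<lambda>i::nat. undefined, \<lambda>i::nat. undefined, \<lambda>i::nat. undefined)"
      have "bimodule_isomorphic R R L (power_sum 0 0 0 0)"
        by (rule bimodule_isomorphicI[where f = "\<lambda>_. ?z" and g = "\<lambda>_. \<zero>\<^sub>L"])
          (auto simp: bimodule_hom_def True restrict_def)
      then show ?thesis by blast
    next
      case False
      note step = decomposition_step[OF less.prems] and comb = isomorphic_sum_trans
      consider "splits_off L LO" | "splits_off L LP" | "splits_off L C1" | "splits_off L C2"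
        using splits_off_cases[OF less.prems(1) False] by blast
      then show ?thesis
      proof cases
        case 1
        then show ?thesis using step[OF lat_ideal model_nonzero(1)] less.hyps comb[OF _ _ power_sum_absorb(1)] by metis
      next
        case 2
        then show ?thesis using step[OF lat_ideal model_nonzero(2)] less.hyps comb[OF _ _ power_sum_absorb(2)] by metis
      next
        case 3
        then show ?thesis using step[OF lat_column(1) model_nonzero(3)] less.hyps comb[OF _ _ power_sum_absorb(3)] by metis
      next
        case 4
        then show ?thesis using step[OF lat_column(2) model_nonzero(4)] less.hyps comb[OF _ _ power_sum_absorb(4)] by metis
      qed
    qed
  qed
  moreover obtain I :: "'m set" and e \<nu> where "dual_basis L I e \<nu>" using lattice_bimod.dual[OF assms] by blast
  ultimately show ?thesis using assms by blast
qed

end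

section \<open>Invariants of the reduction\<close>

text \<open>Closure of the carrier under both actions lets an injective homomorphism reflect
  equations between scalar multiples, and so carry homogeneous parts to homogeneous parts.\<close>

definition stable :: "('a, 'e) ring_scheme \<Rightarrow> ('b, 'f) ring_scheme \<Rightarrow> ('a, 'b, 'm) bimodule \<Rightarrow> bool" where
  "stable R S Q \<longleftrightarrow> (\<forall>V\<in>carrier Q. (\<forall>a\<in>carrier R. a \<odot>\<^sub>Q V \<in> carrier Q) \<and> (\<forall>b\<in>carrier S. V \<star>\<^sub>Q b \<in> carrier Q))"

context quat_order
begin

text \<open>For the p-adic order this is the ideal generated by p: \<pi>^2 and p differ by a unit of
  the p-adic integers, as \<open>multiples_p\<close> records.\<close>

definition pi2_ideal :: "'a set" where "pi2_ideal = (\<lambda>r. pi2 \<otimes> r) ` carrier R"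

lemma ideal_pi2: "ideal pi2_ideal R"
proof (rule idealI)
  show "ring R" by (rule ring_axioms)
  show "subgroup pi2_ideal (add_monoid R)"
  proof (rule add.subgroupI)
    show "pi2_ideal \<subseteq> carrier R" by (auto simp: pi2_ideal_def)
    show "pi2_ideal \<noteq> {}" by (auto simp: pi2_ideal_def)
    show "\<ominus> a \<in> pi2_ideal" if "a \<in> pi2_ideal" for a
      using that by (auto simp: pi2_ideal_def r_minus[symmetric])
    show "a \<oplus> b \<in> pi2_ideal" if "a \<in> pi2_ideal" "b \<in> pi2_ideal" for a b
      using that by (auto simp: pi2_ideal_def r_distr[symmetric])
  qed
  fix a x assume "a \<in> pi2_ideal" and x: "x \<in> carrier R"
  then obtain r where r: "r \<in> carrier R" "a = pi2 \<otimes> r" by (auto simp: pi2_ideal_def)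
  have "x \<otimes> a = (x \<otimes> pi2) \<otimes> r" using r x m_assoc[of x pi2 r] by simp
  also have "\<dots> = pi2 \<otimes> (x \<otimes> r)" using r x m_assoc[of pi2 x r] by (simp add: pi2_comm)
  finally show "x \<otimes> a \<in> pi2_ideal" using r x by (auto simp: pi2_ideal_def)
  have "a \<otimes> x = pi2 \<otimes> (r \<otimes> x)" using r x m_assoc[of pi2 r x] by simp
  then show "a \<otimes> x \<in> pi2_ideal" using r x by (auto simp: pi2_ideal_def)
qed

text \<open>The setting in which reductions are computed. Agreement of the two
  \<open>Z\<close>-actions makes \<open>pi2_ideal\<close> act as zero from the right on L modulo
  \<pi> L, and the notion passes to sums and powers at once.\<close>

definition cbimod :: "('a, 'a, 'm) bimodule \<Rightarrow> bool" where
  "cbimod L \<longleftrightarrow> bimodule R R L \<and> (\<forall>z\<in>Z. \<forall>x\<in>carrier L. z \<odot>\<^sub>L x = x \<star>\<^sub>L z)"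

lemma lat_cbimod: "lat L \<Longrightarrow> cbimod L"
  by (auto simp: cbimod_def lattice_bimod_def lattice_bimod_axioms_def bimod_def)

lemma cbimod_sum: "cbimod L \<Longrightarrow> cbimod M \<Longrightarrow> cbimod (L \<oplus>\<^sub>B M)"
  by (auto simp: cbimod_def bimodule_sum_bimodule)

lemma cbimod_power: "cbimod L \<Longrightarrow> cbimod (L ^\<^sub>B n)"
  unfolding cbimod_def using bimodule_power_bimodule
  by (auto simp: PiE_iff intro!: restrict_ext)

abbreviation piL :: "('a, 'a, 'm) bimodule \<Rightarrow> 'm set" where "piL L \<equiv> (\<lambda>x. \<pi> \<odot>\<^sub>L x) ` carrier L"

lemma generated_True: "generated True = (\<lambda>r. \<pi> \<otimes> r) ` carrier R"
  using pi_swap by (force simp: generated_def generator_def)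

lemma piL_subbimodule:
  assumes "bimodule R R L"
  shows "subbimodule R R L (piL L)"
proof -
  interpret L: bimod R R L using assms by (simp add: bimod_def)
  show ?thesis
  proof (rule L.subbimoduleI)
    show "piL L \<subseteq> carrier L" by auto
    show "\<zero>\<^sub>L \<in> piL L" by (intro image_eqI[of _ _ "\<zero>\<^sub>L"]) simp_all
    show "x \<oplus>\<^sub>L y \<in> piL L" if "x \<in> piL L" "y \<in> piL L" for x y
      using that by (auto simp: L.smult_r_distr[symmetric])
    show "a \<odot>\<^sub>L x \<in> piL L" if a: "a \<in> carrier R" and x: "x \<in> piL L" for a x
    proof -
      obtain y where y: "x = \<pi> \<odot>\<^sub>L y" "y \<in> carrier L" using x by blast
      obtain a' where a': "a' \<in> carrier R" "a \<otimes> \<pi> = \<pi> \<otimes> a'" using pi_swap(1) a by blast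
      have "a \<odot>\<^sub>L x = \<pi> \<odot>\<^sub>L (a' \<odot>\<^sub>L y)" using y a a' by (simp add: L.smult_assoc[symmetric])
      then show ?thesis using y a' by auto
    qed
    show "x \<star>\<^sub>L b \<in> piL L" if "x \<in> piL L" "b \<in> carrier R" for x b
      using that by (auto simp: L.smult_rsmult)
  qed
qed

text \<open>The products already form a subgroup: (\<pi> r) x = \<pi> (r x), and \<pi> L is closed
  under addition.\<close>

lemma ideal_times_pi:
  assumes "bimodule R R L"
  shows "ideal_times (generated True) L = piL L"
proof -
  interpret L: bimod R R L using assms by (simp add: bimod_def)
  have "{a \<odot>\<^sub>L x | a x. a \<in> generated True \<and> x \<in> carrier L} = piL L" (is "?A = _")
  proof (intro equalityI subsetI)
    fix v assume "v \<in> ?A"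
    then obtain r x where "r \<in> carrier R" "x \<in> carrier L" "v = (\<pi> \<otimes> r) \<odot>\<^sub>L x" by (auto simp: generated_True)
    then show "v \<in> piL L" by (auto simp: L.smult_assoc)
  next
    fix v assume "v \<in> piL L"
    moreover have "\<pi> \<in> generated True" by (auto simp: generated_True intro: image_eqI[of _ _ \<one>])
    ultimately show "v \<in> ?A" by blast
  qed
  moreover have "generate (add_monoid L) (piL L) = piL L"
    using L.add.generate_subgroup_incl[of "piL L" "piL L"] generate.incl[of _ "piL L" "add_monoid L"]
      piL_subbimodule[OF assms] by (auto simp: subbimodule_def left_submodule_def)
  ultimately show ?thesis by (simp add: ideal_times_def)
qed

abbreviation red :: "('a, 'a, 'm) bimodule \<Rightarrow> ('a set, 'a set, 'm set) bimodule" where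
  "red L \<equiv> quotient_bimodule L (piL L)"

lemma bimod_quotient_red:
  assumes "cbimod L"
  shows "bimod_quotient R R L (generated True) pi2_ideal (piL L)"
proof -
  have b: "bimodule R R L" using assms by (simp add: cbimod_def)
  interpret L: bimod R R L using b by (simp add: bimod_def)
  show ?thesis
  proof (intro bimod_quotient.intro bimod_quotient_axioms.intro)
    show "a \<odot>\<^sub>L x \<in> piL L" if "a \<in> generated True" "x \<in> carrier L" for a x
      using that by (auto simp: generated_True L.smult_assoc)
    show "x \<star>\<^sub>L b \<in> piL L" if b: "b \<in> pi2_ideal" and x: "x \<in> carrier L" for b x
    proof -
      obtain r where r: "r \<in> carrier R" "b = pi2 \<otimes> r" using b by (auto simp: pi2_ideal_def)
      note that = b x
      have "x \<star>\<^sub>L b = (x \<star>\<^sub>L pi2) \<star>\<^sub>L r" using r that(2) by (simp only: L.rsmult_assoc m_closed pi_closed)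
      also have "x \<star>\<^sub>L pi2 = pi2 \<odot>\<^sub>L x" using assms that(2) pi2_Z unfolding cbimod_def by metis
      also have "pi2 \<odot>\<^sub>L x \<star>\<^sub>L r = \<pi> \<odot>\<^sub>L (\<pi> \<odot>\<^sub>L (x \<star>\<^sub>L r))" using r that(2) by (simp add: L.smult_assoc L.smult_rsmult)
      finally show ?thesis using r that(2) by auto
    qed
  qed (rule L.bimod_axioms ideal_generated ideal_pi2 piL_subbimodule[OF b])+
qed

abbreviation RP where "RP \<equiv> R Quot generated True"
abbreviation Rpi2 where "Rpi2 \<equiv> R Quot pi2_ideal"

text \<open>A homogeneous part read off from the reduction alone, through the residue classes of
  elements of \<open>W\<close> on either side; hence it is respected by isomorphisms of
  reductions.\<close>

definition red_comp :: "bool \<Rightarrow> ('a set, 'a set, 'm) bimodule \<Rightarrow> 'm set" where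
  "red_comp s Q = {V \<in> carrier Q. \<forall>a\<in>W. (generated True +> a) \<odot>\<^sub>Q V = V \<star>\<^sub>Q (pi2_ideal +> tw s a)}"

text \<open>Cardinalities stand in for dimensions over the residue field: they multiply along direct
  sums and are compared through the exponents of \<open>residue_card\<close>.\<close>

definition comp_card :: "bool \<Rightarrow> ('a set, 'a set, 'm) bimodule \<Rightarrow> nat" where
  "comp_card s Q = card (red_comp s Q)"

definition shift_card :: "bool \<Rightarrow> ('a set, 'a set, 'm) bimodule \<Rightarrow> nat" where
  "shift_card s Q = card ((\<lambda>V. V \<star>\<^sub>Q (pi2_ideal +> \<pi>)) ` red_comp s Q)"

lemma class_closed: "a \<in> carrier R \<Longrightarrow> generated True +> a \<in> carrier RP" "a \<in> carrier R \<Longrightarrow> pi2_ideal +> a \<in> carrier Rpi2"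
  by (simp_all add: carrier_FactRing)

lemma invariants_isomorphic:
  assumes iso: "bimodule_isomorphic RP Rpi2 Q Q'" and st: "stable RP Rpi2 Q"
  shows "comp_card s Q = comp_card s Q'" "shift_card s Q = shift_card s Q'"
proof -
  obtain f where f: "bimodule_hom RP Rpi2 Q Q' f" "bij_betw f (carrier Q) (carrier Q')"
    using iso by (auto simp: bimodule_isomorphic_iff)
  have inj: "inj_on f (carrier Q)" and surj: "f ` carrier Q = carrier Q'" using f(2) by (auto simp: bij_betw_def)
  have fl: "f ((generated True +> a) \<odot>\<^sub>Q V) = (generated True +> a) \<odot>\<^sub>Q' f V"
      and fr: "f (V \<star>\<^sub>Q (pi2_ideal +> a)) = f V \<star>\<^sub>Q' (pi2_ideal +> a)"
      and cl: "(generated True +> a) \<odot>\<^sub>Q V \<in> carrier Q" and cr: "V \<star>\<^sub>Q (pi2_ideal +> a) \<in> carrier Q"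
    if "V \<in> carrier Q" "a \<in> carrier R" for V a
    using f(1) st class_closed[OF that(2)] that(1) by (simp_all add: bimodule_hom_def stable_def)
  have eq: "f ` red_comp s Q = red_comp s Q'"
  proof (intro equalityI subsetI)
    fix Y assume "Y \<in> f ` red_comp s Q"
    then obtain V where V: "V \<in> red_comp s Q" "Y = f V" by blast
    then have Xc: "V \<in> carrier Q" by (simp add: red_comp_def)
    have "(generated True +> a) \<odot>\<^sub>Q' Y = Y \<star>\<^sub>Q' (pi2_ideal +> tw s a)" if "a \<in> W" for a
      using fl[OF Xc, of a] fr[OF Xc, of "tw s a"] V that by (simp add: red_comp_def)
    then show "Y \<in> red_comp s Q'" using Xc surj V(2) by (auto simp: red_comp_def)
  next
    fix Y assume Y: "Y \<in> red_comp s Q'"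
    then obtain V where V: "V \<in> carrier Q" "Y = f V" using surj by (auto simp: red_comp_def)
    have "(generated True +> a) \<odot>\<^sub>Q V = V \<star>\<^sub>Q (pi2_ideal +> tw s a)" if a: "a \<in> W" for a
    proof -
      have "f ((generated True +> a) \<odot>\<^sub>Q V) = f (V \<star>\<^sub>Q (pi2_ideal +> tw s a))"
        using fl[OF V(1), of a] fr[OF V(1), of "tw s a"] V(2) Y a by (simp add: red_comp_def)
      then show ?thesis using inj_onD[OF inj] cl[OF V(1), of a] cr[OF V(1), of "tw s a"] a by simp
    qed
    then show "Y \<in> f ` red_comp s Q" using V by (auto simp: red_comp_def)
  qed
  have sub: "red_comp s Q \<subseteq> carrier Q" by (auto simp: red_comp_def)
  show "comp_card s Q = comp_card s Q'" unfolding comp_card_def eq[symmetric]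
    by (rule card_image[symmetric, OF inj_on_subset[OF inj sub]])
  have "(\<lambda>V. V \<star>\<^sub>Q' (pi2_ideal +> \<pi>)) ` red_comp s Q' = f ` (\<lambda>V. V \<star>\<^sub>Q (pi2_ideal +> \<pi>)) ` red_comp s Q"
    unfolding eq[symmetric] image_image using sub by (intro image_cong) (auto simp: fr)
  moreover have "(\<lambda>V. V \<star>\<^sub>Q (pi2_ideal +> \<pi>)) ` red_comp s Q \<subseteq> carrier Q" using sub cr by auto
  ultimately show "shift_card s Q = shift_card s Q'" unfolding shift_card_def
    by (simp add: card_image[OF inj_on_subset[OF inj]])
qed

lemma stable_red: assumes "cbimod L" shows "stable RP Rpi2 (red L)"
proof -
  interpret Q: bimod_quotient R R L "generated True" pi2_ideal "piL L" by (rule bimod_quotient_red[OF assms])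
  show ?thesis by (auto simp: stable_def Q.carrier_Q carrier_FactRing Q.smult_cls Q.cls_rsmult)
qed

lemma invariants_sum:
  "comp_card s (Q \<oplus>\<^sub>B Q') = comp_card s Q * comp_card s Q'"
  "shift_card s (Q \<oplus>\<^sub>B Q') = shift_card s Q * shift_card s Q'"
proof -
  have eq: "red_comp s (Q \<oplus>\<^sub>B Q') = red_comp s Q \<times> red_comp s Q'" by (auto simp: red_comp_def)
  show "comp_card s (Q \<oplus>\<^sub>B Q') = comp_card s Q * comp_card s Q'"
    by (simp add: comp_card_def eq card_cartesian_product)
  have "(\<lambda>V. V \<star>\<^bsub>Q \<oplus>\<^sub>B Q'\<^esub> (pi2_ideal +> \<pi>)) ` red_comp s (Q \<oplus>\<^sub>B Q') =
     (\<lambda>V. V \<star>\<^sub>Q (pi2_ideal +> \<pi>)) ` red_comp s Q \<times> (\<lambda>V. V \<star>\<^sub>Q' (pi2_ideal +> \<pi>)) ` red_comp s Q'"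
    unfolding eq by (force simp: image_iff)
  then show "shift_card s (Q \<oplus>\<^sub>B Q') = shift_card s Q * shift_card s Q'"
    by (simp add: shift_card_def card_cartesian_product)
qed

lemma invariants_red_sum:
  assumes "cbimod L" "cbimod M"
  shows "comp_card s (red (L \<oplus>\<^sub>B M)) = comp_card s (red L) * comp_card s (red M)"
    "shift_card s (red (L \<oplus>\<^sub>B M)) = shift_card s (red L) * shift_card s (red M)"
proof -
  have "piL (L \<oplus>\<^sub>B M) = piL L \<times> piL M" by (force simp: image_iff)
  then have iso: "bimodule_isomorphic RP Rpi2 (red L \<oplus>\<^sub>B red M) (red (L \<oplus>\<^sub>B M))"
    using quotient_bimodule_sum[OF bimod_quotient_red[OF assms(1)] bimod_quotient_red[OF assms(2)]] by simp
  have st: "stable RP Rpi2 (red L \<oplus>\<^sub>B red M)"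
    using stable_red[OF assms(1)] stable_red[OF assms(2)] by (auto simp: stable_def)
  show "comp_card s (red (L \<oplus>\<^sub>B M)) = comp_card s (red L) * comp_card s (red M)"
    "shift_card s (red (L \<oplus>\<^sub>B M)) = shift_card s (red L) * shift_card s (red M)"
    using invariants_isomorphic[OF iso st, of s] by (simp_all add: invariants_sum)
qed

lemma red_isomorphic:
  assumes "cbimod L" "cbimod L'" "bimodule_isomorphic R R L L'"
  shows "bimodule_isomorphic RP Rpi2 (red L) (red L')"
proof -
  interpret P: ideal "generated True" R by (rule ideal_generated)
  interpret J: ideal pi2_ideal R by (rule ideal_pi2)
  have b: "bimodule R R L" "bimodule R R L'" using assms by (simp_all add: cbimod_def)
  have "A \<subseteq> carrier R" if "A \<in> carrier RP" for A
    using that a_r_coset_subset_G[OF P.a_subset] by (auto simp: carrier_FactRing)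
  moreover have "A \<subseteq> carrier R" if "A \<in> carrier Rpi2" for A
    using that a_r_coset_subset_G[OF J.a_subset] by (auto simp: carrier_FactRing)
  ultimately show ?thesis
    using quotient_bimodule_isomorphic[OF b assms(3) P.a_subset, of RP Rpi2] by (simp add: ideal_times_pi[OF b(1)] ideal_times_pi[OF b(2)])
qed

lemma invariants_red_isomorphic:
  assumes "cbimod L" "cbimod L'" "bimodule_isomorphic R R L L'"
  shows "comp_card s (red L) = comp_card s (red L')" "shift_card s (red L) = shift_card s (red L')"
  using invariants_isomorphic[OF red_isomorphic[OF assms] stable_red[OF assms(1)]] by blast+

lemma invariants_zero:
  assumes "cbimod L" "carrier L = {\<zero>\<^sub>L}"
  shows "comp_card s (red L) = 1" "shift_card s (red L) = 1"
proof -
  interpret Q: bimod_quotient R R L "generated True" pi2_ideal "piL L" by (rule bimod_quotient_red[OF assms(1)])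
  have "Q.cls ` A = {Q.cls \<zero>\<^sub>L}" if "A = {\<zero>\<^sub>L}" for A unfolding that by (simp only: image_insert image_empty)
  then have c: "carrier (red L) = {Q.cls \<zero>\<^sub>L}" using Q.carrier_Q assms(2) by metis
  have "\<forall>a\<in>W. (generated True +> a) \<odot>\<^bsub>red L\<^esub> Q.cls \<zero>\<^sub>L = Q.cls \<zero>\<^sub>L \<star>\<^bsub>red L\<^esub> (pi2_ideal +> tw s a)"
  proof
    fix a assume a: "a \<in> W"
    show "(generated True +> a) \<odot>\<^bsub>red L\<^esub> Q.cls \<zero>\<^sub>L = Q.cls \<zero>\<^sub>L \<star>\<^bsub>red L\<^esub> (pi2_ideal +> tw s a)"
      unfolding Q.smult_cls[OF W_carrier[OF a] Q.zero_closed]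
        Q.cls_rsmult[OF W_carrier[OF tw_closed[OF a]] Q.zero_closed]
      using a by (simp only: Q.smult_zero Q.zero_rsmult W_carrier tw_closed)
  qed
  then have "red_comp s (red L) = {Q.cls \<zero>\<^sub>L}" unfolding red_comp_def c by blast
  then show "comp_card s (red L) = 1" "shift_card s (red L) = 1" by (simp_all add: comp_card_def shift_card_def)
qed

lemma invariants_power:
  assumes L: "cbimod L"
  shows "comp_card s (red (L ^\<^sub>B n)) = comp_card s (red L) ^ n" "shift_card s (red (L ^\<^sub>B n)) = shift_card s (red L) ^ n"
proof (induction n)
  case 0
  have z: "carrier (L ^\<^sub>B 0) = {\<zero>\<^bsub>L ^\<^sub>B 0\<^esub>}" by (auto simp: restrict_def)
  {
    case 1 show ?case using invariants_zero(1)[OF cbimod_power[OF L] z] by simp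
  next
    case 2 show ?case using invariants_zero(2)[OF cbimod_power[OF L] z] by simp
  }
next
  case (Suc n)
  note c = cbimod_power[OF L]
  note i = invariants_red_isomorphic[OF cbimod_sum[OF L c] c bimodule_power_Suc]
  {
    case 1 show ?case by (simp only: i(1)[symmetric] invariants_red_sum[OF L c] Suc.IH power_Suc)
  next
    case 2 show ?case by (simp only: i(2)[symmetric] invariants_red_sum[OF L c] Suc.IH power_Suc)
  }
qed

end

section \<open>Homogeneous classes in the reduction of a lattice\<close>

context lattice_bimod
begin

lemma piL_smult: "\<lbrakk>a \<in> carrier R; x \<in> piL L\<rbrakk> \<Longrightarrow> a \<odot>\<^sub>L x \<in> piL L"
  using subbimoduleD(5)[OF piL_subbimodule[OF M.bimodule]] by blast

lemma cbimod: "cbimod L"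
  using central by (simp add: cbimod_def M.bimodule)

text \<open>Homogeneous classes lift to homogeneous vectors. If a representative is y + z with z of
  the wrong type, the defect of the class is (w - \<sigma>(w)) z; when it lies in \<pi> L, so does
  z, and y represents the class.\<close>

lemma red_comp_red: "red_comp s (red L) = (\<lambda>x. piL L +>\<^sub>L x) ` comp L s"
proof -
  interpret Q: bimod_quotient R R L "generated True" pi2_ideal "piL L" by (rule bimod_quotient_red[OF cbimod])
  note N = subbimoduleD[OF piL_subbimodule[OF M.bimodule]]
  show ?thesis
  proof (intro equalityI subsetI)
    fix V assume "V \<in> (\<lambda>x. piL L +>\<^sub>L x) ` comp L s"
    then obtain x where x: "x \<in> comp L s" "V = Q.cls x" by blast
    note xc = compD(1)[OF x(1)]
    have "(generated True +> a) \<odot>\<^bsub>red L\<^esub> V = V \<star>\<^bsub>red L\<^esub> (pi2_ideal +> tw s a)" if a: "a \<in> W" for a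
      unfolding x(2) using Q.smult_cls[of a x] Q.cls_rsmult[of "tw s a" x] a xc compD(2)[OF x(1) a] by (simp only: W_carrier tw_closed)
    then show "V \<in> red_comp s (red L)" using Q.cls_closed[OF xc] x(2) by (simp only: red_comp_def mem_Collect_eq) blast
  next
    fix V assume V: "V \<in> red_comp s (red L)"
    then obtain x where x: "x \<in> carrier L" "V = Q.cls x" using Q.carrier_Q by (auto simp only: red_comp_def mem_Collect_eq)
    have "(generated True +> w) \<odot>\<^bsub>red L\<^esub> V = V \<star>\<^bsub>red L\<^esub> (pi2_ideal +> tw s w)"
      using V w_closed by (simp only: red_comp_def mem_Collect_eq)
    then have "Q.cls (w \<odot>\<^sub>L x) = Q.cls (x \<star>\<^sub>L tw s w)"
      unfolding x(2) using Q.smult_cls[of w x] Q.cls_rsmult[of "tw s w" x] x(1) by (simp only: W_carrier tw_closed w_closed)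
    then have d: "w \<odot>\<^sub>L x \<ominus>\<^sub>L x \<star>\<^sub>L tw s w \<in> piL L" using Q.cls_eq_iff[of "w \<odot>\<^sub>L x" "x \<star>\<^sub>L tw s w"] x(1)
      by (simp only: W_carrier tw_closed w_closed M.smult_closed M.rsmult_closed)
    obtain x0 x1 where x01: "x0 \<in> comp L False" "x1 \<in> comp L True" "x = x0 \<oplus>\<^sub>L x1" using comp_decompose x(1) by blast
    obtain y z where yz: "y \<in> comp L s" "z \<in> comp L (\<not> s)" "x = y \<oplus>\<^sub>L z"
    proof (cases s)
      case True
      then show thesis using that[of x1 x0] x01 compD(1) by (simp add: M.a_comm)
    next
      case False
      then show thesis using that[of x0 x1] x01 by simp
    qed
    have c: "y \<in> carrier L" "z \<in> carrier L" using yz compD by blast+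
    have zz: "z \<star>\<^sub>L tw s w = \<sigma> w \<odot>\<^sub>L z" using compD(2)[OF yz(2), of "\<sigma> w"] by (simp add: tw_sigma)
    have "w \<odot>\<^sub>L x \<ominus>\<^sub>L x \<star>\<^sub>L tw s w = (w \<odot>\<^sub>L y \<oplus>\<^sub>L w \<odot>\<^sub>L z) \<ominus>\<^sub>L (w \<odot>\<^sub>L y \<oplus>\<^sub>L \<sigma> w \<odot>\<^sub>L z)"
      using yz(3) c compD(2)[OF yz(1), of w] zz by (simp add: M.smult_r_distr M.rsmult_l_distr)
    also have "\<dots> = w \<odot>\<^sub>L y \<oplus>\<^sub>L (\<ominus>\<^sub>L (w \<odot>\<^sub>L y) \<oplus>\<^sub>L (w \<odot>\<^sub>L z \<oplus>\<^sub>L \<ominus>\<^sub>L (\<sigma> w \<odot>\<^sub>L z)))"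
      using c M.a_lcomm[of "w \<odot>\<^sub>L z" "\<ominus>\<^sub>L (w \<odot>\<^sub>L y)" "\<ominus>\<^sub>L (\<sigma> w \<odot>\<^sub>L z)"] by (simp add: a_minus_def M.minus_add M.a_assoc)
    also have "\<dots> = w \<odot>\<^sub>L z \<oplus>\<^sub>L \<ominus>\<^sub>L (\<sigma> w \<odot>\<^sub>L z)" using c by (simp add: M.r_neg2)
    also have "\<dots> = (w \<ominus> \<sigma> w) \<odot>\<^sub>L z" using c by (simp add: minus_eq M.smult_l_distr M.uminus_smult)
    finally have "(w \<ominus> \<sigma> w) \<odot>\<^sub>L z \<in> piL L" using d by simp
    then have "u \<odot>\<^sub>L ((w \<ominus> \<sigma> w) \<odot>\<^sub>L z) \<in> piL L" by (rule piL_smult[OF W_carrier[OF u_closed]])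
    moreover have "u \<odot>\<^sub>L ((w \<ominus> \<sigma> w) \<odot>\<^sub>L z) = z" using c u_inverse by (simp add: M.smult_assoc[symmetric])
    ultimately have "z \<in> piL L" by simp
    moreover have "x \<ominus>\<^sub>L y = z" using yz(3) c by (simp add: a_minus_def M.a_comm[of y z] M.a_assoc M.r_neg)
    ultimately have "V = Q.cls y" unfolding x(2) using Q.cls_eq_iff[of x y] x(1) c by simp
    then show "V \<in> (\<lambda>x. piL L +>\<^sub>L x) ` comp L s" using yz(1) by blast
  qed
qed

lemma shift_red: "(\<lambda>V. V \<star>\<^bsub>red L\<^esub> (pi2_ideal +> \<pi>)) ` red_comp s (red L) = (\<lambda>x. piL L +>\<^sub>L (x \<star>\<^sub>L \<pi>)) ` comp L s"
proof -
  interpret Q: bimod_quotient R R L "generated True" pi2_ideal "piL L" by (rule bimod_quotient_red[OF cbimod])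
  show ?thesis unfolding red_comp_red image_image
    by (intro image_cong refl Q.cls_rsmult) (use compD(1) in simp_all)
qed

lemma class_eq_iff: "\<lbrakk>x \<in> carrier L; y \<in> carrier L\<rbrakk> \<Longrightarrow> piL L +>\<^sub>L x = piL L +>\<^sub>L y \<longleftrightarrow> x \<ominus>\<^sub>L y \<in> piL L"
proof -
  interpret Q: bimod_quotient R R L "generated True" pi2_ideal "piL L" by (rule bimod_quotient_red[OF cbimod])
  show "\<lbrakk>x \<in> carrier L; y \<in> carrier L\<rbrakk> \<Longrightarrow> ?thesis" by (rule Q.cls_eq_iff)
qed

end

section \<open>Cardinalities for the four models\<close>

context quat_order
begin

definition residue_card :: nat where "residue_card = card ((\<lambda>a. {b \<in> W. \<exists>c\<in>W. a \<ominus> b = pi2 \<otimes> c}) ` W)"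

text \<open>The nontrivial cardinalities of the models all come from here. Each requires deciding
  when two elements of \<open>W\<close> give the same class, and the answer is always congruence
  modulo \<open>pi2\<close>.\<close>

lemma card_residue_image:
  assumes h: "\<And>a b. \<lbrakk>a \<in> W; b \<in> W\<rbrakk> \<Longrightarrow> h a = h b \<longleftrightarrow> (\<exists>c\<in>W. a \<ominus> b = pi2 \<otimes> c)"
  shows "card (h ` W) = residue_card"
proof -
  let ?g = "\<lambda>a. {b \<in> W. \<exists>c\<in>W. a \<ominus> b = pi2 \<otimes> c}"
  have g: "?g a = {b \<in> W. h a = h b}" if "a \<in> W" for a using h that by auto
  have "bij_betw (\<lambda>x. {b \<in> W. x = h b}) (h ` W) (?g ` W)"
    unfolding bij_betw_def
  proof
    show "inj_on (\<lambda>x. {b \<in> W. x = h b}) (h ` W)" by (auto simp: inj_on_def)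
    show "(\<lambda>x. {b \<in> W. x = h b}) ` h ` W = ?g ` W" unfolding image_image using g by (intro image_cong) auto
  qed
  then show ?thesis unfolding residue_card_def by (rule bij_betw_same_card)
qed

text \<open>Coefficients in W + W \<pi> are compared separately. Commuting with \<open>w\<close> up
  to the twist \<open>s\<close> annihilates the coefficient on which the wrong conjugate of
  \<open>w\<close> acts, since w - \<sigma>(w) is nonzero and there are no zero divisors.\<close>

lemma commutant:
  assumes r: "r \<in> carrier R"
  shows "w \<otimes> r = r \<otimes> tw s w \<Longrightarrow> (if s then \<exists>b\<in>W. r = b \<otimes> \<pi> else r \<in> W)"
proof -
  assume e: "w \<otimes> r = r \<otimes> tw s w"
  obtain a b where ab: "a \<in> W" "b \<in> W" "r = a \<oplus> b \<otimes> \<pi>" using decompose r by blast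
  have nz: "w \<ominus> \<sigma> w \<noteq> \<zero>" using u_inverse one_not_zero by (metis W_carrier r_null u_closed)
  have "w \<otimes> a \<oplus> (w \<otimes> b) \<otimes> \<pi> = w \<otimes> r" using ab by (simp add: r_distr m_assoc)
  also have "\<dots> = a \<otimes> tw s w \<oplus> (b \<otimes> \<sigma> (tw s w)) \<otimes> \<pi>"
    unfolding e using ab by (simp add: l_distr m_assoc pi_comm)
  finally have "w \<otimes> a = a \<otimes> tw s w" "w \<otimes> b = b \<otimes> \<sigma> (tw s w)"
    using decompose_unique[of "w \<otimes> a" "w \<otimes> b" "a \<otimes> tw s w" "b \<otimes> \<sigma> (tw s w)"] ab by simp_all
  then have k: "tw s w \<otimes> a = w \<otimes> a" "\<sigma> (tw s w) \<otimes> b = w \<otimes> b"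
    using ab W_comm[of a "tw s w"] W_comm[of b "\<sigma> (tw s w)"] by simp_all
  have z: "c = \<zero>" if "c \<in> W" "\<sigma> w \<otimes> c = w \<otimes> c" for c
  proof -
    have "(w \<ominus> \<sigma> w) \<otimes> c = \<zero>" using that by (simp add: minus_eq l_distr l_minus r_neg)
    then show ?thesis using integral[of "w \<ominus> \<sigma> w" c] nz that by simp
  qed
  show ?thesis
  proof (cases s)
    case True
    then have "a = \<zero>" using z[of a] k(1) ab by simp
    then show ?thesis using True ab by auto
  next
    case False
    then have "b = \<zero>" using z[of b] k(2) ab by simp
    then show ?thesis using False ab by simp
  qed
qed

text \<open>The three congruences that occur for the models: modulo the maximal ideal, modulo
  \<open>pi2_ideal\<close>, and for multiples of \<pi> modulo \<open>pi2_ideal\<close>. Uniqueness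
  of coordinates reduces each to \<open>W\<close>.\<close>

lemma W_in_pi_ideal: "a \<in> W \<Longrightarrow> (\<exists>r\<in>carrier R. a = \<pi> \<otimes> r) \<longleftrightarrow> (\<exists>c\<in>W. a = pi2 \<otimes> c)"
  "a \<in> W \<Longrightarrow> (\<exists>r\<in>carrier R. a = pi2 \<otimes> r) \<longleftrightarrow> (\<exists>c\<in>W. a = pi2 \<otimes> c)"
  "a \<in> W \<Longrightarrow> (\<exists>r\<in>carrier R. a \<otimes> \<pi> = pi2 \<otimes> r) \<longleftrightarrow> (\<exists>c\<in>W. a = pi2 \<otimes> c)"
proof -
  assume a: "a \<in> W"
  have 1: "\<exists>c\<in>W. a = pi2 \<otimes> c" if r: "r \<in> carrier R" "a = \<pi> \<otimes> r" for r
  proof -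
    obtain r' where "r' \<in> carrier R" "\<pi> \<otimes> r = r' \<otimes> \<pi>" using pi_swap(2) r(1) by blast
    then show ?thesis using W_pi_multiple[OF a, of r'] r by simp
  qed
  have 2: "pi2 \<otimes> c = \<pi> \<otimes> (\<pi> \<otimes> c)" if "c \<in> carrier R" for c using that by (simp add: m_assoc)
  show "(\<exists>r\<in>carrier R. a = \<pi> \<otimes> r) \<longleftrightarrow> (\<exists>c\<in>W. a = pi2 \<otimes> c)"
    using 1 2 by (metis W_carrier m_closed pi_closed)
  show "(\<exists>r\<in>carrier R. a = pi2 \<otimes> r) \<longleftrightarrow> (\<exists>c\<in>W. a = pi2 \<otimes> c)"
    using 1 2 by (metis W_carrier m_closed pi_closed)
  have 3: "\<exists>c\<in>W. a = pi2 \<otimes> c" if r: "r \<in> carrier R" "a \<otimes> \<pi> = pi2 \<otimes> r" for r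
  proof -
    have "a \<otimes> \<pi> = (r \<otimes> \<pi>) \<otimes> \<pi>" using r pi2_comm[of r] m_assoc[of r \<pi> \<pi>] by simp
    then have "a = r \<otimes> \<pi>" using cancel_right[of a "r \<otimes> \<pi>" \<pi>] pi_nonzero a r by simp
    then show ?thesis using W_pi_multiple[OF a r(1)] by simp
  qed
  moreover have "\<exists>r\<in>carrier R. a \<otimes> \<pi> = pi2 \<otimes> r" if c: "c \<in> W" "a = pi2 \<otimes> c" for c
    using c m_assoc[of pi2 c \<pi>] by (intro bexI[of _ "c \<otimes> \<pi>"]) simp_all
  ultimately show "(\<exists>r\<in>carrier R. a \<otimes> \<pi> = pi2 \<otimes> r) \<longleftrightarrow> (\<exists>c\<in>W. a = pi2 \<otimes> c)" by blast
qed

end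

context quat_bimodules
begin

text \<open>The part of type \<open>t\<close> is \<open>W\<close> times the generator and gives one
  copy of the residue ring; the other is W \<pi> times the generator and falls into \<pi> T. Since R
  \<pi> = \<pi> R and the generator commutes with \<pi>, right multiplication by \<pi> is zero on
  the reduction.\<close>

lemma ideal_invariants:
  defines "T t \<equiv> ideal_bimodule R (generated t)"
  shows "comp_card t (red (T t)) = residue_card" "comp_card (\<not> t) (red (T t)) = 1" "shift_card s (red (T t)) = 1"
proof -
  let ?g = "generator t" and ?T = "T t"
  interpret T: lattice_bimod R Z W \<sigma> \<pi> w u ?T unfolding T_def by (rule lat_ideal)
  have Tc: "carrier ?T = generated t" by (simp add: T_def)
  have Ts: "a \<odot>\<^sub>?T x = a \<otimes> x" "x \<star>\<^sub>?T a = x \<otimes> a" for a x by (simp_all add: T_def)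
  have sub: "generated t \<subseteq> carrier R" by (auto simp: generated_def)
  have Tm: "x \<ominus>\<^sub>?T y = x \<ominus> y" if "x \<in> generated t" "y \<in> generated t" for x y
  proof -
    have "\<ominus>\<^sub>?T y = (\<ominus> \<one>) \<odot>\<^sub>?T y" using T.M.uminus_smult[of \<one> y] that by (simp add: Tc)
    then show ?thesis using that sub by (auto simp: a_minus_def Ts l_minus T_def)
  qed
  have N: "x \<in> piL ?T \<longleftrightarrow> (\<exists>r\<in>carrier R. x = \<pi> \<otimes> (r \<otimes> ?g))" for x
    unfolding Tc Ts generated_def image_image by blast
  have comp1: "comp ?T t = (\<lambda>a. a \<otimes> ?g) ` W"
  proof (intro equalityI subsetI)
    fix x assume x: "x \<in> comp ?T t"
    then obtain r where r: "r \<in> carrier R" "x = r \<otimes> ?g" using T.compD(1)[OF x] unfolding Tc generated_def by blast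
    have "w \<otimes> x = x \<otimes> tw t w" using T.compD(2)[OF x w_closed] by (simp only: Ts)
    moreover have "?g \<otimes> tw t w = w \<otimes> ?g" using generator_comm[of "tw t w" t] by simp
    ultimately have "(w \<otimes> r) \<otimes> ?g = (r \<otimes> w) \<otimes> ?g" using r by (simp add: m_assoc)
    then have "w \<otimes> r = r \<otimes> tw False w" using cancel_right[of "w \<otimes> r" "r \<otimes> w" ?g] generator_nonzero r by simp
    then show "x \<in> (\<lambda>a. a \<otimes> ?g) ` W" using commutant[OF r(1), of False] r(2) by simp
  next
    fix x assume "x \<in> (\<lambda>a. a \<otimes> ?g) ` W"
    then obtain a where a: "a \<in> W" "x = a \<otimes> ?g" by blast
    have "b \<otimes> x = x \<otimes> tw t b" if "b \<in> W" for b
      using a that generator_comm[of "tw t b" t] W_lcomm[of a b ?g] by (simp add: m_assoc)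
    moreover have "x \<in> generated t" using a by (auto simp: generated_def)
    ultimately show "x \<in> comp ?T t" by (simp add: comp_def Tc Ts)
  qed
  have comp2: "x \<in> piL ?T" if x: "x \<in> comp ?T (\<not> t)" for x
  proof -
    obtain r where r: "r \<in> carrier R" "x = r \<otimes> ?g" using T.compD(1)[OF x] unfolding Tc generated_def by blast
    have "w \<otimes> x = x \<otimes> tw (\<not> t) w" using T.compD(2)[OF x w_closed] by (simp only: Ts)
    moreover have "?g \<otimes> tw (\<not> t) w = \<sigma> w \<otimes> ?g" using generator_comm[of "tw (\<not> t) w" t] by (simp add: tw_tw)
    ultimately have "(w \<otimes> r) \<otimes> ?g = (r \<otimes> \<sigma> w) \<otimes> ?g" using r by (simp add: m_assoc)
    then have "w \<otimes> r = r \<otimes> tw True w" using cancel_right[of "w \<otimes> r" "r \<otimes> \<sigma> w" ?g] generator_nonzero r by simp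
    then obtain b where "b \<in> W" "r = b \<otimes> \<pi>" using commutant[OF r(1), of True] by auto
    then show ?thesis using r by (auto simp: N pi_comm' m_assoc)
  qed
  have zc: "\<zero>\<^sub>?T \<in> comp ?T s" for s by (auto simp: comp_def)
  show "comp_card t (red ?T) = residue_card"
    unfolding comp_card_def T.red_comp_red comp1 image_image
  proof (rule card_residue_image)
    fix a b assume ab: "a \<in> W" "b \<in> W"
    have "piL ?T +>\<^sub>?T a \<otimes> ?g = piL ?T +>\<^sub>?T b \<otimes> ?g \<longleftrightarrow> (a \<ominus> b) \<otimes> ?g \<in> piL ?T"
      using ab T.class_eq_iff[of "a \<otimes> ?g" "b \<otimes> ?g"] Tm[of "a \<otimes> ?g" "b \<otimes> ?g"]
      by (simp add: Tc generated_def minus_eq l_distr l_minus)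
    also have "\<dots> \<longleftrightarrow> (\<exists>r\<in>carrier R. a \<ominus> b = \<pi> \<otimes> r)"
    proof -
      have "(a \<ominus> b) \<otimes> ?g = \<pi> \<otimes> (r \<otimes> ?g) \<longleftrightarrow> a \<ominus> b = \<pi> \<otimes> r" if "r \<in> carrier R" for r
        using cancel_right[OF _ _ generator_closed generator_nonzero, of "a \<ominus> b" "\<pi> \<otimes> r" t] that ab m_assoc[of \<pi> r ?g] by auto
      then show ?thesis unfolding N by blast
    qed
    finally show "piL ?T +>\<^sub>?T a \<otimes> ?g = piL ?T +>\<^sub>?T b \<otimes> ?g \<longleftrightarrow> (\<exists>c\<in>W. a \<ominus> b = pi2 \<otimes> c)"
      using W_in_pi_ideal(1)[of "a \<ominus> b"] ab by simp
  qed
  have one: "card ((\<lambda>x. piL ?T +>\<^sub>?T f x) ` A) = 1"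
    if "\<And>x. x \<in> A \<Longrightarrow> f x \<in> piL ?T" "A \<noteq> {}" for A and f :: "'a \<Rightarrow> 'a"
  proof -
    have NT: "piL ?T \<subseteq> carrier ?T" using subbimoduleD(1)[OF piL_subbimodule[OF T.M.bimodule]] .
    have "piL ?T +>\<^sub>?T f x = piL ?T +>\<^sub>?T \<zero>\<^sub>?T" if "x \<in> A" for x
      using T.class_eq_iff[of "f x" "\<zero>\<^sub>?T"] \<open>\<And>x. x \<in> A \<Longrightarrow> f x \<in> piL ?T\<close>[OF that] NT
      by (metis T.M.minus_eq T.M.r_zero T.M.zero_closed T.M.minus_equality subsetD)
    then have "(\<lambda>x. piL ?T +>\<^sub>?T f x) ` A = {piL ?T +>\<^sub>?T \<zero>\<^sub>?T}" using that(2) by auto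
    then show ?thesis by simp
  qed
  show "comp_card (\<not> t) (red ?T) = 1"
    unfolding comp_card_def T.red_comp_red using one[of "comp ?T (\<not> t)" "\<lambda>x. x"] comp2 zc by blast
  show "shift_card s (red ?T) = 1"
    unfolding shift_card_def T.shift_red
  proof (rule one)
    show "comp ?T s \<noteq> {}" using zc by blast
    fix x assume x: "x \<in> comp ?T s"
    obtain r where r: "r \<in> carrier R" "x = r \<otimes> ?g" using T.compD(1)[OF x] unfolding Tc generated_def by blast
    obtain r' where r': "r' \<in> carrier R" "r \<otimes> \<pi> = \<pi> \<otimes> r'" using pi_swap(1) r(1) by blast
    have "x \<star>\<^sub>?T \<pi> = (r \<otimes> \<pi>) \<otimes> ?g" using r by (simp add: Ts m_assoc generator_pi)
    also have "\<dots> = \<pi> \<otimes> (r' \<otimes> ?g)" using r' by (simp add: m_assoc)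
    finally show "x \<star>\<^sub>?T \<pi> \<in> piL ?T" using r' N by blast
  qed
qed

end

lemma (in bimod) internal_direct_sum_commute:
  assumes "subbimodule R S M A" "subbimodule R S M B" "internal_direct_sum M A B"
  shows "internal_direct_sum M B A"
proof -
  have c: "x \<in> carrier M" if "x \<in> A \<or> x \<in> B" for x using that subbimoduleD(1)[OF assms(1)] subbimoduleD(1)[OF assms(2)] by blast
  have "B <+>\<^sub>M A = A <+>\<^sub>M B"
    unfolding set_add_def'
  proof (intro equalityI subsetI)
    fix v assume "v \<in> (\<Union>h\<in>B. \<Union>k\<in>A. {h \<oplus>\<^sub>M k})"
    then obtain h k where "h \<in> B" "k \<in> A" "v = h \<oplus>\<^sub>M k" by blast
    then have "h \<in> B" "k \<in> A" "v = k \<oplus>\<^sub>M h" using a_comm c by auto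
    then show "v \<in> (\<Union>h\<in>A. \<Union>k\<in>B. {h \<oplus>\<^sub>M k})" by blast
  next
    fix v assume "v \<in> (\<Union>h\<in>A. \<Union>k\<in>B. {h \<oplus>\<^sub>M k})"
    then obtain h k where "h \<in> A" "k \<in> B" "v = h \<oplus>\<^sub>M k" by blast
    then have "h \<in> A" "k \<in> B" "v = k \<oplus>\<^sub>M h" using a_comm c by auto
    then show "v \<in> (\<Union>h\<in>B. \<Union>k\<in>A. {h \<oplus>\<^sub>M k})" by blast
  qed
  then show ?thesis using assms(3) by (simp add: internal_direct_sum_def Int_commute)
qed

context quat_bimodules
begin

text \<open>Here \<pi> (x, y) = (\<pi>^2 y, x), so \<pi> T consists of the columns with first entry
  in \<open>pi2_ideal\<close>, and classes are first entries modulo that ideal. Those of type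
  \<open>t\<close> come from \<open>W\<close>, the others from W \<pi>; right multiplication by
  \<pi> is injective on the former and kills the latter.\<close>

lemma column_invariants:
  defines "T t \<equiv> column_bimodule R (phi t)"
  shows "comp_card s (red (T t)) = residue_card" "shift_card t (red (T t)) = residue_card"
    "shift_card (\<not> t) (red (T t)) = 1"
proof -
  let ?T = "T t"
  interpret T: lattice_bimod R Z W \<sigma> \<pi> w u ?T unfolding T_def by (rule lat_phi)
  note type = phi_type[of t]
  have Tc: "carrier ?T = carrier R \<times> carrier R" by (simp add: T_def)
  have Tr: "(x, y) \<star>\<^sub>?T a = (x \<otimes> a, y \<otimes> a)" for x y a by (simp add: T_def)
  have Tl: "\<pi> \<odot>\<^sub>?T (x, y) = (pi2 \<otimes> y, x)" "a \<in> W \<Longrightarrow> a \<odot>\<^sub>?T (x, y) = (tw t a \<otimes> x, tw (\<not> t) a \<otimes> y)"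
    if "x \<in> carrier R" "y \<in> carrier R" for x y a
    using column_type_smult[OF type that] by (auto simp: T_def)
  have Tm: "(x, y) \<ominus>\<^sub>?T (x', y') = (x \<ominus> x', y \<ominus> y')"
    if "x \<in> carrier R" "y \<in> carrier R" "x' \<in> carrier R" "y' \<in> carrier R" for x y x' y'
  proof -
    have "\<ominus>\<^sub>?T (x', y') = (\<ominus> x', \<ominus> y')" by (rule T.M.minus_equality) (use that in \<open>simp_all add: T_def l_neg\<close>)
    then show ?thesis by (simp add: a_minus_def T_def)
  qed
  have N: "(x, y) \<in> piL ?T \<longleftrightarrow> (\<exists>r\<in>carrier R. x = pi2 \<otimes> r) \<and> y \<in> carrier R" for x y
    unfolding Tc by (force simp: Tl image_iff)
  have eq: "piL ?T +>\<^sub>?T (x, y) = piL ?T +>\<^sub>?T (x', y') \<longleftrightarrow> (\<exists>r\<in>carrier R. x \<ominus> x' = pi2 \<otimes> r)"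
    if "x \<in> carrier R" "y \<in> carrier R" "x' \<in> carrier R" "y' \<in> carrier R" for x y x' y'
  proof -
    have m: "(x, y) \<in> carrier ?T" "(x', y') \<in> carrier ?T" using that by (simp_all add: Tc)
    show ?thesis unfolding T.class_eq_iff[OF m] Tm[OF that] N using that by simp
  qed
  \<comment> \<open>In the first entry \<open>a\<close> acts as \<open>tw t a\<close>, so a column
    of type \<open>s\<close> has a first entry of relative type \<open>s \<noteq> t\<close> in the
    ring itself.\<close>
  have first: "w \<otimes> x = x \<otimes> tw (s \<noteq> t) w" if v: "(x, y) \<in> comp ?T s" for x y s
  proof -
    have c: "x \<in> carrier R" "y \<in> carrier R" using T.compD(1)[OF v] by (simp_all add: Tc)
    have "tw t w \<in> W" by simp
    from T.compD(2)[OF v this] show ?thesis using c by (simp add: Tl Tr tw_tw)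
  qed
  have comp1: "(\<lambda>v. piL ?T +>\<^sub>?T v) ` comp ?T t = (\<lambda>a. piL ?T +>\<^sub>?T (a, \<zero>)) ` W"
    and comp1': "(\<lambda>v. piL ?T +>\<^sub>?T (v \<star>\<^sub>?T \<pi>)) ` comp ?T t = (\<lambda>a. piL ?T +>\<^sub>?T (a \<otimes> \<pi>, \<zero>)) ` W"
  proof -
    have 1: "\<exists>a\<in>W. \<exists>y\<in>carrier R. v = (a, y)" if v: "v \<in> comp ?T t" for v
    proof -
      obtain x y where xy: "v = (x, y)" "x \<in> carrier R" "y \<in> carrier R" using T.compD(1)[OF v] by (auto simp: Tc)
      have "w \<otimes> x = x \<otimes> tw False w" using first[of x y t] v xy by simp
      then show ?thesis using commutant[OF xy(2), of False] xy by simp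
    qed
    have 2: "(a, \<zero>) \<in> comp ?T t" if "a \<in> W" for a
      using that by (simp add: comp_def Tc Tl Tr W_comm)
    show "(\<lambda>v. piL ?T +>\<^sub>?T v) ` comp ?T t = (\<lambda>a. piL ?T +>\<^sub>?T (a, \<zero>)) ` W"
    proof (intro equalityI subsetI)
      fix V assume "V \<in> (\<lambda>v. piL ?T +>\<^sub>?T v) ` comp ?T t"
      then obtain a y where a: "a \<in> W" "y \<in> carrier R" "V = piL ?T +>\<^sub>?T (a, y)" using 1 by blast
      have "V = piL ?T +>\<^sub>?T (a, \<zero>)" unfolding a(3)
        using a(1,2) by (subst eq) (auto simp: minus_eq r_neg intro: bexI[of _ \<zero>])
      then show "V \<in> (\<lambda>a. piL ?T +>\<^sub>?T (a, \<zero>)) ` W" using a(1) by blast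
    qed (use 2 in blast)
    show "(\<lambda>v. piL ?T +>\<^sub>?T (v \<star>\<^sub>?T \<pi>)) ` comp ?T t = (\<lambda>a. piL ?T +>\<^sub>?T (a \<otimes> \<pi>, \<zero>)) ` W"
    proof (intro equalityI subsetI)
      fix V assume "V \<in> (\<lambda>v. piL ?T +>\<^sub>?T (v \<star>\<^sub>?T \<pi>)) ` comp ?T t"
      then obtain v where v: "v \<in> comp ?T t" "V = piL ?T +>\<^sub>?T (v \<star>\<^sub>?T \<pi>)" by blast
      obtain a y where a: "a \<in> W" "y \<in> carrier R" "v = (a, y)" using 1[OF v(1)] by blast
      have "V = piL ?T +>\<^sub>?T (a \<otimes> \<pi>, \<zero>)" unfolding v(2) a(3) Tr
        using a(1,2) by (subst eq) (auto simp: minus_eq r_neg intro: bexI[of _ \<zero>])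
      then show "V \<in> (\<lambda>a. piL ?T +>\<^sub>?T (a \<otimes> \<pi>, \<zero>)) ` W" using a(1) by blast
    next
      fix V assume "V \<in> (\<lambda>a. piL ?T +>\<^sub>?T (a \<otimes> \<pi>, \<zero>)) ` W"
      then obtain a where a: "a \<in> W" "V = piL ?T +>\<^sub>?T ((a, \<zero>) \<star>\<^sub>?T \<pi>)" by (auto simp: Tr)
      then show "V \<in> (\<lambda>v. piL ?T +>\<^sub>?T (v \<star>\<^sub>?T \<pi>)) ` comp ?T t" using 2[OF a(1)] by blast
    qed
  qed
  have 3: "\<exists>b\<in>W. \<exists>y\<in>carrier R. v = (b \<otimes> \<pi>, y)" if v: "v \<in> comp ?T (\<not> t)" for v
  proof -
    obtain x y where xy: "v = (x, y)" "x \<in> carrier R" "y \<in> carrier R" using T.compD(1)[OF v] by (auto simp: Tc)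
    have "w \<otimes> x = x \<otimes> tw True w" using first[of x y "\<not> t"] v xy by simp
    then show ?thesis using commutant[OF xy(2), of True] xy by auto
  qed
  have 4: "(b \<otimes> \<pi>, \<zero>) \<in> comp ?T (\<not> t)" if b: "b \<in> W" for b
  proof -
    have "tw t a \<otimes> (b \<otimes> \<pi>) = b \<otimes> \<pi> \<otimes> tw (\<not> t) a" if "a \<in> W" for a
      using b that pi_comm[of "tw (\<not> t) a"] W_lcomm[of b "tw t a" \<pi>] by (simp add: m_assoc sigma_tw)
    then show ?thesis using b by (simp add: comp_def Tc Tl Tr)
  qed
  have comp2: "(\<lambda>v. piL ?T +>\<^sub>?T v) ` comp ?T (\<not> t) = (\<lambda>a. piL ?T +>\<^sub>?T (a \<otimes> \<pi>, \<zero>)) ` W"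
  proof (intro equalityI subsetI)
    fix V assume "V \<in> (\<lambda>v. piL ?T +>\<^sub>?T v) ` comp ?T (\<not> t)"
    then obtain a y where a: "a \<in> W" "y \<in> carrier R" "V = piL ?T +>\<^sub>?T (a \<otimes> \<pi>, y)" using 3 by blast
    have "V = piL ?T +>\<^sub>?T (a \<otimes> \<pi>, \<zero>)" unfolding a(3)
      using a(1,2) by (subst eq) (auto simp: minus_eq r_neg intro: bexI[of _ \<zero>])
    then show "V \<in> (\<lambda>a. piL ?T +>\<^sub>?T (a \<otimes> \<pi>, \<zero>)) ` W" using a(1) by blast
  qed (use 4 in blast)
  have card1: "card ((\<lambda>a. piL ?T +>\<^sub>?T (a, \<zero>)) ` W) = residue_card"
  proof (rule card_residue_image)
    fix a b assume ab: "a \<in> W" "b \<in> W"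
    then show "piL ?T +>\<^sub>?T (a, \<zero>) = piL ?T +>\<^sub>?T (b, \<zero>) \<longleftrightarrow> (\<exists>c\<in>W. a \<ominus> b = pi2 \<otimes> c)"
      using W_in_pi_ideal(2)[of "a \<ominus> b"] by (subst eq) simp_all
  qed
  have card2: "card ((\<lambda>a. piL ?T +>\<^sub>?T (a \<otimes> \<pi>, \<zero>)) ` W) = residue_card"
  proof (rule card_residue_image)
    fix a b assume ab: "a \<in> W" "b \<in> W"
    have "a \<otimes> \<pi> \<ominus> b \<otimes> \<pi> = (a \<ominus> b) \<otimes> \<pi>" using ab by (simp add: minus_eq l_distr l_minus)
    then show "piL ?T +>\<^sub>?T (a \<otimes> \<pi>, \<zero>) = piL ?T +>\<^sub>?T (b \<otimes> \<pi>, \<zero>) \<longleftrightarrow> (\<exists>c\<in>W. a \<ominus> b = pi2 \<otimes> c)"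
      using W_in_pi_ideal(3)[of "a \<ominus> b"] ab by (subst eq) simp_all
  qed
  show "comp_card s (red ?T) = residue_card"
  proof (cases "s = t")
    case True
    then show ?thesis unfolding comp_card_def T.red_comp_red by (simp only: comp1 card1)
  next
    case False
    then have "s = (\<not> t)" by auto
    then show ?thesis unfolding comp_card_def T.red_comp_red by (simp only: comp2 card2)
  qed
  show "shift_card t (red ?T) = residue_card"
    unfolding shift_card_def T.shift_red comp1' by (rule card2)
  have "(\<lambda>v. piL ?T +>\<^sub>?T (v \<star>\<^sub>?T \<pi>)) ` comp ?T (\<not> t) = {piL ?T +>\<^sub>?T (\<zero>, \<zero>)}"
  proof -
    have "piL ?T +>\<^sub>?T (v \<star>\<^sub>?T \<pi>) = piL ?T +>\<^sub>?T (\<zero>, \<zero>)" if v: "v \<in> comp ?T (\<not> t)" for v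
    proof -
      obtain b y where b: "b \<in> W" "y \<in> carrier R" "v = (b \<otimes> \<pi>, y)" using 3[OF v] by blast
      have "b \<otimes> \<pi> \<otimes> \<pi> \<ominus> \<zero> = pi2 \<otimes> b" using b(1) pi2_comm[of b] by (simp add: minus_eq m_assoc)
      then show ?thesis unfolding b(3) Tr using b(1,2) by (subst eq) auto
    qed
    then show ?thesis using 4[OF W_zero] by blast
  qed
  then show "shift_card (\<not> t) (red ?T) = 1"
    unfolding shift_card_def T.shift_red by simp
qed

section \<open>Uniqueness of exponents, separation of the models, indecomposability\<close>

lemma residue_card_gt: "residue_card > 1"
proof -
  let ?g = "\<lambda>a. {b \<in> W. \<exists>c\<in>W. a \<ominus> b = pi2 \<otimes> c}"
  have "\<zero> \<in> ?g \<zero>" by (auto simp: minus_eq intro: bexI[of _ \<zero>])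
  moreover have "\<zero> \<notin> ?g \<one>"
  proof
    assume "\<zero> \<in> ?g \<one>"
    then obtain c where "c \<in> W" "pi2 \<otimes> c = \<one>" by (auto simp: minus_eq)
    then show False using nonunit_W by blast
  qed
  ultimately have "?g \<zero> \<noteq> ?g \<one>" by blast
  then have "card {?g \<zero>, ?g \<one>} = 2" by simp
  moreover have "card {?g \<zero>, ?g \<one>} \<le> card (?g ` W)"
    by (intro card_mono residue_finite) (use W_zero W_one in blast)
  ultimately show ?thesis unfolding residue_card_def by linarith
qed

lemma cbimod_models: "cbimod LO" "cbimod LP" "cbimod C1" "cbimod C2"
  using lat_cbimod lat_ideal lat_column by blast+

lemma cbimod_power_sum: "cbimod (power_sum r\<^sub>1 r\<^sub>2 t\<^sub>1 t\<^sub>2)"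
  by (intro cbimod_sum cbimod_power cbimod_models)

lemma model_invariants:
  "comp_card False (red LO) = residue_card" "comp_card True (red LO) = 1" "shift_card s (red LO) = 1"
  "comp_card False (red LP) = 1" "comp_card True (red LP) = residue_card" "shift_card s (red LP) = 1"
  "comp_card s (red C1) = residue_card" "shift_card False (red C1) = residue_card" "shift_card True (red C1) = 1"
  "comp_card s (red C2) = residue_card" "shift_card False (red C2) = 1" "shift_card True (red C2) = residue_card"
  using ideal_invariants[where t = False] ideal_invariants[where t = True]
    column_invariants[where t = False] column_invariants[where t = True]
  by (simp_all only: phi_def if_True if_False simp_thms)

lemma power_sum_invariants:
  "comp_card False (red (power_sum r\<^sub>1 r\<^sub>2 t\<^sub>1 t\<^sub>2)) = residue_card ^ (r\<^sub>1 + t\<^sub>1 + t\<^sub>2)"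
  "comp_card True (red (power_sum r\<^sub>1 r\<^sub>2 t\<^sub>1 t\<^sub>2)) = residue_card ^ (r\<^sub>2 + t\<^sub>1 + t\<^sub>2)"
  "shift_card False (red (power_sum r\<^sub>1 r\<^sub>2 t\<^sub>1 t\<^sub>2)) = residue_card ^ t\<^sub>1"
  "shift_card True (red (power_sum r\<^sub>1 r\<^sub>2 t\<^sub>1 t\<^sub>2)) = residue_card ^ t\<^sub>2"
proof -
  note c = cbimod_power[OF cbimod_models(1), of r\<^sub>1] cbimod_power[OF cbimod_models(2), of r\<^sub>2]
    cbimod_power[OF cbimod_models(3), of t\<^sub>1] cbimod_power[OF cbimod_models(4), of t\<^sub>2]
  note s = invariants_red_sum[OF c(1) cbimod_sum[OF c(2) cbimod_sum[OF c(3,4)]]]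
    invariants_red_sum[OF c(2) cbimod_sum[OF c(3,4)]] invariants_red_sum[OF c(3,4)]
  note p = cbimod_models[THEN invariants_power(1)] cbimod_models[THEN invariants_power(2)]
  show "comp_card False (red (power_sum r\<^sub>1 r\<^sub>2 t\<^sub>1 t\<^sub>2)) = residue_card ^ (r\<^sub>1 + t\<^sub>1 + t\<^sub>2)"
    "comp_card True (red (power_sum r\<^sub>1 r\<^sub>2 t\<^sub>1 t\<^sub>2)) = residue_card ^ (r\<^sub>2 + t\<^sub>1 + t\<^sub>2)"
    "shift_card False (red (power_sum r\<^sub>1 r\<^sub>2 t\<^sub>1 t\<^sub>2)) = residue_card ^ t\<^sub>1"
    "shift_card True (red (power_sum r\<^sub>1 r\<^sub>2 t\<^sub>1 t\<^sub>2)) = residue_card ^ t\<^sub>2"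
    by (simp_all only: s p model_invariants power_one mult_1_left mult_1_right power_add mult.assoc)
qed

lemma exponents_unique:
  assumes "bimodule_isomorphic RP Rpi2 (red (power_sum r\<^sub>1 r\<^sub>2 t\<^sub>1 t\<^sub>2)) (red (power_sum r\<^sub>1' r\<^sub>2' t\<^sub>1' t\<^sub>2'))"
  shows "(r\<^sub>1, r\<^sub>2, t\<^sub>1, t\<^sub>2) = (r\<^sub>1', r\<^sub>2', t\<^sub>1', t\<^sub>2')"
proof -
  note i = invariants_isomorphic[OF assms stable_red[OF cbimod_power_sum]]
  have inj: "m = n" if "residue_card ^ m = residue_card ^ n" for m n
    using that residue_card_gt by (simp add: power_inject_exp)
  have "t\<^sub>1 = t\<^sub>1'" "t\<^sub>2 = t\<^sub>2'" using i(2)[of False] i(2)[of True] inj unfolding power_sum_invariants by blast+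
  moreover have "r\<^sub>1 + t\<^sub>1 + t\<^sub>2 = r\<^sub>1' + t\<^sub>1' + t\<^sub>2'" "r\<^sub>2 + t\<^sub>1 + t\<^sub>2 = r\<^sub>2' + t\<^sub>1' + t\<^sub>2'"
    using i(1)[of False] i(1)[of True] inj unfolding power_sum_invariants by blast+
  ultimately show ?thesis by simp
qed

lemma lat_sym: "\<lbrakk>lat L; bimodule_isomorphic R R L M\<rbrakk> \<Longrightarrow> bimodule_isomorphic R R M L"
  using bimodule_isomorphic_sym lat_bimodule by blast

theorem decomposition_unique:
  assumes "lat L" "bimodule_isomorphic R R L (power_sum r\<^sub>1 r\<^sub>2 t\<^sub>1 t\<^sub>2)"
    "bimodule_isomorphic R R L (power_sum r\<^sub>1' r\<^sub>2' t\<^sub>1' t\<^sub>2')"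
  shows "(r\<^sub>1, r\<^sub>2, t\<^sub>1, t\<^sub>2) = (r\<^sub>1', r\<^sub>2', t\<^sub>1', t\<^sub>2')"
  by (intro exponents_unique red_isomorphic cbimod_power_sum
      bimodule_isomorphic_trans[OF lat_sym[OF assms(1,2)] assms(3)])

text \<open>An isomorphism of reductions is not lifted. Both lattices are decomposed, the reductions
  of the two decompositions are isomorphic, and their cardinalities force equal exponents.\<close>

theorem isomorphic_iff_red:
  assumes L: "lat L" and L': "lat L'"
  shows "bimodule_isomorphic R R L L' \<longleftrightarrow> bimodule_isomorphic RP Rpi2 (red L) (red L')"
proof
  note c = lat_cbimod[OF L] lat_cbimod[OF L']
  show "bimodule_isomorphic R R L L' \<Longrightarrow> bimodule_isomorphic RP Rpi2 (red L) (red L')"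
    using red_isomorphic c by blast
  assume iso: "bimodule_isomorphic RP Rpi2 (red L) (red L')"
  obtain r\<^sub>1 r\<^sub>2 t\<^sub>1 t\<^sub>2 where d: "bimodule_isomorphic R R L (power_sum r\<^sub>1 r\<^sub>2 t\<^sub>1 t\<^sub>2)" using decomposition L by blast
  obtain r\<^sub>1' r\<^sub>2' t\<^sub>1' t\<^sub>2' where d': "bimodule_isomorphic R R L' (power_sum r\<^sub>1' r\<^sub>2' t\<^sub>1' t\<^sub>2')" using decomposition L' by blast
  have "bimodule_isomorphic RP Rpi2 (red (power_sum r\<^sub>1 r\<^sub>2 t\<^sub>1 t\<^sub>2)) (red (power_sum r\<^sub>1' r\<^sub>2' t\<^sub>1' t\<^sub>2'))"
    by (rule bimodule_isomorphic_trans[OF red_isomorphic[OF cbimod_power_sum c(1) lat_sym[OF L d]]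
          bimodule_isomorphic_trans[OF iso red_isomorphic[OF c(2) cbimod_power_sum d']]])
  then have "(r\<^sub>1, r\<^sub>2, t\<^sub>1, t\<^sub>2) = (r\<^sub>1', r\<^sub>2', t\<^sub>1', t\<^sub>2')" by (rule exponents_unique)
  then show "bimodule_isomorphic R R L L'"
    using bimodule_isomorphic_trans[OF d] lat_sym[OF L' d'] by simp
qed

text \<open>Here n = r1 + r2 + 2 (t1 + t2) is the total exponent of the two homogeneous parts and t
  = t1 + t2 counts the columns. Each column contributes 2 to n, whence 2 t \<le> n.\<close>

lemma nonzero_exponents:
  assumes L: "lat L" "carrier L \<noteq> {\<zero>\<^sub>L}"
  obtains n t where "n \<ge> 1" "2 * t \<le> n"
    "comp_card False (red L) * comp_card True (red L) = residue_card ^ n"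
    "shift_card False (red L) * shift_card True (red L) = residue_card ^ t"
proof -
  obtain r\<^sub>1 r\<^sub>2 t\<^sub>1 t\<^sub>2 where d: "bimodule_isomorphic R R L (power_sum r\<^sub>1 r\<^sub>2 t\<^sub>1 t\<^sub>2)" using decomposition L by blast
  note i = invariants_red_isomorphic[OF lat_cbimod[OF L(1)] cbimod_power_sum d]
  have "r\<^sub>1 + r\<^sub>2 + 2 * (t\<^sub>1 + t\<^sub>2) \<ge> 1"
  proof (rule ccontr)
    assume "\<not> ?thesis"
    then have z: "r\<^sub>1 = 0" "r\<^sub>2 = 0" "t\<^sub>1 = 0" "t\<^sub>2 = 0" by simp_all
    obtain f where f: "inj_on f (carrier L)" "f ` carrier L = carrier (power_sum 0 0 0 0)"
      using d unfolding z bimodule_isomorphic_def bij_betw_def by blast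
    interpret L: bimod R R L using lat_bimodule[OF L(1)] by (simp add: bimod_def)
    have "x = \<zero>\<^sub>L" if x: "x \<in> carrier L" for x
    proof -
      have "f x \<in> carrier (power_sum 0 0 0 0)" "f \<zero>\<^sub>L \<in> carrier (power_sum 0 0 0 0)" using f(2) x L.zero_closed by blast+
      then have "f x = f \<zero>\<^sub>L" by auto
      then show ?thesis using inj_onD[OF f(1)] x by simp
    qed
    then show False using L(2) L.zero_closed by blast
  qed
  moreover have "comp_card False (red L) * comp_card True (red L) = residue_card ^ (r\<^sub>1 + r\<^sub>2 + 2 * (t\<^sub>1 + t\<^sub>2))"
    unfolding i power_sum_invariants power_add[symmetric] by (rule arg_cong[where f = "\<lambda>k. residue_card ^ k"]) simp
  moreover have "shift_card False (red L) * shift_card True (red L) = residue_card ^ (t\<^sub>1 + t\<^sub>2)"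
    unfolding i power_sum_invariants power_add[symmetric] by (rule refl)
  ultimately show thesis using that[of "r\<^sub>1 + r\<^sub>2 + 2 * (t\<^sub>1 + t\<^sub>2)" "t\<^sub>1 + t\<^sub>2"] by simp
qed

text \<open>The exponents of \<open>nonzero_exponents\<close> add up over two nonzero summands. A
  total n of 1 cannot be shared by parts with n at least 1; for n = 2 each part has n = 1 and so t =
  0, against a total t of 1. The first alternative is met by the ideals, the second by the
  columns.\<close>

lemma indecomposableI:
  assumes L: "lat L" "carrier L \<noteq> {\<zero>\<^sub>L}"
    and small: "comp_card False (red L) * comp_card True (red L) = residue_card \<or>
      comp_card False (red L) * comp_card True (red L) = residue_card ^ 2 \<and>
      shift_card False (red L) * shift_card True (red L) = residue_card"
  shows "indecomposable_bimodule R R L"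
  unfolding indecomposable_bimodule_def
proof (intro conjI allI impI, rule L(2), rule ccontr)
  fix A B
  assume AB: "subbimodule R R L A \<and> subbimodule R R L B \<and> internal_direct_sum L A B"
    and nz: "\<not> (A = {\<zero>\<^sub>L} \<or> B = {\<zero>\<^sub>L})"
  interpret L: lattice_bimod R Z W \<sigma> \<pi> w u L by (rule L(1))
  let ?A = "sub_bimodule L A" and ?B = "sub_bimodule L B"
  have ds: "internal_direct_sum L B A"
    using L.M.internal_direct_sum_commute AB by blast
  have lat: "lat ?A" "lat ?B" using L.lat_direct_summand AB ds by blast+
  have nzA: "carrier ?A \<noteq> {\<zero>\<^sub>?A}" "carrier ?B \<noteq> {\<zero>\<^sub>?B}" using nz by simp_all
  have iso: "bimodule_isomorphic R R L (?A \<oplus>\<^sub>B ?B)" using L.M.internal_direct_sum_isomorphic AB by blast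
  note c = lat_cbimod[OF lat(1)] lat_cbimod[OF lat(2)]
  note i = invariants_red_isomorphic[OF L.cbimod cbimod_sum[OF c] iso] and s = invariants_red_sum[OF c]
  obtain n t where n: "n \<ge> 1" "2 * t \<le> n" "comp_card False (red ?A) * comp_card True (red ?A) = residue_card ^ n"
    "shift_card False (red ?A) * shift_card True (red ?A) = residue_card ^ t"
    by (rule nonzero_exponents[OF lat(1) nzA(1)])
  obtain n' t' where n': "n' \<ge> 1" "2 * t' \<le> n'" "comp_card False (red ?B) * comp_card True (red ?B) = residue_card ^ n'"
    "shift_card False (red ?B) * shift_card True (red ?B) = residue_card ^ t'"
    by (rule nonzero_exponents[OF lat(2) nzA(2)])
  have "comp_card False (red L) * comp_card True (red L) =
      (comp_card False (red ?A) * comp_card True (red ?A)) * (comp_card False (red ?B) * comp_card True (red ?B))"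
    unfolding i s by (simp only: mult_ac)
  then have comp: "comp_card False (red L) * comp_card True (red L) = residue_card ^ (n + n')"
    unfolding n(3) n'(3) power_add .
  have "shift_card False (red L) * shift_card True (red L) =
      (shift_card False (red ?A) * shift_card True (red ?A)) * (shift_card False (red ?B) * shift_card True (red ?B))"
    unfolding i s by (simp only: mult_ac)
  then have shift: "shift_card False (red L) * shift_card True (red L) = residue_card ^ (t + t')"
    unfolding n(4) n'(4) power_add .
  have inj: "k = l" if "residue_card ^ k = residue_card ^ l" for k l
    using that residue_card_gt by (simp add: power_inject_exp)
  show False using small
  proof
    assume "comp_card False (red L) * comp_card True (red L) = residue_card"
    then have "n + n' = 1" using inj[of "n + n'" 1] comp by simp
    then show False using n(1) n'(1) by simp
  next
    assume "comp_card False (red L) * comp_card True (red L) = residue_card ^ 2 \<and>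
      shift_card False (red L) * shift_card True (red L) = residue_card"
    then have "n + n' = 2" "t + t' = 1" using inj[of "n + n'" 2] inj[of "t + t'" 1] comp shift by simp_all
    then show False using n(1,2) n'(1,2) by presburger
  qed
qed

lemma models_indecomposable:
  "indecomposable_bimodule R R LO" "indecomposable_bimodule R R LP"
  "indecomposable_bimodule R R C1" "indecomposable_bimodule R R C2"
  by (rule indecomposableI[OF lat_ideal model_nonzero(1)] indecomposableI[OF lat_ideal model_nonzero(2)]
      indecomposableI[OF lat_column(1) model_nonzero(3)] indecomposableI[OF lat_column(2) model_nonzero(4)];
      simp only: model_invariants mult_1_left mult_1_right power2_eq_square simp_thms)+

text \<open>The part of type \<open>True\<close> separates \<open>LO\<close> from the others, the
  part of type \<open>False\<close> separates \<open>LP\<close> from the columns, and the image of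
  type \<open>False\<close> under right multiplication separates the two columns.\<close>

lemma models_not_isomorphic:
  "\<not> bimodule_isomorphic R R LO LP" "\<not> bimodule_isomorphic R R LO C1" "\<not> bimodule_isomorphic R R LO C2"
  "\<not> bimodule_isomorphic R R LP C1" "\<not> bimodule_isomorphic R R LP C2" "\<not> bimodule_isomorphic R R C1 C2"
  using residue_card_gt model_invariants
    invariants_red_isomorphic(1)[OF cbimod_models(1,2), of True]
    invariants_red_isomorphic(1)[OF cbimod_models(1,3), of True]
    invariants_red_isomorphic(1)[OF cbimod_models(1,4), of True]
    invariants_red_isomorphic(1)[OF cbimod_models(2,3), of False]
    invariants_red_isomorphic(1)[OF cbimod_models(2,4), of False]
    invariants_red_isomorphic(2)[OF cbimod_models(3,4), of False]
  by (metis less_irrefl)+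

text \<open>Indecomposability makes the image of the section or the kernel of the projection zero.
  The image is a copy of the nonzero \<open>T\<close>, so the kernel vanishes and the image is all
  of \<open>L\<close>.\<close>

lemma splits_off_indecomposable:
  assumes L: "lat L" and ind: "indecomposable_bimodule R R L"
    and T: "lat T" "carrier T \<noteq> {\<zero>\<^sub>T}" and sp: "splits_off L T"
  shows "bimodule_isomorphic R R L T"
proof -
  interpret L: lattice_bimod R Z W \<sigma> \<pi> w u L by (rule L)
  interpret T: bimod R R T using lat_bimodule[OF T(1)] by (simp add: bimod_def)
  obtain f h where fh: "bimodule_hom R R L T f" "bimodule_hom R R T L h" "\<And>t. t \<in> carrier T \<Longrightarrow> f (h t) = t"
    using sp unfolding splits_off_def by blast
  have ds: "internal_direct_sum L (h ` carrier T) {x \<in> carrier L. f x = \<zero>\<^sub>T}"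
    and iso: "bimodule_isomorphic R R (sub_bimodule L (h ` carrier T)) T"
    using L.M.split_internal_direct_sum[OF T.bimodule fh] by blast+
  have H: "subbimodule R R L (h ` carrier T)" by (rule L.M.image_subbimodule[OF fh(2) T.bimodule])
  have K: "subbimodule R R L {x \<in> carrier L. f x = \<zero>\<^sub>T}" by (rule L.M.kernel_subbimodule[OF fh(1) T.bimodule])
  obtain t where t: "t \<in> carrier T" "t \<noteq> \<zero>\<^sub>T" using T(2) T.zero_closed by blast
  have "h ` carrier T \<noteq> {\<zero>\<^sub>L}"
  proof
    assume "h ` carrier T = {\<zero>\<^sub>L}"
    then have "h t = h \<zero>\<^sub>T" using t(1) T.zero_closed by (metis image_eqI singletonD)
    then show False using fh(3) t by (metis T.zero_closed)
  qed
  then have K0: "{x \<in> carrier L. f x = \<zero>\<^sub>T} = {\<zero>\<^sub>L}"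
    using ind ds H K unfolding indecomposable_bimodule_def by blast
  have "h ` carrier T = carrier L"
  proof (intro equalityI subsetI)
    show "x \<in> carrier L" if "x \<in> h ` carrier T" for x using that subbimoduleD(1)[OF H] by blast
    fix x assume "x \<in> carrier L"
    then obtain y where "y \<in> h ` carrier T" "x = y \<oplus>\<^sub>L \<zero>\<^sub>L"
      using ds unfolding internal_direct_sum_def K0 set_add_def' by blast
    then show "x \<in> h ` carrier T" using subbimoduleD(1)[OF H] by auto
  qed
  then show ?thesis using iso by simp
qed

theorem indecomposable_cases:
  fixes L :: "('a, 'a, 'm) bimodule"
  assumes L: "lat L" and ind: "indecomposable_bimodule R R L"
  shows "bimodule_isomorphic R R L LO \<or> bimodule_isomorphic R R L LP \<or>
    bimodule_isomorphic R R L C1 \<or> bimodule_isomorphic R R L C2"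
proof -
  interpret L: lattice_bimod R Z W \<sigma> \<pi> w u L by (rule L)
  have nz: "carrier L \<noteq> {\<zero>\<^sub>L}" using ind by (simp add: indecomposable_bimodule_def)
  consider "splits_off L LO" | "splits_off L LP" | "splits_off L C1" | "splits_off L C2"
    using splits_off_cases[OF L nz] by blast
  then show ?thesis
    using splits_off_indecomposable[OF L ind lat_ideal model_nonzero(1)]
      splits_off_indecomposable[OF L ind lat_ideal model_nonzero(2)]
      splits_off_indecomposable[OF L ind lat_column(1) model_nonzero(3)]
      splits_off_indecomposable[OF L ind lat_column(2) model_nonzero(4)] by metis
qed

end

section \<open>The anti-involution and the second reduction\<close>

context quat_order
begin

definition anti :: "'a \<Rightarrow> 'a" where
  "anti r = (THE x. \<exists>a\<in>W. \<exists>b\<in>W. r = a \<oplus> b \<otimes> \<pi> \<and> x = a \<oplus> \<sigma> b \<otimes> \<pi>)"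

lemma anti_eq: assumes "a \<in> W" "b \<in> W" shows "anti (a \<oplus> b \<otimes> \<pi>) = a \<oplus> \<sigma> b \<otimes> \<pi>"
  unfolding anti_def
proof (rule the_equality)
  show "\<exists>a'\<in>W. \<exists>b'\<in>W. a \<oplus> b \<otimes> \<pi> = a' \<oplus> b' \<otimes> \<pi> \<and> a \<oplus> \<sigma> b \<otimes> \<pi> = a' \<oplus> \<sigma> b' \<otimes> \<pi>" using assms by blast
  show "x = a \<oplus> \<sigma> b \<otimes> \<pi>" if "\<exists>a'\<in>W. \<exists>b'\<in>W. a \<oplus> b \<otimes> \<pi> = a' \<oplus> b' \<otimes> \<pi> \<and> x = a' \<oplus> \<sigma> b' \<otimes> \<pi>" for x
    using that decompose_unique assms by metis
qed

lemma anti_closed [simp]: "r \<in> carrier R \<Longrightarrow> anti r \<in> carrier R"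
  and anti_anti [simp]: "r \<in> carrier R \<Longrightarrow> anti (anti r) = r"
proof -
  assume "r \<in> carrier R"
  then obtain a b where "a \<in> W" "b \<in> W" "r = a \<oplus> b \<otimes> \<pi>" using decompose by blast
  then show "anti r \<in> carrier R" "anti (anti r) = r" by (simp_all add: anti_eq)
qed

lemma anti_W [simp]: "a \<in> W \<Longrightarrow> anti a = a" and anti_pi [simp]: "anti \<pi> = \<pi>"
  using anti_eq[of a \<zero>] anti_eq[of \<zero> \<one>] by simp_all

lemma anti_add: "\<lbrakk>r \<in> carrier R; s \<in> carrier R\<rbrakk> \<Longrightarrow> anti (r \<oplus> s) = anti r \<oplus> anti s"
proof -
  assume "r \<in> carrier R" "s \<in> carrier R"
  then obtain a b c d where ab: "a \<in> W" "b \<in> W" "r = a \<oplus> b \<otimes> \<pi>" and cd: "c \<in> W" "d \<in> W" "s = c \<oplus> d \<otimes> \<pi>"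
    using decompose by metis
  have "r \<oplus> s = (a \<oplus> c) \<oplus> (b \<oplus> d) \<otimes> \<pi>" using ab cd by (simp add: l_distr a_ac)
  then have "anti (r \<oplus> s) = (a \<oplus> c) \<oplus> \<sigma> (b \<oplus> d) \<otimes> \<pi>" using ab cd by (simp only: anti_eq W_add)
  then show ?thesis using ab cd by (simp add: anti_eq sigma_add l_distr a_ac)
qed

text \<open>With both factors written in W + W \<pi>, the product formula \<open>prod\<close>
  reduces the reversal of products to commutativity of \<open>W\<close>.\<close>

lemma anti_mult: "\<lbrakk>r \<in> carrier R; s \<in> carrier R\<rbrakk> \<Longrightarrow> anti (r \<otimes> s) = anti s \<otimes> anti r"
proof -
  have prod: "(a \<oplus> b \<otimes> \<pi>) \<otimes> (c \<oplus> d \<otimes> \<pi>) = (a \<otimes> c \<oplus> b \<otimes> \<sigma> d \<otimes> pi2) \<oplus> (a \<otimes> d \<oplus> b \<otimes> \<sigma> c) \<otimes> \<pi>"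
    if "a \<in> W" "b \<in> W" "c \<in> W" "d \<in> W" for a b c d
  proof -
    have 1: "\<pi> \<otimes> (c \<oplus> d \<otimes> \<pi>) = \<sigma> c \<otimes> \<pi> \<oplus> \<sigma> d \<otimes> pi2"
      using that m_assoc[of \<pi> d \<pi>] m_assoc[of "\<sigma> d" \<pi> \<pi>] by (simp add: r_distr pi_comm)
    have "(a \<oplus> b \<otimes> \<pi>) \<otimes> (c \<oplus> d \<otimes> \<pi>) = a \<otimes> (c \<oplus> d \<otimes> \<pi>) \<oplus> b \<otimes> (\<pi> \<otimes> (c \<oplus> d \<otimes> \<pi>))"
      using that by (simp add: l_distr m_assoc)
    then show ?thesis unfolding 1 using that by (simp add: l_distr r_distr m_assoc a_ac)
  qed
  assume "r \<in> carrier R" "s \<in> carrier R"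
  then obtain a b c d where ab: "a \<in> W" "b \<in> W" "r = a \<oplus> b \<otimes> \<pi>" and cd: "c \<in> W" "d \<in> W" "s = c \<oplus> d \<otimes> \<pi>"
    using decompose by metis
  have "anti (r \<otimes> s) = (a \<otimes> c \<oplus> b \<otimes> \<sigma> d \<otimes> pi2) \<oplus> \<sigma> (a \<otimes> d \<oplus> b \<otimes> \<sigma> c) \<otimes> \<pi>"
    unfolding ab(3) cd(3) prod[OF ab(1,2) cd(1,2)] using ab cd by (intro anti_eq) simp_all
  also have "\<dots> = (c \<otimes> a \<oplus> \<sigma> d \<otimes> \<sigma> (\<sigma> b) \<otimes> pi2) \<oplus> (c \<otimes> \<sigma> b \<oplus> \<sigma> d \<otimes> \<sigma> a) \<otimes> \<pi>"
    using ab cd W_comm[of a c] W_comm[of b "\<sigma> d"] W_comm[of "\<sigma> a" "\<sigma> d"] W_comm[of "\<sigma> b" c]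
    by (simp add: sigma_add sigma_mult a_comm[of "\<sigma> d \<otimes> \<sigma> a"])
  also have "\<dots> = anti s \<otimes> anti r"
    unfolding ab(3) cd(3) anti_eq[OF ab(1,2)] anti_eq[OF cd(1,2)]
    using prod[of c "\<sigma> d" a "\<sigma> b"] ab cd by simp
  finally show ?thesis .
qed

lemma anti_image: "anti ` carrier R = carrier R"
proof (intro equalityI subsetI)
  show "x \<in> carrier R" if "x \<in> anti ` carrier R" for x using that by auto
  show "x \<in> anti ` carrier R" if "x \<in> carrier R" for x
    by (rule image_eqI[of _ _ "anti x"]) (simp_all add: that)
qed

lemma anti_image_eqI:
  assumes "A \<subseteq> carrier R" "anti ` A \<subseteq> A"
  shows "anti ` A = A"
proof (rule equalityI[OF assms(2)], rule subsetI)
  fix x assume x: "x \<in> A"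
  then have "x \<in> carrier R" "anti x \<in> A" using assms by blast+
  then show "x \<in> anti ` A" by (intro image_eqI[of _ _ "anti x"]) simp_all
qed

lemma anti_generated: "anti ` generated True = generated True"
proof -
  have "anti ` generated True \<subseteq> generated True"
  proof
    fix x assume "x \<in> anti ` generated True"
    then obtain r where r: "r \<in> carrier R" "x = anti (\<pi> \<otimes> r)" by (auto simp: generated_True)
    then show "x \<in> generated True" by (auto simp: anti_mult generated_def generator_def)
  qed
  moreover have "generated True \<subseteq> carrier R" by (auto simp: generated_def)
  ultimately show ?thesis by (intro anti_image_eqI)
qed

lemma anti_pi2_ideal: "anti ` pi2_ideal = pi2_ideal"
proof -
  have "anti ` pi2_ideal \<subseteq> pi2_ideal"
  proof
    fix x assume "x \<in> anti ` pi2_ideal"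
    then obtain r where r: "r \<in> carrier R" "x = anti (pi2 \<otimes> r)" by (auto simp: pi2_ideal_def)
    then have "x = pi2 \<otimes> anti r" using anti_mult[of pi2 r] anti_W[of pi2] pi2_comm[of "anti r"] by simp
    then show "x \<in> pi2_ideal" using r by (auto simp: pi2_ideal_def)
  qed
  moreover have "pi2_ideal \<subseteq> carrier R" by (auto simp: pi2_ideal_def)
  ultimately show ?thesis by (intro anti_image_eqI)
qed

lemma anti_class:
  assumes "anti ` I = I" "I \<subseteq> carrier R" "A \<in> carrier (R Quot I)"
  shows "anti ` A \<in> carrier (R Quot I)" "anti ` anti ` A = A" "A \<subseteq> carrier R"
proof -
  obtain a where a: "a \<in> carrier R" "A = I +> a" using assms(3) by (auto simp: carrier_FactRing)
  have "anti ` A = I +> anti a"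
    using a_r_coset_image[of R anti R I a] anti_add assms a by simp
  then show "anti ` A \<in> carrier (R Quot I)" using a(1) by (simp add: carrier_FactRing)
  show s: "A \<subseteq> carrier R" using a_r_coset_subset_G[OF assms(2) a(1)] a(2) by simp
  have "(\<lambda>x. anti (anti x)) ` A = (\<lambda>x. x) ` A" using s by (intro image_cong) auto
  then show "anti ` anti ` A = A" by (simp add: image_image)
qed

text \<open>Exchanges the left and the right action. Because \<open>anti\<close> reverses products,
  a right action composed with it is a left action, and the outcome is again a bimodule over
  \<open>R\<close>.\<close>

definition twist :: "('a, 'a, 'm) bimodule \<Rightarrow> ('a, 'a, 'm) bimodule" where
  "twist L = L\<lparr>module.smult := (\<lambda>a x. x \<star>\<^sub>L anti a), rsmult := (\<lambda>x a. anti a \<odot>\<^sub>L x)\<rparr>"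

lemma twist_simps [simp]:
  "carrier (twist L) = carrier L" "ring.add (twist L) = ring.add L" "\<zero>\<^bsub>twist L\<^esub> = \<zero>\<^sub>L"
  "a \<odot>\<^bsub>twist L\<^esub> x = x \<star>\<^sub>L anti a" "x \<star>\<^bsub>twist L\<^esub> a = anti a \<odot>\<^sub>L x"
  "finsum (twist L) = finsum L" "(+>\<^bsub>twist L\<^esub>) = (+>\<^sub>L)" "add_monoid (twist L) = add_monoid L"
  "a_rcosets\<^bsub>twist L\<^esub> N = a_rcosets\<^bsub>L\<^esub> N" "set_add (twist L) = set_add L"
  by (simp_all add: twist_def finsum_def fun_eq_iff a_r_coset_def r_coset_def A_RCOSETS_def RCOSETS_def set_add_def set_mult_def)

lemma twist_bimodule:
  assumes "bimodule R R L"
  shows "bimodule R R (twist L)"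
proof -
  interpret L: bimod R R L using assms by (simp add: bimod_def)
  have "abelian_group (twist L)"
  proof (rule abelian_groupI)
    fix x assume "x \<in> carrier (twist L)"
    then show "\<exists>y\<in>carrier (twist L). y \<oplus>\<^bsub>twist L\<^esub> x = \<zero>\<^bsub>twist L\<^esub>"
      by (intro bexI[of _ "\<ominus>\<^sub>L x"]) (simp_all add: L.l_neg)
  qed (simp_all add: L.a_ac)
  then show ?thesis using ring_axioms unfolding bimodule_def left_module_def
    by (intro conjI ballI) (simp_all add: anti_add anti_mult L.smult_l_distr L.smult_r_distr L.smult_assoc
        L.rsmult_l_distr L.rsmult_r_distr L.rsmult_assoc L.smult_rsmult)
qed

text \<open>On \<open>Z\<close> the anti-involution is the identity and the two actions agree, so
  the twist has the same \<open>Z\<close>-module structure and the same dual basis serves.\<close>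

lemma twist_lat:
  fixes L :: "('a, 'a, 'm) bimodule"
  assumes "lat L"
  shows "lat (twist L)"
proof -
  interpret L: lattice_bimod R Z W \<sigma> \<pi> w u L by fact
  interpret T: bimod R R "twist L" using twist_bimodule[OF L.M.bimodule] by (simp add: bimod_def)
  have z: "z \<odot>\<^bsub>twist L\<^esub> x = z \<odot>\<^sub>L x" if "z \<in> Z" "x \<in> carrier L" for z x
    using that L.central[of z x] by simp
  obtain I e \<nu> where d: "dual_basis L (I :: 'm set) e \<nu>" using L.dual by blast
  have e: "e i \<in> carrier L" "Zlinear L (\<nu> i)" if "i \<in> I" for i using d that by (auto simp: dual_basis_def)
  have "dual_basis (twist L) I e \<nu>"
    unfolding dual_basis_def
  proof (intro conjI ballI)
    show "finite I" "e \<in> I \<rightarrow> carrier (twist L)" using d by (simp_all add: dual_basis_def)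
    show "Zlinear (twist L) (\<nu> i)" if "i \<in> I" for i
      using e(2)[OF that] z unfolding Zlinear_def twist_simps(1,2) by metis
    fix x assume x: "x \<in> carrier (twist L)"
    have "finsum L (\<lambda>i. \<nu> i x \<odot>\<^bsub>twist L\<^esub> e i) I = finsum L (\<lambda>i. \<nu> i x \<odot>\<^sub>L e i) I"
      using x e z by (intro L.M.finsum_cong') (auto simp: Zlinear_def simp del: twist_simps(4))
    note this[symmetric]
    moreover have "x = finsum L (\<lambda>i. \<nu> i x \<odot>\<^sub>L e i) I" using d x by (simp only: dual_basis_def twist_simps(1))
    ultimately show "x = finsum (twist L) (\<lambda>i. \<nu> i x \<odot>\<^bsub>twist L\<^esub> e i) I"
      unfolding twist_simps(6) by (rule trans[rotated])
  qed
  moreover have "z \<odot>\<^bsub>twist L\<^esub> x = x \<star>\<^bsub>twist L\<^esub> z" if "z \<in> Z" "x \<in> carrier L" for z x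
    unfolding z[OF that] using that by simp
  ultimately show ?thesis
    by (intro lattice_bimod.intro lattice_bimod_axioms.intro quat_order_axioms T.bimod_axioms) auto
qed

text \<open>The same maps are isomorphisms before and after twisting: as \<open>anti\<close>
  permutes the ring, equivariance for all \<open>anti a\<close> is equivariance for all
  \<open>a\<close>.\<close>

lemma twist_isomorphic:
  fixes L :: "('a, 'a, 'm) bimodule" and L' :: "('a, 'a, 'n) bimodule"
  shows "bimodule_isomorphic R R (twist L) (twist L') \<longleftrightarrow> bimodule_isomorphic R R L L'"
proof -
  have all: "(\<forall>a\<in>carrier R. P (anti a)) \<longleftrightarrow> (\<forall>a\<in>carrier R. P a)" for P
    using anti_image by (metis image_iff)
  have e1: "(\<forall>a\<in>carrier R. \<forall>x\<in>carrier L. f (x \<star>\<^sub>L anti a) = f x \<star>\<^sub>L' anti a) \<longleftrightarrow>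
      (\<forall>x\<in>carrier L. \<forall>a\<in>carrier R. f (x \<star>\<^sub>L a) = f x \<star>\<^sub>L' a)" for f :: "'m \<Rightarrow> 'n"
    using all[of "\<lambda>a. \<forall>x\<in>carrier L. f (x \<star>\<^sub>L a) = f x \<star>\<^sub>L' a"] by blast
  have e2: "(\<forall>x\<in>carrier L. \<forall>a\<in>carrier R. f (anti a \<odot>\<^sub>L x) = anti a \<odot>\<^sub>L' f x) \<longleftrightarrow>
      (\<forall>a\<in>carrier R. \<forall>x\<in>carrier L. f (a \<odot>\<^sub>L x) = a \<odot>\<^sub>L' f x)" for f :: "'m \<Rightarrow> 'n"
    using all[of "\<lambda>a. \<forall>x\<in>carrier L. f (a \<odot>\<^sub>L x) = a \<odot>\<^sub>L' f x"] by blast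
  show ?thesis unfolding bimodule_isomorphic_def twist_simps e1 e2 by (simp only: conj_ac)
qed

text \<open>The maximal ideal is stable under \<open>anti\<close>, through which right products
  become left products in the twist.\<close>

lemma times_ideal_twist: "times_ideal L (generated True) = ideal_times (generated True) (twist L)"
proof -
  have "{x \<star>\<^sub>L b |x b. x \<in> carrier L \<and> b \<in> generated True} = {x \<star>\<^sub>L anti a |a x. a \<in> generated True \<and> x \<in> carrier L}"
    (is "?A = ?B")
  proof (intro equalityI subsetI)
    fix v assume "v \<in> ?A"
    then obtain x b where v: "v = x \<star>\<^sub>L b" "x \<in> carrier L" "b \<in> anti ` generated True" unfolding anti_generated by blast
    then show "v \<in> ?B" by blast
  next
    fix v assume "v \<in> ?B"
    then obtain x a where v: "v = x \<star>\<^sub>L anti a" "x \<in> carrier L" "anti a \<in> anti ` generated True" by blast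
    then show "v \<in> ?A" unfolding anti_generated by blast
  qed
  then show ?thesis by (simp add: times_ideal_def ideal_times_def)
qed

lemma quotient_twist:
  "A \<odot>\<^bsub>quotient_bimodule (twist L) N\<^esub> C = C \<star>\<^bsub>quotient_bimodule L N\<^esub> (anti ` A)"
  "C \<star>\<^bsub>quotient_bimodule (twist L) N\<^esub> A = (anti ` A) \<odot>\<^bsub>quotient_bimodule L N\<^esub> C"
  "carrier (quotient_bimodule (twist L) N) = carrier (quotient_bimodule L N)"
  "C \<oplus>\<^bsub>quotient_bimodule (twist L) N\<^esub> D = C \<oplus>\<^bsub>quotient_bimodule L N\<^esub> D"
  by (auto simp: quotient_bimodule_def)

text \<open>A residue class acts on the quotient of the twist through its image under
  \<open>anti\<close>. Both ideals are stable, so \<open>anti\<close> permutes the classes modulo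
  each of them, and the two residue rings trade sides.\<close>

lemma quotient_twist_isomorphic:
  fixes L :: "('a, 'a, 'm) bimodule" and L' :: "('a, 'a, 'n) bimodule"
  shows "bimodule_isomorphic RP Rpi2 (quotient_bimodule (twist L) N) (quotient_bimodule (twist L') N') \<longleftrightarrow>
   bimodule_isomorphic Rpi2 RP (quotient_bimodule L N) (quotient_bimodule L' N')"
proof -
  have all: "(\<forall>A\<in>carrier (R Quot I). P (anti ` A)) \<longleftrightarrow> (\<forall>A\<in>carrier (R Quot I). P A)"
    if "anti ` I = I" "I \<subseteq> carrier R" for P I
    using anti_class[OF that] by metis
  have g: "generated True \<subseteq> carrier R" "pi2_ideal \<subseteq> carrier R" by (auto simp: generated_def pi2_ideal_def)
  let ?Q = "quotient_bimodule L N" and ?Q' = "quotient_bimodule L' N'"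
  have e1: "(\<forall>A\<in>carrier RP. \<forall>x\<in>carrier ?Q. f (x \<star>\<^sub>?Q (anti ` A)) = f x \<star>\<^sub>?Q' (anti ` A)) \<longleftrightarrow>
      (\<forall>x\<in>carrier ?Q. \<forall>A\<in>carrier RP. f (x \<star>\<^sub>?Q A) = f x \<star>\<^sub>?Q' A)" for f :: "'m set \<Rightarrow> 'n set"
    using all[OF anti_generated g(1), of "\<lambda>A. \<forall>x\<in>carrier ?Q. f (x \<star>\<^sub>?Q A) = f x \<star>\<^sub>?Q' A"] by blast
  have e2: "(\<forall>x\<in>carrier ?Q. \<forall>A\<in>carrier Rpi2. f ((anti ` A) \<odot>\<^sub>?Q x) = (anti ` A) \<odot>\<^sub>?Q' f x) \<longleftrightarrow>
      (\<forall>A\<in>carrier Rpi2. \<forall>x\<in>carrier ?Q. f (A \<odot>\<^sub>?Q x) = A \<odot>\<^sub>?Q' f x)" for f :: "'m set \<Rightarrow> 'n set"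
    using all[OF anti_pi2_ideal g(2), of "\<lambda>A. \<forall>x\<in>carrier ?Q. f (A \<odot>\<^sub>?Q x) = A \<odot>\<^sub>?Q' f x"] by blast
  show ?thesis unfolding bimodule_isomorphic_def quotient_twist e1 e2 by (simp only: conj_ac)
qed

end

theorem (in quat_bimodules) isomorphic_iff_left_reduction:
  assumes L: "lat L" and L': "lat L'"
  shows "bimodule_isomorphic R R L L' \<longleftrightarrow> bimodule_isomorphic RP Rpi2
    (quotient_bimodule L (ideal_times (generated True) L)) (quotient_bimodule L' (ideal_times (generated True) L'))"
  unfolding ideal_times_pi[OF lat_bimodule[OF L]] ideal_times_pi[OF lat_bimodule[OF L']]
  by (rule isomorphic_iff_red[OF assms])

text \<open>The reduction of \<open>L\<close> on the right is the reduction on the left of its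
  twist, with the two actions exchanged.\<close>

theorem (in quat_bimodules) isomorphic_iff_right_reduction:
  fixes L :: "('a, 'a, 'm) bimodule" and L' :: "('a, 'a, 'n) bimodule"
  assumes L: "lat L" and L': "lat L'"
  shows "bimodule_isomorphic R R L L' \<longleftrightarrow> bimodule_isomorphic Rpi2 RP
    (quotient_bimodule L (times_ideal L (generated True))) (quotient_bimodule L' (times_ideal L' (generated True)))"
proof -
  note twist_isomorphic[of L L', symmetric]
  also note isomorphic_iff_left_reduction[OF twist_lat[OF L] twist_lat[OF L']]
  also note quotient_twist_isomorphic
  finally show ?thesis unfolding times_ideal_twist .
qed

section \<open>Free modules over the valuation ring\<close>

context quat_order
begin

text \<open>Freeness with coefficients inside the ring itself. A bilattice has its coefficients in
  the p-adic integers, acting through their embedding; \<open>free_iff_Zfree\<close> compares the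
  two.\<close>

definition Zfree :: "('a, 'a, 'm) bimodule \<Rightarrow> bool" where
  "Zfree L \<longleftrightarrow> (\<exists>B. finite B \<and> B \<subseteq> carrier L \<and>
     (\<forall>x\<in>carrier L. \<exists>!c. c \<in> B \<rightarrow>\<^sub>E Z \<and> x = finsum L (\<lambda>b. c b \<odot>\<^sub>L b) B))"

definition Zspans :: "('a, 'a, 'm) bimodule \<Rightarrow> 'm set \<Rightarrow> 'm set \<Rightarrow> bool" where
  "Zspans L B N \<longleftrightarrow> finite B \<and> B \<subseteq> carrier L \<and>
     (\<forall>x\<in>N. \<exists>c. c \<in> B \<rightarrow> Z \<and> x = finsum L (\<lambda>b. c b \<odot>\<^sub>L b) B)"

lemma (in bimod) finsum_lincomb_add:
  assumes "B \<subseteq> carrier M" "c \<in> B \<rightarrow> carrier R" "d \<in> B \<rightarrow> carrier R"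
  shows "finsum M (\<lambda>b. (c b \<oplus>\<^sub>R d b) \<odot>\<^sub>M b) B = finsum M (\<lambda>b. c b \<odot>\<^sub>M b) B \<oplus>\<^sub>M finsum M (\<lambda>b. d b \<odot>\<^sub>M b) B"
proof -
  interpret R: ring R by (rule left_ring)
  have m: "b \<in> carrier M" "c b \<in> carrier R" "d b \<in> carrier R" if "b \<in> B" for b using assms that by auto
  have "finsum M (\<lambda>b. (c b \<oplus>\<^sub>R d b) \<odot>\<^sub>M b) B = finsum M (\<lambda>b. c b \<odot>\<^sub>M b \<oplus>\<^sub>M d b \<odot>\<^sub>M b) B"
    using m by (intro finsum_cong') (auto simp: smult_l_distr)
  also have "\<dots> = finsum M (\<lambda>b. c b \<odot>\<^sub>M b) B \<oplus>\<^sub>M finsum M (\<lambda>b. d b \<odot>\<^sub>M b) B"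
    using m by (intro finsum_addf) auto
  finally show ?thesis .
qed

lemma (in bimod) finsum_lincomb_smult:
  assumes "B \<subseteq> carrier M" "c \<in> B \<rightarrow> carrier R" "a \<in> carrier R"
  shows "finsum M (\<lambda>b. (a \<otimes>\<^sub>R c b) \<odot>\<^sub>M b) B = a \<odot>\<^sub>M finsum M (\<lambda>b. c b \<odot>\<^sub>M b) B"
proof -
  have m: "b \<in> carrier M" "c b \<in> carrier R" if "b \<in> B" for b using assms that by auto
  have "finsum M (\<lambda>b. (a \<otimes>\<^sub>R c b) \<odot>\<^sub>M b) B = finsum M (\<lambda>b. a \<odot>\<^sub>M (c b \<odot>\<^sub>M b)) B"
    using m assms(3) by (intro finsum_cong') (auto simp: smult_assoc)
  also have "\<dots> = a \<odot>\<^sub>M finsum M (\<lambda>b. c b \<odot>\<^sub>M b) B"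
    using m assms(3) by (intro finsum_smult[symmetric]) auto
  finally show ?thesis .
qed

text \<open>Unique coordinates are automatically \<open>Z\<close>-linear, so a basis together with
  its coordinate functions is a dual basis indexed by itself. Arbitrary coefficient functions are
  restricted to the basis before uniqueness applies.\<close>

lemma Zfree_dual_basis:
  fixes L :: "('a, 'a, 'm) bimodule"
  assumes L: "bimodule R R L" and free: "Zfree L"
  shows "\<exists>(I :: 'm set) e \<nu>. dual_basis L I e \<nu>"
proof -
  interpret L: bimod R R L using L by (simp add: bimod_def)
  obtain B where B: "finite B" "B \<subseteq> carrier L"
    and "\<forall>x\<in>carrier L. \<exists>!c. c \<in> B \<rightarrow>\<^sub>E Z \<and> x = finsum L (\<lambda>b. c b \<odot>\<^sub>L b) B"
    using free unfolding Zfree_def by (elim exE conjE)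
  then have u: "\<And>x. x \<in> carrier L \<Longrightarrow> \<exists>!c. c \<in> B \<rightarrow>\<^sub>E Z \<and> x = finsum L (\<lambda>b. c b \<odot>\<^sub>L b) B" by (elim bspec)
  have "\<forall>x\<in>carrier L. \<exists>c. c \<in> B \<rightarrow>\<^sub>E Z \<and> x = finsum L (\<lambda>b. c b \<odot>\<^sub>L b) B"
    using ex1_implies_ex[OF u] by (rule ballI)
  from bchoice[OF this] obtain c where "\<forall>x\<in>carrier L. c x \<in> B \<rightarrow>\<^sub>E Z \<and> x = finsum L (\<lambda>b. c x b \<odot>\<^sub>L b) B" ..
  then have c: "c x \<in> B \<rightarrow>\<^sub>E Z" "x = finsum L (\<lambda>b. c x b \<odot>\<^sub>L b) B" if "x \<in> carrier L" for x
    using that by blast+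
  have cZ: "c x b \<in> Z" if "x \<in> carrier L" "b \<in> B" for x b using c(1) that by blast
  have uniq: "c x b = d b" if "x \<in> carrier L" "d \<in> B \<rightarrow> Z" "x = finsum L (\<lambda>b. d b \<odot>\<^sub>L b) B" "b \<in> B" for x d b
  proof -
    have "finsum L (\<lambda>b. restrict d B b \<odot>\<^sub>L b) B = finsum L (\<lambda>b. d b \<odot>\<^sub>L b) B"
      using that(2) B by (intro L.finsum_cong') (auto simp: Pi_iff subset_iff)
    then have "restrict d B \<in> B \<rightarrow>\<^sub>E Z \<and> x = finsum L (\<lambda>b. restrict d B b \<odot>\<^sub>L b) B" using that by auto
    then have "c x = restrict d B" using u[OF that(1)] c that(1) by blast
    then show ?thesis using that(4) by simp
  qed
  have "Zlinear L (\<lambda>x. c x b)" if b: "b \<in> B" for b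
    unfolding Zlinear_def
  proof (intro conjI ballI)
    show "c x b \<in> Z" if "x \<in> carrier L" for x using cZ b that by blast
    show "c (x \<oplus>\<^sub>L y) b = c x b \<oplus> c y b" if xy: "x \<in> carrier L" "y \<in> carrier L" for x y
    proof (rule uniq[of "x \<oplus>\<^sub>L y" "\<lambda>b. c x b \<oplus> c y b" b, OF _ _ _ b])
      have "finsum L (\<lambda>b. (c x b \<oplus> c y b) \<odot>\<^sub>L b) B = x \<oplus>\<^sub>L y"
        using c(2)[OF xy(1)] c(2)[OF xy(2)] cZ xy B(2) by (subst L.finsum_lincomb_add) auto
      then show "x \<oplus>\<^sub>L y = finsum L (\<lambda>b. (c x b \<oplus> c y b) \<odot>\<^sub>L b) B" by simp
    qed (use cZ xy in auto)
    show "c (z \<odot>\<^sub>L x) b = z \<otimes> c x b" if zx: "z \<in> Z" "x \<in> carrier L" for z x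
    proof (rule uniq[of "z \<odot>\<^sub>L x" "\<lambda>b. z \<otimes> c x b" b, OF _ _ _ b])
      have "finsum L (\<lambda>b. (z \<otimes> c x b) \<odot>\<^sub>L b) B = z \<odot>\<^sub>L x"
        using c(2)[OF zx(2)] cZ zx B(2) by (subst L.finsum_lincomb_smult) auto
      then show "z \<odot>\<^sub>L x = finsum L (\<lambda>b. (z \<otimes> c x b) \<odot>\<^sub>L b) B" by simp
    qed (use cZ zx in auto)
  qed
  then have "dual_basis L B (\<lambda>b. b) (\<lambda>b x. c x b)"
    unfolding dual_basis_def using B c(2) by blast
  then show ?thesis by blast
qed

text \<open>A nonzero coefficient of least valuation serves: each nonzero coefficient is a power of
  \<open>pi2\<close> times a unit, and the quotient is the remaining power times units.\<close>

lemma minimal_coefficient: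
  assumes "finite B" "\<And>b. b \<in> B \<Longrightarrow> d b \<in> Z" "b1 \<in> B" "d b1 \<noteq> \<zero>"
  obtains b0 where "b0 \<in> B" "d b0 \<noteq> \<zero>" "\<And>b. b \<in> B \<Longrightarrow> \<exists>e\<in>Z. d b = d b0 \<otimes> e"
proof -
  let ?S = "{b \<in> B. d b \<noteq> \<zero>}"
  let ?P = "\<lambda>b n v v'. v \<in> Z \<and> v' \<in> Z \<and> v \<otimes> v' = \<one> \<and> d b = pi2 [^] (n::nat) \<otimes> v"
  have "\<forall>b\<in>?S. \<exists>n v v'. ?P b n v v'"
  proof
    fix b assume "b \<in> ?S"
    then show "\<exists>n v v'. ?P b n v v'" using dvr[of "d b"] assms(2)[of b] by blast
  qed
  from bchoice[OF this] obtain n where n: "\<forall>b\<in>?S. \<exists>v v'. ?P b (n b) v v'" ..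
  have p: "pi2 [^] k \<in> Z" for k :: nat by (induction k) simp_all
  have "Min (n ` ?S) \<in> n ` ?S" using assms by (intro Min_in) auto
  then obtain b0 where b0: "b0 \<in> ?S" "n b0 = Min (n ` ?S)" by auto
  have "\<exists>e\<in>Z. d b = d b0 \<otimes> e" if b: "b \<in> B" for b
  proof (cases "d b = \<zero>")
    case True
    then show ?thesis using b0 assms(2) by (intro bexI[of _ \<zero>]) simp_all
  next
    case False
    then have bS: "b \<in> ?S" using b by simp
    have "n b0 \<le> n b" unfolding b0(2) using assms(1) bS by (intro Min_le) auto
    then obtain k where k: "n b = n b0 + k" using le_Suc_ex by blast
    obtain v where m: "v \<in> Z" "d b = pi2 [^] n b \<otimes> v" using n bS by blast
    obtain v0 v0' where m0: "v0 \<in> Z" "v0' \<in> Z" "v0 \<otimes> v0' = \<one>" "d b0 = pi2 [^] n b0 \<otimes> v0" using n b0(1) by blast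
    have "d b0 \<otimes> (v0' \<otimes> (pi2 [^] k \<otimes> v)) = pi2 [^] n b0 \<otimes> ((v0 \<otimes> v0') \<otimes> (pi2 [^] k \<otimes> v))"
      using m(1) m0(1,2) p unfolding m0(4) by (simp add: m_assoc)
    also have "\<dots> = pi2 [^] n b0 \<otimes> pi2 [^] k \<otimes> v" using m(1) m0(1-3) p by (simp add: m_assoc)
    also have "\<dots> = d b" unfolding m(2) k by (simp add: nat_pow_mult)
    finally show ?thesis using m(1) m0(2) p by (intro bexI[of _ "v0' \<otimes> (pi2 [^] k \<otimes> v)"]) simp_all
  qed
  then show thesis using that b0(1) by blast
qed

text \<open>A relation between generators is divided by its coefficient of least valuation, which
  torsion-freeness permits. That coefficient becomes 1, its generator can be eliminated, and the
  number of generators drops until no relation is left.\<close>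

lemma spanned_Zfree:
  fixes L :: "('a, 'a, 'm) bimodule"
  assumes L: "bimodule R R L" and tf: "\<And>z x. \<lbrakk>z \<in> Z; x \<in> carrier L; z \<odot>\<^sub>L x = \<zero>\<^sub>L\<rbrakk> \<Longrightarrow> z = \<zero> \<or> x = \<zero>\<^sub>L"
    and B: "Zspans L B (carrier L)"
  shows "Zfree L"
  using B
proof (induction "card B" arbitrary: B rule: less_induct)
  case less
  interpret L: bimod R R L using L by (simp add: bimod_def)
  have fin: "finite B" and sub: "B \<subseteq> carrier L" using less.prems by (auto simp: Zspans_def)
  have ex: "\<exists>c. c \<in> B \<rightarrow>\<^sub>E Z \<and> x = finsum L (\<lambda>b. c b \<odot>\<^sub>L b) B" if x: "x \<in> carrier L" for x
  proof -
    obtain c where c: "c \<in> B \<rightarrow> Z" "x = finsum L (\<lambda>b. c b \<odot>\<^sub>L b) B" using less.prems x by (auto simp: Zspans_def)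
    have "finsum L (\<lambda>b. restrict c B b \<odot>\<^sub>L b) B = finsum L (\<lambda>b. c b \<odot>\<^sub>L b) B"
      using c(1) sub by (intro L.finsum_cong') (auto simp: Pi_iff subset_iff)
    then show ?thesis using c by (intro exI[of _ "restrict c B"]) auto
  qed
  define F where "F c = finsum L (\<lambda>b. c b \<odot>\<^sub>L b) B" for c
  show ?case
  proof (cases "\<forall>c\<in>B \<rightarrow>\<^sub>E Z. \<forall>c'\<in>B \<rightarrow>\<^sub>E Z. F c = F c' \<longrightarrow> c = c'")
    case True
    have "\<exists>!c. c \<in> B \<rightarrow>\<^sub>E Z \<and> x = F c" if x: "x \<in> carrier L" for x
      using ex[OF x] True unfolding F_def[symmetric] by (intro ex_ex1I) simp_all
    then have "\<forall>x\<in>carrier L. \<exists>!c. c \<in> B \<rightarrow>\<^sub>E Z \<and> x = finsum L (\<lambda>b. c b \<odot>\<^sub>L b) B"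
      unfolding F_def by (rule ballI)
    then show ?thesis using fin sub unfolding Zfree_def by (intro exI[of _ B] conjI)
  next
    case False
    then obtain c c' where cc: "c \<in> B \<rightarrow>\<^sub>E Z" "c' \<in> B \<rightarrow>\<^sub>E Z" "c \<noteq> c'"
      "F c = F c'" by blast
    note cc4 = cc(4)[unfolded F_def]
    have cZ: "c b \<in> Z" "c' b \<in> Z" if "b \<in> B" for b using cc that by blast+
    have bL: "b \<in> carrier L" if "b \<in> B" for b using sub that by blast
    define d where "d b = c b \<oplus> (\<ominus> \<one>) \<otimes> c' b" for b
    have dZ: "d b \<in> Z" if "b \<in> B" for b using cZ[OF that] by (simp add: d_def)
    have cL: "finsum L (\<lambda>b. c' b \<odot>\<^sub>L b) B \<in> carrier L" using cZ bL by (intro L.finsum_closed) auto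
    have "finsum L (\<lambda>b. d b \<odot>\<^sub>L b) B = finsum L (\<lambda>b. c b \<odot>\<^sub>L b) B \<oplus>\<^sub>L (\<ominus> \<one>) \<odot>\<^sub>L finsum L (\<lambda>b. c' b \<odot>\<^sub>L b) B"
      unfolding d_def using cZ sub
      by (subst L.finsum_lincomb_add) (auto simp: L.finsum_lincomb_smult Pi_iff)
    also have "\<dots> = \<zero>\<^sub>L" unfolding cc4 using cL by (simp add: L.uminus_smult L.r_neg)
    finally have d0: "finsum L (\<lambda>b. d b \<odot>\<^sub>L b) B = \<zero>\<^sub>L" .
    obtain b1 where b1: "b1 \<in> B" "c b1 \<noteq> c' b1" using cc(1-3) by (metis PiE_ext)
    have "d b1 \<noteq> \<zero>"
    proof
      assume "d b1 = \<zero>"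
      then have "c b1 \<ominus> c' b1 = \<zero>" using cZ[OF b1(1)] by (simp add: d_def minus_eq l_minus)
      then show False using b1(2) cZ[OF b1(1)] by simp
    qed
    then obtain b0 where b0: "b0 \<in> B" "d b0 \<noteq> \<zero>" "\<And>b. b \<in> B \<Longrightarrow> \<exists>e\<in>Z. d b = d b0 \<otimes> e"
      using minimal_coefficient[of B d b1, OF fin dZ b1(1)] by blast
    then obtain e where e: "\<And>b. b \<in> B \<Longrightarrow> e b \<in> Z" "\<And>b. b \<in> B \<Longrightarrow> d b = d b0 \<otimes> e b" by metis
    have "d b0 \<otimes> e b0 = d b0 \<otimes> \<one>" using e(2)[OF b0(1)] dZ[OF b0(1)] by simp
    then have "e b0 \<otimes> d b0 = \<one> \<otimes> d b0" using W_comm[of "d b0" "e b0"] dZ[OF b0(1)] e(1)[OF b0(1)] by simp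
    then have e0: "e b0 = \<one>" using cancel_right[of "e b0" \<one> "d b0"] dZ[OF b0(1)] e(1)[OF b0(1)] b0(2) by simp
    have eL: "finsum L (\<lambda>b. e b \<odot>\<^sub>L b) B \<in> carrier L" using e(1) bL by (intro L.finsum_closed) auto
    have "finsum L (\<lambda>b. (d b0 \<otimes> e b) \<odot>\<^sub>L b) B = d b0 \<odot>\<^sub>L finsum L (\<lambda>b. e b \<odot>\<^sub>L b) B"
      using e(1) sub dZ[OF b0(1)] by (intro L.finsum_lincomb_smult) auto
    moreover have "finsum L (\<lambda>b. (d b0 \<otimes> e b) \<odot>\<^sub>L b) B = finsum L (\<lambda>b. d b \<odot>\<^sub>L b) B"
      using e dZ bL by (intro L.finsum_cong') auto
    ultimately have "d b0 \<odot>\<^sub>L finsum L (\<lambda>b. e b \<odot>\<^sub>L b) B = \<zero>\<^sub>L" using d0 by simp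
    then have es: "finsum L (\<lambda>b. e b \<odot>\<^sub>L b) B = \<zero>\<^sub>L" using tf[OF dZ[OF b0(1)] eL] b0(2) by blast
    have "Zspans L (B - {b0}) (carrier L)"
      unfolding Zspans_def
    proof (intro conjI ballI)
      show "finite (B - {b0})" "B - {b0} \<subseteq> carrier L" using fin sub by auto
      fix x assume x: "x \<in> carrier L"
      obtain a where a: "a \<in> B \<rightarrow>\<^sub>E Z" "x = finsum L (\<lambda>b. a b \<odot>\<^sub>L b) B" using ex[OF x] by blast
      have aZ: "a b \<in> Z" if "b \<in> B" for b using a(1) that by blast
      define f where "f b = a b \<oplus> (\<ominus> a b0) \<otimes> e b" for b
      have fZ: "f b \<in> Z" if "b \<in> B" for b using aZ[OF that] aZ[OF b0(1)] e(1)[OF that] by (simp add: f_def)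
      have "finsum L (\<lambda>b. f b \<odot>\<^sub>L b) B = x \<oplus>\<^sub>L (\<ominus> a b0) \<odot>\<^sub>L finsum L (\<lambda>b. e b \<odot>\<^sub>L b) B"
        unfolding f_def using aZ e(1) sub aZ[OF b0(1)] a(2)
        by (subst L.finsum_lincomb_add) (auto simp: L.finsum_lincomb_smult Pi_iff)
      also have "\<dots> = x" unfolding es using aZ[OF b0(1)] x by simp
      finally have "x = finsum L (\<lambda>b. f b \<odot>\<^sub>L b) (insert b0 (B - {b0}))" using b0(1) by (simp add: insert_absorb)
      also have "\<dots> = f b0 \<odot>\<^sub>L b0 \<oplus>\<^sub>L finsum L (\<lambda>b. f b \<odot>\<^sub>L b) (B - {b0})"
        using fin fZ bL b0(1) by (intro L.finsum_insert) auto
      also have "f b0 = \<zero>" using e0 aZ[OF b0(1)] by (simp add: f_def r_neg)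
      also have "\<zero> \<odot>\<^sub>L b0 \<oplus>\<^sub>L finsum L (\<lambda>b. f b \<odot>\<^sub>L b) (B - {b0}) = finsum L (\<lambda>b. f b \<odot>\<^sub>L b) (B - {b0})"
      proof -
        have "finsum L (\<lambda>b. f b \<odot>\<^sub>L b) (B - {b0}) \<in> carrier L" using fZ bL by (intro L.finsum_closed) auto
        then show ?thesis using bL[OF b0(1)] by simp
      qed
      finally show "\<exists>c. c \<in> (B - {b0}) \<rightarrow> Z \<and> x = finsum L (\<lambda>b. c b \<odot>\<^sub>L b) (B - {b0})" using fZ by blast
    qed
    moreover have "card (B - {b0}) < card B" using fin b0(1) by (intro psubset_card_mono) auto
    ultimately show ?thesis using less.hyps by blast
  qed
qed

lemma Zspans_superset:
  assumes L: "bimodule R R L" and B: "Zspans L B N" and B': "finite B'" "B \<subseteq> B'" "B' \<subseteq> carrier L"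
  shows "Zspans L B' N"
proof -
  interpret L: bimod R R L using L by (simp add: bimod_def)
  have "\<exists>c. c \<in> B' \<rightarrow> Z \<and> x = finsum L (\<lambda>b. c b \<odot>\<^sub>L b) B'" if x: "x \<in> N" for x
  proof -
    obtain c where c: "c \<in> B \<rightarrow> Z" "x = finsum L (\<lambda>b. c b \<odot>\<^sub>L b) B" using B x by (auto simp: Zspans_def)
    let ?c = "\<lambda>b. if b \<in> B then c b else \<zero>"
    have "x = finsum L (\<lambda>b. ?c b \<odot>\<^sub>L b) B'" unfolding c(2)
      using B' c(1) by (intro L.add.finprod_mono_neutral_cong_left) (auto simp: Pi_iff subset_iff)
    then show ?thesis using c(1) by (intro exI[of _ ?c]) auto
  qed
  then show ?thesis using B' by (simp add: Zspans_def)
qed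

lemma Zspans_sum:
  assumes L: "bimodule R R L" and B: "Zspans L B N" "Zspans L B' N'"
    and all: "\<And>x. x \<in> N'' \<Longrightarrow> \<exists>y\<in>N. \<exists>z\<in>N'. x = y \<oplus>\<^sub>L z"
  shows "Zspans L (B \<union> B') N''"
proof -
  interpret L: bimod R R L using L by (simp add: bimod_def)
  have f: "finite (B \<union> B')" "B \<union> B' \<subseteq> carrier L" using B by (auto simp: Zspans_def)
  have s: "Zspans L (B \<union> B') N" "Zspans L (B \<union> B') N'"
    using Zspans_superset[OF L B(1) f(1) _ f(2)] Zspans_superset[OF L B(2) f(1) _ f(2)] by blast+
  have "\<exists>c. c \<in> B \<union> B' \<rightarrow> Z \<and> x = finsum L (\<lambda>b. c b \<odot>\<^sub>L b) (B \<union> B')" if x: "x \<in> N''" for x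
  proof -
    obtain y z where yz: "y \<in> N" "z \<in> N'" "x = y \<oplus>\<^sub>L z" using all[OF x] by blast
    obtain c where c: "c \<in> B \<union> B' \<rightarrow> Z" "y = finsum L (\<lambda>b. c b \<odot>\<^sub>L b) (B \<union> B')"
      using s(1) yz(1) unfolding Zspans_def by blast
    obtain d where d: "d \<in> B \<union> B' \<rightarrow> Z" "z = finsum L (\<lambda>b. d b \<odot>\<^sub>L b) (B \<union> B')"
      using s(2) yz(2) unfolding Zspans_def by blast
    have "x = finsum L (\<lambda>b. (c b \<oplus> d b) \<odot>\<^sub>L b) (B \<union> B')" unfolding yz(3) c(2) d(2)
      using c(1) d(1) f(2) by (intro L.finsum_lincomb_add[symmetric]) (auto simp: Pi_iff)
    then show ?thesis using c(1) d(1) by (intro exI[of _ "\<lambda>b. c b \<oplus> d b"]) (auto simp: Pi_iff)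
  qed
  then show ?thesis using f by (simp add: Zspans_def)
qed

lemma Zspans_image:
  assumes L: "bimodule R R L" and M: "bimodule R R M" and f: "Zhom L M f" "inj_on f (carrier L)"
    and B: "Zspans L B (carrier L)"
  shows "Zspans M (f ` B) (f ` carrier L)"
proof -
  interpret M: bimod R R M using M by (simp add: bimod_def)
  interpret L: bimod R R L using L by (simp add: bimod_def)
  have fin: "finite B" and sub: "B \<subseteq> carrier L" using B by (auto simp: Zspans_def)
  have injB: "inj_on f B" using inj_on_subset[OF f(2) sub] .
  have fc: "f x \<in> carrier M" if "x \<in> carrier L" for x using f(1) that by (auto simp: Zhom_def)
  have "\<exists>c. c \<in> f ` B \<rightarrow> Z \<and> f x = finsum M (\<lambda>b. c b \<odot>\<^sub>M b) (f ` B)" if x: "x \<in> carrier L" for x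
  proof -
    obtain c where c: "c \<in> B \<rightarrow> Z" "x = finsum L (\<lambda>b. c b \<odot>\<^sub>L b) B" using B x by (auto simp: Zspans_def)
    let ?c = "\<lambda>y. c (inv_into B f y)"
    have "f x = finsum M (\<lambda>b. f (c b \<odot>\<^sub>L b)) B" unfolding c(2)
      using c(1) sub by (intro Zhom_finsum[OF f(1) L M]) (auto simp: Pi_iff subset_iff)
    also have "\<dots> = finsum M (\<lambda>b. ?c (f b) \<odot>\<^sub>M f b) B"
      using c(1) sub f(1) fc injB by (intro M.finsum_cong') (auto simp: Zhom_def Pi_iff subset_iff)
    also have "\<dots> = finsum M (\<lambda>b. ?c b \<odot>\<^sub>M b) (f ` B)"
      using c(1) sub fc injB by (intro M.finsum_reindex[symmetric]) (auto simp: Pi_iff subset_iff)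
    finally show ?thesis using c(1) injB by (intro exI[of _ ?c]) (auto simp: Pi_iff)
  qed
  then show ?thesis using fin sub fc by (auto simp: Zspans_def)
qed

end

section \<open>The ring of p-adic integers\<close>

locale padic =
  fixes p :: nat
  assumes prime_p: "Factorial_Ring.prime p"
begin

abbreviation ZZ where "ZZ \<equiv> Zp p"

definition pz :: "nat \<Rightarrow> int" where "pz n = int p mod int p ^ n"

lemma p_gt: "int p > 1" using prime_p prime_gt_1_nat by simp

lemma p_pos: "int p ^ n > 0" using p_gt by simp

lemma Zp_simps:
  "x \<in> carrier ZZ \<longleftrightarrow> (\<forall>n. 0 \<le> x n \<and> x n < int p ^ n \<and> x (Suc n) mod int p ^ n = x n)"
  "(x \<otimes>\<^sub>ZZ y) n = (x n * y n) mod int p ^ n" "(x \<oplus>\<^sub>ZZ y) n = (x n + y n) mod int p ^ n"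
  "\<one>\<^sub>ZZ n = 1 mod int p ^ n" "\<zero>\<^sub>ZZ n = 0"
  by (simp_all add: Zp_def)

lemma mod_Suc: "a mod int p ^ Suc n mod int p ^ n = a mod int p ^ n"
  by (rule mod_mod_cancel) (simp add: le_imp_power_dvd)

lemma Zp_mod: "x \<in> carrier ZZ \<Longrightarrow> x n mod int p ^ n = x n"
  by (simp add: Zp_simps)

lemma Zp_mod_Suc: "x \<in> carrier ZZ \<Longrightarrow> x (Suc n) mod int p ^ n = x n"
  by (simp add: Zp_simps)

lemma Zp_closedI: "(\<And>n. f (Suc n) mod int p ^ n = f n mod int p ^ n) \<Longrightarrow> (\<lambda>n. f n mod int p ^ n) \<in> carrier ZZ"
  using p_pos mod_Suc by (simp add: Zp_simps)

lemma Zp_add_closed: "\<lbrakk>x \<in> carrier ZZ; y \<in> carrier ZZ\<rbrakk> \<Longrightarrow> x \<oplus>\<^sub>ZZ y \<in> carrier ZZ"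
proof -
  assume h: "x \<in> carrier ZZ" "y \<in> carrier ZZ"
  have "x \<oplus>\<^sub>ZZ y = (\<lambda>n. (x n + y n) mod int p ^ n)" by (simp add: fun_eq_iff Zp_simps)
  also have "\<dots> \<in> carrier ZZ"
    by (rule Zp_closedI) (metis Zp_mod_Suc[OF h(1)] Zp_mod_Suc[OF h(2)] mod_add_eq)
  finally show ?thesis .
qed

lemma Zp_mult_closed: "\<lbrakk>x \<in> carrier ZZ; y \<in> carrier ZZ\<rbrakk> \<Longrightarrow> x \<otimes>\<^sub>ZZ y \<in> carrier ZZ"
proof -
  assume h: "x \<in> carrier ZZ" "y \<in> carrier ZZ"
  have "x \<otimes>\<^sub>ZZ y = (\<lambda>n. (x n * y n) mod int p ^ n)" by (simp add: fun_eq_iff Zp_simps)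
  also have "\<dots> \<in> carrier ZZ"
    by (rule Zp_closedI) (metis Zp_mod_Suc[OF h(1)] Zp_mod_Suc[OF h(2)] mod_mult_eq)
  finally show ?thesis .
qed

lemma Zp_one_closed: "\<one>\<^sub>ZZ \<in> carrier ZZ"
proof -
  have "\<one>\<^sub>ZZ = (\<lambda>n. 1 mod int p ^ n)" by (simp add: fun_eq_iff Zp_simps)
  then show ?thesis using Zp_closedI[of "\<lambda>_. 1"] by simp
qed

lemma Zp_cring: "cring ZZ"
proof (rule cringI)
  show "abelian_group ZZ"
  proof (rule abelian_groupI)
    show "\<zero>\<^sub>ZZ \<in> carrier ZZ" using p_pos by (simp add: Zp_simps)
    show "x \<oplus>\<^sub>ZZ y \<oplus>\<^sub>ZZ z = x \<oplus>\<^sub>ZZ (y \<oplus>\<^sub>ZZ z)" for x y z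
      by (simp add: fun_eq_iff Zp_simps mod_simps add.assoc)
    show "x \<oplus>\<^sub>ZZ y = y \<oplus>\<^sub>ZZ x" for x y by (simp add: fun_eq_iff Zp_simps add.commute)
    show "\<zero>\<^sub>ZZ \<oplus>\<^sub>ZZ x = x" if "x \<in> carrier ZZ" for x
      using Zp_mod[OF that] by (simp add: fun_eq_iff Zp_simps)
    fix x assume x: "x \<in> carrier ZZ"
    have "(\<lambda>n. (- x n) mod int p ^ n) \<in> carrier ZZ"
      by (rule Zp_closedI) (metis Zp_mod_Suc[OF x] mod_minus_eq)
    moreover have "(\<lambda>n. (- x n) mod int p ^ n) \<oplus>\<^sub>ZZ x = \<zero>\<^sub>ZZ"
      by (simp add: fun_eq_iff Zp_simps mod_simps)
    ultimately show "\<exists>y\<in>carrier ZZ. y \<oplus>\<^sub>ZZ x = \<zero>\<^sub>ZZ" by blast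
  qed (rule Zp_add_closed)
  show "Group.comm_monoid ZZ"
  proof (rule comm_monoidI)
    show "x \<otimes>\<^sub>ZZ y \<otimes>\<^sub>ZZ z = x \<otimes>\<^sub>ZZ (y \<otimes>\<^sub>ZZ z)" for x y z
      by (simp add: fun_eq_iff Zp_simps mod_simps mult.assoc)
    show "x \<otimes>\<^sub>ZZ y = y \<otimes>\<^sub>ZZ x" for x y by (simp add: fun_eq_iff Zp_simps mult.commute)
    show "\<one>\<^sub>ZZ \<otimes>\<^sub>ZZ x = x" if "x \<in> carrier ZZ" for x
      using Zp_mod[OF that] by (simp add: fun_eq_iff Zp_simps mod_simps)
  qed (rule Zp_mult_closed Zp_one_closed; assumption)+
  show "(x \<oplus>\<^sub>ZZ y) \<otimes>\<^sub>ZZ z = x \<otimes>\<^sub>ZZ z \<oplus>\<^sub>ZZ y \<otimes>\<^sub>ZZ z" for x y z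
    by (simp add: fun_eq_iff Zp_simps mod_simps distrib_right)
qed

sublocale Zp: cring ZZ by (rule Zp_cring)

lemma pz_closed [simp]: "pz \<in> carrier ZZ"
proof -
  have "pz = (\<lambda>n. int p mod int p ^ n)" by (simp add: fun_eq_iff pz_def)
  then show ?thesis using Zp_closedI[of "\<lambda>_. int p"] by simp
qed

lemma pz_pow: "(pz [^]\<^sub>ZZ (k::nat)) n = int p ^ k mod int p ^ n"
  by (induction k) (simp_all add: Zp_simps pz_def mod_simps mult.commute)

text \<open>Division by p costs one digit of precision: the quotient modulo p^n is computed from
  \<open>x\<close> modulo p^(n + 1), hence the shift of the index.\<close>

lemma Zp_divide_p:
  assumes x: "x \<in> carrier ZZ" and x1: "x 1 = 0"
  obtains y where "y \<in> carrier ZZ" "x = pz \<otimes>\<^sub>ZZ y" "\<And>n. y n = x (Suc n) div int p"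
proof -
  define y where "y n = x (Suc n) div int p" for n
  have xm: "x (n + k) mod int p ^ n = x n" for n k
  proof (induction k)
    case 0 show ?case using Zp_mod[OF x] by simp
  next
    case (Suc k)
    have "x (n + Suc k) mod int p ^ n = x (Suc (n + k)) mod int p ^ (n + k) mod int p ^ n"
      by (simp add: mod_mod_cancel le_imp_power_dvd)
    then show ?case using Suc Zp_mod_Suc[OF x] by simp
  qed
  have dv: "int p dvd x (Suc n)" for n
    using xm[of 1 n] x1 by (simp add: dvd_eq_mod_eq_0)
  have "y \<in> carrier ZZ"
    unfolding Zp_simps(1)
  proof (intro allI conjI)
    fix n
    have b: "0 \<le> x (Suc n)" "x (Suc n) < int p * int p ^ n"
      using x[unfolded Zp_simps(1), rule_format, of "Suc n"] by simp_all
    obtain q' where q': "x (Suc n) = int p * q'" using dv[of n] by (auto simp: dvd_def)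
    have "y n = q'" using q' p_gt by (simp add: y_def)
    then show "0 \<le> y n" "y n < int p ^ n" using b p_gt unfolding q' by (simp_all add: zero_le_mult_iff)
    obtain q where q: "x (Suc (Suc n)) = int p * q" using dv[of "Suc n"] by (auto simp: dvd_def)
    have "x (Suc n) = (int p * q) mod (int p * int p ^ n)" using Zp_mod_Suc[OF x, of "Suc n"] q by simp
    also have "\<dots> = int p * (q mod int p ^ n)" by (rule mult_mod_right[symmetric])
    finally show "y (Suc n) mod int p ^ n = y n" using q p_gt by (simp add: y_def)
  qed
  moreover have "x = pz \<otimes>\<^sub>ZZ y"
  proof
    fix n
    have "(pz \<otimes>\<^sub>ZZ y) n = (int p * y n) mod int p ^ n" by (simp add: Zp_simps pz_def mod_simps)
    also have "int p * y n = x (Suc n)" using dv[of n] by (simp add: y_def)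
    finally show "x n = (pz \<otimes>\<^sub>ZZ y) n" using Zp_mod_Suc[OF x] by simp
  qed
  ultimately show thesis using that y_def by blast
qed

text \<open>Modulo each p^n the component is prime to p and has an inverse by Bezout. Inverses are
  unique modulo p^n, which makes the chosen ones compatible.\<close>

lemma Zp_unit:
  assumes x: "x \<in> carrier ZZ" and x1: "x 1 \<noteq> 0"
  obtains y where "y \<in> carrier ZZ" "x \<otimes>\<^sub>ZZ y = \<one>\<^sub>ZZ"
proof -
  have xm: "x (Suc n) mod int p = x 1" for n
  proof (induction n)
    case 0 show ?case using Zp_mod[OF x, of 1] by simp
  next
    case (Suc n)
    have "x (Suc (Suc n)) mod int p = x (Suc (Suc n)) mod int p ^ Suc n mod int p" by (simp add: mod_mod_cancel)
    then show ?case using Suc Zp_mod_Suc[OF x, of "Suc n"] by simp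
  qed
  have cop: "coprime (x n) (int p ^ n)" for n
  proof (cases n)
    case (Suc m)
    have "\<not> int p dvd x (Suc m)" using xm[of m] x1 by (simp add: dvd_eq_mod_eq_0)
    then have "coprime (int p) (x (Suc m))" using prime_p by (simp add: prime_imp_coprime)
    then show ?thesis using Suc by (simp add: coprime_commute)
  qed simp
  have "\<exists>z. (x n * z) mod int p ^ n = 1 mod int p ^ n" for n
  proof -
    obtain a b where "a * x n + b * int p ^ n = 1" using bezout_int[of "x n" "int p ^ n"] cop[of n] by auto
    then have "x n * a = 1 - b * int p ^ n" by (simp add: mult.commute)
    then have "(x n * a) mod int p ^ n = (1 - b * int p ^ n) mod int p ^ n" by simp
    also have "\<dots> = 1 mod int p ^ n" by (simp add: mod_diff_eq[symmetric])
    finally show ?thesis by blast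
  qed
  then obtain z where z: "\<And>n. (x n * z n) mod int p ^ n = 1 mod int p ^ n" by metis
  have "z (Suc n) mod int p ^ n = z n mod int p ^ n" for n
  proof -
    have "(x n * z (Suc n)) mod int p ^ n = 1 mod int p ^ n"
    proof -
      have "(x n * z (Suc n)) mod int p ^ n = (x (Suc n) mod int p ^ n * z (Suc n)) mod int p ^ n"
        using Zp_mod_Suc[OF x] by simp
      also have "\<dots> = (x (Suc n) * z (Suc n)) mod int p ^ n" by (simp add: mod_simps)
      also have "\<dots> = (x (Suc n) * z (Suc n)) mod int p ^ Suc n mod int p ^ n" by (rule mod_Suc[symmetric])
      also have "\<dots> = 1 mod int p ^ n" unfolding z by (rule mod_Suc)
      finally show ?thesis .
    qed
    then have "int p ^ n dvd x n * z (Suc n) - x n * z n" using z[of n] by (metis mod_eq_dvd_iff)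
    then have "int p ^ n dvd x n * (z (Suc n) - z n)" by (simp add: right_diff_distrib)
    then have "int p ^ n dvd z (Suc n) - z n" using cop[of n] by (simp add: coprime_dvd_mult_right_iff coprime_commute)
    then show ?thesis by (simp add: mod_eq_dvd_iff)
  qed
  then have "(\<lambda>n. z n mod int p ^ n) \<in> carrier ZZ" by (rule Zp_closedI)
  moreover have "x \<otimes>\<^sub>ZZ (\<lambda>n. z n mod int p ^ n) = \<one>\<^sub>ZZ" by (simp add: fun_eq_iff Zp_simps mod_simps z)
  ultimately show thesis using that by blast
qed

text \<open>Induction on the index of a nonzero component. If the component at 1 is zero, division
  by p moves a nonzero component one index down; otherwise the element is a unit.\<close>

lemma Zp_factor:
  assumes "x \<in> carrier ZZ" "x \<noteq> \<zero>\<^sub>ZZ"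
  obtains n v v' where "v \<in> carrier ZZ" "v' \<in> carrier ZZ" "v \<otimes>\<^sub>ZZ v' = \<one>\<^sub>ZZ" "x = pz [^]\<^sub>ZZ (n::nat) \<otimes>\<^sub>ZZ v"
proof -
  have "\<exists>n v v'. v \<in> carrier ZZ \<and> v' \<in> carrier ZZ \<and> v \<otimes>\<^sub>ZZ v' = \<one>\<^sub>ZZ \<and> x = pz [^]\<^sub>ZZ (n::nat) \<otimes>\<^sub>ZZ v"
    if "x \<in> carrier ZZ" "x m \<noteq> 0" for x and m :: nat
    using that
  proof (induction m arbitrary: x)
    case 0
    then show ?case by (auto simp: Zp_simps dest: spec[of _ 0])
  next
    case (Suc m)
    show ?case
    proof (cases "x 1 = 0")
      case True
      obtain y where y: "y \<in> carrier ZZ" "x = pz \<otimes>\<^sub>ZZ y" "\<And>n. y n = x (Suc n) div int p"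
        using Zp_divide_p[OF Suc.prems(1) True] by blast
      have "y m \<noteq> 0"
      proof
        assume "y m = 0"
        then have "x (Suc m) < int p" "0 \<le> x (Suc m)"
          using y(3)[of m] Suc.prems(1) p_gt by (auto simp: Zp_simps pos_imp_zdiv_pos_iff not_less[symmetric] zdiv_eq_0_iff)
        moreover have "x (Suc m) mod int p = 0"
        proof -
          have "x (Suc m) = (int p mod int p ^ Suc m * y (Suc m)) mod int p ^ Suc m"
            using y(2) by (simp add: Zp_simps pz_def)
          also have "\<dots> = (int p * y (Suc m)) mod int p ^ Suc m" by (simp add: mod_simps)
          finally have "x (Suc m) mod int p = (int p * y (Suc m)) mod int p ^ Suc m mod int p" by simp
          also have "\<dots> = (int p * y (Suc m)) mod int p" by (rule mod_mod_cancel) simp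
          finally show ?thesis by simp
        qed
        ultimately show False using Suc.prems(2) by simp
      qed
      then obtain n v v' where nv: "v \<in> carrier ZZ" "v' \<in> carrier ZZ" "v \<otimes>\<^sub>ZZ v' = \<one>\<^sub>ZZ" "y = pz [^]\<^sub>ZZ (n::nat) \<otimes>\<^sub>ZZ v"
        using Suc.IH[OF y(1)] by blast
      have "x = pz [^]\<^sub>ZZ (Suc n) \<otimes>\<^sub>ZZ v" using y(2) nv by (simp add: Zp.m_ac)
      then show ?thesis using nv by blast
    next
      case False
      obtain y where "y \<in> carrier ZZ" "x \<otimes>\<^sub>ZZ y = \<one>\<^sub>ZZ" using Zp_unit[OF Suc.prems(1) False] by blast
      then show ?thesis using Suc.prems(1) by (intro exI[of _ 0] exI[of _ x] exI[of _ y]) simp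
    qed
  qed
  moreover obtain m where "x m \<noteq> 0" using assms(2) by (auto simp: fun_eq_iff Zp_simps)
  ultimately show thesis using that assms(1) by blast
qed

text \<open>The component at \<open>Suc n\<close> is the first one that detects p^n.\<close>

lemma pz_pow_nonzero: "pz [^]\<^sub>ZZ (n::nat) \<noteq> \<zero>\<^sub>ZZ"
proof
  assume "pz [^]\<^sub>ZZ (n::nat) = \<zero>\<^sub>ZZ"
  then have "(pz [^]\<^sub>ZZ (n::nat)) (Suc n) = 0" by (simp add: Zp_simps)
  then have "int p ^ n mod int p ^ Suc n = 0" unfolding pz_pow .
  moreover have "int p ^ n < int p ^ Suc n" using p_gt by (intro power_strict_increasing) simp_all
  ultimately show False using p_gt by simp
qed

lemma Zp_domain: "domain ZZ"
proof (rule domainI[OF Zp_cring])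
  show "\<one>\<^sub>ZZ \<noteq> \<zero>\<^sub>ZZ" using pz_pow_nonzero[of 0] by simp
  fix x y assume xy: "x \<otimes>\<^sub>ZZ y = \<zero>\<^sub>ZZ" "x \<in> carrier ZZ" "y \<in> carrier ZZ"
  show "x = \<zero>\<^sub>ZZ \<or> y = \<zero>\<^sub>ZZ"
  proof (rule ccontr)
    assume "\<not> ?thesis"
    then obtain n v v' m a a' where x: "v \<in> carrier ZZ" "v' \<in> carrier ZZ" "v \<otimes>\<^sub>ZZ v' = \<one>\<^sub>ZZ" "x = pz [^]\<^sub>ZZ (n::nat) \<otimes>\<^sub>ZZ v"
      and y: "a \<in> carrier ZZ" "a' \<in> carrier ZZ" "a \<otimes>\<^sub>ZZ a' = \<one>\<^sub>ZZ" "y = pz [^]\<^sub>ZZ (m::nat) \<otimes>\<^sub>ZZ a"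
      using Zp_factor[OF xy(2)] Zp_factor[OF xy(3)] by metis
    have c: "pz [^]\<^sub>ZZ n \<in> carrier ZZ" "pz [^]\<^sub>ZZ m \<in> carrier ZZ" by simp_all
    have "(x \<otimes>\<^sub>ZZ y) \<otimes>\<^sub>ZZ (v' \<otimes>\<^sub>ZZ a') = pz [^]\<^sub>ZZ n \<otimes>\<^sub>ZZ pz [^]\<^sub>ZZ m \<otimes>\<^sub>ZZ ((v \<otimes>\<^sub>ZZ v') \<otimes>\<^sub>ZZ (a \<otimes>\<^sub>ZZ a'))"
      unfolding x(4) y(4) using x(1,2) y(1,2) c by (simp add: Zp.m_ac)
    also have "\<dots> = pz [^]\<^sub>ZZ (n + m)" unfolding x(3) y(3) by (simp add: Zp.nat_pow_mult)
    finally have "pz [^]\<^sub>ZZ (n + m) = \<zero>\<^sub>ZZ" using xy(1) x(2) y(2) by simp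
    then show False using pz_pow_nonzero by blast
  qed
qed

lemma pz_nonunit: "x \<in> carrier ZZ \<Longrightarrow> pz \<otimes>\<^sub>ZZ x \<noteq> \<one>\<^sub>ZZ"
proof
  assume "pz \<otimes>\<^sub>ZZ x = \<one>\<^sub>ZZ"
  then have "(pz \<otimes>\<^sub>ZZ x) 1 = \<one>\<^sub>ZZ 1" by simp
  then show False using p_gt by (simp add: Zp_simps pz_def)
qed

text \<open>A uniformizer is no unit, so u = p y, and its ideal lies in the proper ideal generated
  by p. Maximality makes the two ideals equal, whence p = r u, and cancelling p gives y r =
  1.\<close>

lemma uniformizer_associate:
  assumes "Zp_uniformizer p u"
  obtains v v' where "v \<in> carrier ZZ" "v' \<in> carrier ZZ" "v \<otimes>\<^sub>ZZ v' = \<one>\<^sub>ZZ" "u = pz \<otimes>\<^sub>ZZ v"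
proof -
  have u: "u \<in> carrier ZZ" and max: "maximalideal (PIdl\<^bsub>ZZ\<^esub> u) ZZ" using assms by (simp_all add: Zp_uniformizer_def)
  interpret max: maximalideal "PIdl\<^bsub>ZZ\<^esub> u" ZZ by (rule max)
  interpret D: domain ZZ by (rule Zp_domain)
  have "u 1 = 0"
  proof (rule ccontr)
    assume "u 1 \<noteq> 0"
    then obtain y where y: "y \<in> carrier ZZ" "u \<otimes>\<^sub>ZZ y = \<one>\<^sub>ZZ" using Zp_unit u by blast
    then have "\<one>\<^sub>ZZ = y \<otimes>\<^sub>ZZ u" using u Zp.m_comm[of u y] by simp
    then have "\<one>\<^sub>ZZ \<in> PIdl\<^bsub>ZZ\<^esub> u" using y(1) unfolding cgenideal_def by blast
    then show False using max.I_notcarr max.one_imp_carrier by blast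
  qed
  then obtain y where y: "y \<in> carrier ZZ" "u = pz \<otimes>\<^sub>ZZ y" using Zp_divide_p u by blast
  have sub: "PIdl\<^bsub>ZZ\<^esub> u \<subseteq> PIdl\<^bsub>ZZ\<^esub> pz"
  proof
    fix z assume "z \<in> PIdl\<^bsub>ZZ\<^esub> u"
    then obtain r where r: "r \<in> carrier ZZ" "z = r \<otimes>\<^sub>ZZ u" unfolding cgenideal_def by blast
    have "z = (r \<otimes>\<^sub>ZZ y) \<otimes>\<^sub>ZZ pz" using r y by (simp add: Zp.m_ac)
    then show "z \<in> PIdl\<^bsub>ZZ\<^esub> pz" using Zp_mult_closed[OF r(1) y(1)] unfolding cgenideal_def by blast
  qed
  have "PIdl\<^bsub>ZZ\<^esub> pz \<noteq> carrier ZZ"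
  proof
    assume "PIdl\<^bsub>ZZ\<^esub> pz = carrier ZZ"
    then have "\<one>\<^sub>ZZ \<in> PIdl\<^bsub>ZZ\<^esub> pz" using Zp_one_closed by simp
    then obtain r where r: "r \<in> carrier ZZ" "\<one>\<^sub>ZZ = r \<otimes>\<^sub>ZZ pz" unfolding cgenideal_def by blast
    then show False using pz_nonunit[OF r(1)] Zp.m_comm[OF r(1) pz_closed] by simp
  qed
  then have "PIdl\<^bsub>ZZ\<^esub> pz = PIdl\<^bsub>ZZ\<^esub> u"
    using max.I_maximal[OF Zp.cgenideal_ideal[OF pz_closed] sub] ideal.Icarr[OF Zp.cgenideal_ideal[OF pz_closed]] by blast
  then have "pz \<in> PIdl\<^bsub>ZZ\<^esub> u" using Zp.cgenideal_self[OF pz_closed] by simp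
  then obtain r where r: "r \<in> carrier ZZ" "pz = r \<otimes>\<^sub>ZZ u" unfolding cgenideal_def by blast
  have "pz = r \<otimes>\<^sub>ZZ (pz \<otimes>\<^sub>ZZ y)" using r(2) unfolding y(2) .
  also have "\<dots> = pz \<otimes>\<^sub>ZZ (y \<otimes>\<^sub>ZZ r)" using r(1) y(1) by (simp add: Zp.m_ac)
  finally have e: "pz = pz \<otimes>\<^sub>ZZ (y \<otimes>\<^sub>ZZ r)" .
  have "pz \<otimes>\<^sub>ZZ (y \<otimes>\<^sub>ZZ r) = pz \<otimes>\<^sub>ZZ \<one>\<^sub>ZZ"
    unfolding e[symmetric] by (rule sym[OF Zp.r_one[OF pz_closed]])
  moreover have "pz \<noteq> \<zero>\<^sub>ZZ" using pz_pow_nonzero[of 1] by simp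
  ultimately have "y \<otimes>\<^sub>ZZ r = \<one>\<^sub>ZZ" using D.m_lcancel[of pz "y \<otimes>\<^sub>ZZ r" "\<one>\<^sub>ZZ"] r(1) y(1) by simp
  then show thesis using that[of y r] y r(1) by blast
qed

lemma uniformizer_factor:
  assumes u: "Zp_uniformizer p u" and x: "x \<in> carrier ZZ" "x \<noteq> \<zero>\<^sub>ZZ"
  obtains n v v' where "v \<in> carrier ZZ" "v' \<in> carrier ZZ" "v \<otimes>\<^sub>ZZ v' = \<one>\<^sub>ZZ" "x = u [^]\<^sub>ZZ (n::nat) \<otimes>\<^sub>ZZ v"
proof -
  obtain a a' where a: "a \<in> carrier ZZ" "a' \<in> carrier ZZ" "a \<otimes>\<^sub>ZZ a' = \<one>\<^sub>ZZ" "u = pz \<otimes>\<^sub>ZZ a"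
    using uniformizer_associate[OF u] by metis
  obtain n v v' where v: "v \<in> carrier ZZ" "v' \<in> carrier ZZ" "v \<otimes>\<^sub>ZZ v' = \<one>\<^sub>ZZ" "x = pz [^]\<^sub>ZZ (n::nat) \<otimes>\<^sub>ZZ v"
    using Zp_factor[OF x] by metis
  have aa: "a [^]\<^sub>ZZ n \<otimes>\<^sub>ZZ a' [^]\<^sub>ZZ n = \<one>\<^sub>ZZ"
    unfolding Zp.nat_pow_distrib[OF a(1,2), symmetric] a(3) by simp
  have c: "a [^]\<^sub>ZZ n \<in> carrier ZZ" "a' [^]\<^sub>ZZ n \<in> carrier ZZ" "pz [^]\<^sub>ZZ n \<in> carrier ZZ"
    using a(1,2) by simp_all
  have "u [^]\<^sub>ZZ n \<otimes>\<^sub>ZZ (a' [^]\<^sub>ZZ n \<otimes>\<^sub>ZZ v) =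
      pz [^]\<^sub>ZZ n \<otimes>\<^sub>ZZ ((a [^]\<^sub>ZZ n \<otimes>\<^sub>ZZ a' [^]\<^sub>ZZ n) \<otimes>\<^sub>ZZ v)"
    unfolding a(4) Zp.nat_pow_distrib[OF pz_closed a(1)] using c v(1) by (simp add: Zp.m_assoc)
  also have "\<dots> = x" unfolding aa v(4) using v(1) by simp
  finally have 1: "x = u [^]\<^sub>ZZ n \<otimes>\<^sub>ZZ (a' [^]\<^sub>ZZ n \<otimes>\<^sub>ZZ v)" by simp
  have "(a' [^]\<^sub>ZZ n \<otimes>\<^sub>ZZ v) \<otimes>\<^sub>ZZ (a [^]\<^sub>ZZ n \<otimes>\<^sub>ZZ v') =
      (a [^]\<^sub>ZZ n \<otimes>\<^sub>ZZ a' [^]\<^sub>ZZ n) \<otimes>\<^sub>ZZ (v \<otimes>\<^sub>ZZ v')"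
    using c v(1,2) by (simp add: Zp.m_ac)
  then have 2: "(a' [^]\<^sub>ZZ n \<otimes>\<^sub>ZZ v) \<otimes>\<^sub>ZZ (a [^]\<^sub>ZZ n \<otimes>\<^sub>ZZ v') = \<one>\<^sub>ZZ" unfolding aa v(3) by simp
  show thesis using that[of "a' [^]\<^sub>ZZ n \<otimes>\<^sub>ZZ v" "a [^]\<^sub>ZZ n \<otimes>\<^sub>ZZ v'" n, OF _ _ 2 1] c v(1,2) by simp
qed

end

section \<open>The four bilattices are lattices, and the residue field\<close>

context quat_order
begin

lemma latI:
  assumes "bimodule R R L" "Zfree L" "\<And>z x. \<lbrakk>z \<in> Z; x \<in> carrier L\<rbrakk> \<Longrightarrow> z \<odot>\<^sub>L x = x \<star>\<^sub>L z"
  shows "lat L"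
  using assms Zfree_dual_basis[of L] quat_order_axioms
  unfolding lattice_bimod_def lattice_bimod_axioms_def bimod_def by blast

lemma Zspans_singleton:
  assumes L: "bimodule R R L" and g: "g \<in> carrier L" and all: "\<And>x. x \<in> N \<Longrightarrow> \<exists>z\<in>Z. x = z \<odot>\<^sub>L g"
  shows "Zspans L {g} N"
proof -
  interpret L: bimod R R L using L by (simp add: bimod_def)
  have "\<exists>c. c \<in> {g} \<rightarrow> Z \<and> x = finsum L (\<lambda>b. c b \<odot>\<^sub>L b) {g}" if xN: "x \<in> N" for x
  proof -
    obtain z where z: "z \<in> Z" "x = z \<odot>\<^sub>L g" using all[OF xN] by blast
    have "finsum L (\<lambda>b. z \<odot>\<^sub>L b) {g} = z \<odot>\<^sub>L g" using z(1) g L.finsum_insert[of "{}" g "\<lambda>b. z \<odot>\<^sub>L b"] by simp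
    then show ?thesis using z by (intro exI[of _ "\<lambda>_. z"]) auto
  qed
  then show ?thesis using g by (simp add: Zspans_def)
qed

text \<open>The generators 1, w, \<pi> and w \<pi> arise from W = Z + Z w and R = W + W \<pi>.
  Freeness is left to \<open>spanned_Zfree\<close>, which works from generators.\<close>

lemma ring_Zspans: "\<exists>B. Zspans (ideal_bimodule R (carrier R)) B (carrier R)"
proof -
  let ?L = "ideal_bimodule R (carrier R)"
  have L: "bimodule R R ?L" by (rule ideal_bimodule_bimodule[OF oneideal])
  note s = Zspans_singleton[OF L]
  note a = Zspans_sum[OF L]
  let ?M = "\<lambda>g. (\<lambda>z. z \<otimes> g) ` Z"
  have 1: "Zspans ?L {g} (?M g)" if "g \<in> carrier R" for g using that by (intro s) auto
  have W: "Zspans ?L ({g} \<union> {w \<otimes> g}) ((\<lambda>b. b \<otimes> g) ` W)" if g: "g \<in> carrier R" for g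
  proof (rule a[OF 1[OF g] 1[of "w \<otimes> g"]])
    show "w \<otimes> g \<in> carrier R" using g by simp
    fix x assume "x \<in> (\<lambda>b. b \<otimes> g) ` W"
    then obtain b where b: "b \<in> W" "x = b \<otimes> g" by blast
    obtain y z where "y \<in> Z" "z \<in> Z" "b = y \<oplus> z \<otimes> w" using W_span[OF b(1)] by blast
    then have "x = y \<otimes> g \<oplus>\<^sub>?L z \<otimes> (w \<otimes> g)" using b g by (simp add: l_distr m_assoc)
    then show "\<exists>y\<in>?M g. \<exists>z\<in>?M (w \<otimes> g). x = y \<oplus>\<^sub>?L z" using \<open>y \<in> Z\<close> \<open>z \<in> Z\<close> by blast
  qed
  have "Zspans ?L (({\<one>} \<union> {w \<otimes> \<one>}) \<union> ({\<pi>} \<union> {w \<otimes> \<pi>})) (carrier R)"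
  proof (rule a[OF W[OF one_closed] W[OF pi_closed]])
    fix x assume "x \<in> carrier R"
    then obtain b c where "b \<in> W" "c \<in> W" "x = b \<oplus> c \<otimes> \<pi>" using decompose by blast
    then show "\<exists>y\<in>(\<lambda>b. b \<otimes> \<one>) ` W. \<exists>z\<in>(\<lambda>b. b \<otimes> \<pi>) ` W. x = y \<oplus>\<^sub>?L z"
      by (intro bexI[of _ "b \<otimes> \<one>"] bexI[of _ "c \<otimes> \<pi>"]) auto
  qed
  then show ?thesis by blast
qed

text \<open>Right multiplication by the generator is injective and carries generators of the ring to
  generators of the ideal; torsion-freeness is the absence of zero divisors.\<close>

lemma lat_ideal_generated: "Zfree (ideal_bimodule R (generated t))" "lat (ideal_bimodule R (generated t))"
proof -
  let ?T = "ideal_bimodule R (generated t)" and ?L = "ideal_bimodule R (carrier R)"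
  interpret I: ideal "generated t" R by (rule ideal_generated)
  have sub: "x \<in> carrier R" if "x \<in> generated t" for x using that I.a_subset by blast
  have T: "bimodule R R ?T" by (rule ideal_bimodule_bimodule[OF ideal_generated])
  have L: "bimodule R R ?L" by (rule ideal_bimodule_bimodule[OF oneideal])
  obtain B where B: "Zspans ?L B (carrier ?L)" using ring_Zspans by auto
  have f: "Zhom ?L ?T (\<lambda>r. r \<otimes> generator t)"
    unfolding Zhom_def ideal_bimodule_simps
    by (intro conjI ballI Pi_I) (simp_all add: generated_def l_distr m_assoc)
  have inj: "inj_on (\<lambda>r. r \<otimes> generator t) (carrier ?L)"
    by (rule inj_onI, rule cancel_right[OF _ _ generator_closed generator_nonzero]) simp_all
  have "Zspans ?T ((\<lambda>r. r \<otimes> generator t) ` B) (carrier ?T)"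
    using Zspans_image[OF L T f inj B] by (simp add: generated_def)
  moreover have "z = \<zero> \<or> x = \<zero>\<^sub>?T" if "z \<in> Z" "x \<in> carrier ?T" "z \<odot>\<^sub>?T x = \<zero>\<^sub>?T" for z x
    using that integral[of z x] sub[of x] by simp
  ultimately show free: "Zfree ?T" using spanned_Zfree[OF T] by blast
  have "z \<odot>\<^sub>?T x = x \<star>\<^sub>?T z" if "z \<in> Z" "x \<in> carrier ?T" for z x
    using that Z_central[of z x] sub[of x] by simp
  then show "lat ?T" by (rule latI[OF T free])
qed

lemma lat_column_type:
  assumes phi: "column_type s \<phi>"
  shows "Zfree (column_bimodule R \<phi>)" "lat (column_bimodule R \<phi>)"
proof -
  let ?T = "column_bimodule R \<phi>" and ?L = "ideal_bimodule R (carrier R)"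
  have T: "bimodule R R ?T" using phi column_bimodule_bimodule by (simp add: column_type_def)
  have L: "bimodule R R ?L" by (rule ideal_bimodule_bimodule[OF oneideal])
  obtain B where B: "Zspans ?L B (carrier ?L)" using ring_Zspans by auto
  have z: "z \<odot>\<^sub>?T (x, y) = (z \<otimes> x, z \<otimes> y)" if "z \<in> Z" "x \<in> carrier R" "y \<in> carrier R" for z x y
    using column_type_smult(2)[OF phi that(2,3), of z] that by simp
  have f: "Zhom ?L ?T (\<lambda>r. (r, \<zero>))" "Zhom ?L ?T (\<lambda>r. (\<zero>, r))"
    unfolding Zhom_def by (auto simp: z)
  have inj: "inj_on (\<lambda>r. (r, \<zero>)) (carrier ?L)" "inj_on (\<lambda>r. (\<zero>, r)) (carrier ?L)" by (auto simp: inj_on_def)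
  note S = Zspans_sum[OF T Zspans_image[OF L T f(1) inj(1) B] Zspans_image[OF L T f(2) inj(2) B]]
  have "Zspans ?T ((\<lambda>r. (r, \<zero>)) ` B \<union> (\<lambda>r. (\<zero>, r)) ` B) (carrier ?T)"
  proof (rule S)
    fix x assume "x \<in> carrier ?T"
    then obtain a b where ab: "x = (a, b)" "a \<in> carrier R" "b \<in> carrier R" by auto
    then have "x = (a, \<zero>) \<oplus>\<^sub>?T (\<zero>, b)" by simp
    then show "\<exists>y\<in>(\<lambda>r. (r, \<zero>)) ` carrier ?L. \<exists>z\<in>(\<lambda>r. (\<zero>, r)) ` carrier ?L. x = y \<oplus>\<^sub>?T z"
      using ab by (intro bexI[of _ "(a, \<zero>)"] bexI[of _ "(\<zero>, b)"]) auto
  qed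
  moreover have "z = \<zero> \<or> x = \<zero>\<^sub>?T" if tf: "z \<in> Z" "x \<in> carrier ?T" "z \<odot>\<^sub>?T x = \<zero>\<^sub>?T" for z x
  proof -
    obtain a b where ab: "x = (a, b)" "a \<in> carrier R" "b \<in> carrier R" using tf(2) by auto
    then show ?thesis using tf z[of z a b] integral[of z a] integral[of z b] by auto
  qed
  ultimately show free: "Zfree ?T" using spanned_Zfree[OF T] by blast
  have "z \<odot>\<^sub>?T x = x \<star>\<^sub>?T z" if "z \<in> Z" "x \<in> carrier ?T" for z x
    using that z Z_central[of z] by auto
  then show "lat ?T" by (rule latI[OF T free])
qed

text \<open>For r = a + b \<pi> outside the ideal, a is a unit of \<open>W\<close>. Multiplying r by
  \<sigma>(a) - b \<pi> gives the reduced norm a \<sigma>(a) - \<pi>^2 b \<sigma>(b), again a unit,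
  and so a right inverse of r; cancellation makes it two-sided.\<close>

lemma unit_outside_generated:
  assumes r: "r \<in> carrier R" "r \<notin> generated True"
  obtains s where "s \<in> carrier R" "r \<otimes> s = \<one>" "s \<otimes> r = \<one>"
proof -
  obtain a b where ab: "a \<in> W" "b \<in> W" "r = a \<oplus> b \<otimes> \<pi>" using decompose r(1) by blast
  have "\<not> (\<exists>c\<in>W. a = pi2 \<otimes> c)"
  proof
    assume "\<exists>c\<in>W. a = pi2 \<otimes> c"
    then obtain c where c: "c \<in> W" "a = pi2 \<otimes> c" by blast
    then have "a = c \<otimes> \<pi> \<otimes> \<pi>" using pi2_comm[of c] by (simp add: m_assoc)
    then have "r = (c \<otimes> \<pi> \<oplus> b) \<otimes> \<pi>" using ab c(1) by (simp add: l_distr)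
    moreover have "c \<otimes> \<pi> \<oplus> b \<in> carrier R" using ab(2) c(1) by simp
    ultimately have "r \<in> generated True" unfolding generated_def generator_def by auto
    then show False using r(2) by simp
  qed
  then obtain a' where a': "a' \<in> W" "a \<otimes> a' = \<one>" using local[OF ab(1)] by blast
  define n where "n = a \<otimes> \<sigma> a \<ominus> pi2 \<otimes> (b \<otimes> \<sigma> b)"
  have n: "n \<in> W" using ab by (simp add: n_def)
  have "r \<otimes> (\<sigma> a \<ominus> b \<otimes> \<pi>) = a \<otimes> \<sigma> a \<oplus> b \<otimes> (\<pi> \<otimes> \<sigma> a) \<oplus> \<ominus> (a \<otimes> (b \<otimes> \<pi>)) \<oplus> \<ominus> (b \<otimes> (\<pi> \<otimes> b) \<otimes> \<pi>)"
    unfolding ab(3) using ab(1,2) by (simp add: minus_eq l_distr r_distr r_minus minus_add m_assoc a_ac)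
  also have "b \<otimes> (\<pi> \<otimes> \<sigma> a) = a \<otimes> (b \<otimes> \<pi>)" using ab(1,2) by (simp add: pi_comm W_lcomm)
  also have "b \<otimes> (\<pi> \<otimes> b) \<otimes> \<pi> = pi2 \<otimes> (b \<otimes> \<sigma> b)"
    using ab(1,2) pi2_comm[of "b \<otimes> \<sigma> b"] by (simp add: pi_comm m_assoc)
  also have "a \<otimes> \<sigma> a \<oplus> a \<otimes> (b \<otimes> \<pi>) \<oplus> \<ominus> (a \<otimes> (b \<otimes> \<pi>)) \<oplus> \<ominus> (pi2 \<otimes> (b \<otimes> \<sigma> b)) = n"
    unfolding n_def using ab(1,2) by (simp add: minus_eq a_assoc r_neg)
  finally have rn: "r \<otimes> (\<sigma> a \<ominus> b \<otimes> \<pi>) = n" .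
  have "\<not> (\<exists>c\<in>W. n = pi2 \<otimes> c)"
  proof
    assume "\<exists>c\<in>W. n = pi2 \<otimes> c"
    then obtain c where c: "c \<in> W" "n = pi2 \<otimes> c" by blast
    have "a \<otimes> \<sigma> a = n \<oplus> pi2 \<otimes> (b \<otimes> \<sigma> b)" unfolding n_def using ab(1,2) by (simp add: minus_eq a_assoc l_neg)
    also have "\<dots> = pi2 \<otimes> (c \<oplus> b \<otimes> \<sigma> b)" unfolding c(2) using ab(1,2) c(1) by (simp add: r_distr)
    finally have e: "a \<otimes> \<sigma> a = pi2 \<otimes> (c \<oplus> b \<otimes> \<sigma> b)" .
    have "(a \<otimes> a') \<otimes> \<sigma> (a \<otimes> a') = (a \<otimes> \<sigma> a) \<otimes> (a' \<otimes> \<sigma> a')" using ab(1) a'(1) by (simp add: sigma_mult W_ac)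
    also have "\<dots> = pi2 \<otimes> ((c \<oplus> b \<otimes> \<sigma> b) \<otimes> (a' \<otimes> \<sigma> a'))" unfolding e using ab(1,2) c(1) a'(1) by (simp add: m_assoc)
    finally have "pi2 \<otimes> ((c \<oplus> b \<otimes> \<sigma> b) \<otimes> (a' \<otimes> \<sigma> a')) = \<one>" unfolding a'(2) by simp
    moreover have "(c \<oplus> b \<otimes> \<sigma> b) \<otimes> (a' \<otimes> \<sigma> a') \<in> W" using c(1) ab(2) a'(1) by simp
    ultimately show False using nonunit_W by blast
  qed
  then obtain n' where n': "n' \<in> W" "n \<otimes> n' = \<one>" using local[OF n] by blast
  define s where "s = (\<sigma> a \<ominus> b \<otimes> \<pi>) \<otimes> n'"
  have s: "s \<in> carrier R" using ab n' by (simp add: s_def)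
  have "r \<otimes> s = (r \<otimes> (\<sigma> a \<ominus> b \<otimes> \<pi>)) \<otimes> n'" unfolding s_def using r ab(1,2) n'(1) by (simp add: m_assoc)
  then have rs: "r \<otimes> s = \<one>" unfolding rn n'(2) .
  have "(s \<otimes> r) \<otimes> s = \<one> \<otimes> s" using rs r(1) s by (simp add: m_assoc)
  moreover have "s \<noteq> \<zero>" using rs r(1) one_not_zero by auto
  ultimately have "s \<otimes> r = \<one>" using cancel_right[of "s \<otimes> r" \<one> s] s r(1) by simp
  then show thesis using that s rs by blast
qed

lemma one_notin_generated: "\<one> \<notin> generated True"
  using W_in_pi_ideal(1)[of \<one>] nonunit_W by (fastforce simp: generated_True)

text \<open>Everything outside \<open>generated True\<close> is invertible, so each proper ideal is
  contained in this one, which is itself proper.\<close>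

lemma maximal_ideal_unique:
  assumes "maximalideal J R"
  shows "J = generated True"
proof -
  interpret J: maximalideal J R by fact
  interpret I: ideal "generated True" R by (rule ideal_generated)
  have "J \<subseteq> generated True"
  proof (rule ccontr)
    assume "\<not> J \<subseteq> generated True"
    then obtain r where r: "r \<in> J" "r \<notin> generated True" by blast
    obtain s where s: "s \<in> carrier R" "r \<otimes> s = \<one>" "s \<otimes> r = \<one>"
      using unit_outside_generated[OF J.Icarr[OF r(1)] r(2)] by metis
    then have "\<one> \<in> J" using J.I_r_closed[OF r(1) s(1)] by simp
    then show False using J.I_notcarr J.one_imp_carrier by blast
  qed
  then show ?thesis
    using J.I_maximal[OF ideal_generated] I.a_subset one_notin_generated one_closed by blast
qed

lemma residue_field_carrier: "carrier (R Quot generated True) = (\<lambda>a. generated True +> a) ` W"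
proof -
  interpret I: ideal "generated True" R by (rule ideal_generated)
  have "generated True +> r \<in> (\<lambda>a. generated True +> a) ` W" if r: "r \<in> carrier R" for r
  proof -
    obtain a b where ab: "a \<in> W" "b \<in> W" "r = a \<oplus> b \<otimes> \<pi>" using decompose r by blast
    have "r \<ominus> a = b \<otimes> \<pi>" unfolding ab(3) using ab(1,2) by (simp add: minus_eq a_ac r_neg2 r_neg1)
    also have "\<dots> \<in> generated True" using ab(2) by (auto simp: generated_def generator_def)
    finally show ?thesis using quotient_eq_iff_same_a_r_cos[OF ideal_generated r, of a True] ab(1) by auto
  qed
  then show ?thesis unfolding carrier_FactRing using W_carrier by blast
qed

text \<open>Residue classes have representatives in the commutative ring \<open>W\<close>, and a
  nonzero class is represented by an element outside the ideal, which is a unit of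
  \<open>R\<close>.\<close>

lemma residue_field: "field (R Quot generated True)"
proof -
  interpret I: ideal "generated True" R by (rule ideal_generated)
  interpret Q: ring "R Quot generated True" by (rule I.quotient_is_ring)
  let ?c = "\<lambda>r. generated True +> r"
  have h: "?c \<in> ring_hom R (R Quot generated True)" by (rule I.rcos_ring_hom)
  have mult: "?c r \<otimes>\<^bsub>R Quot generated True\<^esub> ?c s = ?c (r \<otimes> s)" if "r \<in> carrier R" "s \<in> carrier R" for r s
    using ring_hom_mult[OF h that] by simp
  have one: "\<one>\<^bsub>R Quot generated True\<^esub> = ?c \<one>" using ring_hom_one[OF h] by simp
  have car: "?c r \<in> carrier (R Quot generated True)" if "r \<in> carrier R" for r using ring_hom_closed[OF h that] .
  have comm: "A \<otimes>\<^bsub>R Quot generated True\<^esub> B = B \<otimes>\<^bsub>R Quot generated True\<^esub> A"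
    if "A \<in> carrier (R Quot generated True)" "B \<in> carrier (R Quot generated True)" for A B
    using that unfolding residue_field_carrier by (auto simp: mult W_comm)
  have zero: "\<zero>\<^bsub>R Quot generated True\<^esub> = generated True" by (simp add: FactRing_def)
  interpret Q: cring "R Quot generated True"
    by (intro cring.intro Q.ring_axioms Group.comm_monoid.intro Q.monoid_axioms comm_monoid_axioms.intro comm)
  show ?thesis
  proof (rule Q.cring_fieldI2)
    show "\<zero>\<^bsub>R Quot generated True\<^esub> \<noteq> \<one>\<^bsub>R Quot generated True\<^esub>"
      unfolding zero one using one_notin_generated I.a_rcos_self[OF one_closed] by auto
    fix A assume A: "A \<in> carrier (R Quot generated True)" "A \<noteq> \<zero>\<^bsub>R Quot generated True\<^esub>"
    then obtain r where r: "r \<in> carrier R" "A = ?c r" by (auto simp: FactRing_def A_RCOSETS_def')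
    have "r \<notin> generated True" using A(2) I.a_rcos_const[of r] unfolding zero r(2) by blast
    then obtain s where s: "s \<in> carrier R" "r \<otimes> s = \<one>" "s \<otimes> r = \<one>" using unit_outside_generated[OF r(1)] by metis
    then show "\<exists>B\<in>carrier (R Quot generated True). A \<otimes>\<^bsub>R Quot generated True\<^esub> B = \<one>\<^bsub>R Quot generated True\<^esub>"
      using mult[OF r(1) s(1)] car[OF s(1)] unfolding r(2) one by (intro bexI[of _ "?c s"]) simp_all
  qed
qed

lemma card_residue_field: "card (carrier (R Quot generated True)) = residue_card"
  unfolding residue_field_carrier
proof (rule card_residue_image)
  fix a b assume ab: "a \<in> W" "b \<in> W"
  have "generated True +> a = generated True +> b \<longleftrightarrow> a \<ominus> b \<in> generated True"
    using quotient_eq_iff_same_a_r_cos[OF ideal_generated, of a b True] ab by simp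
  also have "\<dots> \<longleftrightarrow> (\<exists>r\<in>carrier R. a \<ominus> b = \<pi> \<otimes> r)" unfolding generated_True by blast
  also have "\<dots> \<longleftrightarrow> (\<exists>c\<in>W. a \<ominus> b = pi2 \<otimes> c)" using W_in_pi_ideal(1)[of "a \<ominus> b"] ab by simp
  finally show "generated True +> a = generated True +> b \<longleftrightarrow> (\<exists>c\<in>W. a \<ominus> b = pi2 \<otimes> c)" .
qed

text \<open>\<open>\<rho>\<close> is any labelling of the residue classes of \<open>Z\<close>. The
  coordinates in W = Z + Z w identify the residue classes of \<open>W\<close> with pairs of residue
  classes of \<open>Z\<close>, whence the square.\<close>

lemma residue_card_square:
  assumes rho: "\<And>x y. \<lbrakk>x \<in> Z; y \<in> Z\<rbrakk> \<Longrightarrow> \<rho> x = \<rho> y \<longleftrightarrow> (\<exists>z\<in>Z. x \<ominus> y = pi2 \<otimes> z)"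
  shows "residue_card = (card (\<rho> ` Z))\<^sup>2"
proof -
  define y where "y a = (a \<ominus> \<sigma> a) \<otimes> u" for a
  define x where "x a = a \<ominus> y a \<otimes> w" for a
  have coord: "x (b \<oplus> c \<otimes> w) = b" "y (b \<oplus> c \<otimes> w) = c" if bc: "b \<in> Z" "c \<in> Z" for b c
  proof -
    have "(b \<oplus> c \<otimes> w) \<ominus> \<sigma> (b \<oplus> c \<otimes> w) = c \<otimes> (w \<ominus> \<sigma> w)"
      using bc by (simp add: sigma_add sigma_mult minus_eq minus_add r_distr r_minus a_ac r_neg2 r_neg1)
    then show y: "y (b \<oplus> c \<otimes> w) = c" using bc u_inverse' by (simp add: y_def m_assoc)
    show "x (b \<oplus> c \<otimes> w) = b" unfolding x_def y using bc by (simp add: minus_eq a_assoc r_neg)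
  qed
  have span: "x a \<in> Z" "y a \<in> Z" "a = x a \<oplus> y a \<otimes> w" if aW: "a \<in> W" for a
  proof -
    obtain b c where bc: "b \<in> Z" "c \<in> Z" "a = b \<oplus> c \<otimes> w" using W_span[OF aW] by blast
    show "x a \<in> Z" "y a \<in> Z" "a = x a \<oplus> y a \<otimes> w" unfolding bc(3) coord[OF bc(1,2)] using bc by auto
  qed
  have sum: "(b \<oplus> c \<otimes> w) \<ominus> (b' \<oplus> c' \<otimes> w) = (b \<ominus> b') \<oplus> (c \<ominus> c') \<otimes> w" if "b \<in> Z" "c \<in> Z" "b' \<in> Z" "c' \<in> Z" for b c b' c'
    using that by (simp add: minus_eq minus_add l_distr l_minus a_ac)
  have "card ((\<lambda>a. (\<rho> (x a), \<rho> (y a))) ` W) = residue_card"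
  proof (rule card_residue_image)
    fix a b assume a: "a \<in> W" and b: "b \<in> W"
    note sa = span[OF a] and sb = span[OF b]
    have "(\<rho> (x a), \<rho> (y a)) = (\<rho> (x b), \<rho> (y b)) \<longleftrightarrow> (\<exists>z\<in>Z. x a \<ominus> x b = pi2 \<otimes> z) \<and> (\<exists>z\<in>Z. y a \<ominus> y b = pi2 \<otimes> z)"
      using rho[OF sa(1) sb(1)] rho[OF sa(2) sb(2)] by simp
    also have "\<dots> \<longleftrightarrow> (\<exists>c\<in>W. (x a \<ominus> x b) \<oplus> (y a \<ominus> y b) \<otimes> w = pi2 \<otimes> c)"
    proof
      assume "(\<exists>z\<in>Z. x a \<ominus> x b = pi2 \<otimes> z) \<and> (\<exists>z\<in>Z. y a \<ominus> y b = pi2 \<otimes> z)"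
      then obtain z z' where z: "z \<in> Z" "z' \<in> Z" "x a \<ominus> x b = pi2 \<otimes> z" "y a \<ominus> y b = pi2 \<otimes> z'" by blast
      have "(x a \<ominus> x b) \<oplus> (y a \<ominus> y b) \<otimes> w = pi2 \<otimes> (z \<oplus> z' \<otimes> w)"
        unfolding z(3,4) using z(1,2) by (simp add: r_distr m_assoc)
      moreover have "z \<oplus> z' \<otimes> w \<in> W" using z(1,2) by simp
      ultimately show "\<exists>c\<in>W. (x a \<ominus> x b) \<oplus> (y a \<ominus> y b) \<otimes> w = pi2 \<otimes> c" by blast
    next
      assume "\<exists>c\<in>W. (x a \<ominus> x b) \<oplus> (y a \<ominus> y b) \<otimes> w = pi2 \<otimes> c"
      then obtain c where c: "c \<in> W" "(x a \<ominus> x b) \<oplus> (y a \<ominus> y b) \<otimes> w = pi2 \<otimes> c" by blast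
      have "pi2 \<otimes> c = pi2 \<otimes> (x c \<oplus> y c \<otimes> w)" using span(3)[OF c(1)] by simp
      also have "\<dots> = pi2 \<otimes> x c \<oplus> (pi2 \<otimes> y c) \<otimes> w"
        using span(1,2)[OF c(1)] m_assoc[of pi2 "y c" w] by (simp add: r_distr del: pi_closed)
      finally have e: "(x a \<ominus> x b) \<oplus> (y a \<ominus> y b) \<otimes> w = pi2 \<otimes> x c \<oplus> (pi2 \<otimes> y c) \<otimes> w" using c(2) by simp
      have m: "x a \<ominus> x b \<in> Z" "y a \<ominus> y b \<in> Z" "pi2 \<otimes> x c \<in> Z" "pi2 \<otimes> y c \<in> Z"
        using sa(1,2) sb(1,2) span(1,2)[OF c(1)] by simp_all
      show "(\<exists>z\<in>Z. x a \<ominus> x b = pi2 \<otimes> z) \<and> (\<exists>z\<in>Z. y a \<ominus> y b = pi2 \<otimes> z)"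
        using arg_cong[OF e, of x] arg_cong[OF e, of y] unfolding coord[OF m(1,2)] coord[OF m(3,4)]
        using span(1,2)[OF c(1)] by blast
    qed
    also have "(x a \<ominus> x b) \<oplus> (y a \<ominus> y b) \<otimes> w = a \<ominus> b"
      using sum[OF sa(1,2) sb(1,2)] unfolding sa(3)[symmetric] sb(3)[symmetric] by simp
    finally show "(\<rho> (x a), \<rho> (y a)) = (\<rho> (x b), \<rho> (y b)) \<longleftrightarrow> (\<exists>c\<in>W. a \<ominus> b = pi2 \<otimes> c)" .
  qed
  moreover have "(\<lambda>a. (\<rho> (x a), \<rho> (y a))) ` W = \<rho> ` Z \<times> \<rho> ` Z"
  proof
    show "(\<lambda>a. (\<rho> (x a), \<rho> (y a))) ` W \<subseteq> \<rho> ` Z \<times> \<rho> ` Z" using span by blast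
    show "\<rho> ` Z \<times> \<rho> ` Z \<subseteq> (\<lambda>a. (\<rho> (x a), \<rho> (y a))) ` W"
    proof
      fix q assume "q \<in> \<rho> ` Z \<times> \<rho> ` Z"
      then obtain b c where bc: "b \<in> Z" "c \<in> Z" "q = (\<rho> b, \<rho> c)" by blast
      show "q \<in> (\<lambda>a. (\<rho> (x a), \<rho> (y a))) ` W"
        using bc coord[OF bc(1,2)] by (intro image_eqI[of _ _ "b \<oplus> c \<otimes> w"]) simp_all
    qed
  qed
  ultimately show ?thesis by (simp add: card_cartesian_product power2_eq_square)
qed

end

section \<open>Maximal orders containing an unramified quadratic order\<close>

locale quaternion_order = padic p + ring D for p and D :: "'d ring" (structure) +
  fixes \<iota> :: "(nat \<Rightarrow> int) \<Rightarrow> 'd" and S K OK :: "'d set" and \<sigma> :: "'d \<Rightarrow> 'd" and \<pi> :: "nat \<Rightarrow> int" and PI :: 'd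
  assumes quaternion: "quaternion_division_algebra p D \<iota>" and order: "Zp_order p D \<iota> S"
    and unramified: "unramified_quadratic_in p D \<iota> K" and OK_def: "OK = ring_of_integers p D \<iota> K"
    and automorphism: "nontrivial_automorphism p D \<iota> K \<sigma>" and uniformizer: "Zp_uniformizer p \<pi>"
    and PI_S: "PI \<in> S" and PI_square: "PI \<otimes> PI = \<iota> \<pi>" and PI_twist: "\<forall>a\<in>OK. PI \<otimes> a = \<sigma> a \<otimes> PI"
    and direct_sum: "internal_direct_sum (D\<lparr>carrier := S\<rparr>) OK {a \<otimes> PI | a. a \<in> OK}"
begin

section \<open>The division algebra and the integers of the quadratic field\<close>

lemma D_integral: "\<lbrakk>x \<in> carrier D; y \<in> carrier D; x \<otimes> y = \<zero>\<rbrakk> \<Longrightarrow> x = \<zero> \<or> y = \<zero>"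
proof -
  assume h: "x \<in> carrier D" "y \<in> carrier D" "x \<otimes> y = \<zero>"
  show ?thesis
  proof (rule disjCI)
    assume "y \<noteq> \<zero>"
    then have "y \<in> Units D" using quaternion h(2) by (auto simp: quaternion_division_algebra_def division_algebra_def)
    then obtain z where z: "z \<in> carrier D" "y \<otimes> z = \<one>" unfolding Units_def by blast
    have "x = (x \<otimes> y) \<otimes> z" using h(1,2) z by (simp add: m_assoc)
    then show "x = \<zero>" using h(3) z(1) by simp
  qed
qed

lemma D_one_not_zero: "\<one> \<noteq> \<zero>"
  using quaternion by (simp add: quaternion_division_algebra_def division_algebra_def)

lemma D_cancel: "\<lbrakk>t \<in> carrier D; t \<noteq> \<zero>; x \<in> carrier D; y \<in> carrier D; t \<otimes> x = t \<otimes> y\<rbrakk> \<Longrightarrow> x = y"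
  "\<lbrakk>t \<in> carrier D; t \<noteq> \<zero>; x \<in> carrier D; y \<in> carrier D; x \<otimes> t = y \<otimes> t\<rbrakk> \<Longrightarrow> x = y"
proof -
  assume h: "t \<in> carrier D" "t \<noteq> \<zero>" "x \<in> carrier D" "y \<in> carrier D"
  { assume "t \<otimes> x = t \<otimes> y"
    then have "t \<otimes> (x \<ominus> y) = \<zero>" using h by (simp add: minus_eq r_distr r_minus r_neg)
    then show "x = y" using D_integral[of t "x \<ominus> y"] h by auto }
  { assume "x \<otimes> t = y \<otimes> t"
    then have "(x \<ominus> y) \<otimes> t = \<zero>" using h by (simp add: minus_eq l_distr l_minus r_neg)
    then show "x = y" using D_integral[of "x \<ominus> y" t] h by auto }
qed

lemma iota_hom: "\<iota> \<in> ring_hom ZZ D" and iota_inj: "inj_on \<iota> (carrier ZZ)"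
  and center: "ring_center D = Qp_in p D \<iota>"
  using quaternion by (simp_all add: quaternion_division_algebra_def)

sublocale iota: ring_hom_ring ZZ D \<iota>
  by (rule ring_hom_ringI2[OF Zp.ring_axioms ring_axioms iota_hom])

lemma iota_zero_iff: "z \<in> carrier ZZ \<Longrightarrow> \<iota> z = \<zero> \<longleftrightarrow> z = \<zero>\<^sub>ZZ"
  using inj_onD[OF iota_inj, of z "\<zero>\<^sub>ZZ"] by auto

lemma iota_unit: "\<lbrakk>v \<in> carrier ZZ; v' \<in> carrier ZZ; v \<otimes>\<^sub>ZZ v' = \<one>\<^sub>ZZ\<rbrakk> \<Longrightarrow> \<iota> v \<otimes> \<iota> v' = \<one>"
  by (metis iota.hom_mult iota.hom_one)

lemma iota_Qp: "z \<in> carrier ZZ \<Longrightarrow> \<iota> z \<in> Qp_in p D \<iota>"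
proof -
  assume z: "z \<in> carrier ZZ"
  have "\<iota> z = \<iota> z \<otimes> inv (\<iota> \<one>\<^sub>ZZ)" using z by simp
  moreover have "\<one>\<^sub>ZZ \<noteq> \<zero>\<^sub>ZZ" using pz_pow_nonzero[of 0] by simp
  ultimately show ?thesis unfolding Qp_in_def using z Zp.one_closed by blast
qed

lemma iota_central: "\<lbrakk>z \<in> carrier ZZ; x \<in> carrier D\<rbrakk> \<Longrightarrow> \<iota> z \<otimes> x = x \<otimes> \<iota> z"
  using iota_Qp center unfolding ring_center_def by blast

lemma K_subfield: "subfield K D" and Qp_K: "Qp_in p D \<iota> \<subseteq> K"
  and max_OK: "maximalideal (multiples p (D\<lparr>carrier := OK\<rparr>)) (D\<lparr>carrier := OK\<rparr>)"
  using unramified by (simp_all add: unramified_quadratic_in_def Let_def OK_def)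

lemma K_closed [simp]: "x \<in> K \<Longrightarrow> x \<in> carrier D" "\<zero> \<in> K" "\<one> \<in> K" "x \<in> K \<Longrightarrow> \<ominus> x \<in> K"
  "\<lbrakk>x \<in> K; y \<in> K\<rbrakk> \<Longrightarrow> x \<otimes> y \<in> K" "\<lbrakk>x \<in> K; y \<in> K\<rbrakk> \<Longrightarrow> x \<oplus> y \<in> K"
  using subringE[OF subfieldE(1)[OF K_subfield]] by auto

lemma K_comm: "\<lbrakk>x \<in> K; y \<in> K\<rbrakk> \<Longrightarrow> x \<otimes> y = y \<otimes> x"
  using subfieldE(4)[OF K_subfield] by blast

lemma OK_K: "OK \<subseteq> K"
  by (auto simp: OK_def ring_of_integers_def)

lemma OK_subring: "subring OK D"
proof -
  interpret M: maximalideal "multiples p (D\<lparr>carrier := OK\<rparr>)" "D\<lparr>carrier := OK\<rparr>" by (rule max_OK)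
  show ?thesis using subring_iff[of OK] M.ring_axioms OK_K K_closed(1) by blast
qed

lemma OK_closed [simp]: "x \<in> OK \<Longrightarrow> x \<in> carrier D" "\<zero> \<in> OK" "\<one> \<in> OK" "x \<in> OK \<Longrightarrow> \<ominus> x \<in> OK"
  "\<lbrakk>x \<in> OK; y \<in> OK\<rbrakk> \<Longrightarrow> x \<otimes> y \<in> OK" "\<lbrakk>x \<in> OK; y \<in> OK\<rbrakk> \<Longrightarrow> x \<oplus> y \<in> OK"
  using subringE[OF OK_subring] by auto

lemma OK_comm: "\<lbrakk>x \<in> OK; y \<in> OK\<rbrakk> \<Longrightarrow> x \<otimes> y = y \<otimes> x"
  using K_comm OK_K by blast

lemma OK_lcomm: "\<lbrakk>x \<in> OK; y \<in> OK; z \<in> OK\<rbrakk> \<Longrightarrow> x \<otimes> (y \<otimes> z) = y \<otimes> (x \<otimes> z)"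
  using OK_comm[of x y] m_assoc[of x y z] m_assoc[of y x z] by simp

lemmas OK_ac = m_assoc OK_comm OK_lcomm

lemma S_subring: "subring S D" and S_span: "x \<in> carrier D \<Longrightarrow> \<exists>z\<in>carrier ZZ. z \<noteq> \<zero>\<^sub>ZZ \<and> \<iota> z \<otimes> x \<in> S"
  using order by (simp_all add: Zp_order_def)

lemma S_closed [simp]: "x \<in> S \<Longrightarrow> x \<in> carrier D" "\<zero> \<in> S" "\<one> \<in> S" "x \<in> S \<Longrightarrow> \<ominus> x \<in> S"
  "\<lbrakk>x \<in> S; y \<in> S\<rbrakk> \<Longrightarrow> x \<otimes> y \<in> S" "\<lbrakk>x \<in> S; y \<in> S\<rbrakk> \<Longrightarrow> x \<oplus> y \<in> S"
  using subringE[OF S_subring] by auto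

lemma PI_closed [simp]: "PI \<in> carrier D"
  using PI_S by simp

lemma iota_OK [simp]: "z \<in> carrier ZZ \<Longrightarrow> \<iota> z \<in> OK"
proof -
  assume z: "z \<in> carrier ZZ"
  \<comment> \<open>The monic polynomial X - z of degree 1 exhibits the image of \<open>z\<close> as
    integral.\<close>
  have "finsum D (\<lambda>i. \<iota> z \<otimes> \<iota> z [^] i) {..<1::nat} = \<iota> z"
    using z finsum_insert[of "{}" "0::nat" "\<lambda>i. \<iota> z \<otimes> \<iota> z [^] i"] by (simp add: lessThan_Suc)
  then have e: "\<iota> z [^] (1::nat) = finsum D (\<lambda>i. \<iota> z \<otimes> \<iota> z [^] i) {..<1::nat}" using z by simp
  have K: "\<iota> z \<in> K" using Qp_K iota_Qp[OF z] by blast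
  show ?thesis unfolding OK_def ring_of_integers_def
    by (intro CollectI conjI exI[of _ "1::nat"] exI[of _ "\<lambda>_. z"] K e) (use z in simp)
qed

lemma pi_closed [simp]: "\<pi> \<in> carrier ZZ"
  using uniformizer by (simp add: Zp_uniformizer_def)

lemma iota_pi_nonzero: "\<iota> \<pi> \<noteq> \<zero>"
proof -
  obtain v v' where v: "v \<in> carrier ZZ" "v' \<in> carrier ZZ" "v \<otimes>\<^sub>ZZ v' = \<one>\<^sub>ZZ" "\<pi> = pz \<otimes>\<^sub>ZZ v"
    using uniformizer_associate[OF uniformizer] by metis
  have "\<pi> \<otimes>\<^sub>ZZ v' = pz" unfolding v(4) using v(1-3) by (simp add: Zp.m_assoc)
  then have "\<pi> \<noteq> \<zero>\<^sub>ZZ" using v(2) pz_pow_nonzero[of 1] by auto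
  then show ?thesis by (simp add: iota_zero_iff)
qed

lemma pz_multiple: "pz = [p] \<cdot>\<^bsub>ZZ\<^esub> \<one>\<^sub>ZZ"
proof -
  have "([k] \<cdot>\<^bsub>ZZ\<^esub> \<one>\<^sub>ZZ) n = int k mod int p ^ n" for k n
    by (induction k) (simp_all add: Zp_simps mod_simps Zp.add.nat_pow_Suc add.commute)
  then show ?thesis by (simp add: fun_eq_iff pz_def)
qed

lemma multiple_p: "x \<in> carrier D \<Longrightarrow> [p] \<cdot> x = \<iota> pz \<otimes> x"
proof -
  assume x: "x \<in> carrier D"
  have 1: "[k] \<cdot> x = \<iota> ([k] \<cdot>\<^bsub>ZZ\<^esub> \<one>\<^sub>ZZ) \<otimes> x" for k :: nat
    using x by (induction k) (simp_all add: l_distr)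
  show ?thesis unfolding pz_multiple by (rule 1)
qed

text \<open>p and the uniformizer differ by a unit of the p-adic integers, which \<open>A\<close>
  absorbs.\<close>

lemma pz_pi_multiples:
  assumes A: "A \<subseteq> carrier D" "\<And>z x. \<lbrakk>z \<in> carrier ZZ; x \<in> A\<rbrakk> \<Longrightarrow> \<iota> z \<otimes> x \<in> A"
  shows "{[p] \<cdot> x | x. x \<in> A} = (\<lambda>x. \<iota> \<pi> \<otimes> x) ` A"
proof -
  obtain v v' where v: "v \<in> carrier ZZ" "v' \<in> carrier ZZ" "v \<otimes>\<^sub>ZZ v' = \<one>\<^sub>ZZ" "\<pi> = pz \<otimes>\<^sub>ZZ v"
    using uniformizer_associate[OF uniformizer] by metis
  have e: "\<pi> \<otimes>\<^sub>ZZ v' = pz" unfolding v(4) using v(1-3) by (simp add: Zp.m_assoc)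
  have 1: "\<iota> pz \<otimes> x = \<iota> \<pi> \<otimes> (\<iota> v' \<otimes> x)" if "x \<in> A" for x
    unfolding e[symmetric] using v(2) A(1) that by (simp add: m_assoc subset_iff)
  have 2: "\<iota> \<pi> \<otimes> x = \<iota> pz \<otimes> (\<iota> v \<otimes> x)" if "x \<in> A" for x
    unfolding v(4) using v(1) A(1) that by (simp add: m_assoc subset_iff)
  have "{[p] \<cdot> x | x. x \<in> A} = (\<lambda>x. \<iota> pz \<otimes> x) ` A"
    unfolding setcompr_eq_image using multiple_p A(1) by (intro image_cong) auto
  also have "\<dots> = (\<lambda>x. \<iota> \<pi> \<otimes> x) ` A"
    using 1 2 A(2)[OF v(1)] A(2)[OF v(2)] by blast
  finally show ?thesis .
qed

lemma carrier_update_multiple: "[(n::nat)] \<cdot>\<^bsub>D\<lparr>carrier := A\<rparr>\<^esub> x = [n] \<cdot> x"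
  by (induction n) (simp_all add: add_pow_def)

lemma max_OK': "maximalideal ((\<lambda>x. \<iota> \<pi> \<otimes> x) ` OK) (D\<lparr>carrier := OK\<rparr>)"
proof -
  have "multiples p (D\<lparr>carrier := OK\<rparr>) = {[p] \<cdot> x | x. x \<in> OK}"
    by (simp add: multiples_def carrier_update_multiple)
  also have "\<dots> = (\<lambda>x. \<iota> \<pi> \<otimes> x) ` OK" by (rule pz_pi_multiples) auto
  finally show ?thesis using max_OK by simp
qed

lemma pz_image_OK: "(\<lambda>x. \<iota> pz \<otimes> x) ` OK = (\<lambda>x. \<iota> \<pi> \<otimes> x) ` OK"
proof -
  have "(\<lambda>x. \<iota> pz \<otimes> x) ` OK = {[p] \<cdot> x | x. x \<in> OK}"
    unfolding setcompr_eq_image by (intro image_cong multiple_p[symmetric]) auto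
  also have "\<dots> = (\<lambda>x. \<iota> \<pi> \<otimes> x) ` OK" by (rule pz_pi_multiples) auto
  finally show ?thesis .
qed

text \<open>Unramifiedness enters here: p generates a maximal, hence prime, ideal of
  \<open>OK\<close>, and the uniformizer generates the same ideal.\<close>

lemma OK_prime: "\<lbrakk>a \<in> OK; b \<in> OK; c \<in> OK; a \<otimes> b = \<iota> \<pi> \<otimes> c\<rbrakk> \<Longrightarrow> (\<exists>d\<in>OK. a = \<iota> \<pi> \<otimes> d) \<or> (\<exists>d\<in>OK. b = \<iota> \<pi> \<otimes> d)"
proof -
  assume h: "a \<in> OK" "b \<in> OK" "c \<in> OK" "a \<otimes> b = \<iota> \<pi> \<otimes> c"
  interpret M: maximalideal "(\<lambda>x. \<iota> \<pi> \<otimes> x) ` OK" "D\<lparr>carrier := OK\<rparr>" by (rule max_OK')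
  interpret M: cring "D\<lparr>carrier := OK\<rparr>"
    by (intro cring.intro M.ring_axioms Group.comm_monoid.intro M.monoid_axioms comm_monoid_axioms.intro)
      (simp add: OK_comm)
  interpret P: primeideal "(\<lambda>x. \<iota> \<pi> \<otimes> x) ` OK" "D\<lparr>carrier := OK\<rparr>" by (rule M.maximalideal_prime[OF max_OK'])
  have "a \<otimes>\<^bsub>D\<lparr>carrier := OK\<rparr>\<^esub> b \<in> (\<lambda>x. \<iota> \<pi> \<otimes> x) ` OK" using h(3,4) by simp
  then show ?thesis using P.I_prime[of a b] h(1,2) by auto
qed

lemma OK_proper: "a \<in> OK \<Longrightarrow> \<iota> \<pi> \<otimes> a \<noteq> \<one>"
proof
  assume a: "a \<in> OK" "\<iota> \<pi> \<otimes> a = \<one>"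
  interpret M: maximalideal "(\<lambda>x. \<iota> \<pi> \<otimes> x) ` OK" "D\<lparr>carrier := OK\<rparr>" by (rule max_OK')
  have "\<one> \<in> (\<lambda>x. \<iota> \<pi> \<otimes> x) ` OK" using a by (metis imageI)
  then have "(\<lambda>x. \<iota> \<pi> \<otimes> x) ` OK = OK" using M.one_imp_carrier by simp
  then show False using M.I_notcarr by simp
qed

lemma iota_pow: "z \<in> carrier ZZ \<Longrightarrow> \<iota> (z [^]\<^sub>ZZ (n::nat)) = \<iota> z [^] n"
  by (rule iota.hom_nat_pow)

lemma iota_factor:
  assumes z: "z \<in> carrier ZZ" "z \<noteq> \<zero>\<^sub>ZZ"
  obtains n v v' where "v \<in> \<iota> ` carrier ZZ" "v' \<in> \<iota> ` carrier ZZ" "v \<otimes> v' = \<one>" "\<iota> z = \<iota> \<pi> [^] (n::nat) \<otimes> v"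
proof -
  obtain n v v' where v: "v \<in> carrier ZZ" "v' \<in> carrier ZZ" "v \<otimes>\<^sub>ZZ v' = \<one>\<^sub>ZZ" "z = \<pi> [^]\<^sub>ZZ (n::nat) \<otimes>\<^sub>ZZ v"
    using uniformizer_factor[OF uniformizer z] by metis
  have "\<iota> z = \<iota> \<pi> [^] n \<otimes> \<iota> v" unfolding v(4) using v(1) by (simp add: iota_pow)
  then show thesis using that[of "\<iota> v" "\<iota> v'" n] v(1,2) iota_unit[OF v(1-3)] by blast
qed

lemma pi_pow [simp]: "\<iota> \<pi> [^] (n::nat) \<in> OK" "\<iota> \<pi> [^] n \<noteq> \<zero>"
proof -
  show 1: "\<iota> \<pi> [^] (n::nat) \<in> OK" for n by (induction n) simp_all
  show "\<iota> \<pi> [^] n \<noteq> \<zero>"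
  proof (induction n)
    case (Suc n)
    then show ?case using D_integral[of "\<iota> \<pi> [^] n" "\<iota> \<pi>"] iota_pi_nonzero by auto
  qed (simp add: D_one_not_zero)
qed

text \<open>Numerator and denominator are powers of the uniformizer times units. An excess in the
  denominator would make the uniformizer invertible in \<open>OK\<close>, against
  \<open>OK_proper\<close>, so the quotient is already a p-adic integer.\<close>

lemma Qp_OK: "\<lbrakk>x \<in> Qp_in p D \<iota>; x \<in> OK\<rbrakk> \<Longrightarrow> x \<in> \<iota> ` carrier ZZ"
proof -
  assume x: "x \<in> Qp_in p D \<iota>" "x \<in> OK"
  obtain a b where ab: "a \<in> carrier ZZ" "b \<in> carrier ZZ" "b \<noteq> \<zero>\<^sub>ZZ" "x = \<iota> a \<otimes> inv (\<iota> b)"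
    using x(1) unfolding Qp_in_def by blast
  have "\<iota> b \<in> Units D" using quaternion ab(2,3) iota_zero_iff
    by (auto simp: quaternion_division_algebra_def division_algebra_def)
  then have e: "x \<otimes> \<iota> b = \<iota> a" using ab by (simp add: m_assoc)
  show ?thesis
  proof (cases "a = \<zero>\<^sub>ZZ")
    case True
    then have "x = \<zero>" using D_integral[of x "\<iota> b"] e ab(2,3) x(2) by (simp add: iota_zero_iff)
    then show ?thesis using iota.hom_zero Zp.zero_closed by (metis imageI)
  next
    case False
    obtain n v v' where v: "v \<in> \<iota> ` carrier ZZ" "v' \<in> \<iota> ` carrier ZZ" "v \<otimes> v' = \<one>" "\<iota> a = \<iota> \<pi> [^] (n::nat) \<otimes> v"
      using iota_factor[OF ab(1) False] by metis
    obtain m u u' where u: "u \<in> \<iota> ` carrier ZZ" "u' \<in> \<iota> ` carrier ZZ" "u \<otimes> u' = \<one>" "\<iota> b = \<iota> \<pi> [^] (m::nat) \<otimes> u"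
      using iota_factor[OF ab(2,3)] by metis
    have c: "v \<in> OK" "v' \<in> OK" "u \<in> OK" "u' \<in> OK" using u v by auto
    have cd: "v \<in> carrier D" "v' \<in> carrier D" "u \<in> carrier D" "u' \<in> carrier D" using c by auto
    have q: "\<iota> \<pi> [^] k \<in> carrier D" for k :: nat by simp
    have "\<iota> \<pi> [^] m \<otimes> x = (x \<otimes> \<iota> b) \<otimes> u'"
      unfolding u(4) using x(2) c q u(3) OK_comm[of x "\<iota> \<pi> [^] m"] by (simp add: m_assoc)
    then have xe: "\<iota> \<pi> [^] m \<otimes> x = \<iota> \<pi> [^] n \<otimes> (v \<otimes> u')" unfolding e v(4) using cd q by (simp add: m_assoc)
    obtain y z where yz: "v = \<iota> y" "u' = \<iota> z" "y \<in> carrier ZZ" "z \<in> carrier ZZ" using u(2) v(1) by blast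
    show ?thesis
    proof (cases "m \<le> n")
      case True
      then have pw: "\<iota> \<pi> [^] n = \<iota> \<pi> [^] m \<otimes> \<iota> \<pi> [^] (n - m)" using nat_pow_mult[of "\<iota> \<pi>" m "n - m"] by simp
      have "\<iota> \<pi> [^] m \<otimes> x = \<iota> \<pi> [^] m \<otimes> (\<iota> \<pi> [^] (n - m) \<otimes> (v \<otimes> u'))"
        unfolding xe pw by (rule m_assoc) (use cd q in simp_all)
      then have "x = \<iota> \<pi> [^] (n - m) \<otimes> (v \<otimes> u')"
        by (rule D_cancel(1)[rotated 4]) (use x(2) cd q in simp_all)
      also have "\<dots> = \<iota> (\<pi> [^]\<^sub>ZZ (n - m) \<otimes>\<^sub>ZZ (y \<otimes>\<^sub>ZZ z))" unfolding yz using yz(3,4) by (simp add: iota_pow)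
      finally have e: "x = \<iota> (\<pi> [^]\<^sub>ZZ (n - m) \<otimes>\<^sub>ZZ (y \<otimes>\<^sub>ZZ z))" .
      show ?thesis unfolding e using yz(3,4) by (intro imageI) simp
    next
      case False
      then obtain k where k: "m = n + Suc k" by (metis add_Suc_right less_imp_Suc_add not_le)
      have pw: "\<iota> \<pi> [^] m = \<iota> \<pi> [^] n \<otimes> \<iota> \<pi> [^] Suc k" using nat_pow_mult[of "\<iota> \<pi>" n "Suc k"] unfolding k by simp
      have "\<iota> \<pi> [^] n \<otimes> (\<iota> \<pi> [^] Suc k \<otimes> x) = \<iota> \<pi> [^] n \<otimes> (v \<otimes> u')"
        unfolding xe[symmetric] pw by (rule m_assoc[symmetric]) (use x(2) q in simp_all)
      then have "\<iota> \<pi> [^] Suc k \<otimes> x = v \<otimes> u'"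
        by (rule D_cancel(1)[rotated 4]) (use x(2) cd q in simp_all)
      then have "\<iota> \<pi> [^] Suc k \<otimes> x \<otimes> u \<otimes> v' = v \<otimes> (u' \<otimes> u) \<otimes> v'" using cd by (simp add: m_assoc)
      also have "u' \<otimes> u = \<one>" using u(3) OK_comm[OF c(3,4)] by simp
      finally have "\<iota> \<pi> [^] Suc k \<otimes> x \<otimes> u \<otimes> v' = \<one>" using v(3) cd by simp
      moreover have "\<iota> \<pi> [^] Suc k \<otimes> x \<otimes> u \<otimes> v' = \<iota> \<pi> \<otimes> (\<iota> \<pi> [^] k \<otimes> x \<otimes> u \<otimes> v')"
        using cd x(2) q OK_comm[of "\<iota> \<pi> [^] k" "\<iota> \<pi>"] by (simp add: m_assoc)
      moreover have "\<iota> \<pi> [^] k \<otimes> x \<otimes> u \<otimes> v' \<in> OK" using c x(2) by simp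
      ultimately show ?thesis using OK_proper by metis
    qed
  qed
qed

lemma set_add_S: "A <+>\<^bsub>D\<lparr>carrier := S\<rparr>\<^esub> B = {a \<oplus> b | a b. a \<in> A \<and> b \<in> B}"
  by (auto simp: set_add_def set_mult_def)

lemma OK_PI_disjoint: "\<lbrakk>a \<in> OK; b \<in> OK; a = b \<otimes> PI\<rbrakk> \<Longrightarrow> a = \<zero>"
  using direct_sum unfolding internal_direct_sum_def by auto

lemma S_decompose: "x \<in> S \<Longrightarrow> \<exists>a\<in>OK. \<exists>b\<in>OK. x = a \<oplus> b \<otimes> PI"
proof -
  assume "x \<in> S"
  then have "x \<in> {a \<oplus> b | a b. a \<in> OK \<and> b \<in> {a \<otimes> PI | a. a \<in> OK}}"
    using direct_sum unfolding internal_direct_sum_def set_add_S by simp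
  then show ?thesis by blast
qed

lemma OK_S [simp]: "a \<in> OK \<Longrightarrow> a \<in> S"
proof -
  assume a: "a \<in> OK"
  have "a = a \<oplus> \<zero> \<otimes> PI" using a by simp
  then have "a \<in> {a \<oplus> b | a b. a \<in> OK \<and> b \<in> {a \<otimes> PI | a. a \<in> OK}}" using a OK_closed(2) by blast
  moreover have "\<dots> = S" using direct_sum unfolding internal_direct_sum_def set_add_S by simp
  ultimately show ?thesis by blast
qed

lemma PI_nonzero: "PI \<noteq> \<zero>"
  using PI_square iota_pi_nonzero by auto

lemma PI_notin_K: "PI \<notin> K"
proof
  assume K: "PI \<in> K"
  \<comment> \<open>The coefficients that express the square of \<open>PI\<close> as a monic
    integral equation. Inside \<open>K\<close> this would put \<open>PI\<close> into
    \<open>OK\<close>, against the directness of the sum.\<close>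
  let ?c = "\<lambda>i::nat. if i = 0 then \<pi> else \<zero>\<^sub>ZZ"
  have "finsum D (\<lambda>i. \<iota> (?c i) \<otimes> PI [^] i) {..<Suc (Suc 0)} = \<iota> \<pi>" by (simp add: lessThan_Suc)
  then have e: "PI [^] Suc (Suc 0) = finsum D (\<lambda>i. \<iota> (?c i) \<otimes> PI [^] i) {..<Suc (Suc 0)}" using PI_square by simp
  have "PI \<in> OK" unfolding OK_def ring_of_integers_def
    by (intro CollectI conjI exI[of _ "Suc (Suc 0)"] exI[of _ ?c] K e) simp
  then show False using OK_PI_disjoint[of PI \<one>] PI_nonzero by simp
qed

lemma PI_multiple_K: "\<lbrakk>a \<in> K; a \<otimes> PI \<in> K\<rbrakk> \<Longrightarrow> a = \<zero>"
  using subfield_m_inv_simprule[OF K_subfield, of a PI] PI_notin_K by auto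

lemma S_K: "\<lbrakk>x \<in> S; x \<in> K\<rbrakk> \<Longrightarrow> x \<in> OK"
proof -
  assume x: "x \<in> S" "x \<in> K"
  obtain a b where ab: "a \<in> OK" "b \<in> OK" "x = a \<oplus> b \<otimes> PI" using S_decompose[OF x(1)] by blast
  have "b \<otimes> PI = \<ominus> a \<oplus> x" unfolding ab(3) using ab(1,2) by (simp add: a_assoc[symmetric] l_neg)
  also have "\<dots> \<in> K" using ab(1) x(2) OK_K by auto
  finally have "b = \<zero>" using PI_multiple_K ab(2) OK_K by blast
  then show ?thesis using ab by simp
qed

section \<open>The Galois action on the integers and an element separated from its conjugate by a
  unit\<close>

lemma sigma_iso: "\<sigma> \<in> ring_iso (D\<lparr>carrier := K\<rparr>) (D\<lparr>carrier := K\<rparr>)" and sigma_Qp: "x \<in> Qp_in p D \<iota> \<Longrightarrow> \<sigma> x = x"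
  using automorphism by (simp_all add: nontrivial_automorphism_def)

lemma sigma_K: "x \<in> K \<Longrightarrow> \<sigma> x \<in> K" "\<lbrakk>x \<in> K; y \<in> K\<rbrakk> \<Longrightarrow> \<sigma> (x \<oplus> y) = \<sigma> x \<oplus> \<sigma> y"
  "\<lbrakk>x \<in> K; y \<in> K\<rbrakk> \<Longrightarrow> \<sigma> (x \<otimes> y) = \<sigma> x \<otimes> \<sigma> y"
  using sigma_iso by (auto simp: ring_iso_def ring_hom_def)

text \<open>The product of \<open>PI\<close> and a lies in the order and equals \<sigma>(a)
  \<open>PI\<close>. Comparing it with its decomposition along OK + OK \<open>PI\<close> places
  \<sigma>(a) in \<open>OK\<close>, since a nonzero element of \<open>K\<close> times
  \<open>PI\<close> never lies in \<open>K\<close>.\<close>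

lemma sigma_OK [simp]: "a \<in> OK \<Longrightarrow> \<sigma> a \<in> OK"
proof -
  assume a: "a \<in> OK"
  have aK: "\<sigma> a \<in> K" using sigma_K(1) a OK_K by blast
  have "PI \<otimes> a \<in> S" using a PI_S by simp
  then obtain c d where cd: "c \<in> OK" "d \<in> OK" "PI \<otimes> a = c \<oplus> d \<otimes> PI" using S_decompose by blast
  then have e: "\<sigma> a \<otimes> PI = c \<oplus> d \<otimes> PI" using PI_twist a by simp
  have "(\<sigma> a \<oplus> \<ominus> d) \<otimes> PI = \<sigma> a \<otimes> PI \<oplus> \<ominus> (d \<otimes> PI)" using aK cd(2) by (simp add: l_distr l_minus)
  also have "\<dots> = c" unfolding e using cd(1,2) by (simp add: a_assoc r_neg)
  finally have "(\<sigma> a \<oplus> \<ominus> d) \<otimes> PI \<in> K" using cd(1) OK_K by auto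
  moreover have "\<sigma> a \<oplus> \<ominus> d \<in> K" using aK cd(2) OK_K by auto
  ultimately have "\<sigma> a \<oplus> \<ominus> d = \<zero>" using PI_multiple_K by blast
  then have "\<sigma> a = d" using aK cd(2) r_right_minus_eq[of "\<sigma> a" d] unfolding minus_eq by simp
  then show ?thesis using cd(2) by simp
qed

lemma sigma_OK_hom: "\<lbrakk>x \<in> OK; y \<in> OK\<rbrakk> \<Longrightarrow> \<sigma> (x \<oplus> y) = \<sigma> x \<oplus> \<sigma> y" "\<lbrakk>x \<in> OK; y \<in> OK\<rbrakk> \<Longrightarrow> \<sigma> (x \<otimes> y) = \<sigma> x \<otimes> \<sigma> y"
  using sigma_K OK_K by blast+

lemma sigma_iota [simp]: "z \<in> carrier ZZ \<Longrightarrow> \<sigma> (\<iota> z) = \<iota> z"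
  using sigma_Qp iota_Qp by blast

text \<open>On \<open>OK\<close> the automorphism is conjugation by \<open>PI\<close>, whose square
  is central.\<close>

lemma sigma_OK_sigma [simp]: "a \<in> OK \<Longrightarrow> \<sigma> (\<sigma> a) = a"
proof -
  assume a: "a \<in> OK"
  have "PI \<otimes> (PI \<otimes> a) = \<sigma> (\<sigma> a) \<otimes> (PI \<otimes> PI)"
    using a PI_twist sigma_OK[OF a] by (simp add: m_assoc[symmetric])
  then have "\<iota> \<pi> \<otimes> a = \<sigma> (\<sigma> a) \<otimes> \<iota> \<pi>" using a PI_square by (simp add: m_assoc[symmetric])
  then have "\<iota> \<pi> \<otimes> a = \<iota> \<pi> \<otimes> \<sigma> (\<sigma> a)" using iota_central[OF pi_closed, of "\<sigma> (\<sigma> a)"] a by simp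
  then show ?thesis by (rule D_cancel(1)[rotated 4, symmetric]) (use a iota_pi_nonzero in simp_all)
qed

lemma sigma_OK_neg: "a \<in> OK \<Longrightarrow> \<sigma> (\<ominus> a) = \<ominus> \<sigma> a"
proof -
  assume a: "a \<in> OK"
  have "\<sigma> a \<oplus> \<sigma> (\<ominus> a) = \<sigma> \<zero>" using a sigma_OK_hom(1)[of a "\<ominus> a"] by (simp add: r_neg)
  also have "\<dots> = \<zero>" using sigma_iota[of "\<zero>\<^sub>ZZ"] by simp
  finally show ?thesis using a minus_equality[of "\<sigma> (\<ominus> a)" "\<sigma> a"] a_comm[of "\<sigma> a" "\<sigma> (\<ominus> a)"] by simp
qed

text \<open>A fixed element commutes with \<open>OK\<close> and with \<open>PI\<close>, hence with
  the order, and hence with \<open>D\<close>, which the order spans. The center is the fraction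
  field of the p-adic integers, and \<open>Qp_OK\<close> describes its elements in
  \<open>OK\<close>.\<close>

lemma sigma_OK_fixed: "\<lbrakk>a \<in> OK; \<sigma> a = a\<rbrakk> \<Longrightarrow> a \<in> \<iota> ` carrier ZZ"
proof -
  assume a: "a \<in> OK" "\<sigma> a = a"
  have S: "a \<otimes> x = x \<otimes> a" if xS: "x \<in> S" for x
  proof -
    obtain b c where bc: "b \<in> OK" "c \<in> OK" "x = b \<oplus> c \<otimes> PI" using S_decompose[OF xS] by blast
    have "PI \<otimes> a = a \<otimes> PI" using PI_twist a by simp
    then have "(c \<otimes> PI) \<otimes> a = (a \<otimes> c) \<otimes> PI" using a(1) bc(2) OK_comm[of a c] by (simp add: m_assoc)
    then show ?thesis unfolding bc(3) using a(1) bc(1,2) OK_comm[of a b] by (simp add: l_distr r_distr m_assoc)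
  qed
  have "a \<otimes> x = x \<otimes> a" if x: "x \<in> carrier D" for x
  proof -
    obtain z where z: "z \<in> carrier ZZ" "z \<noteq> \<zero>\<^sub>ZZ" "\<iota> z \<otimes> x \<in> S" using S_span[OF x] by blast
    have "\<iota> z \<otimes> (a \<otimes> x) = a \<otimes> (\<iota> z \<otimes> x)"
      using a(1) x z(1) iota_central[of z a] by (simp add: m_assoc[symmetric])
    also have "\<dots> = \<iota> z \<otimes> (x \<otimes> a)" unfolding S[OF z(3)] using a(1) x z(1) by (simp add: m_assoc)
    finally show ?thesis by (rule D_cancel(1)[rotated 4]) (use a(1) x z iota_zero_iff in simp_all)
  qed
  then have "a \<in> ring_center D" using a(1) by (simp add: ring_center_def)
  then show ?thesis using Qp_OK a(1) center by simp
qed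

lemma norm_Zp: "a \<in> OK \<Longrightarrow> a \<otimes> \<sigma> a \<in> \<iota> ` carrier ZZ"
  by (rule sigma_OK_fixed) (simp_all add: sigma_OK_hom OK_comm)

text \<open>The norm a \<sigma>(a) is a p-adic integer. If it is a unit, so is a; if not, the
  uniformizer divides it, hence divides a or \<sigma>(a) by primality, and \<sigma> carries the
  second case to the first.\<close>

lemma OK_local: "a \<in> OK \<Longrightarrow> (\<exists>b\<in>OK. a \<otimes> b = \<one>) \<or> (\<exists>b\<in>OK. a = \<iota> \<pi> \<otimes> b)"
proof -
  assume a: "a \<in> OK"
  obtain z where z: "z \<in> carrier ZZ" "a \<otimes> \<sigma> a = \<iota> z" using norm_Zp[OF a] by blast
  show ?thesis
  proof (cases "z = \<zero>\<^sub>ZZ")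
    case True
    then have "a = \<zero> \<or> \<sigma> a = \<zero>" using D_integral[of a "\<sigma> a"] a z by simp
    then have "a = \<zero>" using sigma_OK_sigma[OF a] sigma_iota[of "\<zero>\<^sub>ZZ"] by auto
    then have "a = \<iota> \<pi> \<otimes> \<zero>" by simp
    then show ?thesis using OK_closed(2) by blast
  next
    case False
    obtain n v v' where v: "v \<in> \<iota> ` carrier ZZ" "v' \<in> \<iota> ` carrier ZZ" "v \<otimes> v' = \<one>" "\<iota> z = \<iota> \<pi> [^] (n::nat) \<otimes> v"
      using iota_factor[OF z(1) False] by metis
    have c: "v \<in> OK" "v' \<in> OK" using v by auto
    show ?thesis
    proof (cases n)
      case 0
      have "a \<otimes> (\<sigma> a \<otimes> v') = (a \<otimes> \<sigma> a) \<otimes> v'" using a c by (simp add: m_assoc)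
      also have "\<dots> = \<one>" using z(2) v(3,4) 0 c by simp
      finally show ?thesis using a c OK_closed(5) sigma_OK by blast
    next
      case (Suc k)
      have "a \<otimes> \<sigma> a = \<iota> \<pi> \<otimes> (\<iota> \<pi> [^] k \<otimes> v)"
        using z(2) v(4) Suc c OK_comm[of "\<iota> \<pi> [^] k" "\<iota> \<pi>"] by (simp add: m_assoc[symmetric])
      then consider "\<exists>d\<in>OK. a = \<iota> \<pi> \<otimes> d" | d where "d \<in> OK" "\<sigma> a = \<iota> \<pi> \<otimes> d"
        using OK_prime[of a "\<sigma> a" "\<iota> \<pi> [^] k \<otimes> v"] a c by auto
      then show ?thesis
      proof cases
        case 2
        have "a = \<sigma> (\<sigma> a)" using a by simp
        also have "\<dots> = \<iota> \<pi> \<otimes> \<sigma> d" unfolding 2(2) using 2(1) by (simp add: sigma_OK_hom)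
        finally show ?thesis using sigma_OK[OF 2(1)] by blast
      qed blast
    qed
  qed
qed

text \<open>Descent on the valuation of the norm: dividing a by the uniformizer lowers it by two. A
  nonunit therefore has a norm of valuation at least two, which excludes the cases 0 and 1.\<close>

lemma OK_factor:
  assumes a: "a \<in> OK" "a \<noteq> \<zero>"
  obtains n c c' where "c \<in> OK" "c' \<in> OK" "c \<otimes> c' = \<one>" "a = \<iota> \<pi> [^] (n::nat) \<otimes> c"
proof -
  have "\<exists>n c c'. c \<in> OK \<and> c' \<in> OK \<and> c \<otimes> c' = \<one> \<and> a = \<iota> \<pi> [^] (n::nat) \<otimes> c"
    if "a \<in> OK" "v \<in> OK" "v' \<in> OK" "v \<otimes> v' = \<one>" "a \<otimes> \<sigma> a = \<iota> \<pi> [^] m \<otimes> v" for a v v' and m :: nat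
    using that
  proof (induction m arbitrary: a rule: less_induct)
    case (less m)
    note a = less.prems(1) and v = less.prems(2-4)
    show ?case
    proof (cases "\<exists>b\<in>OK. a \<otimes> b = \<one>")
      case True
      then obtain b where "b \<in> OK" "a \<otimes> b = \<one>" by blast
      then show ?thesis using a by (intro exI[of _ 0] exI[of _ a] exI[of _ b]) simp
    next
      case False
      then obtain b where b: "b \<in> OK" "a = \<iota> \<pi> \<otimes> b" using OK_local[OF a] by blast
      have "\<iota> \<pi> \<otimes> (\<iota> \<pi> \<otimes> (b \<otimes> \<sigma> b)) = a \<otimes> \<sigma> a"
        unfolding b(2) using b(1) by (simp add: sigma_OK_hom OK_ac)
      then have e: "\<iota> \<pi> \<otimes> (\<iota> \<pi> \<otimes> (b \<otimes> \<sigma> b)) = \<iota> \<pi> [^] m \<otimes> v" using less.prems(5) by simp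
      consider "m = 0" | "m = 1" | k where "m = Suc (Suc k)" by (metis One_nat_def not0_implies_Suc)
      then show ?thesis
      proof cases
        case 1
        then have "\<iota> \<pi> \<otimes> (\<iota> \<pi> \<otimes> (b \<otimes> \<sigma> b)) \<otimes> v' = \<one>" using e v by simp
        then have "\<iota> \<pi> \<otimes> (\<iota> \<pi> \<otimes> (b \<otimes> \<sigma> b) \<otimes> v') = \<one>" using v(2) b(1) by (simp add: m_assoc)
        then show ?thesis using OK_proper[of "\<iota> \<pi> \<otimes> (b \<otimes> \<sigma> b) \<otimes> v'"] v(2) b(1) by simp
      next
        case 2
        then have "\<iota> \<pi> \<otimes> (\<iota> \<pi> \<otimes> (b \<otimes> \<sigma> b)) = \<iota> \<pi> \<otimes> v" using e v by simp
        then have "\<iota> \<pi> \<otimes> (b \<otimes> \<sigma> b) = v" by (rule D_cancel(1)[rotated 4]) (use b(1) v(1) iota_pi_nonzero in simp_all)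
        then have "\<iota> \<pi> \<otimes> (b \<otimes> \<sigma> b) \<otimes> v' = \<one>" using v(3) by simp
        then have "\<iota> \<pi> \<otimes> (b \<otimes> \<sigma> b \<otimes> v') = \<one>" using v(2) b(1) by (simp add: m_assoc)
        then show ?thesis using OK_proper[of "b \<otimes> \<sigma> b \<otimes> v'"] v(2) b(1) by simp
      next
        case 3
        have q: "\<iota> \<pi> [^] k \<in> carrier D" by simp
        have "\<iota> \<pi> [^] m \<otimes> v = \<iota> \<pi> \<otimes> (\<iota> \<pi> \<otimes> (\<iota> \<pi> [^] k \<otimes> v))"
          unfolding 3 using q v(1) OK_comm[of "\<iota> \<pi> [^] k" "\<iota> \<pi>"] iota_central[OF pi_closed, of "\<iota> \<pi> [^] k \<otimes> \<iota> \<pi>"]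
          by (simp add: m_assoc[symmetric])
        then have "\<iota> \<pi> \<otimes> (\<iota> \<pi> \<otimes> (b \<otimes> \<sigma> b)) = \<iota> \<pi> \<otimes> (\<iota> \<pi> \<otimes> (\<iota> \<pi> [^] k \<otimes> v))" using e by simp
        then have "\<iota> \<pi> \<otimes> (b \<otimes> \<sigma> b) = \<iota> \<pi> \<otimes> (\<iota> \<pi> [^] k \<otimes> v)"
          by (rule D_cancel(1)[rotated 4]) (use b(1) v(1) q iota_pi_nonzero in simp_all)
        then have "b \<otimes> \<sigma> b = \<iota> \<pi> [^] k \<otimes> v"
          by (rule D_cancel(1)[rotated 4]) (use b(1) v(1) q iota_pi_nonzero in simp_all)
        then obtain n c c' where c: "c \<in> OK" "c' \<in> OK" "c \<otimes> c' = \<one>" "b = \<iota> \<pi> [^] (n::nat) \<otimes> c"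
          using less.IH[of k b] 3 b(1) v by auto
        have "a = \<iota> \<pi> [^] Suc n \<otimes> c"
          unfolding b(2) c(4) using c(1) OK_comm[of "\<iota> \<pi> [^] n" "\<iota> \<pi>"] by (simp add: m_assoc[symmetric])
        then show ?thesis using c(1-3) by blast
      qed
    qed
  qed
  moreover obtain z where z: "z \<in> carrier ZZ" "a \<otimes> \<sigma> a = \<iota> z" using norm_Zp[OF a(1)] by blast
  moreover have "z \<noteq> \<zero>\<^sub>ZZ"
  proof
    assume "z = \<zero>\<^sub>ZZ"
    then have "a = \<zero> \<or> \<sigma> a = \<zero>" using D_integral[of a "\<sigma> a"] a(1) z by simp
    then show False using sigma_OK_sigma[OF a(1)] sigma_iota[of "\<zero>\<^sub>ZZ"] a(2) by auto
  qed
  then obtain n v v' where v: "v \<in> \<iota> ` carrier ZZ" "v' \<in> \<iota> ` carrier ZZ" "v \<otimes> v' = \<one>" "\<iota> z = \<iota> \<pi> [^] (n::nat) \<otimes> v"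
    using iota_factor[OF z(1)] by metis
  moreover have "v \<in> OK" "v' \<in> OK" using v by auto
  ultimately have "\<exists>n c c'. c \<in> OK \<and> c' \<in> OK \<and> c \<otimes> c' = \<one> \<and> a = \<iota> \<pi> [^] (n::nat) \<otimes> c" using a(1) by metis
  then show thesis using that by blast
qed

text \<open>An element moved by \<sigma> is scaled into \<open>OK\<close>; its difference with its
  conjugate is antisymmetric and nonzero. Powers of the uniformizer are fixed by \<sigma>, so
  stripping them off leaves an antisymmetric unit.\<close>

lemma antisymmetric_unit:
  obtains c c' where "c \<in> OK" "c' \<in> OK" "c \<otimes> c' = \<one>" "\<sigma> c = \<ominus> c"
proof -
  obtain x where x: "x \<in> K" "\<sigma> x \<noteq> x" using automorphism by (auto simp: nontrivial_automorphism_def)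
  obtain z where z: "z \<in> carrier ZZ" "z \<noteq> \<zero>\<^sub>ZZ" "\<iota> z \<otimes> x \<in> S" using S_span[of x] x(1) by auto
  have zK: "\<iota> z \<in> K" using z(1) iota_OK OK_K by blast
  define a where "a = \<iota> z \<otimes> x"
  have a: "a \<in> OK" using S_K[OF z(3)] zK x(1) by (simp add: a_def)
  have sa: "\<sigma> a = \<iota> z \<otimes> \<sigma> x" using sigma_K(3)[OF zK x(1)] z(1) by (simp add: a_def)
  have ne: "\<sigma> a \<noteq> a"
  proof
    assume "\<sigma> a = a"
    then have "\<iota> z \<otimes> \<sigma> x = \<iota> z \<otimes> x" unfolding sa by (simp add: a_def)
    then have "\<sigma> x = x"
      by (rule D_cancel(1)[rotated 4]) (use z x(1) sigma_K(1) iota_zero_iff in auto)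
    then show False using x(2) by simp
  qed
  define d where "d = a \<oplus> \<ominus> \<sigma> a"
  have d: "d \<in> OK" using a by (simp add: d_def)
  have "d \<noteq> \<zero>" using ne r_right_minus_eq[of a "\<sigma> a"] a unfolding d_def minus_eq by auto
  then obtain n c c' where c: "c \<in> OK" "c' \<in> OK" "c \<otimes> c' = \<one>" "d = \<iota> \<pi> [^] (n::nat) \<otimes> c"
    using OK_factor[OF d] by metis
  have "\<iota> \<pi> [^] n \<otimes> \<sigma> c = \<sigma> d" unfolding c(4) using c(1) by (simp add: sigma_OK_hom iota_pow[symmetric])
  also have "\<dots> = \<ominus> d" unfolding d_def using a by (simp add: sigma_OK_hom sigma_OK_neg minus_add a_comm)
  also have "\<dots> = \<iota> \<pi> [^] n \<otimes> (\<ominus> c)" unfolding c(4) using c(1) by (simp add: r_minus)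
  finally have "\<sigma> c = \<ominus> c" by (rule D_cancel(1)[rotated 4]) (use c(1) in simp_all)
  then show thesis using that c(1-3) by blast
qed

lemma Zp_two: "\<lbrakk>p \<noteq> 2\<rbrakk> \<Longrightarrow> \<exists>h\<in>carrier ZZ. (\<one>\<^sub>ZZ \<oplus>\<^sub>ZZ \<one>\<^sub>ZZ) \<otimes>\<^sub>ZZ h = \<one>\<^sub>ZZ"
  "p = 2 \<Longrightarrow> pz = \<one>\<^sub>ZZ \<oplus>\<^sub>ZZ \<one>\<^sub>ZZ"
proof -
  assume "p \<noteq> 2"
  then have "p > 2" using p_gt by simp
  then have "(\<one>\<^sub>ZZ \<oplus>\<^sub>ZZ \<one>\<^sub>ZZ) 1 \<noteq> 0" by (simp add: Zp_simps)
  then show "\<exists>h\<in>carrier ZZ. (\<one>\<^sub>ZZ \<oplus>\<^sub>ZZ \<one>\<^sub>ZZ) \<otimes>\<^sub>ZZ h = \<one>\<^sub>ZZ"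
    by (rule Zp_unit[rotated]) auto
next
  assume "p = 2"
  moreover have "(\<one>\<^sub>ZZ \<oplus>\<^sub>ZZ \<one>\<^sub>ZZ) n = 2 mod int p ^ n" for n by (simp add: Zp_simps mod_simps)
  moreover have "pz n = int p mod int p ^ n" for n by (rule pz_def)
  ultimately show "pz = \<one>\<^sub>ZZ \<oplus>\<^sub>ZZ \<one>\<^sub>ZZ" by (simp add: fun_eq_iff)
qed

text \<open>For \<open>p = 2\<close> a unit \<open>c\<close> with \<open>\<sigma> c = -c\<close> has odd square, so \<open>c = 1 + 2 e\<close> and \<open>e - \<sigma> e = c\<close>.\<close>

lemma separating_element:
  obtains w u where "w \<in> OK" "u \<in> OK" "u \<otimes> (w \<oplus> \<ominus> \<sigma> w) = \<one>"
proof -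
  obtain c c' where c: "c \<in> OK" "c' \<in> OK" "c \<otimes> c' = \<one>" "\<sigma> c = \<ominus> c" using antisymmetric_unit by metis
  show thesis
  proof (cases "p = 2")
    case False
    obtain h where h: "h \<in> carrier ZZ" "(\<one>\<^sub>ZZ \<oplus>\<^sub>ZZ \<one>\<^sub>ZZ) \<otimes>\<^sub>ZZ h = \<one>\<^sub>ZZ" using Zp_two(1)[OF False] by blast
    have "\<iota> ((\<one>\<^sub>ZZ \<oplus>\<^sub>ZZ \<one>\<^sub>ZZ) \<otimes>\<^sub>ZZ h) = (\<one> \<oplus> \<one>) \<otimes> \<iota> h" using h(1) by simp
    then have two: "(\<one> \<oplus> \<one>) \<otimes> \<iota> h = \<one>" unfolding h(2) by simp
    \<comment> \<open>For odd p the unit itself works: its difference with its conjugate is 2 c, and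
      2 is invertible.\<close>
    have "c \<oplus> \<ominus> \<sigma> c = (\<one> \<oplus> \<one>) \<otimes> c" unfolding c(4) using c(1) by (simp add: l_distr)
    then have "(c' \<otimes> \<iota> h) \<otimes> (c \<oplus> \<ominus> \<sigma> c) = (c \<otimes> c') \<otimes> ((\<one> \<oplus> \<one>) \<otimes> \<iota> h)"
      using c(1,2) h(1) by (simp add: OK_ac)
    then have "(c' \<otimes> \<iota> h) \<otimes> (c \<oplus> \<ominus> \<sigma> c) = \<one>" unfolding two c(3) by simp
    then show thesis using that[of c "c' \<otimes> \<iota> h"] c(1,2) h(1) by simp
  next
    case True
    obtain z where z: "z \<in> carrier ZZ" "c \<otimes> \<sigma> c = \<iota> z" using norm_Zp[OF c(1)] by blast
    obtain z' where z': "z' \<in> carrier ZZ" "c' \<otimes> \<sigma> c' = \<iota> z'" using norm_Zp[OF c(2)] by blast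
    have "\<iota> (z \<otimes>\<^sub>ZZ z') = (c \<otimes> \<sigma> c) \<otimes> (c' \<otimes> \<sigma> c')" using z z' by simp
    also have "\<dots> = (c \<otimes> c') \<otimes> \<sigma> (c \<otimes> c')"
      using c(1,2) by (simp add: sigma_OK_hom OK_ac)
    also have "\<dots> = \<iota> \<one>\<^sub>ZZ" unfolding c(3) using sigma_iota[of "\<one>\<^sub>ZZ"] by simp
    finally have zz: "z \<otimes>\<^sub>ZZ z' = \<one>\<^sub>ZZ" using inj_onD[OF iota_inj] z(1) z'(1) by simp
    have "z 1 \<noteq> 0"
    proof
      assume "z 1 = 0"
      then obtain y where "y \<in> carrier ZZ" "z = pz \<otimes>\<^sub>ZZ y" using Zp_divide_p[OF z(1)] by metis
      then show False using zz z'(1) pz_nonunit[of "y \<otimes>\<^sub>ZZ z'"] by (simp add: Zp.m_assoc)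
    qed
    moreover have "0 \<le> z 1" "z 1 < int p" using z(1)[unfolded Zp_simps(1), rule_format, of 1] by simp_all
    ultimately have z1: "z 1 = 1" using True by simp
    have "(\<one>\<^sub>ZZ \<oplus>\<^sub>ZZ z) 1 = (1 mod int p + z 1) mod int p" by (simp add: Zp_simps)
    then have z2: "(\<one>\<^sub>ZZ \<oplus>\<^sub>ZZ z) 1 = 0" using z1 True by simp
    obtain y where y: "y \<in> carrier ZZ" "\<one>\<^sub>ZZ \<oplus>\<^sub>ZZ z = pz \<otimes>\<^sub>ZZ y"
      by (rule Zp_divide_p[where x = "\<one>\<^sub>ZZ \<oplus>\<^sub>ZZ z", OF _ z2]) (use z(1) in auto)
    define t where "t = \<iota> pz"
    have t: "t \<in> OK" "t = \<one> \<oplus> \<one>" using Zp_two(2)[OF True] by (simp_all add: t_def)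
    have t2: "t \<otimes> x = x \<oplus> x" if "x \<in> carrier D" for x using that by (simp add: t(2) l_distr)
    have t0: "t \<noteq> \<zero>" using pz_pow_nonzero[of 1] by (simp add: t_def iota_zero_iff)
    \<comment> \<open>This product is 1 - c^2, and c \<sigma>(c) = -c^2 is an odd 2-adic integer, so
      the product is even. As 2 is prime in \<open>OK\<close>, one of the two factors is
      even.\<close>
    have "(\<one> \<oplus> \<ominus> c) \<otimes> (\<one> \<oplus> c) = \<one> \<oplus> c \<otimes> \<sigma> c"
      unfolding c(4) using c(1) by (simp add: l_distr r_distr l_minus r_minus a_assoc r_neg1 r_neg2)
    also have "\<dots> = \<iota> (\<one>\<^sub>ZZ \<oplus>\<^sub>ZZ z)" unfolding z(2) using z(1) by simp
    also have "\<dots> = t \<otimes> \<iota> y" unfolding y(2) using y(1) by (simp add: t_def)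
    finally have "(\<one> \<oplus> \<ominus> c) \<otimes> (\<one> \<oplus> c) \<in> (\<lambda>x. t \<otimes> x) ` OK" using y(1) by simp
    then obtain x where "x \<in> OK" "(\<one> \<oplus> \<ominus> c) \<otimes> (\<one> \<oplus> c) = \<iota> \<pi> \<otimes> x" unfolding t_def pz_image_OK by blast
    then have "(\<one> \<oplus> \<ominus> c) \<in> (\<lambda>x. t \<otimes> x) ` OK \<or> (\<one> \<oplus> c) \<in> (\<lambda>x. t \<otimes> x) ` OK"
      unfolding t_def pz_image_OK using OK_prime[of "\<one> \<oplus> \<ominus> c" "\<one> \<oplus> c" x] c(1) by auto
    then consider e where "e \<in> OK" "\<one> \<oplus> \<ominus> c = t \<otimes> e" | e where "e \<in> OK" "\<one> \<oplus> c = t \<otimes> e" by blast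
    then obtain e where e: "e \<in> OK" "\<one> \<oplus> c = t \<otimes> e"
    proof cases
      case 1
      have "\<one> \<oplus> c = t \<otimes> \<one> \<oplus> \<ominus> (\<one> \<oplus> \<ominus> c)" using c(1) by (simp add: t2 minus_add a_assoc r_neg1 r_neg2)
      also have "\<dots> = t \<otimes> (\<one> \<oplus> \<ominus> e)" unfolding 1(2) using 1(1) t(1) by (simp add: r_distr r_minus)
      finally show thesis using that[of "\<one> \<oplus> \<ominus> e"] 1(1) by simp
    qed
    have "t \<otimes> \<sigma> e = \<sigma> (t \<otimes> e)" using e(1) t(1) by (simp add: sigma_OK_hom t_def)
    also have "\<dots> = \<one> \<oplus> \<ominus> c" unfolding e(2)[symmetric] using c(1,4) sigma_iota[of "\<one>\<^sub>ZZ"] by (simp add: sigma_OK_hom)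
    finally have se: "t \<otimes> \<sigma> e = \<one> \<oplus> \<ominus> c" .
    have "t \<otimes> (e \<oplus> \<ominus> \<sigma> e) = t \<otimes> e \<oplus> \<ominus> (t \<otimes> \<sigma> e)" using e(1) t(1) by (simp add: r_distr r_minus)
    also have "\<dots> = t \<otimes> c" unfolding se e(2)[symmetric] using c(1) by (simp add: t2 minus_add a_ac r_neg r_neg1 r_neg2)
    finally have "e \<oplus> \<ominus> \<sigma> e = c" by (rule D_cancel(1)[rotated 4]) (use e(1) t(1) t0 c(1) in simp_all)
    then show thesis using that[of e c'] e(1) c(1-3) OK_comm[of c c'] by simp
  qed
qed

section \<open>The order as an instance of the abstract axioms\<close>

lemma dvr_Zp:
  assumes z: "z \<in> \<iota> ` carrier ZZ" "z \<noteq> \<zero>"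
  shows "\<exists>n::nat. \<exists>v\<in>\<iota> ` carrier ZZ. \<exists>v'\<in>\<iota> ` carrier ZZ. v \<otimes> v' = \<one> \<and> z = \<iota> \<pi> [^] n \<otimes> v"
proof -
  obtain x where x: "x \<in> carrier ZZ" "z = \<iota> x" using z(1) by blast
  then have "x \<noteq> \<zero>\<^sub>ZZ" using z(2) by auto
  then show ?thesis using iota_factor[OF x(1)] x(2) by metis
qed

abbreviation OD where "OD \<equiv> D\<lparr>carrier := S\<rparr>"

lemma ring_O: "ring OD"
  by (rule subring_is_ring[OF S_subring])

lemma neg_O: "x \<in> S \<Longrightarrow> \<ominus>\<^sub>OD x = \<ominus> x"
proof -
  interpret O: ring OD by (rule ring_O)
  assume x: "x \<in> S"
  show ?thesis by (rule O.minus_equality) (use x in \<open>simp_all add: l_neg\<close>)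
qed

lemma minus_O: "\<lbrakk>x \<in> S; y \<in> S\<rbrakk> \<Longrightarrow> x \<ominus>\<^sub>OD y = x \<oplus> \<ominus> y"
  by (simp add: a_minus_def neg_O)

lemma pow_O: "x [^]\<^sub>OD (n::nat) = x [^] n"
  by (rule nat_pow_consistent[symmetric])

lemma subring_O: "A \<subseteq> S \<Longrightarrow> subring A D \<Longrightarrow> subring A OD"
  using ring.ring_incl_imp_subring[OF ring_O] subring_is_ring by simp

lemma quat_order_O: "\<exists>w u. quat_order OD (\<iota> ` carrier ZZ) OK \<sigma> PI w u"
proof -
  obtain w u where w: "w \<in> OK" "u \<in> OK" "u \<otimes> (w \<oplus> \<ominus> \<sigma> w) = \<one>" using separating_element by metis
  have Zsub: "subring (\<iota> ` carrier ZZ) D"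
    by (rule iota.img_is_subring[OF Zp.carrier_is_subring])
  have "quat_order OD (\<iota> ` carrier ZZ) OK \<sigma> PI w u"
  proof (intro quat_order.intro quat_order_axioms.intro ring_O)
    show "subring (\<iota> ` carrier ZZ) OD" "subring OK OD" by (rule subring_O; use Zsub OK_subring in auto)+
    show "\<iota> ` carrier ZZ \<subseteq> OK" by auto
    show "z \<otimes>\<^sub>OD r = r \<otimes>\<^sub>OD z" if "z \<in> \<iota> ` carrier ZZ" "r \<in> carrier OD" for z r
      using that iota_central by auto
    show "u \<otimes>\<^sub>OD (w \<ominus>\<^sub>OD \<sigma> w) = \<one>\<^sub>OD" using w by (simp add: minus_O)
    show "\<exists>a\<in>OK. \<exists>b\<in>OK. r = a \<oplus>\<^sub>OD b \<otimes>\<^sub>OD PI" if "r \<in> carrier OD" for r using that S_decompose by simp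
    show "r = \<zero>\<^sub>OD \<or> s = \<zero>\<^sub>OD" if "r \<in> carrier OD" "s \<in> carrier OD" "r \<otimes>\<^sub>OD s = \<zero>\<^sub>OD" for r s
      using that D_integral[of r s] by simp
    show "a = \<zero>\<^sub>OD" if "a \<in> OK" "b \<in> OK" "a \<oplus>\<^sub>OD b \<otimes>\<^sub>OD PI = \<zero>\<^sub>OD" for a b
    proof -
      have "a \<oplus> b \<otimes> PI = \<zero>" using that(3) by simp
      then have "a = (\<ominus> b) \<otimes> PI" using that(1,2) minus_equality[of a "b \<otimes> PI"] by (simp add: l_minus)
      then show ?thesis using OK_PI_disjoint[of a "\<ominus> b"] that(1,2) by simp
    qed
    show "\<exists>n::nat. \<exists>v\<in>\<iota> ` carrier ZZ. \<exists>v'\<in>\<iota> ` carrier ZZ. v \<otimes>\<^sub>OD v' = \<one>\<^sub>OD \<and> z = (PI \<otimes>\<^sub>OD PI) [^]\<^sub>OD n \<otimes>\<^sub>OD v"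
      if "z \<in> \<iota> ` carrier ZZ" "z \<noteq> \<zero>\<^sub>OD" for z
      using dvr_Zp[of z] that by (simp add: PI_square pow_O)
  qed (use w PI_S PI_square PI_twist OK_proper OK_local PI_nonzero in \<open>auto simp: OK_comm sigma_OK_hom sigma_OK_fixed\<close>)
  then show ?thesis by blast
qed

text \<open>The component at 1 is the residue modulo p. Divisibility by p becomes divisibility by
  the uniformizer through \<open>pz_pi_multiples\<close>.\<close>

lemma residue_map:
  assumes "x \<in> carrier ZZ" "y \<in> carrier ZZ"
  shows "x 1 = y 1 \<longleftrightarrow> (\<exists>z\<in>\<iota> ` carrier ZZ. \<iota> x \<ominus>\<^sub>OD \<iota> y = \<iota> \<pi> \<otimes> z)"
proof -
  have e: "\<iota> x \<ominus>\<^sub>OD \<iota> y = \<iota> (x \<ominus>\<^sub>ZZ y)" using assms by (simp add: minus_O Zp.minus_eq)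
  have d: "x \<ominus>\<^sub>ZZ y \<in> carrier ZZ" using assms by simp
  have "x = (x \<ominus>\<^sub>ZZ y) \<oplus>\<^sub>ZZ y" using assms by (simp add: Zp.minus_eq Zp.a_assoc Zp.l_neg)
  then have x1: "x 1 = ((x \<ominus>\<^sub>ZZ y) 1 + y 1) mod int p" using Zp_simps(3)[of "x \<ominus>\<^sub>ZZ y" y 1] by simp
  have y1: "y 1 mod int p = y 1" using Zp_mod[OF assms(2), of 1] by simp
  have d1: "(x \<ominus>\<^sub>ZZ y) 1 mod int p = (x \<ominus>\<^sub>ZZ y) 1" using Zp_mod[OF d, of 1] by simp
  have "x 1 = y 1 \<longleftrightarrow> (x \<ominus>\<^sub>ZZ y) 1 = 0"
  proof
    assume "x 1 = y 1"
    then have "((x \<ominus>\<^sub>ZZ y) 1 + y 1) mod int p = y 1 mod int p" using x1 y1 by simp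
    then have "(x \<ominus>\<^sub>ZZ y) 1 mod int p = 0" by (simp add: mod_eq_dvd_iff dvd_eq_mod_eq_0)
    then show "(x \<ominus>\<^sub>ZZ y) 1 = 0" using d1 by simp
  qed (use x1 y1 in simp)
  also have "\<dots> \<longleftrightarrow> (\<exists>z\<in>carrier ZZ. x \<ominus>\<^sub>ZZ y = pz \<otimes>\<^sub>ZZ z)"
  proof
    assume "(x \<ominus>\<^sub>ZZ y) 1 = 0"
    then show "\<exists>z\<in>carrier ZZ. x \<ominus>\<^sub>ZZ y = pz \<otimes>\<^sub>ZZ z" using Zp_divide_p[OF d] by metis
  next
    assume "\<exists>z\<in>carrier ZZ. x \<ominus>\<^sub>ZZ y = pz \<otimes>\<^sub>ZZ z"
    then obtain z where "x \<ominus>\<^sub>ZZ y = pz \<otimes>\<^sub>ZZ z" by blast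
    then show "(x \<ominus>\<^sub>ZZ y) 1 = 0" by (simp add: Zp_simps pz_def)
  qed
  also have "\<dots> \<longleftrightarrow> \<iota> (x \<ominus>\<^sub>ZZ y) \<in> (\<lambda>z. \<iota> pz \<otimes> z) ` \<iota> ` carrier ZZ"
  proof -
    have "x \<ominus>\<^sub>ZZ y = pz \<otimes>\<^sub>ZZ z \<longleftrightarrow> \<iota> (x \<ominus>\<^sub>ZZ y) = \<iota> pz \<otimes> \<iota> z" if "z \<in> carrier ZZ" for z
      using inj_onD[OF iota_inj, of "x \<ominus>\<^sub>ZZ y" "pz \<otimes>\<^sub>ZZ z"] that d by (metis Zp.m_closed iota.hom_mult pz_closed)
    then show ?thesis by blast
  qed
  also have "(\<lambda>z. \<iota> pz \<otimes> z) ` \<iota> ` carrier ZZ = {[p] \<cdot> z | z. z \<in> \<iota> ` carrier ZZ}"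
    unfolding setcompr_eq_image by (intro image_cong multiple_p[symmetric]) auto
  also have "\<dots> = (\<lambda>z. \<iota> \<pi> \<otimes> z) ` \<iota> ` carrier ZZ"
    by (rule pz_pi_multiples) (auto simp: iota.hom_mult[symmetric] simp del: iota.hom_mult)
  finally show ?thesis unfolding e by blast
qed

lemma residue_classes: "(\<lambda>x. x 1) ` carrier ZZ = {0..<int p}"
proof
  show "(\<lambda>x. x 1) ` carrier ZZ \<subseteq> {0..<int p}"
  proof
    fix k assume "k \<in> (\<lambda>x. x 1) ` carrier ZZ"
    then obtain x where x: "x \<in> carrier ZZ" "k = x 1" by blast
    then show "k \<in> {0..<int p}" using x(1)[unfolded Zp_simps(1), rule_format, of 1] by simp
  qed
  show "{0..<int p} \<subseteq> (\<lambda>x. x 1) ` carrier ZZ"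
  proof
    fix k assume k: "k \<in> {0..<int p}"
    have "(\<lambda>n. k mod int p ^ n) \<in> carrier ZZ" by (rule Zp_closedI) simp
    then show "k \<in> (\<lambda>x. x 1) ` carrier ZZ" using k by (intro image_eqI[of _ _ "\<lambda>n. k mod int p ^ n"]) simp_all
  qed
qed

end

text \<open>Serves to transport the unique existence of coefficients from the p-adic integers to
  their images in \<open>D\<close>.\<close>

lemma bij_ex1_iff:
  assumes F: "bij_betw F A A'" and P: "\<And>c. c \<in> A \<Longrightarrow> P c \<longleftrightarrow> P' (F c)"
  shows "(\<exists>!c. c \<in> A \<and> P c) \<longleftrightarrow> (\<exists>!c. c \<in> A' \<and> P' c)"
proof
  have inj: "\<And>c d. \<lbrakk>c \<in> A; d \<in> A; F c = F d\<rbrakk> \<Longrightarrow> c = d" and img: "A' = F ` A"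
    using F by (auto simp: bij_betw_def inj_on_def)
  { assume "\<exists>!c. c \<in> A \<and> P c"
    then obtain c where c: "c \<in> A" "P c" "\<And>d. \<lbrakk>d \<in> A; P d\<rbrakk> \<Longrightarrow> d = c" by blast
    show "\<exists>!c. c \<in> A' \<and> P' c" unfolding img
      by (rule ex1I[of _ "F c"]) (use c P in blast)+ }
  { assume "\<exists>!c. c \<in> A' \<and> P' c"
    then obtain c where c: "c \<in> A" "P' (F c)" "\<And>d. \<lbrakk>d \<in> A; P' (F d)\<rbrakk> \<Longrightarrow> F d = F c" unfolding img by blast
    show "\<exists>!c. c \<in> A \<and> P c"
      by (rule ex1I[of _ c]) (use c P inj in blast)+ }
qed

context quaternion_order
begin

abbreviation IZ where "IZ \<equiv> \<iota> ` carrier ZZ"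

lemma bij_coefficients:
  "bij_betw (\<lambda>c. \<lambda>b\<in>B. \<iota> (c b)) (B \<rightarrow>\<^sub>E carrier ZZ) (B \<rightarrow>\<^sub>E IZ)"
proof (rule bij_betw_byWitness[where f' = "\<lambda>d. \<lambda>b\<in>B. inv_into (carrier ZZ) \<iota> (d b)"])
  have inv: "inv_into (carrier ZZ) \<iota> (\<iota> z) = z" if "z \<in> carrier ZZ" for z
    using iota_inj that by (rule inv_into_f_f)
  show "\<forall>c\<in>B \<rightarrow>\<^sub>E carrier ZZ. (\<lambda>b\<in>B. inv_into (carrier ZZ) \<iota> ((\<lambda>b\<in>B. \<iota> (c b)) b)) = c"
  proof (rule ballI, rule ext)
    fix c b assume c: "c \<in> B \<rightarrow>\<^sub>E carrier ZZ"
    show "(\<lambda>b\<in>B. inv_into (carrier ZZ) \<iota> ((\<lambda>b\<in>B. \<iota> (c b)) b)) b = c b"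
      using inv[of "c b"] PiE_mem[OF c, of b] PiE_arb[OF c, of b] by (cases "b \<in> B") simp_all
  qed
  have f: "\<iota> (inv_into (carrier ZZ) \<iota> z) = z" if "z \<in> IZ" for z using that by (rule f_inv_into_f)
  show "\<forall>d\<in>B \<rightarrow>\<^sub>E IZ. (\<lambda>b\<in>B. \<iota> ((\<lambda>b\<in>B. inv_into (carrier ZZ) \<iota> (d b)) b)) = d"
  proof (rule ballI, rule ext)
    fix d b assume d: "d \<in> B \<rightarrow>\<^sub>E IZ"
    show "(\<lambda>b\<in>B. \<iota> ((\<lambda>b\<in>B. inv_into (carrier ZZ) \<iota> (d b)) b)) b = d b"
      using f[of "d b"] PiE_mem[OF d, of b] PiE_arb[OF d, of b] by (cases "b \<in> B") simp_all
  qed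
  show "(\<lambda>c. \<lambda>b\<in>B. \<iota> (c b)) ` (B \<rightarrow>\<^sub>E carrier ZZ) \<subseteq> B \<rightarrow>\<^sub>E IZ" by auto
  show "(\<lambda>d. \<lambda>b\<in>B. inv_into (carrier ZZ) \<iota> (d b)) ` (B \<rightarrow>\<^sub>E IZ) \<subseteq> B \<rightarrow>\<^sub>E carrier ZZ"
    using inv_into_into[of _ \<iota> "carrier ZZ"] by (auto intro!: PiE_I) blast
qed

context
  fixes w u
  assumes Q: "quat_order OD IZ OK \<sigma> PI w u"
begin

interpretation Q: quat_order OD IZ OK \<sigma> PI w u by (rule Q)

text \<open>The component at 1 takes p values on the p-adic integers, and
  \<open>residue_card_square\<close> squares this number for the quadratic extension.\<close>

lemma residue_card_p: "Q.residue_card = p\<^sup>2"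
proof -
  let ?r = "\<lambda>z. inv_into (carrier ZZ) \<iota> z 1"
  have inv: "inv_into (carrier ZZ) \<iota> (\<iota> z) = z" if "z \<in> carrier ZZ" for z
    using iota_inj that by (rule inv_into_f_f)
  have "?r ` IZ = (\<lambda>x. x 1) ` carrier ZZ" unfolding image_image by (intro image_cong) (simp_all add: inv)
  then have img: "?r ` IZ = {0..<int p}" unfolding residue_classes .
  have "?r x = ?r y \<longleftrightarrow> (\<exists>z\<in>IZ. x \<ominus>\<^sub>OD y = (PI \<otimes>\<^sub>OD PI) \<otimes>\<^sub>OD z)" if xy: "x \<in> IZ" "y \<in> IZ" for x y
  proof -
    obtain a b where "a \<in> carrier ZZ" "b \<in> carrier ZZ" "x = \<iota> a" "y = \<iota> b" using xy by blast
    then show ?thesis using residue_map[of a b] by (simp add: inv PI_square)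
  qed
  then have "Q.residue_card = (card (?r ` IZ))\<^sup>2" by (rule Q.residue_card_square)
  then show ?thesis unfolding img by simp
qed

lemma multiples_p: "multiples p OD = Q.pi2_ideal"
proof -
  have "multiples p OD = {[p] \<cdot> x | x. x \<in> S}" by (simp add: multiples_def carrier_update_multiple)
  also have "\<dots> = (\<lambda>x. \<iota> \<pi> \<otimes> x) ` S" by (rule pz_pi_multiples) auto
  finally show ?thesis by (simp add: Q.pi2_ideal_def PI_square)
qed

lemma free_iff_Zfree:
  assumes L: "bimodule OD OD L"
  shows "free_of_finite_rank p \<iota> L \<longleftrightarrow> Q.Zfree L"
proof -
  interpret L: bimod OD OD L using L by (simp add: bimod_def)
  have h: "(\<exists>!c. c \<in> B \<rightarrow>\<^sub>E carrier ZZ \<and> x = finsum L (\<lambda>b. \<iota> (c b) \<odot>\<^sub>L b) B) \<longleftrightarrow>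
      (\<exists>!c. c \<in> B \<rightarrow>\<^sub>E IZ \<and> x = finsum L (\<lambda>b. c b \<odot>\<^sub>L b) B)" if B: "B \<subseteq> carrier L" for B x
  proof (rule bij_ex1_iff[OF bij_coefficients])
    fix c assume c: "c \<in> B \<rightarrow>\<^sub>E carrier ZZ"
    have "finsum L (\<lambda>b. \<iota> (c b) \<odot>\<^sub>L b) B = finsum L (\<lambda>b. (\<lambda>b\<in>B. \<iota> (c b)) b \<odot>\<^sub>L b) B"
    proof (rule L.finsum_cong'[OF refl])
      show "(\<lambda>b. (\<lambda>b\<in>B. \<iota> (c b)) b \<odot>\<^sub>L b) \<in> B \<rightarrow> carrier L"
      proof
        fix b assume b: "b \<in> B"
        then have "\<iota> (c b) \<in> carrier OD" using PiE_mem[OF c b] by simp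
        then have "\<iota> (c b) \<odot>\<^sub>L b \<in> carrier L" using b B by (intro L.smult_closed) auto
        then show "(\<lambda>b\<in>B. \<iota> (c b)) b \<odot>\<^sub>L b \<in> carrier L" using b by simp
      qed
    qed simp
    then show "x = finsum L (\<lambda>b. \<iota> (c b) \<odot>\<^sub>L b) B \<longleftrightarrow> x = finsum L (\<lambda>b. (\<lambda>b\<in>B. \<iota> (c b)) b \<odot>\<^sub>L b) B" by simp
  qed
  then show ?thesis unfolding free_of_finite_rank_def Q.Zfree_def by (intro ex_cong1 conj_cong refl ball_cong h)
qed

text \<open>\<open>lat\<close> remembers a dual basis and forgets the free one, so freeness is kept
  beside it to recover the definition of a bilattice.\<close>

lemma bilattice_iff: "bilattice p \<iota> OD L \<longleftrightarrow> Q.Zfree L \<and> Q.lat L"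
proof
  assume L: "bilattice p \<iota> OD L"
  then have b: "bimodule OD OD L" and c: "\<And>z x. \<lbrakk>z \<in> IZ; x \<in> carrier L\<rbrakk> \<Longrightarrow> z \<odot>\<^sub>L x = x \<star>\<^sub>L z"
    by (auto simp: bilattice_def)
  have "Q.Zfree L" using L free_iff_Zfree[OF b] by (simp add: bilattice_def)
  then show "Q.Zfree L \<and> Q.lat L" using Q.latI[OF b _ c] by blast
next
  assume L: "Q.Zfree L \<and> Q.lat L"
  then interpret L: lattice_bimod OD IZ OK \<sigma> PI w u L by blast
  show "bilattice p \<iota> OD L"
    using L free_iff_Zfree[OF L.M.bimodule] L.M.bimodule L.central unfolding bilattice_def by blast
qed

lemma quat_bimodules_O:
  assumes phi: "Q.column_type False \<phi>\<^sub>1" "Q.column_type True \<phi>\<^sub>2"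
  shows "quat_bimodules OD IZ OK \<sigma> PI w u \<phi>\<^sub>1 \<phi>\<^sub>2"
proof (intro quat_bimodules.intro quat_bimodules_axioms.intro Q phi)
  show "Q.lat (ideal_bimodule OD (Q.generated t))" for t by (rule Q.lat_ideal_generated)
  show "Q.lat (column_bimodule OD \<phi>\<^sub>1)" "Q.lat (column_bimodule OD \<phi>\<^sub>2)"
    by (rule Q.lat_column_type[OF phi(1)] Q.lat_column_type[OF phi(2)])+
  \<comment> \<open>Finiteness is inferred from the positive cardinality p^2, since infinite sets
    have cardinality 0.\<close>
  show "finite ((\<lambda>a. {b \<in> OK. \<exists>c\<in>OK. a \<ominus>\<^sub>OD b = (PI \<otimes>\<^sub>OD PI) \<otimes>\<^sub>OD c}) ` OK)"
    using residue_card_p p_gt unfolding Q.residue_card_def by (intro card_ge_0_finite) simp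
qed

lemma column_types:
  assumes "\<phi>\<^sub>1 \<in> ring_hom OD (mat2_ring OD)" "\<phi>\<^sub>1 PI = ((\<zero>\<^sub>OD, \<iota> \<pi>), (\<one>\<^sub>OD, \<zero>\<^sub>OD))"
    "\<forall>a\<in>OK. \<phi>\<^sub>1 a = ((a, \<zero>\<^sub>OD), (\<zero>\<^sub>OD, \<sigma> a))"
    and "\<phi>\<^sub>2 \<in> ring_hom OD (mat2_ring OD)" "\<phi>\<^sub>2 PI = ((\<zero>\<^sub>OD, \<iota> \<pi>), (\<one>\<^sub>OD, \<zero>\<^sub>OD))"
    "\<forall>a\<in>OK. \<phi>\<^sub>2 a = ((\<sigma> a, \<zero>\<^sub>OD), (\<zero>\<^sub>OD, a))"
  shows "Q.column_type False \<phi>\<^sub>1" "Q.column_type True \<phi>\<^sub>2"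
  using assms by (simp_all add: Q.column_type_def PI_square)

end

end

section \<open>Modules over the tensor product\<close>

lemma opposite_ring_simps [simp]:
  "carrier (opposite_ring R) = carrier R" "x \<otimes>\<^bsub>opposite_ring R\<^esub> y = y \<otimes>\<^sub>R x" "\<one>\<^bsub>opposite_ring R\<^esub> = \<one>\<^sub>R"
  "x \<oplus>\<^bsub>opposite_ring R\<^esub> y = x \<oplus>\<^sub>R y" "\<zero>\<^bsub>opposite_ring R\<^esub> = \<zero>\<^sub>R"
  by (simp_all add: opposite_ring_def)

lemma (in ring) ring_opposite_ring: "ring (opposite_ring R)"
proof (intro ringI abelian_groupI monoidI)
  show "\<exists>y\<in>carrier (opposite_ring R). y \<oplus>\<^bsub>opposite_ring R\<^esub> x = \<zero>\<^bsub>opposite_ring R\<^esub>" if "x \<in> carrier (opposite_ring R)" for x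
    using that l_neg[of x] by (intro bexI[of _ "\<ominus> x"]) simp_all
qed (simp_all add: l_distr r_distr m_assoc a_ac)

lemma frag_cmul_diff_distrib2: "frag_cmul c (a - b) = frag_cmul c a - frag_cmul c b"
  by (rule poly_mapping_eqI) (simp add: lookup_minus right_diff_distrib)

lemma frag_extend_fun_diff: "frag_extend (\<lambda>x. f x - g x) u = frag_extend f u - frag_extend g u"
  by (simp add: frag_extend_def sum_subtractf frag_cmul_diff_distrib2)

lemma frag_extend_fun_zero [simp]: "frag_extend (\<lambda>x. 0) u = 0"
  by (simp add: frag_extend_def)

context
  fixes R :: "('a, 'e) ring_scheme" and S :: "('b, 'f) ring_scheme"
  assumes R: "ring R" and S: "ring S"
begin

interpretation R: ring R by (rule R)
interpretation S: ring S by (rule S)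

abbreviation RS where "RS \<equiv> pair_ring R S"

lemma pair_ring_simps:
  "u \<in> carrier RS \<longleftrightarrow> Poly_Mapping.keys u \<subseteq> carrier R \<times> carrier S" "u \<oplus>\<^sub>RS v = u + v" "\<zero>\<^sub>RS = 0"
  "\<one>\<^sub>RS = frag_of (\<one>\<^sub>R, \<one>\<^sub>S)"
  by (simp_all add: pair_ring_def)

lemma pair_mult:
  "frag_of (a, b) \<otimes>\<^sub>RS frag_of (a', b') = frag_of (a \<otimes>\<^sub>R a', b \<otimes>\<^sub>S b')"
  "(u - v) \<otimes>\<^sub>RS x = u \<otimes>\<^sub>RS x - v \<otimes>\<^sub>RS x" "x \<otimes>\<^sub>RS (u - v) = x \<otimes>\<^sub>RS u - x \<otimes>\<^sub>RS v" "0 \<otimes>\<^sub>RS x = 0" "x \<otimes>\<^sub>RS 0 = 0"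
proof -
  show "x \<otimes>\<^sub>RS (u - v) = x \<otimes>\<^sub>RS u - x \<otimes>\<^sub>RS v"
    by (simp add: pair_ring_def frag_extend_diff case_prod_unfold frag_extend_fun_diff)
  show "x \<otimes>\<^sub>RS 0 = 0" by (simp add: pair_ring_def case_prod_unfold)
qed (simp_all add: pair_ring_def frag_extend_diff)

lemma pair_mult_add: "(u + v) \<otimes>\<^sub>RS x = u \<otimes>\<^sub>RS x + v \<otimes>\<^sub>RS x" "x \<otimes>\<^sub>RS (u + v) = x \<otimes>\<^sub>RS u + x \<otimes>\<^sub>RS v"
proof -
  have "(u - (0 - v)) \<otimes>\<^sub>RS x = u \<otimes>\<^sub>RS x - (0 \<otimes>\<^sub>RS x - v \<otimes>\<^sub>RS x)" "x \<otimes>\<^sub>RS (u - (0 - v)) = x \<otimes>\<^sub>RS u - (x \<otimes>\<^sub>RS 0 - x \<otimes>\<^sub>RS v)"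
    by (simp_all only: pair_mult(2,3))
  then show "(u + v) \<otimes>\<^sub>RS x = u \<otimes>\<^sub>RS x + v \<otimes>\<^sub>RS x" "x \<otimes>\<^sub>RS (u + v) = x \<otimes>\<^sub>RS u + x \<otimes>\<^sub>RS v" by (simp_all add: pair_mult(4,5))
qed

text \<open>Pairs generate the free abelian group under differences. As the product is biadditive,
  nested inductions of this kind reduce the ring axioms to pairs.\<close>

lemma pair_ring_induct [consumes 1, case_names zero one diff]:
  assumes "u \<in> carrier RS" "P 0" "\<And>a b. \<lbrakk>a \<in> carrier R; b \<in> carrier S\<rbrakk> \<Longrightarrow> P (frag_of (a, b))"
    "\<And>u v. \<lbrakk>u \<in> carrier RS; v \<in> carrier RS; P u; P v\<rbrakk> \<Longrightarrow> P (u - v)"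
  shows "P u"
proof -
  have "u \<in> carrier RS \<and> P u"
    using assms(1)[unfolded pair_ring_simps]
  proof (induction rule: frag_induction)
    case (diff u v)
    then show ?case using keys_diff[of u v] assms(4) unfolding pair_ring_simps by blast
  qed (use assms(2,3) in \<open>auto simp: pair_ring_simps\<close>)
  then show ?thesis by blast
qed

lemma pair_diff_closed: "\<lbrakk>u \<in> carrier RS; v \<in> carrier RS\<rbrakk> \<Longrightarrow> u - v \<in> carrier RS"
  using keys_diff[of u v] unfolding pair_ring_simps by blast

lemma pair_of_closed: "\<lbrakk>a \<in> carrier R; b \<in> carrier S\<rbrakk> \<Longrightarrow> frag_of (a, b) \<in> carrier RS"
  by (simp add: pair_ring_simps)

lemma pair_mult_closed: "\<lbrakk>u \<in> carrier RS; v \<in> carrier RS\<rbrakk> \<Longrightarrow> u \<otimes>\<^sub>RS v \<in> carrier RS"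
proof (induction u rule: pair_ring_induct)
  case (one a b)
  show ?case using one(3)
  proof (induction v rule: pair_ring_induct)
    case (one a' b')
    then show ?case using \<open>a \<in> carrier R\<close> \<open>b \<in> carrier S\<close> by (simp add: pair_mult pair_of_closed)
  qed (simp_all add: pair_mult pair_ring_simps(1) pair_diff_closed[unfolded pair_ring_simps(1)])
qed (simp_all add: pair_mult pair_ring_simps(1) pair_diff_closed[unfolded pair_ring_simps(1)])

lemma pair_mult_assoc:
  "\<lbrakk>u \<in> carrier RS; v \<in> carrier RS; x \<in> carrier RS\<rbrakk> \<Longrightarrow> (u \<otimes>\<^sub>RS v) \<otimes>\<^sub>RS x = u \<otimes>\<^sub>RS (v \<otimes>\<^sub>RS x)"
proof (induction u rule: pair_ring_induct)
  case (one a b)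
  note u = one(1,2)
  show ?case using one(3,4)
  proof (induction v rule: pair_ring_induct)
    case (one a' b')
    note v = one(1,2)
    show ?case using one(3)
    proof (induction x rule: pair_ring_induct)
      case (one a'' b'')
      then show ?case using u v by (simp add: pair_mult R.m_assoc S.m_assoc)
    qed (simp_all add: pair_mult)
  qed (simp_all add: pair_mult)
qed (simp_all add: pair_mult)

lemma ring_pair_ring: "ring RS"
proof (intro ringI abelian_groupI monoidI)
  have plus: "u + v = u - (0 - v)" for u v :: "('a \<times> 'b) \<Rightarrow>\<^sub>0 int" by simp
  have zero: "0 \<in> carrier RS" by (simp add: pair_ring_simps)
  show "u \<oplus>\<^sub>RS v \<in> carrier RS" if "u \<in> carrier RS" "v \<in> carrier RS" for u v
    unfolding pair_ring_simps(2) plus by (intro pair_diff_closed that zero)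
  show "\<zero>\<^sub>RS \<in> carrier RS" "\<one>\<^sub>RS \<in> carrier RS" by (simp_all add: pair_ring_simps)
  show "\<exists>v\<in>carrier RS. v \<oplus>\<^sub>RS u = \<zero>\<^sub>RS" if "u \<in> carrier RS" for u
    using pair_diff_closed[OF zero that] by (intro bexI[of _ "0 - u"]) (simp_all add: pair_ring_simps(2,3))
  show "\<one>\<^sub>RS \<otimes>\<^sub>RS u = u" if "u \<in> carrier RS" for u
    using that by (induction rule: pair_ring_induct) (simp_all add: pair_ring_simps(4) pair_mult)
  show "u \<otimes>\<^sub>RS \<one>\<^sub>RS = u" if "u \<in> carrier RS" for u
    using that by (induction rule: pair_ring_induct) (simp_all add: pair_ring_simps(4) pair_mult)
  show "(u \<oplus>\<^sub>RS v) \<otimes>\<^sub>RS x = u \<otimes>\<^sub>RS x \<oplus>\<^sub>RS v \<otimes>\<^sub>RS x" "x \<otimes>\<^sub>RS (u \<oplus>\<^sub>RS v) = x \<otimes>\<^sub>RS u \<oplus>\<^sub>RS x \<otimes>\<^sub>RS v" for u v x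
    unfolding pair_ring_simps(2) by (rule pair_mult_add)+
qed (simp_all add: pair_mult_closed pair_mult_assoc pair_ring_simps(2-4) add.assoc add.commute)

end

section \<open>The tensor square and its pure tensors\<close>

locale tensor_square = ring R for R (structure) +
  fixes p :: nat and \<iota> :: "(nat \<Rightarrow> int) \<Rightarrow> 'a"
  assumes iota_closed: "z \<in> carrier (Zp p) \<Longrightarrow> \<iota> z \<in> carrier R"
begin

abbreviation PR where "PR \<equiv> pair_ring R (opposite_ring R)"
abbreviation TI where "TI \<equiv> tensor_ideal p \<iota> \<iota> R (opposite_ring R)"
abbreviation T where "T \<equiv> tensor_ring p \<iota> \<iota> R (opposite_ring R)"
abbreviation cls where "cls u \<equiv> TI +>\<^sub>PR u"
definition pure where "pure a b = cls (frag_of (a, b))"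

lemmas rings = ring_axioms ring_opposite_ring

sublocale PR: ring PR
  by (rule ring_pair_ring[OF rings])

lemma relations_closed: "tensor_relations p \<iota> \<iota> R (opposite_ring R) \<subseteq> carrier PR"
  by (auto simp: tensor_relations_def iota_closed intro!: pair_diff_closed[OF rings] pair_of_closed[OF rings])

sublocale TI: ideal TI PR
  unfolding tensor_ideal_def by (rule PR.genideal_ideal[OF relations_closed])

lemma cls_hom: "cls \<in> ring_hom PR T"
  unfolding tensor_ring_def by (rule TI.rcos_ring_hom)

lemma carrier_T: "carrier T = cls ` carrier PR"
  unfolding tensor_ring_def by (rule carrier_FactRing)

lemma pure_closed: "\<lbrakk>a \<in> carrier R; b \<in> carrier R\<rbrakk> \<Longrightarrow> pure a b \<in> carrier T"
  using pair_of_closed[OF rings, of a b] by (simp add: pure_def carrier_T)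

lemma pure_mult: "\<lbrakk>a \<in> carrier R; b \<in> carrier R; a' \<in> carrier R; b' \<in> carrier R\<rbrakk> \<Longrightarrow>
    pure a b \<otimes>\<^sub>T pure a' b' = pure (a \<otimes> a') (b' \<otimes> b)"
  using ring_hom_mult[OF cls_hom, of "frag_of (a, b)" "frag_of (a', b')"] pair_of_closed[OF rings]
  by (simp add: pure_def pair_mult[OF rings])

lemma pure_one: "pure \<one> \<one> = \<one>\<^sub>T"
  using ring_hom_one[OF cls_hom] by (simp add: pure_def pair_ring_simps[OF rings])

lemma cls_add: "\<lbrakk>u \<in> carrier PR; v \<in> carrier PR\<rbrakk> \<Longrightarrow> cls (u + v) = cls u \<oplus>\<^sub>T cls v"
  using ring_hom_add[OF cls_hom, of u v] by (simp add: pair_ring_simps[OF rings])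

lemma cls_eq:
  assumes "u \<in> carrier PR" "v \<in> carrier PR" "u - v \<in> tensor_relations p \<iota> \<iota> R (opposite_ring R)"
  shows "cls u = cls v"
proof -
  have "u - v \<in> TI" unfolding tensor_ideal_def using PR.genideal_self[OF relations_closed] assms(3) by blast
  moreover have "u \<ominus>\<^sub>PR v = u - v"
  proof -
    have "\<ominus>\<^sub>PR v = 0 - v"
      by (rule PR.minus_equality)
        (use assms(2) pair_diff_closed[OF rings, of 0 v] in \<open>simp_all add: pair_ring_simps[OF rings]\<close>)
    then show ?thesis by (simp add: PR.minus_eq pair_ring_simps[OF rings])
  qed
  ultimately show ?thesis using PR.quotient_eq_iff_same_a_r_cos[OF TI.is_ideal assms(1,2)] by simp
qed

lemma pure_add:
  assumes "a \<in> carrier R" "a' \<in> carrier R" "b \<in> carrier R"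
  shows "pure (a \<oplus> a') b = pure a b \<oplus>\<^sub>T pure a' b" "pure b (a \<oplus> a') = pure b a \<oplus>\<^sub>T pure b a'"
proof -
  note c = pair_of_closed[OF rings]
  let ?r = "tensor_relations p \<iota> \<iota> R (opposite_ring R)"
  have sum: "u + v \<in> carrier PR" if "u \<in> carrier PR" "v \<in> carrier PR" for u v
    using PR.a_closed[OF that] by (simp add: pair_ring_simps(2)[OF rings])
  have "frag_of (a \<oplus> a', b) - (frag_of (a, b) + frag_of (a', b)) \<in> ?r"
    unfolding tensor_relations_def diff_diff_eq[symmetric]
    by (rule UnI1, rule UnI1, rule CollectI, rule exI[of _ a], rule exI[of _ a'], rule exI[of _ b]) (use assms in simp)
  then have "cls (frag_of (a \<oplus> a', b)) = cls (frag_of (a, b) + frag_of (a', b))"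
    by (rule cls_eq[rotated 2]) (use assms in \<open>simp_all add: c sum\<close>)
  then show "pure (a \<oplus> a') b = pure a b \<oplus>\<^sub>T pure a' b" unfolding pure_def using cls_add c assms by simp
  have "frag_of (b, a \<oplus> a') - (frag_of (b, a) + frag_of (b, a')) \<in> ?r"
    unfolding tensor_relations_def diff_diff_eq[symmetric]
    by (rule UnI1, rule UnI2, rule CollectI, rule exI[of _ b], rule exI[of _ a], rule exI[of _ a']) (use assms in simp)
  then have "cls (frag_of (b, a \<oplus> a')) = cls (frag_of (b, a) + frag_of (b, a'))"
    by (rule cls_eq[rotated 2]) (use assms in \<open>simp_all add: c sum\<close>)
  then show "pure b (a \<oplus> a') = pure b a \<oplus>\<^sub>T pure b a'" unfolding pure_def using cls_add c assms by simp
qed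

text \<open>The balancing relation taken at the units; it yields agreement of the two actions of the
  p-adic integers on \<open>bimodule_of M\<close>.\<close>

lemma pure_balanced: "z \<in> carrier (Zp p) \<Longrightarrow> pure (\<iota> z) \<one> = pure \<one> (\<iota> z)"
proof -
  assume z: "z \<in> carrier (Zp p)"
  have "frag_of (\<iota> z, \<one>) - frag_of (\<one>, \<iota> z) \<in> tensor_relations p \<iota> \<iota> R (opposite_ring R)"
    unfolding tensor_relations_def
    by (rule UnI2, rule CollectI, rule exI[of _ \<one>], rule exI[of _ z], rule exI[of _ \<one>]) (use z iota_closed in simp)
  then show ?thesis unfolding pure_def
    by (rule cls_eq[rotated 2]) (use z iota_closed in \<open>simp_all add: pair_of_closed[OF rings]\<close>)
qed

end

context tensor_square
begin

text \<open>Restriction of scalars to the pure tensors with one factor equal to 1. The opposite ring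
  in the second factor is what makes the second action a right action.\<close>

definition bimodule_of :: "(('a \<times> 'a \<Rightarrow>\<^sub>0 int) set, 'm) module \<Rightarrow> ('a, 'a, 'm) bimodule" where
  "bimodule_of M = \<lparr>carrier = carrier M, monoid.mult = undefined, monoid.one = undefined,
     ring.zero = \<zero>\<^sub>M, ring.add = ring.add M,
     module.smult = (\<lambda>a x. pure a \<one> \<odot>\<^sub>M x), rsmult = (\<lambda>x b. pure \<one> b \<odot>\<^sub>M x)\<rparr>"

lemma bimodule_of_simps [simp]:
  "carrier (bimodule_of M) = carrier M" "\<zero>\<^bsub>bimodule_of M\<^esub> = \<zero>\<^sub>M" "x \<oplus>\<^bsub>bimodule_of M\<^esub> y = x \<oplus>\<^sub>M y"
  "a \<odot>\<^bsub>bimodule_of M\<^esub> x = pure a \<one> \<odot>\<^sub>M x" "x \<star>\<^bsub>bimodule_of M\<^esub> b = pure \<one> b \<odot>\<^sub>M x"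
  by (simp_all add: bimodule_of_def)

context
  fixes M :: "(('a \<times> 'a \<Rightarrow>\<^sub>0 int) set, 'm) module"
  assumes M: "left_module T M"
begin

interpretation M: abelian_group M using M by (simp add: left_module_def)

lemma T_smult:
  "\<lbrakk>s \<in> carrier T; x \<in> carrier M\<rbrakk> \<Longrightarrow> s \<odot>\<^sub>M x \<in> carrier M"
  "\<lbrakk>s \<in> carrier T; t \<in> carrier T; x \<in> carrier M\<rbrakk> \<Longrightarrow> (s \<oplus>\<^sub>T t) \<odot>\<^sub>M x = s \<odot>\<^sub>M x \<oplus>\<^sub>M t \<odot>\<^sub>M x"
  "\<lbrakk>s \<in> carrier T; x \<in> carrier M; y \<in> carrier M\<rbrakk> \<Longrightarrow> s \<odot>\<^sub>M (x \<oplus>\<^sub>M y) = s \<odot>\<^sub>M x \<oplus>\<^sub>M s \<odot>\<^sub>M y"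
  "\<lbrakk>s \<in> carrier T; t \<in> carrier T; x \<in> carrier M\<rbrakk> \<Longrightarrow> (s \<otimes>\<^sub>T t) \<odot>\<^sub>M x = s \<odot>\<^sub>M (t \<odot>\<^sub>M x)"
  "x \<in> carrier M \<Longrightarrow> \<one>\<^sub>T \<odot>\<^sub>M x = x"
  using M by (simp_all add: left_module_def)

lemma bimodule_bimodule_of: "bimodule R R (bimodule_of M)"
proof -
  have "abelian_group (bimodule_of M)"
  proof (rule abelian_groupI)
    show "\<exists>y\<in>carrier (bimodule_of M). y \<oplus>\<^bsub>bimodule_of M\<^esub> x = \<zero>\<^bsub>bimodule_of M\<^esub>" if "x \<in> carrier (bimodule_of M)" for x
      using that M.l_neg[of x] by (intro bexI[of _ "\<ominus>\<^sub>M x"]) simp_all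
  qed (simp_all add: M.a_ac)
  moreover have "pure a \<one> \<odot>\<^sub>M (pure \<one> b \<odot>\<^sub>M x) = pure \<one> b \<odot>\<^sub>M (pure a \<one> \<odot>\<^sub>M x)"
    if "a \<in> carrier R" "b \<in> carrier R" "x \<in> carrier M" for a b x
    using that pure_mult[of a \<one> \<one> b] pure_mult[of \<one> b a \<one>] by (simp add: T_smult(4)[symmetric] pure_closed)
  moreover have "pure (a \<otimes> b) \<one> = pure a \<one> \<otimes>\<^sub>T pure b \<one>" "pure \<one> (a \<otimes> b) = pure \<one> b \<otimes>\<^sub>T pure \<one> a"
    if "a \<in> carrier R" "b \<in> carrier R" for a b
    using that by (simp_all add: pure_mult)
  ultimately show ?thesis
    unfolding bimodule_def left_module_def
    by (simp add: ring_axioms pure_closed pure_add pure_one T_smult)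
qed

lemma pure_smult: "\<lbrakk>a \<in> carrier R; b \<in> carrier R; x \<in> carrier M\<rbrakk> \<Longrightarrow> pure a b \<odot>\<^sub>M x = pure a \<one> \<odot>\<^sub>M (pure \<one> b \<odot>\<^sub>M x)"
  using pure_mult[of a \<one> \<one> b] by (simp add: T_smult(4)[symmetric] pure_closed)

lemma cls_closed: "u \<in> carrier PR \<Longrightarrow> cls u \<in> carrier T"
  by (simp add: carrier_T)

lemma cls_smult:
  "x \<in> carrier M \<Longrightarrow> cls 0 \<odot>\<^sub>M x = \<zero>\<^sub>M"
  "\<lbrakk>u \<in> carrier PR; v \<in> carrier PR; x \<in> carrier M\<rbrakk> \<Longrightarrow> cls (u - v) \<odot>\<^sub>M x = cls u \<odot>\<^sub>M x \<ominus>\<^sub>M cls v \<odot>\<^sub>M x"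
proof -
  have d: "cls (u - v) \<odot>\<^sub>M x = cls u \<odot>\<^sub>M x \<ominus>\<^sub>M cls v \<odot>\<^sub>M x" if h: "u \<in> carrier PR" "v \<in> carrier PR" "x \<in> carrier M" for u v x
  proof -
    note c = cls_closed[OF h(1)] cls_closed[OF h(2)] cls_closed[OF pair_diff_closed[OF rings h(1,2)]]
    have "cls u = cls (u - v) \<oplus>\<^sub>T cls v" using cls_add[OF pair_diff_closed[OF rings h(1,2)] h(2)] by simp
    then have "cls u \<odot>\<^sub>M x = cls (u - v) \<odot>\<^sub>M x \<oplus>\<^sub>M cls v \<odot>\<^sub>M x" using T_smult(2)[OF c(3,2) h(3)] by simp
    then show ?thesis using T_smult(1)[OF _ h(3)] c by (simp add: M.minus_eq M.a_assoc M.r_neg)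
  qed
  show "x \<in> carrier M \<Longrightarrow> cls 0 \<odot>\<^sub>M x = \<zero>\<^sub>M"
    using d[of 0 0 x] T_smult(1)[OF cls_closed, of 0 x] by (simp add: pair_ring_simps[OF rings] M.minus_eq M.r_neg)
  show "\<lbrakk>u \<in> carrier PR; v \<in> carrier PR; x \<in> carrier M\<rbrakk> \<Longrightarrow> cls (u - v) \<odot>\<^sub>M x = cls u \<odot>\<^sub>M x \<ominus>\<^sub>M cls v \<odot>\<^sub>M x"
    by (rule d)
qed

text \<open>Pure tensors generate the tensor product additively, and a pure tensor acts as a right
  multiplication followed by a left one; so stability under both actions is stability under the
  whole ring.\<close>

lemma subbimodule_left_submodule:
  assumes A: "subbimodule R R (bimodule_of M) A"
  shows "left_submodule T M A"
proof -
  have sub: "subgroup A (add_monoid M)" and l: "\<And>a x. \<lbrakk>a \<in> carrier R; x \<in> A\<rbrakk> \<Longrightarrow> pure a \<one> \<odot>\<^sub>M x \<in> A"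
    and r: "\<And>b x. \<lbrakk>b \<in> carrier R; x \<in> A\<rbrakk> \<Longrightarrow> pure \<one> b \<odot>\<^sub>M x \<in> A"
    using A by (auto simp: subbimodule_def left_submodule_def bimodule_of_def subgroup_def m_inv_def)
  interpret A: additive_subgroup A M using sub by (simp add: additive_subgroup_def)
  have "cls u \<odot>\<^sub>M x \<in> A" if "u \<in> carrier PR" "x \<in> A" for u x
    using that(1)
  proof (induction u rule: pair_ring_induct[OF rings, consumes 1, case_names zero one diff])
    case (one a b)
    then show ?case using l[of a] r[OF _ that(2), of b] pure_smult[of a b x] that(2) by (simp add: pure_def[symmetric])
  next
    case (diff u v)
    then show ?case using cls_smult(2)[of u v x] that(2) by (simp add: M.minus_eq)
  qed (use cls_smult(1)[of x] that(2) in simp)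
  then show ?thesis using sub by (auto simp: left_submodule_def carrier_T)
qed

lemma indecomposable_bimodule_of:
  assumes "indecomposable_left_module T M"
  shows "indecomposable_bimodule R R (bimodule_of M)"
  using assms subbimodule_left_submodule
  by (simp add: indecomposable_left_module_def indecomposable_bimodule_def internal_direct_sum_def set_add_def set_mult_def)

lemma bilattice_bimodule_of:
  assumes "free_of_finite_rank p (tensor_structure_map p \<iota> \<iota> R (opposite_ring R)) M"
  shows "bilattice p \<iota> R (bimodule_of M)"
proof -
  have "finsum (bimodule_of M) f B = finsum M f B" for f and B :: "'m set"
    by (simp add: finsum_def finprod_def bimodule_of_def)
  then have "free_of_finite_rank p \<iota> (bimodule_of M)"
    using assms by (simp add: free_of_finite_rank_def tensor_structure_map_def pure_def)
  then show ?thesis using bimodule_bimodule_of by (simp add: bilattice_def pure_balanced)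
qed

end

text \<open>A bijection that is equivariant for both actions is so for pure tensors and, being
  additive, for everything they generate.\<close>

lemma left_module_isomorphic_iff:
  assumes M: "left_module T M" and N: "left_module T N"
  shows "left_module_isomorphic T M N \<longleftrightarrow> bimodule_isomorphic R R (bimodule_of M) (bimodule_of N)"
proof
  assume "left_module_isomorphic T M N"
  then show "bimodule_isomorphic R R (bimodule_of M) (bimodule_of N)"
    unfolding left_module_isomorphic_def bimodule_isomorphic_def by (auto simp: pure_closed)
next
  assume "bimodule_isomorphic R R (bimodule_of M) (bimodule_of N)"
  then obtain f where f: "bij_betw f (carrier M) (carrier N)"
    and fa: "\<And>x y. \<lbrakk>x \<in> carrier M; y \<in> carrier M\<rbrakk> \<Longrightarrow> f (x \<oplus>\<^sub>M y) = f x \<oplus>\<^sub>N f y"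
    and fl: "\<And>a x. \<lbrakk>a \<in> carrier R; x \<in> carrier M\<rbrakk> \<Longrightarrow> f (pure a \<one> \<odot>\<^sub>M x) = pure a \<one> \<odot>\<^sub>N f x"
    and fr: "\<And>b x. \<lbrakk>b \<in> carrier R; x \<in> carrier M\<rbrakk> \<Longrightarrow> f (pure \<one> b \<odot>\<^sub>M x) = pure \<one> b \<odot>\<^sub>N f x"
    unfolding bimodule_isomorphic_def by auto
  have fc: "f x \<in> carrier N" if "x \<in> carrier M" for x using f that by (auto simp: bij_betw_def)
  interpret M: abelian_group M using M by (simp add: left_module_def)
  interpret N: abelian_group N using N by (simp add: left_module_def)
  interpret f: abelian_group_hom M N f
    by (intro abelian_group_homI M.abelian_group_axioms N.abelian_group_axioms group_hom.intro M.a_group N.a_group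
        group_hom_axioms.intro) (auto simp: hom_def fc fa)
  have "f (cls u \<odot>\<^sub>M x) = cls u \<odot>\<^sub>N f x" if "u \<in> carrier PR" "x \<in> carrier M" for u x
    using that(1)
  proof (induction u rule: pair_ring_induct[OF rings, consumes 1, case_names zero one diff])
    case (one a b)
    then show ?case
      using pure_smult[OF M, of a b x] pure_smult[OF N, of a b "f x"] that(2) fc fl fr T_smult(1)[OF M]
      by (simp add: pure_def[symmetric] pure_closed)
  next
    case (diff u v)
    then show ?case
      using cls_smult(2)[OF M, of u v x] cls_smult(2)[OF N, of u v "f x"] that(2) fc T_smult(1)[OF M] cls_closed[OF M]
      by (simp add: M.minus_eq N.minus_eq)
  qed (use cls_smult(1)[OF M] cls_smult(1)[OF N] that(2) fc f.hom_zero in simp)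
  then have "f (t \<odot>\<^sub>M x) = t \<odot>\<^sub>N f x" if "t \<in> carrier T" "x \<in> carrier M" for t x
    using that by (auto simp: carrier_T)
  then show "left_module_isomorphic T M N" unfolding left_module_isomorphic_def using f fa by blast
qed

text \<open>Isomorphism classes are described by predicates instead of representatives, because the
  models have different element types, which may also differ from \<open>'m\<close>. Each predicate
  cuts out at most one class, so the classes lie in an image of the finite set
  \<open>F\<close>.\<close>

lemma finite_representation_typeI:
  fixes F :: "(('a, 'a, 'm) bimodule \<Rightarrow> bool) set"
  assumes F: "finite F"
    and cover: "\<And>B :: ('a, 'a, 'm) bimodule. \<lbrakk>bilattice p \<iota> R B; indecomposable_bimodule R R B\<rbrakk> \<Longrightarrow> \<exists>Q\<in>F. Q B"
    and iso: "\<And>Q B B'. \<lbrakk>Q \<in> F; bimodule R R B; bimodule R R B'; Q B\<rbrakk> \<Longrightarrow> Q B' \<longleftrightarrow> bimodule_isomorphic R R B B'"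
  shows "finite_representation_type TYPE('m) p (tensor_structure_map p \<iota> \<iota> R (opposite_ring R)) T"
proof -
  define I where "I = {M :: (('a \<times> 'a \<Rightarrow>\<^sub>0 int) set, 'm) module.
    left_lattice p (tensor_structure_map p \<iota> \<iota> R (opposite_ring R)) T M \<and> indecomposable_left_module T M}"
  have m: "left_module T M" if "M \<in> I" for M using that by (simp add: I_def left_lattice_def)
  have "I // {(M, N) \<in> I \<times> I. left_module_isomorphic T M N} \<subseteq> (\<lambda>Q. {N \<in> I. Q (bimodule_of N)}) ` F"
  proof
    fix C assume "C \<in> I // {(M, N) \<in> I \<times> I. left_module_isomorphic T M N}"
    then obtain M where M: "M \<in> I" "C = {N \<in> I. left_module_isomorphic T M N}"
      by (auto simp: quotient_def)
    have "bilattice p \<iota> R (bimodule_of M)" "indecomposable_bimodule R R (bimodule_of M)"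
      using M(1) bilattice_bimodule_of[OF m] indecomposable_bimodule_of[OF m] by (simp_all add: I_def left_lattice_def)
    then obtain Q where Q: "Q \<in> F" "Q (bimodule_of M)" using cover by blast
    have "left_module_isomorphic T M N \<longleftrightarrow> Q (bimodule_of N)" if N: "N \<in> I" for N
      using left_module_isomorphic_iff[OF m[OF M(1)] m[OF N]]
        iso[OF Q(1) bimodule_bimodule_of[OF m[OF M(1)]] bimodule_bimodule_of[OF m[OF N]] Q(2)] by simp
    then have "C = {N \<in> I. Q (bimodule_of N)}" using M(2) by auto
    then show "C \<in> (\<lambda>Q. {N \<in> I. Q (bimodule_of N)}) ` F" using Q(1) by blast
  qed
  then show ?thesis
    unfolding finite_representation_type_def Let_def I_def[symmetric] using F finite_surj by blast
qed

end

section \<open>The classification\<close>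

text \<open>Makes being isomorphic to a fixed model a predicate of the kind that
  \<open>finite_representation_typeI\<close> expects.\<close>

lemma bimodule_isomorphic_target:
  assumes "bimodule R S B" "bimodule R S B'" "bimodule_isomorphic R S B N"
  shows "bimodule_isomorphic R S B' N \<longleftrightarrow> bimodule_isomorphic R S B B'"
proof
  show "bimodule_isomorphic R S B B'" if "bimodule_isomorphic R S B' N"
    by (rule bimodule_isomorphic_trans[OF assms(3) bimodule_isomorphic_sym[OF that assms(2)]])
  show "bimodule_isomorphic R S B' N" if "bimodule_isomorphic R S B B'"
    by (rule bimodule_isomorphic_trans[OF bimodule_isomorphic_sym[OF that assms(1)] assms(3)])
qed

theorem theorem1p2:
  fixes p :: nat
    and D :: "'d ring" and \<iota> :: "(nat \<Rightarrow> int) \<Rightarrow> 'd"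
    and R :: "'d ring" and P K OK :: "'d set" and \<sigma> :: "'d \<Rightarrow> 'd"
    and \<pi> :: "nat \<Rightarrow> int" and PI :: 'd
    and \<phi>\<^sub>1 \<phi>\<^sub>2 :: "'d \<Rightarrow> 'd mat2"
    and LO LP :: "('d, 'd, 'd) bimodule" and L\<^sub>1 L\<^sub>2 :: "('d, 'd, 'd \<times> 'd) bimodule"
  assumes "Factorial_Ring.prime p"
    and "quaternion_division_algebra p D \<iota>"
    and "maximal_Zp_order p D \<iota> (carrier R)" and "R = D\<lparr>carrier := carrier R\<rparr>"
    and "maximalideal P R"
    and "unramified_quadratic_in p D \<iota> K" and "OK = ring_of_integers p D \<iota> K"
    and "nontrivial_automorphism p D \<iota> K \<sigma>"
    and "Zp_uniformizer p \<pi>"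
    and "PI \<in> carrier R" and "PI \<otimes>\<^bsub>D\<^esub> PI = \<iota> \<pi>"
    and "\<forall>a\<in>OK. PI \<otimes>\<^bsub>D\<^esub> a = \<sigma> a \<otimes>\<^bsub>D\<^esub> PI"
    and "internal_direct_sum R OK {a \<otimes>\<^bsub>D\<^esub> PI | a. a \<in> OK}"
    and "\<phi>\<^sub>1 \<in> ring_hom R (mat2_ring R)" and "inj_on \<phi>\<^sub>1 (carrier R)"
    and "\<phi>\<^sub>1 PI = ((\<zero>\<^bsub>R\<^esub>, \<iota> \<pi>), (\<one>\<^bsub>R\<^esub>, \<zero>\<^bsub>R\<^esub>))"
    and "\<forall>a\<in>OK. \<phi>\<^sub>1 a = ((a, \<zero>\<^bsub>R\<^esub>), (\<zero>\<^bsub>R\<^esub>, \<sigma> a))"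
    and "\<phi>\<^sub>2 \<in> ring_hom R (mat2_ring R)" and "inj_on \<phi>\<^sub>2 (carrier R)"
    and "\<phi>\<^sub>2 PI = ((\<zero>\<^bsub>R\<^esub>, \<iota> \<pi>), (\<one>\<^bsub>R\<^esub>, \<zero>\<^bsub>R\<^esub>))"
    and "\<forall>a\<in>OK. \<phi>\<^sub>2 a = ((\<sigma> a, \<zero>\<^bsub>R\<^esub>), (\<zero>\<^bsub>R\<^esub>, a))"
    and "LO = ideal_bimodule R (carrier R)" and "LP = ideal_bimodule R P"
    and "L\<^sub>1 = column_bimodule R \<phi>\<^sub>1" and "L\<^sub>2 = column_bimodule R \<phi>\<^sub>2"
  shows "
    \<comment> \<open>the maximal two-sided ideal is unique, with residue field of order \<open>p\<^sup>2\<close>\<close>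
    ((\<forall>J. maximalideal J R \<longrightarrow> J = P) \<and> field (R Quot P) \<and> card (carrier (R Quot P)) = p\<^sup>2)
    \<comment> \<open>finite representation type\<close>
    \<and> (finite_representation_type TYPE('l) p
       (tensor_structure_map p \<iota> \<iota> R (opposite_ring R))
       (tensor_ring p \<iota> \<iota> R (opposite_ring R)))
    \<comment> \<open>exactly four indecomposable bilattices\<close>
    \<and> (bilattice p \<iota> R LO \<and> indecomposable_bimodule R R LO \<and>
     bilattice p \<iota> R LP \<and> indecomposable_bimodule R R LP \<and>
     bilattice p \<iota> R L\<^sub>1 \<and> indecomposable_bimodule R R L\<^sub>1 \<and>
     bilattice p \<iota> R L\<^sub>2 \<and> indecomposable_bimodule R R L\<^sub>2)
    \<and> (\<not> bimodule_isomorphic R R LO LP \<and> \<not> bimodule_isomorphic R R LO L\<^sub>1 \<and>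
     \<not> bimodule_isomorphic R R LO L\<^sub>2 \<and> \<not> bimodule_isomorphic R R LP L\<^sub>1 \<and>
     \<not> bimodule_isomorphic R R LP L\<^sub>2 \<and> \<not> bimodule_isomorphic R R L\<^sub>1 L\<^sub>2)
    \<and> (\<forall>L :: ('d, 'd, 'l) bimodule. bilattice p \<iota> R L \<and> indecomposable_bimodule R R L \<longrightarrow>
       bimodule_isomorphic R R L LO \<or> bimodule_isomorphic R R L LP \<or>
       bimodule_isomorphic R R L L\<^sub>1 \<or> bimodule_isomorphic R R L L\<^sub>2)
    \<comment> \<open>unique decomposition\<close>
    \<and> (\<forall>L :: ('d, 'd, 'l) bimodule. bilattice p \<iota> R L \<longrightarrow>
       (\<exists>!q :: nat \<times> nat \<times> nat \<times> nat. case q of (r\<^sub>1, r\<^sub>2, t\<^sub>1, t\<^sub>2) \<Rightarrow>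
          bimodule_isomorphic R R L
            ((LO ^\<^sub>B r\<^sub>1) \<oplus>\<^sub>B (LP ^\<^sub>B r\<^sub>2) \<oplus>\<^sub>B (L\<^sub>1 ^\<^sub>B t\<^sub>1) \<oplus>\<^sub>B (L\<^sub>2 ^\<^sub>B t\<^sub>2))))
    \<comment> \<open>bilattices are determined by either of their reductions\<close>
    \<and> (\<forall>(L :: ('d, 'd, 'l) bimodule) (L' :: ('d, 'd, 'm) bimodule).
       bilattice p \<iota> R L \<and> bilattice p \<iota> R L' \<longrightarrow>
       (bimodule_isomorphic R R L L' \<longleftrightarrow>
          bimodule_isomorphic (R Quot P) (R Quot multiples p R)
            (quotient_bimodule L (ideal_times P L)) (quotient_bimodule L' (ideal_times P L'))) \<and>
       (bimodule_isomorphic R R L L' \<longleftrightarrow>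
          bimodule_isomorphic (R Quot multiples p R) (R Quot P)
            (quotient_bimodule L (times_ideal L P)) (quotient_bimodule L' (times_ideal L' P))))"
proof -
  let ?Z = "\<iota> ` carrier (Zp p)"
  have R: "D\<lparr>carrier := carrier R\<rparr> = R" using assms(4) by (rule sym)
  \<comment> \<open>The order \<open>R\<close> is \<open>D\<close> with a smaller carrier, so
    \<open>carrier R\<close> takes the role of the set \<open>S\<close> of the locale.\<close>
  interpret quaternion_order p D \<iota> "carrier R" K OK \<sigma> \<pi> PI
  proof (intro quaternion_order.intro quaternion_order_axioms.intro padic.intro)
    show "ring D" using assms(2) by (simp add: quaternion_division_algebra_def division_algebra_def)
    show "Zp_order p D \<iota> (carrier R)" using assms(3) by (simp add: maximal_Zp_order_def)
    show "internal_direct_sum (D\<lparr>carrier := carrier R\<rparr>) OK {a \<otimes>\<^sub>D PI | a. a \<in> OK}" using assms(13) unfolding R .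
  qed (fact assms)+
  obtain w u where Q': "quat_order (D\<lparr>carrier := carrier R\<rparr>) ?Z OK \<sigma> PI w u" using quat_order_O by blast
  then have Q: "quat_order R ?Z OK \<sigma> PI w u" unfolding R .
  interpret Q: quat_order R ?Z OK \<sigma> PI w u by (rule Q)
  note ct = column_types[OF Q', unfolded R, OF assms(14,16,17,18,20,21)]
  note bil = bilattice_iff[OF Q', unfolded R]
  interpret B: quat_bimodules R ?Z OK \<sigma> PI w u \<phi>\<^sub>1 \<phi>\<^sub>2
    by (rule quat_bimodules_O[OF Q', unfolded R, OF ct])
  \<comment> \<open>The maximal ideal, given abstractly, is identified with the ideal generated by
    \<open>PI\<close>, for which the invariants were computed.\<close>
  have P: "P = Q.generated True" by (rule Q.maximal_ideal_unique[OF assms(5)])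
  have pR: "multiples p R = Q.pi2_ideal" by (rule multiples_p[OF Q', unfolded R])
  have models: "LO = B.LO" "LP = B.LP" "L\<^sub>1 = B.C1" "L\<^sub>2 = B.C2"
    unfolding assms(22-25) P Q.generated_False by (rule refl)+
  show ?thesis
  proof (intro conjI)
    show "\<forall>J. maximalideal J R \<longrightarrow> J = P" unfolding P using Q.maximal_ideal_unique by blast
    show "field (R Quot P)" unfolding P by (rule Q.residue_field)
    show "card (carrier (R Quot P)) = p\<^sup>2"
      unfolding P Q.card_residue_field by (rule residue_card_p[OF Q', unfolded R])
    interpret T: tensor_square R p \<iota>
      by (intro tensor_square.intro tensor_square_axioms.intro Q.ring_axioms) (use OK_S in simp)
    let ?F = "{\<lambda>B :: ('d, 'd, 'l) bimodule. bimodule_isomorphic R R B LO, \<lambda>B. bimodule_isomorphic R R B LP,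
      \<lambda>B. bimodule_isomorphic R R B L\<^sub>1, \<lambda>B. bimodule_isomorphic R R B L\<^sub>2}"
    show "finite_representation_type TYPE('l) p (tensor_structure_map p \<iota> \<iota> R (opposite_ring R))
        (tensor_ring p \<iota> \<iota> R (opposite_ring R))"
    proof (rule T.finite_representation_typeI[where F = ?F])
      show "\<exists>Q\<in>?F. Q B" if "bilattice p \<iota> R B" "indecomposable_bimodule R R B" for B
      proof -
        have "Q.lat B" using that(1) unfolding bil by blast
        then show ?thesis using B.indecomposable_cases[OF _ that(2)] unfolding models by simp
      qed
      show "Q B' \<longleftrightarrow> bimodule_isomorphic R R B B'"
        if "Q \<in> ?F" "bimodule R R B" "bimodule R R B'" "Q B" for Q B B'
        using that(1,4) bimodule_isomorphic_target[OF that(2,3), of LO] bimodule_isomorphic_target[OF that(2,3), of LP]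
          bimodule_isomorphic_target[OF that(2,3), of L\<^sub>1] bimodule_isomorphic_target[OF that(2,3), of L\<^sub>2] by blast
    qed simp
    show "bilattice p \<iota> R LO" "bilattice p \<iota> R LP" "bilattice p \<iota> R L\<^sub>1" "bilattice p \<iota> R L\<^sub>2"
      unfolding bil models using Q.lat_ideal_generated Q.lat_column_type[OF ct(1)] Q.lat_column_type[OF ct(2)] by blast+
    show "indecomposable_bimodule R R LO" "indecomposable_bimodule R R LP"
      "indecomposable_bimodule R R L\<^sub>1" "indecomposable_bimodule R R L\<^sub>2"
      unfolding models by (rule B.models_indecomposable)+
    show "\<not> bimodule_isomorphic R R LO LP" "\<not> bimodule_isomorphic R R LO L\<^sub>1" "\<not> bimodule_isomorphic R R LO L\<^sub>2"
      "\<not> bimodule_isomorphic R R LP L\<^sub>1" "\<not> bimodule_isomorphic R R LP L\<^sub>2" "\<not> bimodule_isomorphic R R L\<^sub>1 L\<^sub>2"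
      unfolding models by (rule B.models_not_isomorphic)+
    show "\<forall>L :: ('d, 'd, 'l) bimodule. bilattice p \<iota> R L \<and> indecomposable_bimodule R R L \<longrightarrow>
       bimodule_isomorphic R R L LO \<or> bimodule_isomorphic R R L LP \<or>
       bimodule_isomorphic R R L L\<^sub>1 \<or> bimodule_isomorphic R R L L\<^sub>2"
      unfolding bil models using B.indecomposable_cases by blast
    show "\<forall>L :: ('d, 'd, 'l) bimodule. bilattice p \<iota> R L \<longrightarrow>
       (\<exists>!q :: nat \<times> nat \<times> nat \<times> nat. case q of (r\<^sub>1, r\<^sub>2, t\<^sub>1, t\<^sub>2) \<Rightarrow>
          bimodule_isomorphic R R L
            ((LO ^\<^sub>B r\<^sub>1) \<oplus>\<^sub>B (LP ^\<^sub>B r\<^sub>2) \<oplus>\<^sub>B (L\<^sub>1 ^\<^sub>B t\<^sub>1) \<oplus>\<^sub>B (L\<^sub>2 ^\<^sub>B t\<^sub>2)))"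
      unfolding bil models
    proof (intro allI impI)
      fix L :: "('d, 'd, 'l) bimodule" assume "Q.Zfree L \<and> Q.lat L"
      then have L: "Q.lat L" by (rule conjunct2)
      obtain r\<^sub>1 r\<^sub>2 t\<^sub>1 t\<^sub>2 where d: "bimodule_isomorphic R R L (B.power_sum r\<^sub>1 r\<^sub>2 t\<^sub>1 t\<^sub>2)" using B.decomposition[OF L] by blast
      show "\<exists>!q :: nat \<times> nat \<times> nat \<times> nat. case q of (r\<^sub>1, r\<^sub>2, t\<^sub>1, t\<^sub>2) \<Rightarrow> bimodule_isomorphic R R L (B.power_sum r\<^sub>1 r\<^sub>2 t\<^sub>1 t\<^sub>2)"
      proof (rule ex1I[of _ "(r\<^sub>1, r\<^sub>2, t\<^sub>1, t\<^sub>2)"])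
        show "case (r\<^sub>1, r\<^sub>2, t\<^sub>1, t\<^sub>2) of (r\<^sub>1, r\<^sub>2, t\<^sub>1, t\<^sub>2) \<Rightarrow> bimodule_isomorphic R R L (B.power_sum r\<^sub>1 r\<^sub>2 t\<^sub>1 t\<^sub>2)"
          unfolding prod.case by (rule d)
        fix q :: "nat \<times> nat \<times> nat \<times> nat"
        assume q: "case q of (r\<^sub>1, r\<^sub>2, t\<^sub>1, t\<^sub>2) \<Rightarrow> bimodule_isomorphic R R L (B.power_sum r\<^sub>1 r\<^sub>2 t\<^sub>1 t\<^sub>2)"
        obtain a b c e where e: "q = (a, b, c, e)" by (rule prod_cases4)
        show "q = (r\<^sub>1, r\<^sub>2, t\<^sub>1, t\<^sub>2)"
          unfolding e by (rule B.decomposition_unique[OF L q[unfolded e prod.case] d])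
      qed
    qed
    show "\<forall>(L :: ('d, 'd, 'l) bimodule) (L' :: ('d, 'd, 'm) bimodule).
       bilattice p \<iota> R L \<and> bilattice p \<iota> R L' \<longrightarrow>
       (bimodule_isomorphic R R L L' \<longleftrightarrow>
          bimodule_isomorphic (R Quot P) (R Quot multiples p R)
            (quotient_bimodule L (ideal_times P L)) (quotient_bimodule L' (ideal_times P L'))) \<and>
       (bimodule_isomorphic R R L L' \<longleftrightarrow>
          bimodule_isomorphic (R Quot multiples p R) (R Quot P)
            (quotient_bimodule L (times_ideal L P)) (quotient_bimodule L' (times_ideal L' P)))"
      unfolding bil P pR
      by (intro allI impI conjI) (rule B.isomorphic_iff_left_reduction B.isomorphic_iff_right_reduction; blast)+
  qed
qed

end
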